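(* There exist algebra maps realizing any continuous or discrete machine as a synchronous one, namely monoidal natural transformations $$\mathsf{Spn}_{\Sigma_i'}\colon\mathsf{Mch}_N\Rightarrow\mathsf{Mch}_{\mathsf{Sync}}\circ\mathcal{W}_{\Sigma_i'},\qquad\mathsf{Spn}_{\Delta_{\mathsf{Sync}!}}\colon\mathsf{Mch}_C\Rightarrow\mathsf{Mch}_{\mathsf{Sync}}\circ\mathcal{W}_{\Delta_{\mathsf{Sync}!}},$$ whose components send a discrete (resp. continuous) machine $p\colon S\to\widehat{X^{\mathrm{in}}}\times\widehat{X^{\mathrm{out}}}$ to $\Sigma_i'p$ (resp. $\Delta_{\mathsf{Sync}!}p$).
   Context: Interval sheaves. $\mathrm{Int}$ has objects $\ell\in\mathbb{R}_{\ge0}$, morphisms $\mathrm{Tr}_p\colon\ell'\to\ell$ for $p\in\mathbb{R}_{\ge0}$, $p\le\ell-\ell'$, composition by addition. For a presheaf $X$, $x|_{[p,p+\ell']}=X(\mathrm{Tr}_p)(x)$. An $\mathrm{Int}$-sheaf is a presheaf such that for all $x_1\in X(\ell_1)$, $x_2\in X(\ell_2)$ with $x_1|_{[\ell_1,\ell_1]}=x_2|_{[0,0]}$ there is a unique element of $X(\ell_1+\ell_2)$ restricting to $x_1$ on $[0,\ell_1]$ and $x_2$ on $[\ell_1,\ell_1+\ell_2]$. $\widetilde{\mathrm{Int}}$ is the topos of these. $\mathrm{Int}_N$ and $\widetilde{\mathrm{Int}}_N$ are defined in the same way with $\mathbb{N}$ in place of $\mathbb{R}_{\ge0}$. $\mathsf{Sync}\in\widetilde{\mathrm{Int}}$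 is $\mathsf{Sync}(\ell)=\mathbb{R}/\mathbb{Z}$, with restriction along $\mathrm{Tr}_p$ given by $[\theta]\mapsto[\theta+p]$. $\Sigma_i\colon\widetilde{\mathrm{Int}}_N\to\widetilde{\mathrm{Int}}$ is the left adjoint of restriction along the inclusion $i\colon\mathrm{Int}_N\to\mathrm{Int}$; it is given by $\Sigma_iX(\ell)\cong\bigsqcup_{r\in[0,1)}X(\lceil r+\ell\rceil)$, the restriction of $(r,x)$ along $\mathrm{Tr}_p\colon\ell'\to\ell$ being $(p+r-a,\,x|_{[a,b]})$ with $a=\lfloor p+r\rfloor$, $b=\lceil p+r+\ell'\rceil$; and $\Sigma_i(\mathbf{1})\cong\mathsf{Sync}$. $\Sigma_i'\colon\widetilde{\mathrm{Int}}_N\to\widetilde{\mathrm{Int}}/\mathsf{Sync}$ is $X\mapsto\Sigma_i(X\to\mathbf{1})$, and $\Delta_{\mathsf{Sync}!}\colon\widetilde{\mathrm{Int}}\to\widetilde{\mathrm{Int}}/\mathsf{Sync}$ is $Y\mapsto(Y\times\mathsf{Sync}\to\mathsf{Sync})$. Both preserve finite limits. Wiring diagrams. A $\mathcal{C}$-typed finite set is a finite set $X$ with $\tau\colon X\to\mathrm{ob}\,\mathcal{C}$; typed functions preserve types; $\widehat{X}=\prod_{x\in X}\tau(x)$; a typed function $f\colon X\to X'$ induces $\widehat{f}\colon\widehat{X'}\to\widehat{X}$ by reindexing. $\mathcal{W}_{\mathcal{C}}$ is the symmetric monoidal category whose objects (boxes) are pairs $X=(X^{\mathrm{in}},X^{\mathrm{out}})$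 of $\mathcal{C}$-typed finite sets and whose morphisms (wiring diagrams) $\phi\colon X\to Y$ are pairs of typed functions $\phi^{\mathrm{in}}\colon X^{\mathrm{in}}\to X^{\mathrm{out}}+Y^{\mathrm{in}}$, $\phi^{\mathrm{out}}\colon Y^{\mathrm{out}}\to X^{\mathrm{out}}$. The composite $\omega=\psi\circ\phi$ has $\omega^{\mathrm{out}}=\phi^{\mathrm{out}}\circ\psi^{\mathrm{out}}$ and $\omega^{\mathrm{in}}=(\nabla+1)\circ(1+\phi^{\mathrm{out}}+1)\circ(1+\psi^{\mathrm{in}})\circ\phi^{\mathrm{in}}$; the identity is (coproduct inclusion, identity). The tensor $\oplus$ is componentwise disjoint union with unit $(\emptyset,\emptyset)$. $\phi$ induces $\widehat{\phi^{\mathrm{in}}}\colon\widehat{Y^{\mathrm{in}}}\times\widehat{X^{\mathrm{out}}}\to\widehat{X^{\mathrm{in}}}$ and $\widehat{\phi^{\mathrm{out}}}\colon\widehat{X^{\mathrm{out}}}\to\widehat{Y^{\mathrm{out}}}$. A functor $F\colon\mathcal{C}\to\mathcal{D}$ induces a strong monoidal functor $\mathcal{W}_F\colon\mathcal{W}_{\mathcal{C}}\to\mathcal{W}_{\mathcal{D}}$ by postcomposing typing functions with $F$. Algebras are symmetric lax monoidal functors to $(\mathbf{Cat},\times,\mathbf{1})$ and their maps monoidal natural transformations, all in the pseudo sense (up to coherent natural isomorphism). For finitely complete $\mathcal{C}$, the algebra $\mathsf{Spn}_{\mathcal{C}}\colon\mathcal{W}_{\mathcal{C}}\to\mathbf{Cat}$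 is $\mathsf{Spn}_{\mathcal{C}}(X)=\mathcal{C}/(\widehat{X^{\mathrm{in}}}\times\widehat{X^{\mathrm{out}}})$, with $\phi\colon X\to Y$ acting by pullback along $(\widehat{\phi^{\mathrm{in}}},\pi_2)\colon\widehat{Y^{\mathrm{in}}}\times\widehat{X^{\mathrm{out}}}\to\widehat{X^{\mathrm{in}}}\times\widehat{X^{\mathrm{out}}}$ followed by postcomposition with $1\times\widehat{\phi^{\mathrm{out}}}$, and lax structure the cartesian product of spans. $\mathsf{Mch}_C,\mathsf{Mch}_N,\mathsf{Mch}_{\mathsf{Sync}}$ (continuous, discrete, synchronous machines) are $\mathsf{Spn}_{\mathcal{C}}$ for $\mathcal{C}=\widetilde{\mathrm{Int}},\widetilde{\mathrm{Int}}_N,\widetilde{\mathrm{Int}}/\mathsf{Sync}$ respectively. For $F\colon\mathcal{C}\to\mathcal{D}$ preserving finite limits, $(\mathsf{Spn}_F)_X\colon\mathsf{Spn}_{\mathcal{C}}(X)\to\mathsf{Spn}_{\mathcal{D}}(\mathcal{W}_FX)$ sends $p\colon S\to\widehat{X^{\mathrm{in}}}\times\widehat{X^{\mathrm{out}}}$ to $Fp\colon FS\to F(\widehat{X^{\mathrm{in}}}\times\widehat{X^{\mathrm{out}}})\cong F\widehat{X^{\mathrm{in}}}\times F\widehat{X^{\mathrm{out}}}$. *)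

theory Defs
  imports Complex_Main "HOL-Library.FuncSet"
begin

section \<open>Categories, functors, natural isomorphisms\<close>

record ('o, 'm) cat =
  obs :: "'o set"
  arrs :: "'m set"
  src :: "'m \<Rightarrow> 'o"
  tgt :: "'m \<Rightarrow> 'o"
  idn :: "'o \<Rightarrow> 'm"
  cmp :: "'m \<Rightarrow> 'm \<Rightarrow> 'm"  (infixr "\<cdot>\<index>" 70)

definition hom :: "('o, 'm, 'z) cat_scheme \<Rightarrow> 'o \<Rightarrow> 'o \<Rightarrow> 'm set" where
  "hom C a b = {f \<in> arrs C. src C f = a \<and> tgt C f = b}"

locale category =
  fixes C :: "('o, 'm, 'z) cat_scheme" (structure)
  assumes src_obs: "f \<in> arrs C \<Longrightarrow> src C f \<in> obs C"
    and tgt_obs: "f \<in> arrs C \<Longrightarrow> tgt C f \<in> obs C"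
    and idn_hom: "a \<in> obs C \<Longrightarrow> idn C a \<in> hom C a a"
    and cmp_hom: "f \<in> hom C a b \<Longrightarrow> g \<in> hom C b c \<Longrightarrow> g \<cdot> f \<in> hom C a c"
    and idn_left: "f \<in> hom C a b \<Longrightarrow> idn C b \<cdot> f = f"
    and idn_right: "f \<in> hom C a b \<Longrightarrow> f \<cdot> idn C a = f"
    and cmp_assoc: "f \<in> hom C a b \<Longrightarrow> g \<in> hom C b c \<Longrightarrow> h \<in> hom C c d \<Longrightarrow> (h \<cdot> g) \<cdot> f = h \<cdot> (g \<cdot> f)"

definition inverse_arr :: "('o, 'm, 'z) cat_scheme \<Rightarrow> 'm \<Rightarrow> 'm \<Rightarrow> bool" where
  "inverse_arr C f g \<longleftrightarrow> f \<in> arrs C \<and> g \<in> hom C (tgt C f) (src C f) \<and>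
     cmp C g f = idn C (src C f) \<and> cmp C f g = idn C (tgt C f)"

definition is_iso :: "('o, 'm, 'z) cat_scheme \<Rightarrow> 'm \<Rightarrow> bool" where
  "is_iso C f \<longleftrightarrow> (\<exists>g. inverse_arr C f g)"

definition inv_arr :: "('o, 'm, 'z) cat_scheme \<Rightarrow> 'm \<Rightarrow> 'm" where
  "inv_arr C f = (THE g. inverse_arr C f g)"

definition prod_cat :: "('o, 'm, 'z) cat_scheme \<Rightarrow> ('p, 'n, 'y) cat_scheme \<Rightarrow> ('o \<times> 'p, 'm \<times> 'n) cat"
    (infixl "\<times>\<^sub>C" 75) where
  "prod_cat C D = \<lparr> obs = obs C \<times> obs D, arrs = arrs C \<times> arrs D,
     src = map_prod (src C) (src D), tgt = map_prod (tgt C) (tgt D),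
     idn = map_prod (idn C) (idn D),
     cmp = (\<lambda>(g, g') (f, f'). (cmp C g f, cmp D g' f')) \<rparr>"

record ('o, 'm, 'p, 'n) fct =
  fob :: "'o \<Rightarrow> 'p"
  far :: "'m \<Rightarrow> 'n"

locale cat_functor = C: category C + D: category D
  for C :: "('o, 'm, 'z) cat_scheme" and D :: "('p, 'n, 'y) cat_scheme" +
  fixes F :: "('o, 'm, 'p, 'n) fct"
  assumes fob_obs: "a \<in> obs C \<Longrightarrow> fob F a \<in> obs D"
    and far_hom: "f \<in> hom C a b \<Longrightarrow> far F f \<in> hom D (fob F a) (fob F b)"
    and far_idn: "a \<in> obs C \<Longrightarrow> far F (idn C a) = idn D (fob F a)"
    and far_cmp: "f \<in> hom C a b \<Longrightarrow> g \<in> hom C b c \<Longrightarrow> far F (cmp C g f) = cmp D (far F g) (far F f)"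

definition fct_comp :: "('p, 'n, 'q, 'k) fct \<Rightarrow> ('o, 'm, 'p, 'n) fct \<Rightarrow> ('o, 'm, 'q, 'k) fct"
    (infixr "\<circ>\<^sub>F" 70) where
  "G \<circ>\<^sub>F F = \<lparr> fob = fob G \<circ> fob F, far = far G \<circ> far F \<rparr>"

definition fct_prod :: "('o, 'm, 'p, 'n) fct \<Rightarrow> ('o', 'm', 'p', 'n') fct
    \<Rightarrow> ('o \<times> 'o', 'm \<times> 'm', 'p \<times> 'p', 'n \<times> 'n') fct" (infixl "\<times>\<^sub>F" 75) where
  "F \<times>\<^sub>F G = \<lparr> fob = map_prod (fob F) (fob G), far = map_prod (far F) (far G) \<rparr>"

definition fct_id :: "('o, 'm, 'o, 'm) fct" where
  "fct_id = \<lparr> fob = (\<lambda>x. x), far = (\<lambda>f. f) \<rparr>"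

definition fct_assoc :: "(('o \<times> 'p) \<times> 'q, ('m \<times> 'n) \<times> 'k, 'o \<times> ('p \<times> 'q), 'm \<times> ('n \<times> 'k)) fct" where
  "fct_assoc = \<lparr> fob = (\<lambda>((x, y), z). (x, (y, z))), far = (\<lambda>((f, g), h). (f, (g, h))) \<rparr>"

definition fct_swap :: "('o \<times> 'p, 'm \<times> 'n, 'p \<times> 'o, 'n \<times> 'm) fct" where
  "fct_swap = \<lparr> fob = (\<lambda>(x, y). (y, x)), far = (\<lambda>(f, g). (g, f)) \<rparr>"

definition fct_const_left :: "('o, 'm, 'z) cat_scheme \<Rightarrow> 'o \<Rightarrow> ('p, 'n, 'o \<times> 'p, 'm \<times> 'n) fct" where
  "fct_const_left C c = \<lparr> fob = (\<lambda>x. (c, x)), far = (\<lambda>f. (idn C c, f)) \<rparr>"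

definition fct_const_right :: "('o, 'm, 'z) cat_scheme \<Rightarrow> 'o \<Rightarrow> ('p, 'n, 'p \<times> 'o, 'n \<times> 'm) fct" where
  "fct_const_right C c = \<lparr> fob = (\<lambda>x. (x, c)), far = (\<lambda>f. (f, idn C c)) \<rparr>"

locale nat_iso = F: cat_functor C D F + G: cat_functor C D G
  for C :: "('o, 'm, 'z) cat_scheme" and D :: "('p, 'n, 'y) cat_scheme"
    and F G :: "('o, 'm, 'p, 'n) fct" +
  fixes \<eta> :: "'o \<Rightarrow> 'n"
  assumes cpt_hom: "a \<in> obs C \<Longrightarrow> \<eta> a \<in> hom D (fob F a) (fob G a)"
    and cpt_iso: "a \<in> obs C \<Longrightarrow> is_iso D (\<eta> a)"
    and natural: "f \<in> hom C a b \<Longrightarrow> cmp D (far G f) (\<eta> a) = cmp D (\<eta> b) (far F f)"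

section \<open>Symmetric monoidal categories\<close>

record ('o, 'm) smc = "('o, 'm) cat" +
  ten :: "'o \<Rightarrow> 'o \<Rightarrow> 'o"  (infixr "\<otimes>\<index>" 72)
  ten_ar :: "'m \<Rightarrow> 'm \<Rightarrow> 'm"  (infixr "\<odot>\<index>" 72)
  unt :: "'o"
  asc :: "'o \<Rightarrow> 'o \<Rightarrow> 'o \<Rightarrow> 'm"
  lun :: "'o \<Rightarrow> 'm"
  run :: "'o \<Rightarrow> 'm"
  brd :: "'o \<Rightarrow> 'o \<Rightarrow> 'm"

definition ten_fct :: "('o, 'm, 'z) smc_scheme \<Rightarrow> ('o \<times> 'o, 'm \<times> 'm, 'o, 'm) fct" where
  "ten_fct W = \<lparr> fob = (\<lambda>(X, Y). ten W X Y), far = (\<lambda>(f, g). ten_ar W f g) \<rparr>"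

locale symmetric_monoidal_category = category W
  for W :: "('o, 'm, 'z) smc_scheme" (structure) +
  assumes unt_obs: "unt W \<in> obs W"
    and ten_functor: "cat_functor (W \<times>\<^sub>C W) W (ten_fct W)"
    and asc_iso: "nat_iso (W \<times>\<^sub>C W \<times>\<^sub>C W) W
      (ten_fct W \<circ>\<^sub>F (ten_fct W \<times>\<^sub>F fct_id))
      (ten_fct W \<circ>\<^sub>F (fct_id \<times>\<^sub>F ten_fct W) \<circ>\<^sub>F fct_assoc)
      (\<lambda>((X, Y), Z). asc W X Y Z)"
    and lun_iso: "nat_iso W W (ten_fct W \<circ>\<^sub>F fct_const_left W (unt W)) fct_id (lun W)"
    and run_iso: "nat_iso W W (ten_fct W \<circ>\<^sub>F fct_const_right W (unt W)) fct_id (run W)"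
    and brd_iso: "nat_iso (W \<times>\<^sub>C W) W (ten_fct W) (ten_fct W \<circ>\<^sub>F fct_swap) (\<lambda>(X, Y). brd W X Y)"
    and pentagon: "X \<in> obs W \<Longrightarrow> Y \<in> obs W \<Longrightarrow> Z \<in> obs W \<Longrightarrow> V \<in> obs W \<Longrightarrow>
      asc W X Y (Z \<otimes> V) \<cdot> asc W (X \<otimes> Y) Z V
        = (idn W X \<odot> asc W Y Z V) \<cdot> asc W X (Y \<otimes> Z) V \<cdot> (asc W X Y Z \<odot> idn W V)"
    and triangle: "X \<in> obs W \<Longrightarrow> Y \<in> obs W \<Longrightarrow>
      (idn W X \<odot> lun W Y) \<cdot> asc W X (unt W) Y = run W X \<odot> idn W Y"
    and hexagon: "X \<in> obs W \<Longrightarrow> Y \<in> obs W \<Longrightarrow> Z \<in> obs W \<Longrightarrow>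
      asc W Y Z X \<cdot> brd W X (Y \<otimes> Z) \<cdot> asc W X Y Z
        = (idn W Y \<odot> brd W X Z) \<cdot> asc W Y X Z \<cdot> (brd W X Y \<odot> idn W Z)"
    and symmetry: "X \<in> obs W \<Longrightarrow> Y \<in> obs W \<Longrightarrow> brd W Y X \<cdot> brd W X Y = idn W (X \<otimes> Y)"

section \<open>Algebras: symmetric lax monoidal pseudofunctors to Cat\<close>

text \<open>
  The components of the structure cells are directed as follows, with \<open>A\<close> the action,
  \<open>\<mu>\<close> the laxator and \<open>\<epsilon>\<close> the lax unit:
  \<open>act_cmp \<psi> \<phi> : A \<psi> (A \<phi> s) \<rightarrow> A (\<psi> \<cdot> \<phi>) s\<close>,
  \<open>act_idn X : A (idn X) s \<rightarrow> s\<close>,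
  \<open>lax_nat \<phi> \<psi> : A (\<phi> \<odot> \<psi>) (\<mu> (s, t)) \<rightarrow> \<mu> (A \<phi> s, A \<psi> t)\<close>,
  \<open>lax_asc : A asc (\<mu> (\<mu> (s, t), u)) \<rightarrow> \<mu> (s, \<mu> (t, u))\<close>,
  \<open>lax_lun : A lun (\<mu> (\<epsilon>, s)) \<rightarrow> s\<close>,
  \<open>lax_run : A run (\<mu> (s, \<epsilon>)) \<rightarrow> s\<close>,
  \<open>lax_brd : A brd (\<mu> (s, t)) \<rightarrow> \<mu> (t, s)\<close>.
\<close>

record ('w, 'v, 'o, 'm) alg =
  fib :: "'w \<Rightarrow> ('o, 'm) cat"
  act :: "'v \<Rightarrow> ('o, 'm, 'o, 'm) fct"
  act_cmp :: "'v \<Rightarrow> 'v \<Rightarrow> 'o \<Rightarrow> 'm"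
  act_idn :: "'w \<Rightarrow> 'o \<Rightarrow> 'm"
  lax :: "'w \<Rightarrow> 'w \<Rightarrow> ('o \<times> 'o, 'm \<times> 'm, 'o, 'm) fct"
  lax_unt :: "'o"
  lax_nat :: "'v \<Rightarrow> 'v \<Rightarrow> 'o \<times> 'o \<Rightarrow> 'm"
  lax_asc :: "'w \<Rightarrow> 'w \<Rightarrow> 'w \<Rightarrow> ('o \<times> 'o) \<times> 'o \<Rightarrow> 'm"
  lax_lun :: "'w \<Rightarrow> 'o \<Rightarrow> 'm"
  lax_run :: "'w \<Rightarrow> 'o \<Rightarrow> 'm"
  lax_brd :: "'w \<Rightarrow> 'w \<Rightarrow> 'o \<times> 'o \<Rightarrow> 'm"

locale pseudofunctor = category W
  for W :: "('w, 'v, 'z) cat_scheme" (structure) +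
  fixes A :: "('w, 'v, 'o, 'm) alg"
  assumes fib_category: "X \<in> obs W \<Longrightarrow> category (fib A X)"
    and act_functor: "\<phi> \<in> hom W X Y \<Longrightarrow> cat_functor (fib A X) (fib A Y) (act A \<phi>)"
    and act_cmp_iso: "\<phi> \<in> hom W X Y \<Longrightarrow> \<psi> \<in> hom W Y Z \<Longrightarrow>
      nat_iso (fib A X) (fib A Z) (act A \<psi> \<circ>\<^sub>F act A \<phi>) (act A (\<psi> \<cdot> \<phi>)) (act_cmp A \<psi> \<phi>)"
    and act_idn_iso: "X \<in> obs W \<Longrightarrow>
      nat_iso (fib A X) (fib A X) (act A (idn W X)) fct_id (act_idn A X)"
    and act_cmp_assoc:
      "\<phi> \<in> hom W X Y \<Longrightarrow> \<psi> \<in> hom W Y Z \<Longrightarrow> \<chi> \<in> hom W Z V \<Longrightarrow> s \<in> obs (fib A X) \<Longrightarrow>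
        act_cmp A \<chi> (\<psi> \<cdot> \<phi>) s \<cdot>\<^bsub>fib A V\<^esub> far (act A \<chi>) (act_cmp A \<psi> \<phi> s)
          = act_cmp A (\<chi> \<cdot> \<psi>) \<phi> s \<cdot>\<^bsub>fib A V\<^esub> act_cmp A \<chi> \<psi> (fob (act A \<phi>) s)"
    and act_cmp_idn_right: "\<phi> \<in> hom W X Y \<Longrightarrow> s \<in> obs (fib A X) \<Longrightarrow>
        act_cmp A \<phi> (idn W X) s = far (act A \<phi>) (act_idn A X s)"
    and act_cmp_idn_left: "\<phi> \<in> hom W X Y \<Longrightarrow> s \<in> obs (fib A X) \<Longrightarrow>
        act_cmp A (idn W Y) \<phi> s = act_idn A Y (fob (act A \<phi>) s)"

locale algebra_data =
  fixes W :: "('w, 'v, 'z) smc_scheme" (structure) and A :: "('w, 'v, 'o, 'm) alg"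
begin

abbreviation act_ob :: "'v \<Rightarrow> 'o \<Rightarrow> 'o"  where "act_ob \<phi> \<equiv> fob (act A \<phi>)"
abbreviation act_ar :: "'v \<Rightarrow> 'm \<Rightarrow> 'm"  where "act_ar \<phi> \<equiv> far (act A \<phi>)"
abbreviation mu :: "'w \<Rightarrow> 'w \<Rightarrow> 'o \<Rightarrow> 'o \<Rightarrow> 'o"  where "mu X Y s t \<equiv> fob (lax A X Y) (s, t)"
abbreviation mu_ar :: "'w \<Rightarrow> 'w \<Rightarrow> 'm \<Rightarrow> 'm \<Rightarrow> 'm"  where "mu_ar X Y f g \<equiv> far (lax A X Y) (f, g)"

text \<open>Two composites of cells starting at \<open>A \<psi> (A \<phi> s)\<close> and at \<open>A \<psi>' (A \<phi>' s)\<close>, where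
  \<open>\<psi> \<cdot> \<phi> = \<psi>' \<cdot> \<phi>'\<close>, are compared after precomposing with the inverse of \<open>act_cmp\<close>.\<close>

abbreviation cinv :: "'w \<Rightarrow> 'v \<Rightarrow> 'v \<Rightarrow> 'o \<Rightarrow> 'm"
  where "cinv X \<psi> \<phi> s \<equiv> inv_arr (fib A X) (act_cmp A \<psi> \<phi> s)"

end

locale sym_lax_monoidal = symmetric_monoidal_category W + pseudofunctor W A + algebra_data W A
  for W :: "('w, 'v, 'z) smc_scheme" (structure) and A :: "('w, 'v, 'o, 'm) alg" +
  assumes lax_functor: "X \<in> obs W \<Longrightarrow> Y \<in> obs W \<Longrightarrow>
      cat_functor (fib A X \<times>\<^sub>C fib A Y) (fib A (X \<otimes> Y)) (lax A X Y)"
    and lax_unt_obs: "lax_unt A \<in> obs (fib A (unt W))"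

    and lax_nat_iso: "\<phi> \<in> hom W X X' \<Longrightarrow> \<psi> \<in> hom W Y Y' \<Longrightarrow>
      nat_iso (fib A X \<times>\<^sub>C fib A Y) (fib A (X' \<otimes> Y'))
        (act A (\<phi> \<odot> \<psi>) \<circ>\<^sub>F lax A X Y) (lax A X' Y' \<circ>\<^sub>F (act A \<phi> \<times>\<^sub>F act A \<psi>)) (lax_nat A \<phi> \<psi>)"
    and lax_nat_cmp:
      "\<phi> \<in> hom W X X' \<Longrightarrow> \<phi>' \<in> hom W X' X'' \<Longrightarrow> \<psi> \<in> hom W Y Y' \<Longrightarrow> \<psi>' \<in> hom W Y' Y'' \<Longrightarrow>
       s \<in> obs (fib A X) \<Longrightarrow> t \<in> obs (fib A Y) \<Longrightarrow> K = fib A (X'' \<otimes> Y'') \<Longrightarrow>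
       lax_nat A (\<phi>' \<cdot> \<phi>) (\<psi>' \<cdot> \<psi>) (s, t) \<cdot>\<^bsub>K\<^esub> act_cmp A (\<phi>' \<odot> \<psi>') (\<phi> \<odot> \<psi>) (mu X Y s t)
       = mu_ar X'' Y'' (act_cmp A \<phi>' \<phi> s) (act_cmp A \<psi>' \<psi> t)
         \<cdot>\<^bsub>K\<^esub> lax_nat A \<phi>' \<psi>' (act_ob \<phi> s, act_ob \<psi> t)
         \<cdot>\<^bsub>K\<^esub> act_ar (\<phi>' \<odot> \<psi>') (lax_nat A \<phi> \<psi> (s, t))"
    and lax_nat_idn:
      "X \<in> obs W \<Longrightarrow> Y \<in> obs W \<Longrightarrow> s \<in> obs (fib A X) \<Longrightarrow> t \<in> obs (fib A Y) \<Longrightarrow>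
       mu_ar X Y (act_idn A X s) (act_idn A Y t) \<cdot>\<^bsub>fib A (X \<otimes> Y)\<^esub> lax_nat A (idn W X) (idn W Y) (s, t)
       = act_idn A (X \<otimes> Y) (mu X Y s t)"

    and lax_asc_iso: "X \<in> obs W \<Longrightarrow> Y \<in> obs W \<Longrightarrow> Z \<in> obs W \<Longrightarrow>
      nat_iso (fib A X \<times>\<^sub>C fib A Y \<times>\<^sub>C fib A Z) (fib A (X \<otimes> Y \<otimes> Z))
        (act A (asc W X Y Z) \<circ>\<^sub>F lax A (X \<otimes> Y) Z \<circ>\<^sub>F (lax A X Y \<times>\<^sub>F fct_id))
        (lax A X (Y \<otimes> Z) \<circ>\<^sub>F (fct_id \<times>\<^sub>F lax A Y Z) \<circ>\<^sub>F fct_assoc)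
        (lax_asc A X Y Z)"
    and lax_asc_modification:
      "\<phi> \<in> hom W X X' \<Longrightarrow> \<psi> \<in> hom W Y Y' \<Longrightarrow> \<chi> \<in> hom W Z Z' \<Longrightarrow>
       s \<in> obs (fib A X) \<Longrightarrow> t \<in> obs (fib A Y) \<Longrightarrow> u \<in> obs (fib A Z) \<Longrightarrow> K = fib A (X' \<otimes> Y' \<otimes> Z') \<Longrightarrow>
       mu_ar X' (Y' \<otimes> Z') (idn (fib A X') (act_ob \<phi> s)) (lax_nat A \<psi> \<chi> (t, u))
         \<cdot>\<^bsub>K\<^esub> lax_nat A \<phi> (\<psi> \<odot> \<chi>) (s, mu Y Z t u)
         \<cdot>\<^bsub>K\<^esub> act_ar (\<phi> \<odot> \<psi> \<odot> \<chi>) (lax_asc A X Y Z ((s, t), u))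
         \<cdot>\<^bsub>K\<^esub> cinv (X' \<otimes> Y' \<otimes> Z') (\<phi> \<odot> \<psi> \<odot> \<chi>) (asc W X Y Z) (mu (X \<otimes> Y) Z (mu X Y s t) u)
       = lax_asc A X' Y' Z' ((act_ob \<phi> s, act_ob \<psi> t), act_ob \<chi> u)
         \<cdot>\<^bsub>K\<^esub> act_ar (asc W X' Y' Z')
                (mu_ar (X' \<otimes> Y') Z' (lax_nat A \<phi> \<psi> (s, t)) (idn (fib A Z') (act_ob \<chi> u)))
         \<cdot>\<^bsub>K\<^esub> act_ar (asc W X' Y' Z') (lax_nat A (\<phi> \<odot> \<psi>) \<chi> (mu X Y s t, u))
         \<cdot>\<^bsub>K\<^esub> cinv (X' \<otimes> Y' \<otimes> Z') (asc W X' Y' Z') ((\<phi> \<odot> \<psi>) \<odot> \<chi>) (mu (X \<otimes> Y) Z (mu X Y s t) u)"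

    and lax_lun_iso: "X \<in> obs W \<Longrightarrow>
      nat_iso (fib A X) (fib A X)
        (act A (lun W X) \<circ>\<^sub>F lax A (unt W) X \<circ>\<^sub>F fct_const_left (fib A (unt W)) (lax_unt A))
        fct_id (lax_lun A X)"
    and lax_lun_modification:
      "\<phi> \<in> hom W X Y \<Longrightarrow> s \<in> obs (fib A X) \<Longrightarrow> I = unt W \<Longrightarrow> K = fib A Y \<Longrightarrow>
       act_ar \<phi> (lax_lun A X s)
         \<cdot>\<^bsub>K\<^esub> cinv Y \<phi> (lun W X) (mu I X (lax_unt A) s)
       = lax_lun A Y (act_ob \<phi> s)
         \<cdot>\<^bsub>K\<^esub> act_ar (lun W Y) (mu_ar I Y (act_idn A I (lax_unt A)) (idn (fib A Y) (act_ob \<phi> s)))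
         \<cdot>\<^bsub>K\<^esub> act_ar (lun W Y) (lax_nat A (idn W I) \<phi> (lax_unt A, s))
         \<cdot>\<^bsub>K\<^esub> cinv Y (lun W Y) (idn W I \<odot> \<phi>) (mu I X (lax_unt A) s)"

    and lax_run_iso: "X \<in> obs W \<Longrightarrow>
      nat_iso (fib A X) (fib A X)
        (act A (run W X) \<circ>\<^sub>F lax A X (unt W) \<circ>\<^sub>F fct_const_right (fib A (unt W)) (lax_unt A))
        fct_id (lax_run A X)"
    and lax_run_modification:
      "\<phi> \<in> hom W X Y \<Longrightarrow> s \<in> obs (fib A X) \<Longrightarrow> I = unt W \<Longrightarrow> K = fib A Y \<Longrightarrow>
       act_ar \<phi> (lax_run A X s)
         \<cdot>\<^bsub>K\<^esub> cinv Y \<phi> (run W X) (mu X I s (lax_unt A))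
       = lax_run A Y (act_ob \<phi> s)
         \<cdot>\<^bsub>K\<^esub> act_ar (run W Y) (mu_ar Y I (idn (fib A Y) (act_ob \<phi> s)) (act_idn A I (lax_unt A)))
         \<cdot>\<^bsub>K\<^esub> act_ar (run W Y) (lax_nat A \<phi> (idn W I) (s, lax_unt A))
         \<cdot>\<^bsub>K\<^esub> cinv Y (run W Y) (\<phi> \<odot> idn W I) (mu X I s (lax_unt A))"

    and lax_brd_iso: "X \<in> obs W \<Longrightarrow> Y \<in> obs W \<Longrightarrow>
      nat_iso (fib A X \<times>\<^sub>C fib A Y) (fib A (Y \<otimes> X))
        (act A (brd W X Y) \<circ>\<^sub>F lax A X Y) (lax A Y X \<circ>\<^sub>F fct_swap) (lax_brd A X Y)"
    and lax_brd_modification: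
      "\<phi> \<in> hom W X X' \<Longrightarrow> \<psi> \<in> hom W Y Y' \<Longrightarrow> s \<in> obs (fib A X) \<Longrightarrow> t \<in> obs (fib A Y) \<Longrightarrow>
       K = fib A (Y' \<otimes> X') \<Longrightarrow>
       lax_nat A \<psi> \<phi> (t, s)
         \<cdot>\<^bsub>K\<^esub> act_ar (\<psi> \<odot> \<phi>) (lax_brd A X Y (s, t))
         \<cdot>\<^bsub>K\<^esub> cinv (Y' \<otimes> X') (\<psi> \<odot> \<phi>) (brd W X Y) (mu X Y s t)
       = lax_brd A X' Y' (act_ob \<phi> s, act_ob \<psi> t)
         \<cdot>\<^bsub>K\<^esub> act_ar (brd W X' Y') (lax_nat A \<phi> \<psi> (s, t))
         \<cdot>\<^bsub>K\<^esub> cinv (Y' \<otimes> X') (brd W X' Y') (\<phi> \<odot> \<psi>) (mu X Y s t)"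

    and lax_pentagon:
      "X \<in> obs W \<Longrightarrow> Y \<in> obs W \<Longrightarrow> Z \<in> obs W \<Longrightarrow> V \<in> obs W \<Longrightarrow>
       s \<in> obs (fib A X) \<Longrightarrow> t \<in> obs (fib A Y) \<Longrightarrow> u \<in> obs (fib A Z) \<Longrightarrow> v \<in> obs (fib A V) \<Longrightarrow>
       K = fib A (X \<otimes> Y \<otimes> Z \<otimes> V) \<Longrightarrow>
       m = mu ((X \<otimes> Y) \<otimes> Z) V (mu (X \<otimes> Y) Z (mu X Y s t) u) v \<Longrightarrow>
       a = asc W X Y Z \<odot> idn W V \<Longrightarrow> b = asc W X (Y \<otimes> Z) V \<Longrightarrow> c = idn W X \<odot> asc W Y Z V \<Longrightarrow>
       lax_asc A X Y (Z \<otimes> V) ((s, t), mu Z V u v)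
         \<cdot>\<^bsub>K\<^esub> act_ar (asc W X Y (Z \<otimes> V)) (lax_asc A (X \<otimes> Y) Z V ((mu X Y s t, u), v))
         \<cdot>\<^bsub>K\<^esub> cinv (X \<otimes> Y \<otimes> Z \<otimes> V) (asc W X Y (Z \<otimes> V)) (asc W (X \<otimes> Y) Z V) m
       = mu_ar X (Y \<otimes> Z \<otimes> V) (act_idn A X s) (lax_asc A Y Z V ((t, u), v))
         \<cdot>\<^bsub>K\<^esub> lax_nat A (idn W X) (asc W Y Z V) (s, mu (Y \<otimes> Z) V (mu Y Z t u) v)
         \<cdot>\<^bsub>K\<^esub> act_ar c (lax_asc A X (Y \<otimes> Z) V ((s, mu Y Z t u), v))
         \<cdot>\<^bsub>K\<^esub> act_ar c (act_ar b (mu_ar (X \<otimes> Y \<otimes> Z) V (lax_asc A X Y Z ((s, t), u)) (act_idn A V v)))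
         \<cdot>\<^bsub>K\<^esub> act_ar c (act_ar b (lax_nat A (asc W X Y Z) (idn W V) (mu (X \<otimes> Y) Z (mu X Y s t) u, v)))
         \<cdot>\<^bsub>K\<^esub> act_ar c (cinv (X \<otimes> (Y \<otimes> Z) \<otimes> V) b a m)
         \<cdot>\<^bsub>K\<^esub> cinv (X \<otimes> Y \<otimes> Z \<otimes> V) c (b \<cdot> a) m"

    and lax_triangle:
      "X \<in> obs W \<Longrightarrow> Y \<in> obs W \<Longrightarrow> s \<in> obs (fib A X) \<Longrightarrow> t \<in> obs (fib A Y) \<Longrightarrow>
       I = unt W \<Longrightarrow> K = fib A (X \<otimes> Y) \<Longrightarrow> m = mu (X \<otimes> I) Y (mu X I s (lax_unt A)) t \<Longrightarrow>
       mu_ar X Y (act_idn A X s) (lax_lun A Y t)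
         \<cdot>\<^bsub>K\<^esub> lax_nat A (idn W X) (lun W Y) (s, mu I Y (lax_unt A) t)
         \<cdot>\<^bsub>K\<^esub> act_ar (idn W X \<odot> lun W Y) (lax_asc A X I Y ((s, lax_unt A), t))
         \<cdot>\<^bsub>K\<^esub> cinv (X \<otimes> Y) (idn W X \<odot> lun W Y) (asc W X I Y) m
       = mu_ar X Y (lax_run A X s) (act_idn A Y t)
         \<cdot>\<^bsub>K\<^esub> lax_nat A (run W X) (idn W Y) (mu X I s (lax_unt A), t)"

    and lax_hexagon:
      "X \<in> obs W \<Longrightarrow> Y \<in> obs W \<Longrightarrow> Z \<in> obs W \<Longrightarrow>
       s \<in> obs (fib A X) \<Longrightarrow> t \<in> obs (fib A Y) \<Longrightarrow> u \<in> obs (fib A Z) \<Longrightarrow>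
       K = fib A (Y \<otimes> Z \<otimes> X) \<Longrightarrow> m = mu (X \<otimes> Y) Z (mu X Y s t) u \<Longrightarrow>
       a = asc W X Y Z \<Longrightarrow> b = brd W X (Y \<otimes> Z) \<Longrightarrow> c = asc W Y Z X \<Longrightarrow>
       a' = brd W X Y \<odot> idn W Z \<Longrightarrow> b' = asc W Y X Z \<Longrightarrow> c' = idn W Y \<odot> brd W X Z \<Longrightarrow>
       lax_asc A Y Z X ((t, u), s)
         \<cdot>\<^bsub>K\<^esub> act_ar c (lax_brd A X (Y \<otimes> Z) (s, mu Y Z t u))
         \<cdot>\<^bsub>K\<^esub> act_ar c (act_ar b (lax_asc A X Y Z ((s, t), u)))
         \<cdot>\<^bsub>K\<^esub> act_ar c (cinv ((Y \<otimes> Z) \<otimes> X) b a m)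
         \<cdot>\<^bsub>K\<^esub> cinv (Y \<otimes> Z \<otimes> X) c (b \<cdot> a) m
       = mu_ar Y (Z \<otimes> X) (act_idn A Y t) (lax_brd A X Z (s, u))
         \<cdot>\<^bsub>K\<^esub> lax_nat A (idn W Y) (brd W X Z) (t, mu X Z s u)
         \<cdot>\<^bsub>K\<^esub> act_ar c' (lax_asc A Y X Z ((t, s), u))
         \<cdot>\<^bsub>K\<^esub> act_ar c' (act_ar b' (mu_ar (Y \<otimes> X) Z (lax_brd A X Y (s, t)) (act_idn A Z u)))
         \<cdot>\<^bsub>K\<^esub> act_ar c' (act_ar b' (lax_nat A (brd W X Y) (idn W Z) (mu X Y s t, u)))
         \<cdot>\<^bsub>K\<^esub> act_ar c' (cinv (Y \<otimes> X \<otimes> Z) b' a' m)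
         \<cdot>\<^bsub>K\<^esub> cinv (Y \<otimes> Z \<otimes> X) c' (b' \<cdot> a') m"

    and lax_symmetry:
      "X \<in> obs W \<Longrightarrow> Y \<in> obs W \<Longrightarrow> s \<in> obs (fib A X) \<Longrightarrow> t \<in> obs (fib A Y) \<Longrightarrow> K = fib A (X \<otimes> Y) \<Longrightarrow>
       lax_brd A Y X (t, s) \<cdot>\<^bsub>K\<^esub> act_ar (brd W Y X) (lax_brd A X Y (s, t))
       = act_idn A (X \<otimes> Y) (mu X Y s t) \<cdot>\<^bsub>K\<^esub> act_cmp A (brd W Y X) (brd W X Y) (mu X Y s t)"

text \<open>
  Maps of algebras are symmetric monoidal pseudonatural transformations. With \<open>\<theta> X\<close> the component
  functors, the cells are directed
  \<open>cpt_nat \<phi> : \<theta> Y (A \<phi> s) \<rightarrow> B \<phi> (\<theta> X s)\<close>,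
  \<open>cpt_lax X Y : \<theta> (X \<otimes> Y) (\<mu> (s, t)) \<rightarrow> \<mu> (\<theta> X s, \<theta> Y t)\<close>,
  \<open>cpt_unt : \<theta> I \<epsilon> \<rightarrow> \<epsilon>\<close>.
\<close>

record ('w, 'v, 'o, 'm, 'p, 'n) transf =
  cpt :: "'w \<Rightarrow> ('o, 'm, 'p, 'n) fct"
  cpt_nat :: "'v \<Rightarrow> 'o \<Rightarrow> 'n"
  cpt_lax :: "'w \<Rightarrow> 'w \<Rightarrow> 'o \<times> 'o \<Rightarrow> 'n"
  cpt_unt :: "'n"

locale algebra_map = A: sym_lax_monoidal W A + B: sym_lax_monoidal W B
  for W :: "('w, 'v, 'z) smc_scheme" (structure)
    and A :: "('w, 'v, 'o, 'm) alg" and B :: "('w, 'v, 'p, 'n) alg" +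
  fixes \<theta> :: "('w, 'v, 'o, 'm, 'p, 'n) transf"
  assumes cpt_functor: "X \<in> obs W \<Longrightarrow> cat_functor (fib A X) (fib B X) (cpt \<theta> X)"
    and cpt_nat_iso: "\<phi> \<in> hom W X Y \<Longrightarrow>
      nat_iso (fib A X) (fib B Y) (cpt \<theta> Y \<circ>\<^sub>F act A \<phi>) (act B \<phi> \<circ>\<^sub>F cpt \<theta> X) (cpt_nat \<theta> \<phi>)"
    and cpt_nat_cmp:
      "\<phi> \<in> hom W X Y \<Longrightarrow> \<psi> \<in> hom W Y Z \<Longrightarrow> s \<in> obs (fib A X) \<Longrightarrow> K = fib B Z \<Longrightarrow>
       cpt_nat \<theta> (\<psi> \<cdot> \<phi>) s \<cdot>\<^bsub>K\<^esub> far (cpt \<theta> Z) (act_cmp A \<psi> \<phi> s)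
       = act_cmp B \<psi> \<phi> (fob (cpt \<theta> X) s)
         \<cdot>\<^bsub>K\<^esub> B.act_ar \<psi> (cpt_nat \<theta> \<phi> s)
         \<cdot>\<^bsub>K\<^esub> cpt_nat \<theta> \<psi> (A.act_ob \<phi> s)"
    and cpt_nat_idn:
      "X \<in> obs W \<Longrightarrow> s \<in> obs (fib A X) \<Longrightarrow>
       act_idn B X (fob (cpt \<theta> X) s) \<cdot>\<^bsub>fib B X\<^esub> cpt_nat \<theta> (idn W X) s = far (cpt \<theta> X) (act_idn A X s)"

    and cpt_lax_iso: "X \<in> obs W \<Longrightarrow> Y \<in> obs W \<Longrightarrow>
      nat_iso (fib A X \<times>\<^sub>C fib A Y) (fib B (X \<otimes> Y))
        (cpt \<theta> (X \<otimes> Y) \<circ>\<^sub>F lax A X Y) (lax B X Y \<circ>\<^sub>F (cpt \<theta> X \<times>\<^sub>F cpt \<theta> Y)) (cpt_lax \<theta> X Y)"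
    and cpt_lax_modification:
      "\<phi> \<in> hom W X X' \<Longrightarrow> \<psi> \<in> hom W Y Y' \<Longrightarrow> s \<in> obs (fib A X) \<Longrightarrow> t \<in> obs (fib A Y) \<Longrightarrow>
       K = fib B (X' \<otimes> Y') \<Longrightarrow>
       lax_nat B \<phi> \<psi> (fob (cpt \<theta> X) s, fob (cpt \<theta> Y) t)
         \<cdot>\<^bsub>K\<^esub> B.act_ar (\<phi> \<odot> \<psi>) (cpt_lax \<theta> X Y (s, t))
         \<cdot>\<^bsub>K\<^esub> cpt_nat \<theta> (\<phi> \<odot> \<psi>) (A.mu X Y s t)
       = B.mu_ar X' Y' (cpt_nat \<theta> \<phi> s) (cpt_nat \<theta> \<psi> t)
         \<cdot>\<^bsub>K\<^esub> cpt_lax \<theta> X' Y' (A.act_ob \<phi> s, A.act_ob \<psi> t)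
         \<cdot>\<^bsub>K\<^esub> far (cpt \<theta> (X' \<otimes> Y')) (lax_nat A \<phi> \<psi> (s, t))"
    and cpt_unt_hom: "cpt_unt \<theta> \<in> hom (fib B (unt W)) (fob (cpt \<theta> (unt W)) (lax_unt A)) (lax_unt B)"
    and cpt_unt_iso: "is_iso (fib B (unt W)) (cpt_unt \<theta>)"

    and cpt_asc:
      "X \<in> obs W \<Longrightarrow> Y \<in> obs W \<Longrightarrow> Z \<in> obs W \<Longrightarrow>
       s \<in> obs (fib A X) \<Longrightarrow> t \<in> obs (fib A Y) \<Longrightarrow> u \<in> obs (fib A Z) \<Longrightarrow>
       K = fib B (X \<otimes> Y \<otimes> Z) \<Longrightarrow> a = asc W X Y Z \<Longrightarrow>
       B.mu_ar X (Y \<otimes> Z) (idn (fib B X) (fob (cpt \<theta> X) s)) (cpt_lax \<theta> Y Z (t, u))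
         \<cdot>\<^bsub>K\<^esub> cpt_lax \<theta> X (Y \<otimes> Z) (s, A.mu Y Z t u)
         \<cdot>\<^bsub>K\<^esub> far (cpt \<theta> (X \<otimes> Y \<otimes> Z)) (lax_asc A X Y Z ((s, t), u))
       = lax_asc B X Y Z ((fob (cpt \<theta> X) s, fob (cpt \<theta> Y) t), fob (cpt \<theta> Z) u)
         \<cdot>\<^bsub>K\<^esub> B.act_ar a (B.mu_ar (X \<otimes> Y) Z (cpt_lax \<theta> X Y (s, t)) (idn (fib B Z) (fob (cpt \<theta> Z) u)))
         \<cdot>\<^bsub>K\<^esub> B.act_ar a (cpt_lax \<theta> (X \<otimes> Y) Z (A.mu X Y s t, u))
         \<cdot>\<^bsub>K\<^esub> cpt_nat \<theta> a (A.mu (X \<otimes> Y) Z (A.mu X Y s t) u)"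
    and cpt_lun:
      "X \<in> obs W \<Longrightarrow> s \<in> obs (fib A X) \<Longrightarrow> I = unt W \<Longrightarrow> K = fib B X \<Longrightarrow> l = lun W X \<Longrightarrow>
       far (cpt \<theta> X) (lax_lun A X s)
       = lax_lun B X (fob (cpt \<theta> X) s)
         \<cdot>\<^bsub>K\<^esub> B.act_ar l (B.mu_ar I X (cpt_unt \<theta>) (idn (fib B X) (fob (cpt \<theta> X) s)))
         \<cdot>\<^bsub>K\<^esub> B.act_ar l (cpt_lax \<theta> I X (lax_unt A, s))
         \<cdot>\<^bsub>K\<^esub> cpt_nat \<theta> l (A.mu I X (lax_unt A) s)"
    and cpt_run:
      "X \<in> obs W \<Longrightarrow> s \<in> obs (fib A X) \<Longrightarrow> I = unt W \<Longrightarrow> K = fib B X \<Longrightarrow> r = run W X \<Longrightarrow>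
       far (cpt \<theta> X) (lax_run A X s)
       = lax_run B X (fob (cpt \<theta> X) s)
         \<cdot>\<^bsub>K\<^esub> B.act_ar r (B.mu_ar X I (idn (fib B X) (fob (cpt \<theta> X) s)) (cpt_unt \<theta>))
         \<cdot>\<^bsub>K\<^esub> B.act_ar r (cpt_lax \<theta> X I (s, lax_unt A))
         \<cdot>\<^bsub>K\<^esub> cpt_nat \<theta> r (A.mu X I s (lax_unt A))"
    and cpt_brd:
      "X \<in> obs W \<Longrightarrow> Y \<in> obs W \<Longrightarrow> s \<in> obs (fib A X) \<Longrightarrow> t \<in> obs (fib A Y) \<Longrightarrow>
       K = fib B (Y \<otimes> X) \<Longrightarrow> b = brd W X Y \<Longrightarrow>
       cpt_lax \<theta> Y X (t, s) \<cdot>\<^bsub>K\<^esub> far (cpt \<theta> (Y \<otimes> X)) (lax_brd A X Y (s, t))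
       = lax_brd B X Y (fob (cpt \<theta> X) s, fob (cpt \<theta> Y) t)
         \<cdot>\<^bsub>K\<^esub> B.act_ar b (cpt_lax \<theta> X Y (s, t))
         \<cdot>\<^bsub>K\<^esub> cpt_nat \<theta> b (A.mu X Y s t)"

text \<open>Restriction of an algebra along a functor \<open>G\<close> that preserves the symmetric monoidal
  structure strictly, as the functors \<open>Wiring_fct F\<close> below do.\<close>

definition restrict_alg :: "('w, 'v, 'w', 'v') fct \<Rightarrow> ('w', 'v', 'o, 'm) alg \<Rightarrow> ('w, 'v, 'o, 'm) alg" where
  "restrict_alg G B = \<lparr>
     fib = (\<lambda>X. fib B (fob G X)),
     act = (\<lambda>\<phi>. act B (far G \<phi>)),
     act_cmp = (\<lambda>\<psi> \<phi>. act_cmp B (far G \<psi>) (far G \<phi>)),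
     act_idn = (\<lambda>X. act_idn B (fob G X)),
     lax = (\<lambda>X Y. lax B (fob G X) (fob G Y)),
     lax_unt = lax_unt B,
     lax_nat = (\<lambda>\<phi> \<psi>. lax_nat B (far G \<phi>) (far G \<psi>)),
     lax_asc = (\<lambda>X Y Z. lax_asc B (fob G X) (fob G Y) (fob G Z)),
     lax_lun = (\<lambda>X. lax_lun B (fob G X)),
     lax_run = (\<lambda>X. lax_run B (fob G X)),
     lax_brd = (\<lambda>X Y. lax_brd B (fob G X) (fob G Y)) \<rparr>"

section \<open>Chosen finite products and pullbacks, slices\<close>

definition is_product :: "('o, 'm, 'z) cat_scheme \<Rightarrow> ('i \<rightharpoonup> 'o) \<Rightarrow> 'o \<Rightarrow> ('i \<Rightarrow> 'm) \<Rightarrow> bool" where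
  "is_product C T P \<pi> \<longleftrightarrow>
     P \<in> obs C \<and> (\<forall>i\<in>dom T. \<pi> i \<in> hom C P (the (T i))) \<and>
     (\<forall>Q q. Q \<in> obs C \<and> (\<forall>i\<in>dom T. q i \<in> hom C Q (the (T i))) \<longrightarrow>
        (\<exists>!u. u \<in> hom C Q P \<and> (\<forall>i\<in>dom T. cmp C (\<pi> i) u = q i)))"

definition product :: "('o, 'm, 'z) cat_scheme \<Rightarrow> ('i \<rightharpoonup> 'o) \<Rightarrow> 'o \<times> ('i \<Rightarrow> 'm)" where
  "product C T = (SOME (P, \<pi>). is_product C T P \<pi>)"

definition hat :: "('o, 'm, 'z) cat_scheme \<Rightarrow> ('i \<rightharpoonup> 'o) \<Rightarrow> 'o" where
  "hat C T = fst (product C T)"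

definition proj :: "('o, 'm, 'z) cat_scheme \<Rightarrow> ('i \<rightharpoonup> 'o) \<Rightarrow> 'i \<Rightarrow> 'm" where
  "proj C T = snd (product C T)"

definition tuple :: "('o, 'm, 'z) cat_scheme \<Rightarrow> ('i \<rightharpoonup> 'o) \<Rightarrow> 'o \<Rightarrow> ('i \<Rightarrow> 'm) \<Rightarrow> 'm" where
  "tuple C T Q q = (THE u. u \<in> hom C Q (hat C T) \<and> (\<forall>i\<in>dom T. cmp C (proj C T i) u = q i))"

definition two :: "'o \<Rightarrow> 'o \<Rightarrow> bool \<rightharpoonup> 'o" where
  "two a b = (\<lambda>i. Some (if i then b else a))"

definition prd :: "('o, 'm, 'z) cat_scheme \<Rightarrow> 'o \<Rightarrow> 'o \<Rightarrow> 'o" where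
  "prd C a b = hat C (two a b)"

definition pr1 :: "('o, 'm, 'z) cat_scheme \<Rightarrow> 'o \<Rightarrow> 'o \<Rightarrow> 'm" where
  "pr1 C a b = proj C (two a b) False"

definition pr2 :: "('o, 'm, 'z) cat_scheme \<Rightarrow> 'o \<Rightarrow> 'o \<Rightarrow> 'm" where
  "pr2 C a b = proj C (two a b) True"

definition pair :: "('o, 'm, 'z) cat_scheme \<Rightarrow> 'm \<Rightarrow> 'm \<Rightarrow> 'm" where
  "pair C f g = tuple C (two (tgt C f) (tgt C g)) (src C f) (\<lambda>i. if i then g else f)"

definition terminal :: "('o, 'm, 'z) cat_scheme \<Rightarrow> 'o" where
  "terminal C = hat C (Map.empty :: unit \<rightharpoonup> 'o)"

definition bang :: "('o, 'm, 'z) cat_scheme \<Rightarrow> 'o \<Rightarrow> 'm" where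
  "bang C a = tuple C (Map.empty :: unit \<rightharpoonup> 'o) a undefined"

definition is_pullback :: "('o, 'm, 'z) cat_scheme \<Rightarrow> 'm \<Rightarrow> 'm \<Rightarrow> 'o \<times> 'm \<times> 'm \<Rightarrow> bool" where
  "is_pullback C f g = (\<lambda>(P, a, b).
     P \<in> obs C \<and> a \<in> hom C P (src C f) \<and> b \<in> hom C P (src C g) \<and> cmp C f a = cmp C g b \<and>
     (\<forall>Q x y. x \<in> hom C Q (src C f) \<and> y \<in> hom C Q (src C g) \<and> cmp C f x = cmp C g y \<longrightarrow>
        (\<exists>!u. u \<in> hom C Q P \<and> cmp C a u = x \<and> cmp C b u = y)))"

definition pullback :: "('o, 'm, 'z) cat_scheme \<Rightarrow> 'm \<Rightarrow> 'm \<Rightarrow> 'o \<times> 'm \<times> 'm" where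
  "pullback C f g = (SOME P. is_pullback C f g P)"

definition pb_ob :: "('o, 'm, 'z) cat_scheme \<Rightarrow> 'm \<Rightarrow> 'm \<Rightarrow> 'o" where
  "pb_ob C f g = fst (pullback C f g)"

definition pb1 :: "('o, 'm, 'z) cat_scheme \<Rightarrow> 'm \<Rightarrow> 'm \<Rightarrow> 'm" where
  "pb1 C f g = fst (snd (pullback C f g))"

definition pb2 :: "('o, 'm, 'z) cat_scheme \<Rightarrow> 'm \<Rightarrow> 'm \<Rightarrow> 'm" where
  "pb2 C f g = snd (snd (pullback C f g))"

definition pb_lift :: "('o, 'm, 'z) cat_scheme \<Rightarrow> 'm \<Rightarrow> 'm \<Rightarrow> 'm \<Rightarrow> 'm \<Rightarrow> 'm" where
  "pb_lift C f g x y = (THE u. u \<in> hom C (src C x) (pb_ob C f g) \<and>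
     cmp C (pb1 C f g) u = x \<and> cmp C (pb2 C f g) u = y)"

text \<open>An arrow of the slice is recorded together with its source and target.\<close>

definition slice :: "('o, 'm, 'z) cat_scheme \<Rightarrow> 'o \<Rightarrow> ('m, 'm \<times> 'm \<times> 'm) cat" where
  "slice C b = \<lparr>
     obs = {p \<in> arrs C. tgt C p = b},
     arrs = {(p, f, q). p \<in> arrs C \<and> tgt C p = b \<and> q \<in> arrs C \<and> tgt C q = b \<and>
               f \<in> hom C (src C p) (src C q) \<and> cmp C q f = p},
     src = (\<lambda>(p, f, q). p),
     tgt = (\<lambda>(p, f, q). q),
     idn = (\<lambda>p. (p, idn C (src C p), p)),
     cmp = (\<lambda>(q, g, r) (p, f, q'). (p, cmp C g f, r)) \<rparr>"

section \<open>Wiring diagrams\<close>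

text \<open>
  A finite set is a finite set of ports; up to isomorphism every finite set is of this form.
  A \<open>C\<close>-typed finite set is a finite partial map from ports to objects: its domain is the
  underlying set and its values are the types.
\<close>

datatype 'l port = Port 'l | InL "'l port" | InR "'l port"

type_synonym ('l, 'o) tset = "'l port \<rightharpoonup> 'o"

definition is_tset :: "('o, 'm, 'z) cat_scheme \<Rightarrow> ('l, 'o) tset \<Rightarrow> bool" where
  "is_tset C T \<longleftrightarrow> finite (dom T) \<and> ran T \<subseteq> obs C"

fun tsum :: "('l, 'o) tset \<Rightarrow> ('l, 'o) tset \<Rightarrow> ('l, 'o) tset" where
  "tsum S T (InL x) = S x"
| "tsum S T (InR y) = T y"
| "tsum S T (Port l) = None"

record ('l, 'o) box =
  inp :: "('l, 'o) tset"
  outp :: "('l, 'o) tset"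

text \<open>\<open>Inl\<close> marks the summand \<open>X\<^sup>o\<^sup>u\<^sup>t\<close> and \<open>Inr\<close> the summand \<open>Y\<^sup>i\<^sup>n\<close> in the
  codomain of \<open>win\<close>. Both maps are extensional, so that equality of wiring diagrams is equality of
  the typed functions.\<close>

record ('l, 'o) wd =
  wsrc :: "('l, 'o) box"
  wtgt :: "('l, 'o) box"
  win :: "'l port \<Rightarrow> 'l port + 'l port"
  wout :: "'l port \<Rightarrow> 'l port"

definition is_box :: "('o, 'm, 'z) cat_scheme \<Rightarrow> ('l, 'o) box \<Rightarrow> bool" where
  "is_box C X \<longleftrightarrow> is_tset C (inp X) \<and> is_tset C (outp X)"

definition is_wd :: "('o, 'm, 'z) cat_scheme \<Rightarrow> ('l, 'o) wd \<Rightarrow> bool" where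
  "is_wd C \<phi> \<longleftrightarrow> is_box C (wsrc \<phi>) \<and> is_box C (wtgt \<phi>) \<and>
     win \<phi> \<in> extensional (dom (inp (wsrc \<phi>))) \<and>
     (\<forall>x\<in>dom (inp (wsrc \<phi>)). case_sum (outp (wsrc \<phi>)) (inp (wtgt \<phi>)) (win \<phi> x) = inp (wsrc \<phi>) x) \<and>
     wout \<phi> \<in> extensional (dom (outp (wtgt \<phi>))) \<and>
     (\<forall>y\<in>dom (outp (wtgt \<phi>)). outp (wsrc \<phi>) (wout \<phi> y) = outp (wtgt \<phi>) y)"

text \<open>The wiring diagram that only relabels ports along \<open>f : X\<^sup>i\<^sup>n \<rightarrow> Y\<^sup>i\<^sup>n\<close> and
  \<open>g : Y\<^sup>o\<^sup>u\<^sup>t \<rightarrow> X\<^sup>o\<^sup>u\<^sup>t\<close>.\<close>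

definition relabel ::
    "('l, 'o) box \<Rightarrow> ('l, 'o) box \<Rightarrow> ('l port \<Rightarrow> 'l port) \<Rightarrow> ('l port \<Rightarrow> 'l port) \<Rightarrow> ('l, 'o) wd" where
  "relabel X Y f g = \<lparr> wsrc = X, wtgt = Y,
     win = restrict (Inr \<circ> f) (dom (inp X)), wout = restrict g (dom (outp Y)) \<rparr>"

definition wd_id :: "('l, 'o) box \<Rightarrow> ('l, 'o) wd" where
  "wd_id X = relabel X X id id"

definition wd_comp :: "('l, 'o) wd \<Rightarrow> ('l, 'o) wd \<Rightarrow> ('l, 'o) wd" where
  "wd_comp \<psi> \<phi> = \<lparr> wsrc = wsrc \<phi>, wtgt = wtgt \<psi>,
     win = restrict (\<lambda>x. case win \<phi> x of
               Inl x' \<Rightarrow> Inl x'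
             | Inr y \<Rightarrow> (case win \<psi> y of Inl y' \<Rightarrow> Inl (wout \<phi> y') | Inr z \<Rightarrow> Inr z))
           (dom (inp (wsrc \<phi>))),
     wout = restrict (wout \<phi> \<circ> wout \<psi>) (dom (outp (wtgt \<psi>))) \<rparr>"

definition box_sum :: "('l, 'o) box \<Rightarrow> ('l, 'o) box \<Rightarrow> ('l, 'o) box" where
  "box_sum X Y = \<lparr> inp = tsum (inp X) (inp Y), outp = tsum (outp X) (outp Y) \<rparr>"

definition box_empty :: "('l, 'o) box" where
  "box_empty = \<lparr> inp = Map.empty, outp = Map.empty \<rparr>"

primrec port_case :: "('l port \<Rightarrow> 'b) \<Rightarrow> ('l port \<Rightarrow> 'b) \<Rightarrow> 'l port \<Rightarrow> 'b" where
  "port_case f g (InL x) = f x"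
| "port_case f g (InR y) = g y"
| "port_case f g (Port l) = undefined"

definition wd_sum :: "('l, 'o) wd \<Rightarrow> ('l, 'o) wd \<Rightarrow> ('l, 'o) wd" where
  "wd_sum \<phi> \<psi> = \<lparr> wsrc = box_sum (wsrc \<phi>) (wsrc \<psi>), wtgt = box_sum (wtgt \<phi>) (wtgt \<psi>),
     win = restrict (port_case (map_sum InL InL \<circ> win \<phi>) (map_sum InR InR \<circ> win \<psi>))
             (dom (tsum (inp (wsrc \<phi>)) (inp (wsrc \<psi>)))),
     wout = restrict (port_case (InL \<circ> wout \<phi>) (InR \<circ> wout \<psi>))
             (dom (tsum (outp (wtgt \<phi>)) (outp (wtgt \<psi>)))) \<rparr>"

definition assocR :: "'l port \<Rightarrow> 'l port" where
  "assocR = port_case (port_case InL (InR \<circ> InL)) (InR \<circ> InR)"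

definition assocL :: "'l port \<Rightarrow> 'l port" where
  "assocL = port_case (InL \<circ> InL) (port_case (InL \<circ> InR) InR)"

definition swap_port :: "'l port \<Rightarrow> 'l port" where
  "swap_port = port_case InR InL"

definition Wiring :: "('o, 'm, 'z) cat_scheme \<Rightarrow> (('l, 'o) box, ('l, 'o) wd) smc" where
  "Wiring C = \<lparr>
     obs = {X. is_box C X},
     arrs = {\<phi>. is_wd C \<phi>},
     src = wsrc,
     tgt = wtgt,
     idn = wd_id,
     cmp = wd_comp,
     ten = box_sum,
     ten_ar = wd_sum,
     unt = box_empty,
     asc = (\<lambda>X Y Z. relabel (box_sum (box_sum X Y) Z) (box_sum X (box_sum Y Z)) assocR assocL),
     lun = (\<lambda>X. relabel (box_sum box_empty X) X (port_case undefined id) InR),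
     run = (\<lambda>X. relabel (box_sum X box_empty) X (port_case id undefined) InL),
     brd = (\<lambda>X Y. relabel (box_sum X Y) (box_sum Y X) swap_port swap_port) \<rparr>"

definition retype :: "('o, 'm, 'p, 'n) fct \<Rightarrow> ('l, 'o) box \<Rightarrow> ('l, 'p) box" where
  "retype F X = \<lparr> inp = map_option (fob F) \<circ> inp X, outp = map_option (fob F) \<circ> outp X \<rparr>"

definition Wiring_fct :: "('o, 'm, 'p, 'n) fct
    \<Rightarrow> (('l, 'o) box, ('l, 'o) wd, ('l, 'p) box, ('l, 'p) wd) fct" where
  "Wiring_fct F = \<lparr> fob = retype F,
     far = (\<lambda>\<phi>. \<lparr> wsrc = retype F (wsrc \<phi>), wtgt = retype F (wtgt \<phi>),
                  win = win \<phi>, wout = wout \<phi> \<rparr>) \<rparr>"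

lemma retype_tsum: "map_option f \<circ> tsum S T = tsum (map_option f \<circ> S) (map_option f \<circ> T)"
proof
  fix x show "(map_option f \<circ> tsum S T) x = tsum (map_option f \<circ> S) (map_option f \<circ> T) x"
    by (cases x) auto
qed

lemma dom_retype: "dom (map_option f \<circ> T) = dom T"
  by (auto simp: dom_def)

lemma dom_tsum: "dom (tsum S T) = InL ` dom S \<union> InR ` dom T"
proof (intro set_eqI iffI)
  fix x assume "x \<in> dom (tsum S T)" then show "x \<in> InL ` dom S \<union> InR ` dom T"
    by (cases x) auto
qed auto

lemma Wiring_fct_strict:
  fixes F :: "('o, 'm, 'p, 'n) fct"
    and C :: "('o, 'm, 'z) cat_scheme" and D :: "('p, 'n, 'y) cat_scheme"
  shows "fob (Wiring_fct F) (ten (Wiring C) X Y)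
      = ten (Wiring D) (fob (Wiring_fct F) X) (fob (Wiring_fct F) Y)"
    and "far (Wiring_fct F) (ten_ar (Wiring C) \<phi> \<psi>)
      = ten_ar (Wiring D) (far (Wiring_fct F) \<phi>) (far (Wiring_fct F) \<psi>)"
    and "fob (Wiring_fct F) (unt (Wiring C)) = unt (Wiring D)"
    and "far (Wiring_fct F) (asc (Wiring C) X Y Z)
      = asc (Wiring D) (fob (Wiring_fct F) X) (fob (Wiring_fct F) Y) (fob (Wiring_fct F) Z)"
    and "far (Wiring_fct F) (lun (Wiring C) X) = lun (Wiring D) (fob (Wiring_fct F) X)"
    and "far (Wiring_fct F) (run (Wiring C) X) = run (Wiring D) (fob (Wiring_fct F) X)"
    and "far (Wiring_fct F) (brd (Wiring C) X Y)
      = brd (Wiring D) (fob (Wiring_fct F) X) (fob (Wiring_fct F) Y)"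
    and "far (Wiring_fct F) (cmp (Wiring C) \<psi> \<phi>)
      = cmp (Wiring D) (far (Wiring_fct F) \<psi>) (far (Wiring_fct F) \<phi>)"
    and "far (Wiring_fct F) (idn (Wiring C) X) = idn (Wiring D) (fob (Wiring_fct F) X)"
  by (simp_all add: Wiring_fct_def Wiring_def retype_def box_sum_def wd_sum_def box_empty_def
      relabel_def wd_comp_def wd_id_def retype_tsum dom_retype dom_tsum
      fun_eq_iff cong: sum.case_cong)

section \<open>Spans\<close>

definition bound :: "('o, 'm, 'z) cat_scheme \<Rightarrow> ('l, 'o) box \<Rightarrow> 'o" where
  "bound C X = prd C (hat C (inp X)) (hat C (outp X))"

definition mid :: "('o, 'm, 'z) cat_scheme \<Rightarrow> ('l, 'o) wd \<Rightarrow> 'o" where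
  "mid C \<phi> = prd C (hat C (inp (wtgt \<phi>))) (hat C (outp (wsrc \<phi>)))"

definition mid1 :: "('o, 'm, 'z) cat_scheme \<Rightarrow> ('l, 'o) wd \<Rightarrow> 'm" where
  "mid1 C \<phi> = pr1 C (hat C (inp (wtgt \<phi>))) (hat C (outp (wsrc \<phi>)))"

definition mid2 :: "('o, 'm, 'z) cat_scheme \<Rightarrow> ('l, 'o) wd \<Rightarrow> 'm" where
  "mid2 C \<phi> = pr2 C (hat C (inp (wtgt \<phi>))) (hat C (outp (wsrc \<phi>)))"

definition hat_in :: "('o, 'm, 'z) cat_scheme \<Rightarrow> ('l, 'o) wd \<Rightarrow> 'm" where
  "hat_in C \<phi> = tuple C (inp (wsrc \<phi>)) (mid C \<phi>)
     (\<lambda>x. case win \<phi> x of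
        Inl x' \<Rightarrow> cmp C (proj C (outp (wsrc \<phi>)) x') (mid2 C \<phi>)
      | Inr y \<Rightarrow> cmp C (proj C (inp (wtgt \<phi>)) y) (mid1 C \<phi>))"

definition hat_out :: "('o, 'm, 'z) cat_scheme \<Rightarrow> ('l, 'o) wd \<Rightarrow> 'm" where
  "hat_out C \<phi> = tuple C (outp (wtgt \<phi>)) (hat C (outp (wsrc \<phi>)))
     (\<lambda>y. proj C (outp (wsrc \<phi>)) (wout \<phi> y))"

text \<open>\<open>legL \<phi>\<close> is \<open>(\<phi>\<^sup>i\<^sup>n, \<pi>\<^sub>2)\<close>, along which spans are pulled back, and
  \<open>legR \<phi>\<close> is \<open>1 \<times> \<phi>\<^sup>o\<^sup>u\<^sup>t\<close>, with which the result is composed.\<close>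

definition legL :: "('o, 'm, 'z) cat_scheme \<Rightarrow> ('l, 'o) wd \<Rightarrow> 'm" where
  "legL C \<phi> = pair C (hat_in C \<phi>) (mid2 C \<phi>)"

definition legR :: "('o, 'm, 'z) cat_scheme \<Rightarrow> ('l, 'o) wd \<Rightarrow> 'm" where
  "legR C \<phi> = pair C (mid1 C \<phi>) (cmp C (hat_out C \<phi>) (mid2 C \<phi>))"

text \<open>The projections of \<open>bound C X\<close> to the types of single ports, and the arrow into
  \<open>bound C X\<close> with given components.\<close>

definition in_at :: "('o, 'm, 'z) cat_scheme \<Rightarrow> ('l, 'o) box \<Rightarrow> 'l port \<Rightarrow> 'm" where
  "in_at C X x = cmp C (proj C (inp X) x) (pr1 C (hat C (inp X)) (hat C (outp X)))"

definition out_at :: "('o, 'm, 'z) cat_scheme \<Rightarrow> ('l, 'o) box \<Rightarrow> 'l port \<Rightarrow> 'm" where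
  "out_at C X x = cmp C (proj C (outp X) x) (pr2 C (hat C (inp X)) (hat C (outp X)))"

definition to_bound :: "('o, 'm, 'z) cat_scheme \<Rightarrow> ('l, 'o) box \<Rightarrow> 'o
    \<Rightarrow> ('l port \<Rightarrow> 'm) \<Rightarrow> ('l port \<Rightarrow> 'm) \<Rightarrow> 'm" where
  "to_bound C X Q f g = pair C (tuple C (inp X) Q f) (tuple C (outp X) Q g)"

definition spn_act :: "('o, 'm, 'z) cat_scheme \<Rightarrow> ('l, 'o) wd \<Rightarrow> 'm \<Rightarrow> 'm" where
  "spn_act C \<phi> p = cmp C (legR C \<phi>) (pb2 C p (legL C \<phi>))"

definition spn_act_ar :: "('o, 'm, 'z) cat_scheme \<Rightarrow> ('l, 'o) wd \<Rightarrow> 'm \<times> 'm \<times> 'm \<Rightarrow> 'm \<times> 'm \<times> 'm" where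
  "spn_act_ar C \<phi> = (\<lambda>(p, f, q).
     (spn_act C \<phi> p,
      pb_lift C q (legL C \<phi>) (cmp C f (pb1 C p (legL C \<phi>))) (pb2 C p (legL C \<phi>)),
      spn_act C \<phi> q))"

definition spn_act_cmp :: "('o, 'm, 'z) cat_scheme \<Rightarrow> ('l, 'o) wd \<Rightarrow> ('l, 'o) wd \<Rightarrow> 'm \<Rightarrow> 'm \<times> 'm \<times> 'm" where
  "spn_act_cmp C \<psi> \<phi> p =
     (let a = pb1 C p (legL C \<phi>); b = pb2 C p (legL C \<phi>);
          a' = pb1 C (spn_act C \<phi> p) (legL C \<psi>); b' = pb2 C (spn_act C \<phi> p) (legL C \<psi>)
      in (spn_act C \<psi> (spn_act C \<phi> p),
          pb_lift C p (legL C (wd_comp \<psi> \<phi>)) (cmp C a a')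
            (pair C (cmp C (mid1 C \<psi>) b') (cmp C (mid2 C \<phi>) (cmp C b a'))),
          spn_act C (wd_comp \<psi> \<phi>) p))"

definition spn_lax :: "('o, 'm, 'z) cat_scheme \<Rightarrow> ('l, 'o) box \<Rightarrow> ('l, 'o) box \<Rightarrow> 'm \<times> 'm \<Rightarrow> 'm" where
  "spn_lax C X Y = (\<lambda>(p, q).
     let S = src C p; T = src C q; p' = cmp C p (pr1 C S T); q' = cmp C q (pr2 C S T)
     in to_bound C (box_sum X Y) (prd C S T)
          (port_case (\<lambda>x. cmp C (in_at C X x) p') (\<lambda>y. cmp C (in_at C Y y) q'))
          (port_case (\<lambda>x. cmp C (out_at C X x) p') (\<lambda>y. cmp C (out_at C Y y) q')))"

definition spn_lax_ar :: "('o, 'm, 'z) cat_scheme \<Rightarrow> ('l, 'o) box \<Rightarrow> ('l, 'o) box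
    \<Rightarrow> ('m \<times> 'm \<times> 'm) \<times> ('m \<times> 'm \<times> 'm) \<Rightarrow> 'm \<times> 'm \<times> 'm" where
  "spn_lax_ar C X Y = (\<lambda>((p, f, p'), (q, g, q')).
     (spn_lax C X Y (p, q),
      pair C (cmp C f (pr1 C (src C p) (src C q))) (cmp C g (pr2 C (src C p) (src C q))),
      spn_lax C X Y (p', q')))"

definition spn_lax_unt :: "('o, 'm, 'z) cat_scheme \<Rightarrow> 'l itself \<Rightarrow> 'm" where
  "spn_lax_unt C _ = to_bound C (box_empty :: ('l, 'o) box) (terminal C) undefined undefined"

text \<open>The projections of \<open>mid C (wd_sum \<phi> \<psi>)\<close> to \<open>mid C \<phi>\<close> and \<open>mid C \<psi>\<close>.\<close>

definition mid_split :: "('o, 'm, 'z) cat_scheme \<Rightarrow> ('l, 'o) wd \<Rightarrow> ('l, 'o) wd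
    \<Rightarrow> ('l port \<Rightarrow> 'l port) \<Rightarrow> ('l, 'o) wd \<Rightarrow> 'm" where
  "mid_split C \<phi> \<psi> i \<chi> =
     (let Q = mid C (wd_sum \<phi> \<psi>); I = inp (wtgt (wd_sum \<phi> \<psi>)); J = outp (wsrc (wd_sum \<phi> \<psi>))
      in pair C
          (tuple C (inp (wtgt \<chi>)) Q (\<lambda>x. cmp C (proj C I (i x)) (mid1 C (wd_sum \<phi> \<psi>))))
          (tuple C (outp (wsrc \<chi>)) Q (\<lambda>x. cmp C (proj C J (i x)) (mid2 C (wd_sum \<phi> \<psi>)))))"

definition spn_lax_nat :: "('o, 'm, 'z) cat_scheme \<Rightarrow> ('l, 'o) wd \<Rightarrow> ('l, 'o) wd
    \<Rightarrow> 'm \<times> 'm \<Rightarrow> 'm \<times> 'm \<times> 'm" where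
  "spn_lax_nat C \<phi> \<psi> = (\<lambda>(p, q).
     let r = spn_lax C (wsrc \<phi>) (wsrc \<psi>) (p, q);
         a = pb1 C r (legL C (wd_sum \<phi> \<psi>)); b = pb2 C r (legL C (wd_sum \<phi> \<psi>));
         S = src C p; T = src C q
     in (spn_act C (wd_sum \<phi> \<psi>) r,
         pair C
           (pb_lift C p (legL C \<phi>) (cmp C (pr1 C S T) a) (cmp C (mid_split C \<phi> \<psi> InL \<phi>) b))
           (pb_lift C q (legL C \<psi>) (cmp C (pr2 C S T) a) (cmp C (mid_split C \<phi> \<psi> InR \<psi>) b)),
         spn_lax C (wtgt \<phi>) (wtgt \<psi>) (spn_act C \<phi> p, spn_act C \<psi> q)))"

text \<open>The remaining cells project a pullback \<open>A \<phi> r\<close> to the apex of \<open>r\<close> and then rearrange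
  factors of the cartesian product of apexes.\<close>

definition spn_cell :: "('o, 'm, 'z) cat_scheme \<Rightarrow> ('l, 'o) wd \<Rightarrow> 'm \<Rightarrow> ('m \<Rightarrow> 'm) \<Rightarrow> 'm \<Rightarrow> 'm \<times> 'm \<times> 'm" where
  "spn_cell C \<phi> r h q = (spn_act C \<phi> r, h (pb1 C r (legL C \<phi>)), q)"

definition Spn :: "('o, 'm, 'z) cat_scheme \<Rightarrow> (('l, 'o) box, ('l, 'o) wd, 'm, 'm \<times> 'm \<times> 'm) alg" where
  "Spn C =
    (let P1 = (\<lambda>p q. pr1 C (src C p) (src C q)); P2 = (\<lambda>p q. pr2 C (src C p) (src C q));
         \<epsilon> = spn_lax_unt C TYPE('l); W = (Wiring C :: (('l, 'o) box, ('l, 'o) wd) smc)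
     in \<lparr>
     fib = (\<lambda>X. slice C (bound C X)),
     act = (\<lambda>\<phi>. \<lparr> fob = spn_act C \<phi>, far = spn_act_ar C \<phi> \<rparr>),
     act_cmp = spn_act_cmp C,
     act_idn = (\<lambda>X p. spn_cell C (wd_id X) p (\<lambda>a. a) p),
     lax = (\<lambda>X Y. \<lparr> fob = spn_lax C X Y, far = spn_lax_ar C X Y \<rparr>),
     lax_unt = \<epsilon>,
     lax_nat = spn_lax_nat C,
     lax_asc = (\<lambda>X Y Z ((p, q), r).
       let pq = spn_lax C X Y (p, q)
       in spn_cell C (asc W X Y Z) (spn_lax C (box_sum X Y) Z (pq, r))
            (\<lambda>a. pair C (cmp C (P1 p q) (cmp C (P1 pq r) a))
                   (pair C (cmp C (P2 p q) (cmp C (P1 pq r) a)) (cmp C (P2 pq r) a)))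
            (spn_lax C X (box_sum Y Z) (p, spn_lax C Y Z (q, r)))),
     lax_lun = (\<lambda>X p. spn_cell C (lun W X) (spn_lax C box_empty X (\<epsilon>, p)) (cmp C (P2 \<epsilon> p)) p),
     lax_run = (\<lambda>X p. spn_cell C (run W X) (spn_lax C X box_empty (p, \<epsilon>)) (cmp C (P1 p \<epsilon>)) p),
     lax_brd = (\<lambda>X Y (p, q). spn_cell C (brd W X Y) (spn_lax C X Y (p, q))
       (\<lambda>a. pair C (cmp C (P2 p q) a) (cmp C (P1 p q) a)) (spn_lax C Y X (q, p))) \<rparr>)"

text \<open>The canonical map \<open>F (X\<^sup>i\<^sup>n \<times> X\<^sup>o\<^sup>u\<^sup>t) \<rightarrow> F X\<^sup>i\<^sup>n \<times> F X\<^sup>o\<^sup>u\<^sup>t\<close> (an isomorphism if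
  \<open>F\<close> preserves finite products), and the component at \<open>X\<close> of \<open>Spn F\<close>.\<close>

definition compare :: "('o, 'm, 'z) cat_scheme \<Rightarrow> ('p, 'n, 'y) cat_scheme \<Rightarrow> ('o, 'm, 'p, 'n) fct
    \<Rightarrow> ('l, 'o) box \<Rightarrow> 'n" where
  "compare C D F X = to_bound D (retype F X) (fob F (bound C X))
     (\<lambda>x. far F (in_at C X x)) (\<lambda>x. far F (out_at C X x))"

definition Spn_fct :: "('o, 'm, 'z) cat_scheme \<Rightarrow> ('p, 'n, 'y) cat_scheme \<Rightarrow> ('o, 'm, 'p, 'n) fct
    \<Rightarrow> ('l, 'o) box \<Rightarrow> ('m, 'm \<times> 'm \<times> 'm, 'n, 'n \<times> 'n \<times> 'n) fct" where
  "Spn_fct C D F X =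
     (let F' = (\<lambda>p. cmp D (compare C D F X) (far F p))
      in \<lparr> fob = F', far = (\<lambda>(p, f, q). (F' p, far F f, F' q)) \<rparr>)"

section \<open>Interval sheaves\<close>

text \<open>
  The time domain is the nonnegative part of \<open>'t\<close>, instantiated to \<open>real\<close> and to \<open>nat\<close>.
  \<open>is_Tr l' p l\<close> says that \<open>Tr\<^sub>p : l' \<rightarrow> l\<close> is a morphism, and \<open>res X l p l'\<close> is
  \<open>X(Tr\<^sub>p) : X(l) \<rightarrow> X(l')\<close>, that is, restriction to \<open>[p, p + l']\<close>.
\<close>

definition is_Tr :: "'t::linordered_semidom \<Rightarrow> 't \<Rightarrow> 't \<Rightarrow> bool" where
  "is_Tr l' p l \<longleftrightarrow> 0 \<le> l' \<and> 0 \<le> p \<and> p + l' \<le> l"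

record ('t, 'u) psh =
  sec :: "'t \<Rightarrow> 'u set"
  res :: "'t \<Rightarrow> 't \<Rightarrow> 't \<Rightarrow> 'u \<Rightarrow> 'u"

definition presheaf :: "('t::linordered_semidom, 'u) psh \<Rightarrow> bool" where
  "presheaf X \<longleftrightarrow>
     (\<forall>l. \<not> 0 \<le> l \<longrightarrow> sec X l = {}) \<and>
     (\<forall>l p l'. is_Tr l' p l \<longrightarrow> res X l p l' \<in> sec X l \<rightarrow>\<^sub>E sec X l') \<and>
     (\<forall>l p l'. \<not> is_Tr l' p l \<longrightarrow> res X l p l' = (\<lambda>_. undefined)) \<and>
     (\<forall>l x. x \<in> sec X l \<longrightarrow> res X l 0 l x = x) \<and>
     (\<forall>l p l' q l'' x. is_Tr l' p l \<and> is_Tr l'' q l' \<and> x \<in> sec X l \<longrightarrow>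
        res X l' q l'' (res X l p l' x) = res X l (p + q) l'' x)"

definition sheaf :: "('t::linordered_semidom, 'u) psh \<Rightarrow> bool" where
  "sheaf X \<longleftrightarrow> presheaf X \<and>
     (\<forall>l1 l2 x1 x2. x1 \<in> sec X l1 \<and> x2 \<in> sec X l2 \<and> res X l1 l1 0 x1 = res X l2 0 0 x2 \<longrightarrow>
        (\<exists>!x. x \<in> sec X (l1 + l2) \<and> res X (l1 + l2) 0 l1 x = x1 \<and> res X (l1 + l2) l1 l2 x = x2))"

record ('t, 'u) shmap =
  smsrc :: "('t, 'u) psh"
  smtgt :: "('t, 'u) psh"
  smap :: "'t \<Rightarrow> 'u \<Rightarrow> 'u"

definition is_shmap :: "('t::linordered_semidom, 'u) shmap \<Rightarrow> bool" where
  "is_shmap h \<longleftrightarrow> sheaf (smsrc h) \<and> sheaf (smtgt h) \<and>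
     (\<forall>l. smap h l \<in> sec (smsrc h) l \<rightarrow>\<^sub>E sec (smtgt h) l) \<and>
     (\<forall>l p l' x. is_Tr l' p l \<and> x \<in> sec (smsrc h) l \<longrightarrow>
        smap h l' (res (smsrc h) l p l' x) = res (smtgt h) l p l' (smap h l x))"

definition Sheaves :: "(('t::linordered_semidom, 'u) psh, ('t, 'u) shmap) cat" where
  "Sheaves = \<lparr>
     obs = {X. sheaf X},
     arrs = {h. is_shmap h},
     src = smsrc,
     tgt = smtgt,
     idn = (\<lambda>X. \<lparr> smsrc = X, smtgt = X, smap = (\<lambda>l. restrict id (sec X l)) \<rparr>),
     cmp = (\<lambda>g f. \<lparr> smsrc = smsrc f, smtgt = smtgt g,
              smap = (\<lambda>l. restrict (smap g l \<circ> smap f l) (sec (smsrc f) l)) \<rparr>) \<rparr>"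

text \<open>
  Sets of sections are subsets of a fixed type. The type below is closed under pairing and contains
  the real numbers and the elements of \<open>\<real>/\<int>\<close> (as cosets); through the arbitrary type \<open>'a\<close> of
  atoms it is as large as one likes.
\<close>

datatype 'a univ = Atom 'a | Num real | Cls "real set" | Pr "'a univ" "'a univ"

type_synonym 'a cont_sheaf = "(real, 'a univ) psh"
type_synonym 'a cont_map = "(real, 'a univ) shmap"
type_synonym 'a disc_sheaf = "(nat, 'a univ) psh"
type_synonym 'a disc_map = "(nat, 'a univ) shmap"

abbreviation IntC :: "('a cont_sheaf, 'a cont_map) cat" where "IntC \<equiv> Sheaves"
abbreviation IntN :: "('a disc_sheaf, 'a disc_map) cat" where "IntN \<equiv> Sheaves"

definition rmod1 :: "(real \<times> real) set" where
  "rmod1 = {(x, y). x - y \<in> \<int>}"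

definition Sync :: "'a cont_sheaf" where
  "Sync = \<lparr>
     sec = (\<lambda>l. if 0 \<le> l then Cls ` (UNIV // rmod1) else {}),
     res = (\<lambda>l p l'. if is_Tr l' p l
       then restrict (\<lambda>z. case z of Cls c \<Rightarrow> Cls ((\<lambda>t. t + p) ` c)) (Cls ` (UNIV // rmod1))
       else (\<lambda>_. undefined)) \<rparr>"

abbreviation IntSync :: "('a cont_map, 'a cont_map \<times> 'a cont_map \<times> 'a cont_map) cat" where
  "IntSync \<equiv> slice IntC Sync"

section \<open>The functors into synchronous sheaves\<close>

text \<open>
  \<open>Sigma_ob\<close> and \<open>Sigma_ar\<close> are the explicit form of the left adjoint of restriction along the
  inclusion of natural-length into real-length intervals: a section of length \<open>l\<close> is an offset
  \<open>r \<in> [0, 1)\<close> with a discrete section whose length is that of \<open>[r, r + l]\<close> rounded out to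
  integer endpoints.
\<close>

definition Sigma_sec :: "'a disc_sheaf \<Rightarrow> real \<Rightarrow> 'a univ set" where
  "Sigma_sec X l =
     (if 0 \<le> l then {Pr (Num r) x | r x. 0 \<le> r \<and> r < 1 \<and> x \<in> sec X (nat \<lceil>r + l\<rceil>)} else {})"

definition Sigma_ob :: "'a disc_sheaf \<Rightarrow> 'a cont_sheaf" where
  "Sigma_ob X = \<lparr>
     sec = Sigma_sec X,
     res = (\<lambda>l p l'. if is_Tr l' p l
       then restrict (\<lambda>z. case z of Pr (Num r) x \<Rightarrow>
              (let a = \<lfloor>p + r\<rfloor>; b = \<lceil>p + r + l'\<rceil>
               in Pr (Num (p + r - a)) (res X (nat \<lceil>r + l\<rceil>) (nat a) (nat (b - a)) x)))
            (Sigma_sec X l)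
       else (\<lambda>_. undefined)) \<rparr>"

definition Sigma_ar :: "'a disc_map \<Rightarrow> 'a cont_map" where
  "Sigma_ar h = \<lparr> smsrc = Sigma_ob (smsrc h), smtgt = Sigma_ob (smtgt h),
     smap = (\<lambda>l. restrict (\<lambda>z. case z of Pr (Num r) x \<Rightarrow> Pr (Num r) (smap h (nat \<lceil>r + l\<rceil>) x))
              (Sigma_sec (smsrc h) l)) \<rparr>"

text \<open>The isomorphism between \<open>Sigma_ob 1\<close> and \<open>Sync\<close>.\<close>

definition Sigma_one :: "'a cont_map" where
  "Sigma_one = \<lparr> smsrc = Sigma_ob (terminal IntN), smtgt = Sync,
     smap = (\<lambda>l. restrict (\<lambda>z. case z of Pr (Num r) x \<Rightarrow> Cls (rmod1 `` {r}))
              (Sigma_sec (terminal IntN) l)) \<rparr>"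

definition Sigma_Sync ::
    "('a disc_sheaf, 'a disc_map, 'a cont_map, 'a cont_map \<times> 'a cont_map \<times> 'a cont_map) fct" where
  "Sigma_Sync =
     (let S = (\<lambda>X. cmp IntC Sigma_one (Sigma_ar (bang IntN X)))
      in \<lparr> fob = S, far = (\<lambda>h. (S (smsrc h), Sigma_ar h, S (smtgt h))) \<rparr>)"

definition Delta_Sync ::
    "('a cont_sheaf, 'a cont_map, 'a cont_map, 'a cont_map \<times> 'a cont_map \<times> 'a cont_map) fct" where
  "Delta_Sync = \<lparr>
     fob = (\<lambda>Y. pr2 IntC Y Sync),
     far = (\<lambda>h. (pr2 IntC (smsrc h) Sync,
                 pair IntC (cmp IntC h (pr1 IntC (smsrc h) Sync)) (pr2 IntC (smsrc h) Sync),
                 pr2 IntC (smtgt h) Sync)) \<rparr>"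

section \<open>Machines\<close>

type_synonym ('l, 'o, 'm) machines = "(('l, 'o) box, ('l, 'o) wd, 'm, 'm \<times> 'm \<times> 'm) alg"

definition Mch_C :: "('l, 'a cont_sheaf, 'a cont_map) machines" where
  "Mch_C = Spn IntC"

definition Mch_N :: "('l, 'a disc_sheaf, 'a disc_map) machines" where
  "Mch_N = Spn IntN"

definition Mch_Sync ::
    "('l, 'a cont_map, 'a cont_map \<times> 'a cont_map \<times> 'a cont_map) machines" where
  "Mch_Sync = Spn IntSync"

end

theory Submission
  imports Defs
begin

text \<open>
  An arrow into a span obtained by actions and laxators is determined by its composite with the
  boundary map together with its composites with the projections to the apexes of the spans one
  started from (the roots). All structure cells of \<open>Spn\<close> commute with root projections, so every
  coherence equation holds because both sides are arrows between the same spans, and have the same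
  roots. The comparison cells of \<open>Spn_fct C D F\<close> are handled in the same way when \<open>F\<close> preserves finite
  limits. A pullback of sheaves is computed sectionwise. Therefore \<open>Sigma_Sync\<close> preserves pullbacks, as
  \<open>Sigma_ob X\<close> is sectionwise a disjoint union of sections of \<open>X\<close>, and it preserves the terminal object,
  as every class modulo 1 has exactly one representative in \<open>[0, 1)\<close>; and \<open>Delta_Sync\<close> is the base
  change functor to a slice.
\<close>

section \<open>Categories, slices and products\<close>

text \<open>The limits used by \<open>Spn\<close> are picked by \<open>SOME\<close>, so composites
  of cells cannot be compared by computation; only universal properties are available, and each
  axiom would call for its own chase through nested pullbacks. Roots turn these chases into
  bookkeeping: the chase is done once, in the proof that roots separate arrows, and every axiom
  becomes a backwards application of typing rules. The same choice of limits affects functors: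
  \<open>F\<close> need not send chosen products to chosen ones, so the boundary of a machine has to
  be corrected by the comparison map \<open>compare\<close>, and images of limits are handled by
  lifting and cancellation lemmas of their own. Pullbacks along \<open>legL\<close> are described by
  the relation \<open>wd_rel\<close> on generalized elements, which says port by port what a wiring
  diagram demands; composites, sums and coherence diagrams then become statements about single
  wires. Finite products are obtained as iterated pullbacks over a terminal object, so that a
  functor only has to be examined on pullbacks and on terminal objects.\<close>

abbreviation und :: "'m \<times> 'm \<times> 'm \<Rightarrow> 'm" where
  "und F \<equiv> fst (snd F)"

lemma hom_iff: "f \<in> hom C a b \<longleftrightarrow> f \<in> arrs C \<and> src C f = a \<and> tgt C f = b"
  by (auto simp: hom_def)

lemma src_hom: "f \<in> hom C a b \<Longrightarrow> src C f = a"
  and tgt_hom: "f \<in> hom C a b \<Longrightarrow> tgt C f = b"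
  by (auto simp: hom_def)

context category
begin

lemma hom_src_obs: "f \<in> hom C a b \<Longrightarrow> a \<in> obs C"
  using src_obs by (auto simp: hom_def)

lemma hom_tgt_obs: "f \<in> hom C a b \<Longrightarrow> b \<in> obs C"
  using tgt_obs by (auto simp: hom_def)

lemma inverse_arrI:
  "f \<in> hom C a b \<Longrightarrow> g \<in> hom C b a \<Longrightarrow> g \<cdot> f = idn C a \<Longrightarrow> f \<cdot> g = idn C b \<Longrightarrow> inverse_arr C f g"
  by (auto simp: inverse_arr_def hom_def)

lemma inverse_arr_unique:
  assumes "inverse_arr C f g" "inverse_arr C f h"
  shows "g = h"
proof -
  have f: "f \<in> hom C (src C f) (tgt C f)"
    and g: "g \<in> hom C (tgt C f) (src C f)" and h: "h \<in> hom C (tgt C f) (src C f)"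
    using assms by (auto simp: inverse_arr_def hom_def)
  have "g = g \<cdot> (f \<cdot> h)"
    using assms g by (simp add: inverse_arr_def idn_right)
  also have "\<dots> = (g \<cdot> f) \<cdot> h"
    using f g h by (simp add: cmp_assoc)
  also have "\<dots> = h"
    using assms h by (simp add: inverse_arr_def idn_left)
  finally show ?thesis .
qed

lemma inverse_arr_inv_arr: "is_iso C f \<Longrightarrow> inverse_arr C f (inv_arr C f)"
  unfolding is_iso_def inv_arr_def by (rule theI') (metis inverse_arr_unique)

lemma inv_arr_hom: "is_iso C f \<Longrightarrow> f \<in> hom C a b \<Longrightarrow> inv_arr C f \<in> hom C b a"
  using inverse_arr_inv_arr[of f] by (auto simp: inverse_arr_def hom_def)

lemma cmp_inv_arr: "is_iso C f \<Longrightarrow> f \<in> hom C a b \<Longrightarrow> f \<cdot> inv_arr C f = idn C b"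
  using inverse_arr_inv_arr[of f] by (auto simp: inverse_arr_def hom_def)

lemma is_isoI:
  "f \<in> hom C a b \<Longrightarrow> g \<in> hom C b a \<Longrightarrow> g \<cdot> f = idn C a \<Longrightarrow> f \<cdot> g = idn C b \<Longrightarrow> is_iso C f"
  using inverse_arrI unfolding is_iso_def by blast

end

lemma slice_simps [simp]:
  "obs (slice C b) = {p \<in> arrs C. tgt C p = b}"
  "src (slice C b) F = fst F" "tgt (slice C b) F = snd (snd F)"
  "idn (slice C b) p = (p, idn C (src C p), p)"
  "cmp (slice C b) G F = (fst F, cmp C (und G) (und F), snd (snd G))"
  by (auto simp: slice_def split: prod.splits)

lemma hom_slice:
  "F \<in> hom (slice C b) p q \<longleftrightarrow> fst F = p \<and> snd (snd F) = q \<and> p \<in> obs (slice C b) \<and> q \<in> obs (slice C b)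
     \<and> und F \<in> hom C (src C p) (src C q) \<and> cmp C q (und F) = p"
  by (cases F) (auto simp: slice_def hom_def)

lemma slice_arr_eq: "F \<in> hom (slice C b) p q \<Longrightarrow> F = (p, und F, q)"
  by (cases F) (auto simp: hom_slice)

lemma slice_eqI: "F \<in> hom (slice C b) p q \<Longrightarrow> G \<in> hom (slice C b) p q \<Longrightarrow> und F = und G \<Longrightarrow> F = G"
  by (metis slice_arr_eq)

lemma (in category) slice_category: "category (slice C b)"
proof
  show "src (slice C b) f \<in> obs (slice C b)" "tgt (slice C b) f \<in> obs (slice C b)"
    if "f \<in> arrs (slice C b)" for f
    using that by (auto simp: slice_def)
  show "idn (slice C b) a \<in> hom (slice C b) a a" if "a \<in> obs (slice C b)" for a
    using that by (auto simp: hom_slice intro!: idn_hom src_obs idn_right) (auto simp: hom_def)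
  show "cmp (slice C b) g f \<in> hom (slice C b) p r"
    if "f \<in> hom (slice C b) p q" "g \<in> hom (slice C b) q r" for f g p q r
  proof -
    have "r \<in> obs (slice C b)" using that(2) unfolding hom_slice by blast
    then have r: "r \<in> hom C (src C r) b" by (simp add: hom_iff)
    have "r \<cdot> (und g \<cdot> und f) = (r \<cdot> und g) \<cdot> und f"
      using that r by (subst cmp_assoc) (auto simp: hom_slice)
    then show ?thesis
      using that by (auto simp: hom_slice intro: cmp_hom)
  qed
  show "cmp (slice C b) (idn (slice C b) q) f = f" "cmp (slice C b) f (idn (slice C b) p) = f"
    if "f \<in> hom (slice C b) p q" for f p q
    using that idn_left[of "und f"] idn_right[of "und f"]
    by (auto simp: hom_slice intro!: prod_eqI)
  show "cmp (slice C b) (cmp (slice C b) h g) f = cmp (slice C b) h (cmp (slice C b) g f)"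
    if "f \<in> hom (slice C b) p q" "g \<in> hom (slice C b) q r" "h \<in> hom (slice C b) r s" for f g h p q r s
    using that by (auto simp: hom_slice cmp_assoc)
qed

lemma prod_cat_simps [simp]:
  "obs (prod_cat C D) = obs C \<times> obs D" "arrs (prod_cat C D) = arrs C \<times> arrs D"
  "src (prod_cat C D) = map_prod (src C) (src D)" "tgt (prod_cat C D) = map_prod (tgt C) (tgt D)"
  "idn (prod_cat C D) = map_prod (idn C) (idn D)"
  "cmp (prod_cat C D) F G = (cmp C (fst F) (fst G), cmp D (snd F) (snd G))"
  by (auto simp: prod_cat_def split: prod.splits)

lemma hom_prod_cat:
  "f \<in> hom (prod_cat C D) a b \<longleftrightarrow> fst f \<in> hom C (fst a) (fst b) \<and> snd f \<in> hom D (snd a) (snd b)"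
  by (cases f; cases a; cases b) (auto simp: hom_def)

lemma prod_category:
  assumes "category C" "category D"
  shows "category (prod_cat C D)"
proof -
  interpret C: category C by fact
  interpret D: category D by fact
  show ?thesis
    by unfold_locales
      (auto simp: hom_prod_cat C.src_obs D.src_obs C.tgt_obs D.tgt_obs C.idn_hom D.idn_hom
        C.idn_left C.idn_right D.idn_left D.idn_right C.cmp_assoc D.cmp_assoc
        intro: C.cmp_hom D.cmp_hom prod_eqI)
qed

lemma fct_comp_functor:
  assumes "cat_functor C D F" "cat_functor D E G"
  shows "cat_functor C E (G \<circ>\<^sub>F F)"
proof -
  interpret F: cat_functor C D F by fact
  interpret G: cat_functor D E G by fact
  show ?thesis
    by unfold_locales
      (auto simp: fct_comp_def F.fob_obs G.fob_obs F.far_idn G.far_idn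
        F.far_cmp G.far_cmp[OF F.far_hom F.far_hom] intro: F.far_hom G.far_hom)
qed

lemma fct_prod_functor:
  assumes "cat_functor C D F" "cat_functor C' D' F'"
  shows "cat_functor (prod_cat C C') (prod_cat D D') (F \<times>\<^sub>F F')"
proof -
  interpret F: cat_functor C D F by fact
  interpret F': cat_functor C' D' F' by fact
  interpret P: category "prod_cat C C'" by (rule prod_category) unfold_locales
  interpret Q: category "prod_cat D D'" by (rule prod_category) unfold_locales
  show ?thesis
    by unfold_locales
      (auto simp: fct_prod_def hom_prod_cat F.fob_obs F'.fob_obs F.far_idn F'.far_idn
        F.far_cmp F'.far_cmp intro: F.far_hom F'.far_hom)
qed

lemma fct_id_functor: "category C \<Longrightarrow> cat_functor C C fct_id"
  by (auto simp: cat_functor_def cat_functor_axioms_def fct_id_def)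

lemma fct_assoc_functor:
  assumes "category C" "category D" "category E"
  shows "cat_functor (prod_cat (prod_cat C D) E) (prod_cat C (prod_cat D E)) fct_assoc"
  using assms
  by (auto simp: cat_functor_def cat_functor_axioms_def fct_assoc_def hom_prod_cat prod_category)

lemma fct_swap_functor:
  assumes "category C" "category D"
  shows "cat_functor (prod_cat C D) (prod_cat D C) fct_swap"
  using assms
  by (auto simp: cat_functor_def cat_functor_axioms_def fct_swap_def hom_prod_cat prod_category)

lemma fct_const_left_functor:
  assumes "category C" "category D" "c \<in> obs C"
  shows "cat_functor D (prod_cat C D) (fct_const_left C c)"
proof -
  interpret C: category C by fact
  show ?thesis
    using assms C.idn_hom[of c] C.idn_left[of "idn C c" c c]
    by (auto simp: cat_functor_def cat_functor_axioms_def fct_const_left_def hom_prod_cat prod_category)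
qed

lemma fct_const_right_functor:
  assumes "category C" "category D" "c \<in> obs C"
  shows "cat_functor D (prod_cat D C) (fct_const_right C c)"
proof -
  interpret C: category C by fact
  show ?thesis
    using assms C.idn_hom[of c] C.idn_left[of "idn C c" c c]
    by (auto simp: cat_functor_def cat_functor_axioms_def fct_const_right_def hom_prod_cat prod_category)
qed

lemma fct_comp_simps [simp]:
  "fob (G \<circ>\<^sub>F F) x = fob G (fob F x)" "far (G \<circ>\<^sub>F F) f = far G (far F f)"
  by (auto simp: fct_comp_def)

lemma fct_prod_simps [simp]:
  "fob (F \<times>\<^sub>F G) (x, y) = (fob F x, fob G y)" "far (F \<times>\<^sub>F G) (f, g) = (far F f, far G g)"
  by (auto simp: fct_prod_def)

lemma fct_basic_simps [simp]:
  "fob fct_id x = x" "far fct_id f = f"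
  "fob fct_assoc ((x, y), z) = (x, (y, z))" "far fct_assoc ((f, g), h) = (f, (g, h))"
  "fob fct_swap (x, y) = (y, x)" "far fct_swap (f, g) = (g, f)"
  "fob (fct_const_left C c) x = (c, x)" "far (fct_const_left C c) f = (idn C c, f)"
  "fob (fct_const_right C c) x = (x, c)" "far (fct_const_right C c) f = (f, idn C c)"
  by (auto simp: fct_id_def fct_assoc_def fct_swap_def fct_const_left_def fct_const_right_def)

lemma ten_fct_simps [simp]:
  "fob (ten_fct W) (X, Y) = ten W X Y" "far (ten_fct W) (f, g) = ten_ar W f g"
  by (auto simp: ten_fct_def)

section \<open>Coherence from root projections\<close>

text \<open>
  Families of roots carry labels, so that two families that lead to the same span can be compared.
\<close>

definition family :: "('o, 'm, 'z) cat_scheme \<Rightarrow> 'o \<Rightarrow> (nat \<rightharpoonup> 'm) \<Rightarrow> bool" where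
  "family C a R \<longleftrightarrow> (\<forall>r\<in>ran R. r \<in> arrs C \<and> src C r = a)"

definition fcmp :: "('o, 'm, 'z) cat_scheme \<Rightarrow> (nat \<rightharpoonup> 'm) \<Rightarrow> 'm \<Rightarrow> (nat \<rightharpoonup> 'm)" where
  "fcmp C R f = (\<lambda>i. map_option (\<lambda>r. cmp C r f) (R i))"

lemma dom_fcmp [simp]: "dom (fcmp C R f) = dom R"
  by (auto simp: fcmp_def dom_def)

lemma fcmp_add: "fcmp C (R ++ S) f = fcmp C R f ++ fcmp C S f"
  by (auto simp: fcmp_def map_add_def fun_eq_iff split: option.splits)

lemma fcmp_empty [simp]: "fcmp C Map.empty f = Map.empty"
  by (auto simp: fcmp_def)

lemma fcmp_single [simp]: "fcmp C [i \<mapsto> r] f = [i \<mapsto> cmp C r f]"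
  by (auto simp: fcmp_def)

lemma family_empty [simp]: "family C a Map.empty"
  by (simp add: family_def)

context category
begin

lemma family_fcmp: "family C b R \<Longrightarrow> f \<in> hom C a b \<Longrightarrow> family C a (fcmp C R f)"
  using cmp_hom[of f a b]
  by (fastforce simp: family_def fcmp_def ran_def hom_iff)

lemma family_add: "family C a R \<Longrightarrow> family C a S \<Longrightarrow> family C a (R ++ S)"
  by (auto simp: family_def ran_def map_add_Some_iff)

lemma fcmp_fcmp:
  assumes "family C c R" "g \<in> hom C b c" "f \<in> hom C a b"
  shows "fcmp C (fcmp C R g) f = fcmp C R (g \<cdot> f)"
proof
  fix i show "fcmp C (fcmp C R g) f i = fcmp C R (g \<cdot> f) i"
    using assms cmp_assoc[OF assms(3,2)]
    by (cases "R i") (auto simp: fcmp_def family_def ran_def hom_iff)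
qed

lemma fcmp_idn: "family C a R \<Longrightarrow> fcmp C R (idn C a) = R"
proof
  fix i assume "family C a R" then show "fcmp C R (idn C a) i = R i"
    by (cases "R i") (auto simp: fcmp_def family_def ran_def intro!: idn_right[of _ _ "tgt C _"] simp: hom_iff)
qed

end

section \<open>Pointwise form of the symmetric monoidal axioms\<close>

context symmetric_monoidal_category
begin

sublocale ten: cat_functor "W \<times>\<^sub>C W" W "ten_fct W"
  by (rule ten_functor)

lemma ten_obs: "X \<in> obs W \<Longrightarrow> Y \<in> obs W \<Longrightarrow> X \<otimes> Y \<in> obs W"
  using ten.fob_obs[of "(X, Y)"] by simp

lemma ten_ar_hom:
  "\<phi> \<in> hom W X X' \<Longrightarrow> \<psi> \<in> hom W Y Y' \<Longrightarrow> \<phi> \<odot> \<psi> \<in> hom W (X \<otimes> Y) (X' \<otimes> Y')"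
  using ten.far_hom[of "(\<phi>, \<psi>)" "(X, Y)" "(X', Y')"] by (simp add: hom_prod_cat)

lemma ten_ar_cmp:
  "\<phi> \<in> hom W X X' \<Longrightarrow> \<phi>' \<in> hom W X' X'' \<Longrightarrow> \<psi> \<in> hom W Y Y' \<Longrightarrow> \<psi>' \<in> hom W Y' Y'' \<Longrightarrow>
    (\<phi>' \<cdot> \<phi>) \<odot> (\<psi>' \<cdot> \<psi>) = (\<phi>' \<odot> \<psi>') \<cdot> (\<phi> \<odot> \<psi>)"
  using ten.far_cmp[of "(\<phi>, \<psi>)" "(X, Y)" "(X', Y')" "(\<phi>', \<psi>')" "(X'', Y'')"] by (simp add: hom_prod_cat)

lemma ten_ar_idn: "X \<in> obs W \<Longrightarrow> Y \<in> obs W \<Longrightarrow> idn W X \<odot> idn W Y = idn W (X \<otimes> Y)"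
  using ten.far_idn[of "(X, Y)"] by simp

lemma asc_hom:
  "X \<in> obs W \<Longrightarrow> Y \<in> obs W \<Longrightarrow> Z \<in> obs W \<Longrightarrow> asc W X Y Z \<in> hom W ((X \<otimes> Y) \<otimes> Z) (X \<otimes> Y \<otimes> Z)"
  using nat_iso.cpt_hom[OF asc_iso, of "((X, Y), Z)"] by simp

lemma lun_hom: "X \<in> obs W \<Longrightarrow> lun W X \<in> hom W (unt W \<otimes> X) X"
  using nat_iso.cpt_hom[OF lun_iso, of X] by simp

lemma run_hom: "X \<in> obs W \<Longrightarrow> run W X \<in> hom W (X \<otimes> unt W) X"
  using nat_iso.cpt_hom[OF run_iso, of X] by simp

lemma brd_hom: "X \<in> obs W \<Longrightarrow> Y \<in> obs W \<Longrightarrow> brd W X Y \<in> hom W (X \<otimes> Y) (Y \<otimes> X)"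
  using nat_iso.cpt_hom[OF brd_iso, of "(X, Y)"] by simp

lemma asc_natural:
  "\<phi> \<in> hom W X X' \<Longrightarrow> \<psi> \<in> hom W Y Y' \<Longrightarrow> \<chi> \<in> hom W Z Z' \<Longrightarrow>
    (\<phi> \<odot> \<psi> \<odot> \<chi>) \<cdot> asc W X Y Z = asc W X' Y' Z' \<cdot> ((\<phi> \<odot> \<psi>) \<odot> \<chi>)"
  using nat_iso.natural[OF asc_iso, of "((\<phi>, \<psi>), \<chi>)" "((X, Y), Z)" "((X', Y'), Z')"]
  by (simp add: hom_prod_cat)

lemma lun_natural: "\<phi> \<in> hom W X Y \<Longrightarrow> \<phi> \<cdot> lun W X = lun W Y \<cdot> (idn W (unt W) \<odot> \<phi>)"
  using nat_iso.natural[OF lun_iso, of \<phi> X Y] by simp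

lemma run_natural: "\<phi> \<in> hom W X Y \<Longrightarrow> \<phi> \<cdot> run W X = run W Y \<cdot> (\<phi> \<odot> idn W (unt W))"
  using nat_iso.natural[OF run_iso, of \<phi> X Y] by simp

lemma brd_natural:
  "\<phi> \<in> hom W X X' \<Longrightarrow> \<psi> \<in> hom W Y Y' \<Longrightarrow> (\<psi> \<odot> \<phi>) \<cdot> brd W X Y = brd W X' Y' \<cdot> (\<phi> \<odot> \<psi>)"
  using nat_iso.natural[OF brd_iso, of "(\<phi>, \<psi>)" "(X, Y)" "(X', Y')"] by (simp add: hom_prod_cat)

lemmas W_typing = unt_obs ten_obs idn_hom ten_ar_hom asc_hom lun_hom run_hom brd_hom cmp_hom

end

text \<open>On disjoint domains \<open>++\<close> overwrites nothing, and the domain of an entry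
  tells which summand it came from. This is how labels allow the roots of two factors to be merged
  without loss.\<close>

lemma add_eq_disjoint:
  assumes "R ++ S = R' ++ S'" "dom R = dom R'" "dom S = dom S'" "dom R \<inter> dom S = {}"
  shows "R = R' \<and> S = S'"
  using assms
  by (metis map_add_comm Map.map_add_subsumed1 map_add_dom_app_simps(1,3) domIff ext inf_commute)

text \<open>
  \<open>root\<close> projects the apex of \<open>A \<phi> s\<close>, and \<open>P1\<close>, \<open>P2\<close> that of \<open>\<mu> (s, t)\<close>, to the apexes of the
  arguments; \<open>out\<close> is the output part of a boundary. \<open>root_in\<close> and \<open>root_out\<close> express that the
  inputs of \<open>X\<close> are fed by outputs of \<open>X\<close> and inputs of \<open>Y\<close>, and the outputs of \<open>Y\<close> by outputs of \<open>X\<close>.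
\<close>

locale span_algebra = symmetric_monoidal_category W + algebra_data W A + C: category C
  for W :: "('w, 'v, 'z) smc_scheme" (structure) and A :: "('w, 'v, 'm, 'm \<times> 'm \<times> 'm) alg"
    and C :: "('o, 'm, 'y) cat_scheme" +
  fixes bd :: "'w \<Rightarrow> 'o" and out :: "'w \<Rightarrow> 'm" and root :: "'v \<Rightarrow> 'm \<Rightarrow> 'm"
    and P1 P2 :: "'m \<Rightarrow> 'm \<Rightarrow> 'm"
  assumes fib_eq: "X \<in> obs W \<Longrightarrow> fib A X = slice C (bd X)"
    and act_obs: "\<phi> \<in> hom W X Y \<Longrightarrow> s \<in> obs (fib A X) \<Longrightarrow> act_ob \<phi> s \<in> obs (fib A Y)"
    and root_hom: "\<phi> \<in> hom W X Y \<Longrightarrow> s \<in> obs (fib A X) \<Longrightarrow>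
      root \<phi> s \<in> hom C (src C (act_ob \<phi> s)) (src C s)"
    and root_sep: "\<phi> \<in> hom W X Y \<Longrightarrow> s \<in> obs (fib A X) \<Longrightarrow>
      x \<in> hom C Q (src C (act_ob \<phi> s)) \<Longrightarrow> y \<in> hom C Q (src C (act_ob \<phi> s)) \<Longrightarrow>
      cmp C (act_ob \<phi> s) x = cmp C (act_ob \<phi> s) y \<Longrightarrow> cmp C (root \<phi> s) x = cmp C (root \<phi> s) y \<Longrightarrow> x = y"
    and root_in: "\<phi> \<in> hom W X Y \<Longrightarrow> s \<in> obs (fib A X) \<Longrightarrow>
      x \<in> hom C Q (src C (act_ob \<phi> s)) \<Longrightarrow> y \<in> hom C Q (src C (act_ob \<phi> s)) \<Longrightarrow>
      cmp C (act_ob \<phi> s) x = cmp C (act_ob \<phi> s) y \<Longrightarrow>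
      cmp C (out X) (cmp C s (cmp C (root \<phi> s) x)) = cmp C (out X) (cmp C s (cmp C (root \<phi> s) y)) \<Longrightarrow>
      cmp C s (cmp C (root \<phi> s) x) = cmp C s (cmp C (root \<phi> s) y)"
    and root_out: "\<phi> \<in> hom W X Y \<Longrightarrow> s \<in> obs (fib A X) \<Longrightarrow>
      x \<in> hom C Q (src C (act_ob \<phi> s)) \<Longrightarrow> y \<in> hom C Q (src C (act_ob \<phi> s)) \<Longrightarrow>
      cmp C (out X) (cmp C s (cmp C (root \<phi> s) x)) = cmp C (out X) (cmp C s (cmp C (root \<phi> s) y)) \<Longrightarrow>
      cmp C (out Y) (cmp C (act_ob \<phi> s) x) = cmp C (out Y) (cmp C (act_ob \<phi> s) y)"
    and act_ar_hom: "\<phi> \<in> hom W X Y \<Longrightarrow> f \<in> hom (fib A X) s t \<Longrightarrow>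
      act_ar \<phi> f \<in> hom (fib A Y) (act_ob \<phi> s) (act_ob \<phi> t)"
    and act_ar_root: "\<phi> \<in> hom W X Y \<Longrightarrow> f \<in> hom (fib A X) s t \<Longrightarrow>
      cmp C (root \<phi> t) (und (act_ar \<phi> f)) = cmp C (und f) (root \<phi> s)"
    and mu_obs: "X \<in> obs W \<Longrightarrow> Y \<in> obs W \<Longrightarrow> s \<in> obs (fib A X) \<Longrightarrow> t \<in> obs (fib A Y) \<Longrightarrow>
      mu X Y s t \<in> obs (fib A (X \<otimes> Y))"
    and P1_hom: "X \<in> obs W \<Longrightarrow> Y \<in> obs W \<Longrightarrow> s \<in> obs (fib A X) \<Longrightarrow> t \<in> obs (fib A Y) \<Longrightarrow>
      P1 s t \<in> hom C (src C (mu X Y s t)) (src C s)"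
    and P2_hom: "X \<in> obs W \<Longrightarrow> Y \<in> obs W \<Longrightarrow> s \<in> obs (fib A X) \<Longrightarrow> t \<in> obs (fib A Y) \<Longrightarrow>
      P2 s t \<in> hom C (src C (mu X Y s t)) (src C t)"
    and mu_sep: "X \<in> obs W \<Longrightarrow> Y \<in> obs W \<Longrightarrow> s \<in> obs (fib A X) \<Longrightarrow> t \<in> obs (fib A Y) \<Longrightarrow>
      x \<in> hom C Q (src C (mu X Y s t)) \<Longrightarrow> y \<in> hom C Q (src C (mu X Y s t)) \<Longrightarrow>
      cmp C (P1 s t) x = cmp C (P1 s t) y \<Longrightarrow> cmp C (P2 s t) x = cmp C (P2 s t) y \<Longrightarrow> x = y"
    and mu_in: "X \<in> obs W \<Longrightarrow> Y \<in> obs W \<Longrightarrow> s \<in> obs (fib A X) \<Longrightarrow> t \<in> obs (fib A Y) \<Longrightarrow>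
      x \<in> hom C Q (src C (mu X Y s t)) \<Longrightarrow> y \<in> hom C Q (src C (mu X Y s t)) \<Longrightarrow>
      cmp C (mu X Y s t) x = cmp C (mu X Y s t) y \<Longrightarrow>
      cmp C s (cmp C (P1 s t) x) = cmp C s (cmp C (P1 s t) y) \<and>
      cmp C t (cmp C (P2 s t) x) = cmp C t (cmp C (P2 s t) y)"
    and mu_out: "X \<in> obs W \<Longrightarrow> Y \<in> obs W \<Longrightarrow> s \<in> obs (fib A X) \<Longrightarrow> t \<in> obs (fib A Y) \<Longrightarrow>
      x \<in> hom C Q (src C (mu X Y s t)) \<Longrightarrow> y \<in> hom C Q (src C (mu X Y s t)) \<Longrightarrow>
      cmp C (out X) (cmp C s (cmp C (P1 s t) x)) = cmp C (out X) (cmp C s (cmp C (P1 s t) y)) \<Longrightarrow>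
      cmp C (out Y) (cmp C t (cmp C (P2 s t) x)) = cmp C (out Y) (cmp C t (cmp C (P2 s t) y)) \<Longrightarrow>
      cmp C (out (X \<otimes> Y)) (cmp C (mu X Y s t) x) = cmp C (out (X \<otimes> Y)) (cmp C (mu X Y s t) y)"
    and mu_ar_hom: "X \<in> obs W \<Longrightarrow> Y \<in> obs W \<Longrightarrow> f \<in> hom (fib A X) s s' \<Longrightarrow> g \<in> hom (fib A Y) t t' \<Longrightarrow>
      mu_ar X Y f g \<in> hom (fib A (X \<otimes> Y)) (mu X Y s t) (mu X Y s' t')"
    and mu_ar_root: "X \<in> obs W \<Longrightarrow> Y \<in> obs W \<Longrightarrow> f \<in> hom (fib A X) s s' \<Longrightarrow> g \<in> hom (fib A Y) t t' \<Longrightarrow>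
      cmp C (P1 s' t') (und (mu_ar X Y f g)) = cmp C (und f) (P1 s t) \<and>
      cmp C (P2 s' t') (und (mu_ar X Y f g)) = cmp C (und g) (P2 s t)"
    and unt_ob: "lax_unt A \<in> obs (fib A (unt W))"
    and unt_sep: "x \<in> hom C Q (src C (lax_unt A)) \<Longrightarrow> y \<in> hom C Q (src C (lax_unt A)) \<Longrightarrow> x = y"
    and act_cmp_hom: "\<phi> \<in> hom W X Y \<Longrightarrow> \<psi> \<in> hom W Y Z \<Longrightarrow> s \<in> obs (fib A X) \<Longrightarrow>
      act_cmp A \<psi> \<phi> s \<in> hom (fib A Z) (act_ob \<psi> (act_ob \<phi> s)) (act_ob (\<psi> \<cdot> \<phi>) s)"
    and act_cmp_root: "\<phi> \<in> hom W X Y \<Longrightarrow> \<psi> \<in> hom W Y Z \<Longrightarrow> s \<in> obs (fib A X) \<Longrightarrow>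
      cmp C (root (\<psi> \<cdot> \<phi>) s) (und (act_cmp A \<psi> \<phi> s)) = cmp C (root \<phi> s) (root \<psi> (act_ob \<phi> s))"
    and act_cmp_inv: "\<phi> \<in> hom W X Y \<Longrightarrow> \<psi> \<in> hom W Y Z \<Longrightarrow> s \<in> obs (fib A X) \<Longrightarrow>
      \<exists>G \<in> hom (fib A Z) (act_ob (\<psi> \<cdot> \<phi>) s) (act_ob \<psi> (act_ob \<phi> s)).
        cmp C (root \<phi> s) (cmp C (root \<psi> (act_ob \<phi> s)) (und G)) = root (\<psi> \<cdot> \<phi>) s"
    and act_idn_hom: "X \<in> obs W \<Longrightarrow> s \<in> obs (fib A X) \<Longrightarrow>
      act_idn A X s \<in> hom (fib A X) (act_ob (idn W X) s) s"
    and act_idn_root: "X \<in> obs W \<Longrightarrow> s \<in> obs (fib A X) \<Longrightarrow> und (act_idn A X s) = root (idn W X) s"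
    and act_idn_inv: "X \<in> obs W \<Longrightarrow> s \<in> obs (fib A X) \<Longrightarrow>
      \<exists>G \<in> hom (fib A X) s (act_ob (idn W X) s). cmp C (root (idn W X) s) (und G) = idn C (src C s)"
    and lax_nat_hom: "\<phi> \<in> hom W X X' \<Longrightarrow> \<psi> \<in> hom W Y Y' \<Longrightarrow> s \<in> obs (fib A X) \<Longrightarrow> t \<in> obs (fib A Y) \<Longrightarrow>
      lax_nat A \<phi> \<psi> (s, t) \<in> hom (fib A (X' \<otimes> Y'))
        (act_ob (\<phi> \<odot> \<psi>) (mu X Y s t)) (mu X' Y' (act_ob \<phi> s) (act_ob \<psi> t))"
    and lax_nat_root: "\<phi> \<in> hom W X X' \<Longrightarrow> \<psi> \<in> hom W Y Y' \<Longrightarrow> s \<in> obs (fib A X) \<Longrightarrow> t \<in> obs (fib A Y) \<Longrightarrow>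
      cmp C (root \<phi> s) (cmp C (P1 (act_ob \<phi> s) (act_ob \<psi> t)) (und (lax_nat A \<phi> \<psi> (s, t))))
        = cmp C (P1 s t) (root (\<phi> \<odot> \<psi>) (mu X Y s t)) \<and>
      cmp C (root \<psi> t) (cmp C (P2 (act_ob \<phi> s) (act_ob \<psi> t)) (und (lax_nat A \<phi> \<psi> (s, t))))
        = cmp C (P2 s t) (root (\<phi> \<odot> \<psi>) (mu X Y s t))"
    and lax_nat_inv: "\<phi> \<in> hom W X X' \<Longrightarrow> \<psi> \<in> hom W Y Y' \<Longrightarrow> s \<in> obs (fib A X) \<Longrightarrow> t \<in> obs (fib A Y) \<Longrightarrow>
      \<exists>G \<in> hom (fib A (X' \<otimes> Y')) (mu X' Y' (act_ob \<phi> s) (act_ob \<psi> t)) (act_ob (\<phi> \<odot> \<psi>) (mu X Y s t)).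
        cmp C (P1 s t) (cmp C (root (\<phi> \<odot> \<psi>) (mu X Y s t)) (und G))
          = cmp C (root \<phi> s) (P1 (act_ob \<phi> s) (act_ob \<psi> t)) \<and>
        cmp C (P2 s t) (cmp C (root (\<phi> \<odot> \<psi>) (mu X Y s t)) (und G))
          = cmp C (root \<psi> t) (P2 (act_ob \<phi> s) (act_ob \<psi> t))"
    and lax_asc_hom: "X \<in> obs W \<Longrightarrow> Y \<in> obs W \<Longrightarrow> Z \<in> obs W \<Longrightarrow>
      s \<in> obs (fib A X) \<Longrightarrow> t \<in> obs (fib A Y) \<Longrightarrow> u \<in> obs (fib A Z) \<Longrightarrow>
      lax_asc A X Y Z ((s, t), u) \<in> hom (fib A (X \<otimes> Y \<otimes> Z))
        (act_ob (asc W X Y Z) (mu (X \<otimes> Y) Z (mu X Y s t) u)) (mu X (Y \<otimes> Z) s (mu Y Z t u))"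
    and lax_asc_root: "X \<in> obs W \<Longrightarrow> Y \<in> obs W \<Longrightarrow> Z \<in> obs W \<Longrightarrow>
      s \<in> obs (fib A X) \<Longrightarrow> t \<in> obs (fib A Y) \<Longrightarrow> u \<in> obs (fib A Z) \<Longrightarrow>
      m = mu (X \<otimes> Y) Z (mu X Y s t) u \<Longrightarrow> F = und (lax_asc A X Y Z ((s, t), u)) \<Longrightarrow>
      cmp C (P1 s (mu Y Z t u)) F = cmp C (P1 s t) (cmp C (P1 (mu X Y s t) u) (root (asc W X Y Z) m)) \<and>
      cmp C (P1 t u) (cmp C (P2 s (mu Y Z t u)) F)
        = cmp C (P2 s t) (cmp C (P1 (mu X Y s t) u) (root (asc W X Y Z) m)) \<and>
      cmp C (P2 t u) (cmp C (P2 s (mu Y Z t u)) F) = cmp C (P2 (mu X Y s t) u) (root (asc W X Y Z) m)"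
    and lax_asc_inv: "X \<in> obs W \<Longrightarrow> Y \<in> obs W \<Longrightarrow> Z \<in> obs W \<Longrightarrow>
      s \<in> obs (fib A X) \<Longrightarrow> t \<in> obs (fib A Y) \<Longrightarrow> u \<in> obs (fib A Z) \<Longrightarrow>
      m = mu (X \<otimes> Y) Z (mu X Y s t) u \<Longrightarrow>
      \<exists>G \<in> hom (fib A (X \<otimes> Y \<otimes> Z)) (mu X (Y \<otimes> Z) s (mu Y Z t u)) (act_ob (asc W X Y Z) m).
      cmp C (P1 s t) (cmp C (P1 (mu X Y s t) u) (cmp C (root (asc W X Y Z) m) (und G))) = P1 s (mu Y Z t u) \<and>
      cmp C (P2 s t) (cmp C (P1 (mu X Y s t) u) (cmp C (root (asc W X Y Z) m) (und G)))
        = cmp C (P1 t u) (P2 s (mu Y Z t u)) \<and>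
      cmp C (P2 (mu X Y s t) u) (cmp C (root (asc W X Y Z) m) (und G)) = cmp C (P2 t u) (P2 s (mu Y Z t u))"
    and lax_lun_hom: "X \<in> obs W \<Longrightarrow> s \<in> obs (fib A X) \<Longrightarrow>
      lax_lun A X s \<in> hom (fib A X) (act_ob (lun W X) (mu (unt W) X (lax_unt A) s)) s"
    and lax_lun_root: "X \<in> obs W \<Longrightarrow> s \<in> obs (fib A X) \<Longrightarrow>
      und (lax_lun A X s) = cmp C (P2 (lax_unt A) s) (root (lun W X) (mu (unt W) X (lax_unt A) s))"
    and lax_lun_inv: "X \<in> obs W \<Longrightarrow> s \<in> obs (fib A X) \<Longrightarrow>
      \<exists>G \<in> hom (fib A X) s (act_ob (lun W X) (mu (unt W) X (lax_unt A) s)).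
        cmp C (P2 (lax_unt A) s) (cmp C (root (lun W X) (mu (unt W) X (lax_unt A) s)) (und G)) = idn C (src C s)"
    and lax_run_hom: "X \<in> obs W \<Longrightarrow> s \<in> obs (fib A X) \<Longrightarrow>
      lax_run A X s \<in> hom (fib A X) (act_ob (run W X) (mu X (unt W) s (lax_unt A))) s"
    and lax_run_root: "X \<in> obs W \<Longrightarrow> s \<in> obs (fib A X) \<Longrightarrow>
      und (lax_run A X s) = cmp C (P1 s (lax_unt A)) (root (run W X) (mu X (unt W) s (lax_unt A)))"
    and lax_run_inv: "X \<in> obs W \<Longrightarrow> s \<in> obs (fib A X) \<Longrightarrow>
      \<exists>G \<in> hom (fib A X) s (act_ob (run W X) (mu X (unt W) s (lax_unt A))).
        cmp C (P1 s (lax_unt A)) (cmp C (root (run W X) (mu X (unt W) s (lax_unt A))) (und G)) = idn C (src C s)"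
    and lax_brd_hom: "X \<in> obs W \<Longrightarrow> Y \<in> obs W \<Longrightarrow> s \<in> obs (fib A X) \<Longrightarrow> t \<in> obs (fib A Y) \<Longrightarrow>
      lax_brd A X Y (s, t) \<in> hom (fib A (Y \<otimes> X)) (act_ob (brd W X Y) (mu X Y s t)) (mu Y X t s)"
    and lax_brd_root: "X \<in> obs W \<Longrightarrow> Y \<in> obs W \<Longrightarrow> s \<in> obs (fib A X) \<Longrightarrow> t \<in> obs (fib A Y) \<Longrightarrow>
      cmp C (P1 t s) (und (lax_brd A X Y (s, t))) = cmp C (P2 s t) (root (brd W X Y) (mu X Y s t)) \<and>
      cmp C (P2 t s) (und (lax_brd A X Y (s, t))) = cmp C (P1 s t) (root (brd W X Y) (mu X Y s t))"
    and lax_brd_inv: "X \<in> obs W \<Longrightarrow> Y \<in> obs W \<Longrightarrow> s \<in> obs (fib A X) \<Longrightarrow> t \<in> obs (fib A Y) \<Longrightarrow>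
      \<exists>G \<in> hom (fib A (Y \<otimes> X)) (mu Y X t s) (act_ob (brd W X Y) (mu X Y s t)).
        cmp C (P1 s t) (cmp C (root (brd W X Y) (mu X Y s t)) (und G)) = P2 t s \<and>
        cmp C (P2 s t) (cmp C (root (brd W X Y) (mu X Y s t)) (und G)) = P1 t s"
begin

lemma fib_category: "X \<in> obs W \<Longrightarrow> category (fib A X)"
  by (simp add: fib_eq C.slice_category)

lemma fib_und_hom: "X \<in> obs W \<Longrightarrow> F \<in> hom (fib A X) m n \<Longrightarrow> und F \<in> hom C (src C m) (src C n)"
  by (simp add: fib_eq hom_slice)

lemma fib_und_over: "X \<in> obs W \<Longrightarrow> F \<in> hom (fib A X) m n \<Longrightarrow> cmp C n (und F) = m"
  by (simp add: fib_eq hom_slice)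

lemma fib_hom_obs: "X \<in> obs W \<Longrightarrow> F \<in> hom (fib A X) m n \<Longrightarrow> m \<in> obs (fib A X) \<and> n \<in> obs (fib A X)"
  by (simp add: fib_eq hom_slice)

lemma fib_ob_hom: "X \<in> obs W \<Longrightarrow> s \<in> obs (fib A X) \<Longrightarrow> s \<in> hom C (src C s) (bd X)"
  by (simp add: fib_eq hom_iff)

lemma fib_und_cmp: "X \<in> obs W \<Longrightarrow> und (cmp (fib A X) G F) = cmp C (und G) (und F)"
  by (simp add: fib_eq)

section \<open>Arrows of spans that respect roots\<close>

definition rooted :: "'w \<Rightarrow> 'm \<Rightarrow> (nat \<rightharpoonup> 'm) \<Rightarrow> bool" where
  "rooted X s R \<longleftrightarrow> X \<in> obs W \<and> s \<in> obs (fib A X) \<and> family C (src C s) R"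

text \<open>Families are compared label by label, so an arrow that exchanges two factors does not in
  general respect a family. The roots of the source are the roots of the target composed with the
  arrow, which makes the notion closed under composition.\<close>

definition mor :: "'w \<Rightarrow> 'm \<times> 'm \<times> 'm \<Rightarrow> 'm \<Rightarrow> (nat \<rightharpoonup> 'm) \<Rightarrow> 'm \<Rightarrow> (nat \<rightharpoonup> 'm) \<Rightarrow> bool" where
  "mor X F m R n S \<longleftrightarrow> rooted X m R \<and> rooted X n S \<and> F \<in> hom (fib A X) m n \<and> fcmp C S (und F) = R"

text \<open>
  The condition on \<open>out\<close> makes \<open>sep\<close> stable under the action: the inputs of the inner span are only
  known after its outputs, which the roots must therefore determine on their own.
\<close>

definition sep :: "'w \<Rightarrow> 'm \<Rightarrow> (nat \<rightharpoonup> 'm) \<Rightarrow> bool" where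
  "sep X s R \<longleftrightarrow> rooted X s R \<and>
     (\<forall>Q x y. x \<in> hom C Q (src C s) \<and> y \<in> hom C Q (src C s) \<and> fcmp C R x = fcmp C R y \<longrightarrow>
        cmp C (out X) (cmp C s x) = cmp C (out X) (cmp C s y) \<and> (cmp C s x = cmp C s y \<longrightarrow> x = y))"

lemma sep_rooted: "sep X s R \<Longrightarrow> rooted X s R"
  by (simp add: sep_def)

lemma rooted_obs: "rooted X s R \<Longrightarrow> X \<in> obs W" "rooted X s R \<Longrightarrow> s \<in> obs (fib A X)"
  "rooted X s R \<Longrightarrow> family C (src C s) R"
  by (auto simp: rooted_def)

text \<open>The starting point of every derivation of \<open>sep\<close>: a span that is not
  decomposed any further has the identity of its apex as its only root, and that root already
  determines every arrow into the apex.\<close>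

lemma sep_leaf:
  assumes "X \<in> obs W" "s \<in> obs (fib A X)"
  shows "sep X s [i \<mapsto> idn C (src C s)]"
  unfolding sep_def rooted_def
proof (intro conjI allI impI; (elim conjE)?)
  have s: "s \<in> hom C (src C s) (bd X)" using assms by (rule fib_ob_hom)
  show "family C (src C s) [i \<mapsto> idn C (src C s)]"
    using C.idn_hom[OF C.hom_src_obs[OF s]] by (simp add: family_def hom_iff)
  fix Q x y
  assume *: "x \<in> hom C Q (src C s)" "y \<in> hom C Q (src C s)"
    "fcmp C [i \<mapsto> idn C (src C s)] x = fcmp C [i \<mapsto> idn C (src C s)] y"
  then have "x = y"
    using C.idn_left[OF *(1)] C.idn_left[OF *(2)] by (auto simp: fun_eq_iff split: if_splits)
  then show "cmp C (out X) (cmp C s x) = cmp C (out X) (cmp C s y)" "x = y" by auto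
qed (use assms in auto)

text \<open>Being arrows of a slice, both sides give \<open>m\<close> when composed with
  \<open>n\<close>; respecting roots, both give \<open>R\<close> when composed with
  \<open>S\<close>. This is all the information that \<open>sep\<close> asks for. Every coherence
  axiom is reduced to this lemma.\<close>

lemma mor_unique:
  assumes "mor X F m R n S" "mor X G m R n S" "sep X n S"
  shows "F = G"
proof -
  have X: "X \<in> obs W" and F: "F \<in> hom (fib A X) m n" and G: "G \<in> hom (fib A X) m n"
    using assms by (auto simp: mor_def rooted_def)
  have "und F = und G"
    using assms fib_und_hom[OF X F] fib_und_hom[OF X G] fib_und_over[OF X F] fib_und_over[OF X G]
    unfolding sep_def mor_def by metis
  then show ?thesis
    using F G X by (auto simp: fib_eq intro: slice_eqI)
qed

text \<open>In many axioms the two sides start at actions along two composites of wiring diagrams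
  that are equal only by an axiom of \<open>W\<close>. This variant leaves that equality as a goal
  of its own.\<close>

lemma mor_unique':
  assumes "mor X F (act_ob \<phi> s) (fcmp C R (root \<phi> s)) n S"
    and "mor X G (act_ob \<psi> s) (fcmp C R (root \<psi> s)) n S" "\<phi> = \<psi>" "sep X n S"
  shows "F = G"
  using assms mor_unique by blast

text \<open>Both composites respect roots, and so do the identities, hence uniqueness identifies
  them. No equation between the two arrows has to be proved by hand.\<close>

lemma mor_iso:
  assumes "mor X F m R n S" "mor X G n S m R" "sep X m R" "sep X n S"
  shows "is_iso (fib A X) F"
proof -
  have X: "X \<in> obs W" and F: "F \<in> hom (fib A X) m n" and G: "G \<in> hom (fib A X) n m"
    using assms by (auto simp: mor_def rooted_def)
  interpret K: category "fib A X" using X by (rule fib_category)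
  have cF: "fcmp C S (und F) = R" and cG: "fcmp C R (und G) = S"
    and fR: "family C (src C m) R" and fS: "family C (src C n) S"
    and m: "m \<in> obs (fib A X)" and n: "n \<in> obs (fib A X)"
    using assms by (auto simp: mor_def rooted_def)
  note uF = fib_und_hom[OF X F] and uG = fib_und_hom[OF X G]
  have idm: "mor X (idn (fib A X) m) m R m R" and idn: "mor X (idn (fib A X) n) n S n S"
    using m n fR fS X K.idn_hom[OF m] K.idn_hom[OF n]
    by (auto simp: mor_def rooted_def C.fcmp_idn fib_eq)
  have "mor X (cmp (fib A X) G F) m R m R"
    using m fR X K.cmp_hom[OF F G] C.fcmp_fcmp[OF fR uG uF] cF cG
    by (simp add: mor_def rooted_def fib_und_cmp)
  moreover have "mor X (cmp (fib A X) F G) n S n S"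
    using n fS X K.cmp_hom[OF G F] C.fcmp_fcmp[OF fS uF uG] cF cG
    by (simp add: mor_def rooted_def fib_und_cmp)
  ultimately show ?thesis
    using mor_unique[OF _ idm] mor_unique[OF _ idn] assms K.is_isoI[OF F G] by blast
qed

lemma mor_idn: "rooted X s R \<Longrightarrow> mor X (idn (fib A X) s) s R s R"
  using category.idn_hom[OF fib_category]
  by (auto simp: mor_def rooted_def fib_eq C.fcmp_idn)

lemma mor_cmp:
  assumes "mor X F m R n S" "mor X G n S k T"
  shows "mor X (cmp (fib A X) G F) m R k T"
proof -
  have X: "X \<in> obs W" and F: "F \<in> hom (fib A X) m n" and G: "G \<in> hom (fib A X) n k"
    and T: "family C (src C k) T"
    using assms by (auto simp: mor_def rooted_def)
  interpret K: category "fib A X" using X by (rule fib_category)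
  show ?thesis
    using assms K.cmp_hom[OF F G] C.fcmp_fcmp[OF T fib_und_hom[OF X G] fib_und_hom[OF X F]]
    by (auto simp: mor_def fib_und_cmp X)
qed

text \<open>Naturality squares contain an arbitrary arrow \<open>f\<close>. Giving its source the
  roots of its target composed with \<open>f\<close> makes it respect roots by construction.\<close>

lemma mor_arr:
  assumes "X \<in> obs W" "f \<in> hom (fib A X) s t" "rooted X t R"
  shows "mor X f s (fcmp C R (und f)) t R"
  using assms C.family_fcmp[OF _ fib_und_hom] fib_hom_obs by (auto simp: mor_def rooted_def)

text \<open>The cells \<open>cinv\<close> in the axioms are known only as inverses. Since
  \<open>R\<close> is \<open>S\<close> composed with \<open>F\<close>, composing once more with the
  inverse gives back \<open>S\<close>.\<close>

lemma mor_inv: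
  assumes F: "mor X F m R n S" and i: "is_iso (fib A X) F"
  shows "mor X (inv_arr (fib A X) F) n S m R"
proof -
  have X: "X \<in> obs W" and Fh: "F \<in> hom (fib A X) m n" and S: "family C (src C n) S"
    using assms by (auto simp: mor_def rooted_def)
  interpret K: category "fib A X" using X by (rule fib_category)
  note Gh = K.inv_arr_hom[OF i Fh]
  have "cmp C (und F) (und (inv_arr (fib A X) F)) = idn C (src C n)"
    using arg_cong[OF K.cmp_inv_arr[OF i Fh], of und] X by (simp add: fib_eq)
  then show ?thesis
    using F Gh C.fcmp_fcmp[OF S fib_und_hom[OF X Fh] fib_und_hom[OF X Gh]] C.fcmp_idn[OF S]
    by (auto simp: mor_def)
qed

lemma hom_W_obs: "\<phi> \<in> hom W X Y \<Longrightarrow> X \<in> obs W" "\<phi> \<in> hom W X Y \<Longrightarrow> Y \<in> obs W"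
  by (rule hom_src_obs hom_tgt_obs; assumption)+

lemma rooted_act: "\<phi> \<in> hom W X Y \<Longrightarrow> rooted X s R \<Longrightarrow> rooted Y (act_ob \<phi> s) (fcmp C R (root \<phi> s))"
  using act_obs root_hom hom_W_obs C.family_fcmp[OF _ root_hom] by (auto simp: rooted_def)

lemma rooted_mu:
  "rooted X s R \<Longrightarrow> rooted Y t S \<Longrightarrow>
    rooted (X \<otimes> Y) (mu X Y s t) (fcmp C R (P1 s t) ++ fcmp C S (P2 s t))"
  by (auto simp: rooted_def intro!: mu_obs ten_obs C.family_add C.family_fcmp[OF _ P1_hom] C.family_fcmp[OF _ P2_hom])

text \<open>An empty family suffices because the apex of the unit receives at most one arrow from
  each object.\<close>

lemma sep_unt: "sep (unt W) (lax_unt A) Map.empty"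
  unfolding sep_def rooted_def using unt_ob unt_obs unt_sep by auto

text \<open>The order of deduction matters. The roots fix the outputs of \<open>s\<close>; together
  with the boundary of the action these fix its inputs by \<open>root_in\<close>, hence the whole
  boundary of \<open>s\<close>; only then does \<open>sep\<close> for \<open>s\<close> fix the
  projection to its apex, and \<open>root_sep\<close> concludes.\<close>

lemma sep_act:
  assumes \<phi>: "\<phi> \<in> hom W X Y" and s: "sep X s R"
  shows "sep Y (act_ob \<phi> s) (fcmp C R (root \<phi> s))"
  unfolding sep_def
proof (intro conjI allI impI; (elim conjE)?)
  have r: "rooted X s R" using s by (rule sep_rooted)
  note [simp] = rooted_obs(2,3)[OF r]
  note h = root_hom[OF \<phi> rooted_obs(2)[OF r]]
  show "rooted Y (act_ob \<phi> s) (fcmp C R (root \<phi> s))"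
    using \<phi> r by (rule rooted_act)
  fix Q x y
  assume x: "x \<in> hom C Q (src C (act_ob \<phi> s))" and y: "y \<in> hom C Q (src C (act_ob \<phi> s))"
    and e: "fcmp C (fcmp C R (root \<phi> s)) x = fcmp C (fcmp C R (root \<phi> s)) y"
  have e': "fcmp C R (cmp C (root \<phi> s) x) = fcmp C R (cmp C (root \<phi> s) y)"
    using e C.fcmp_fcmp[OF _ h x] C.fcmp_fcmp[OF _ h y] by simp
  note * = C.cmp_hom[OF x h] C.cmp_hom[OF y h] e'
  have 1: "cmp C (out X) (cmp C s (cmp C (root \<phi> s) x)) = cmp C (out X) (cmp C s (cmp C (root \<phi> s) y))"
    using s * unfolding sep_def by blast
  then show "cmp C (out Y) (cmp C (act_ob \<phi> s) x) = cmp C (out Y) (cmp C (act_ob \<phi> s) y)"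
    using root_out[OF \<phi> _ x y] by simp
  assume 2: "cmp C (act_ob \<phi> s) x = cmp C (act_ob \<phi> s) y"
  have "cmp C s (cmp C (root \<phi> s) x) = cmp C s (cmp C (root \<phi> s) y)"
    using root_in[OF \<phi> _ x y 2 1] by simp
  then have "cmp C (root \<phi> s) x = cmp C (root \<phi> s) y"
    using s * unfolding sep_def by blast
  then show "x = y" using root_sep[OF \<phi> _ x y 2] by simp
qed

text \<open>Disjoint labels split the equality of merged families, so each factor can be separated
  on its own. The boundary of the product determines the boundaries of both factors by
  \<open>mu_in\<close>, which is what their own \<open>sep\<close> requires.\<close>

lemma sep_mu:
  assumes s: "sep X s R" and t: "sep Y t S" and d: "dom R \<inter> dom S = {}"
  shows "sep (X \<otimes> Y) (mu X Y s t) (fcmp C R (P1 s t) ++ fcmp C S (P2 s t))"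
  unfolding sep_def
proof (intro conjI allI impI; (elim conjE)?)
  have r: "rooted X s R" "rooted Y t S" using s t by (auto simp: sep_rooted)
  note o = rooted_obs(1)[OF r(1)] rooted_obs(1)[OF r(2)] rooted_obs(2)[OF r(1)] rooted_obs(2)[OF r(2)]
  note f = rooted_obs(3)[OF r(1)] rooted_obs(3)[OF r(2)]
  note h = P1_hom[OF o] P2_hom[OF o]
  show "rooted (X \<otimes> Y) (mu X Y s t) (fcmp C R (P1 s t) ++ fcmp C S (P2 s t))"
    using r by (rule rooted_mu)
  fix Q x y
  assume x: "x \<in> hom C Q (src C (mu X Y s t))" and y: "y \<in> hom C Q (src C (mu X Y s t))"
    and e: "fcmp C (fcmp C R (P1 s t) ++ fcmp C S (P2 s t)) x = fcmp C (fcmp C R (P1 s t) ++ fcmp C S (P2 s t)) y"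
  have e': "fcmp C R (cmp C (P1 s t) x) = fcmp C R (cmp C (P1 s t) y) \<and>
      fcmp C S (cmp C (P2 s t) x) = fcmp C S (cmp C (P2 s t) y)"
    using e d unfolding fcmp_add C.fcmp_fcmp[OF f(1) h(1) x] C.fcmp_fcmp[OF f(1) h(1) y]
      C.fcmp_fcmp[OF f(2) h(2) x] C.fcmp_fcmp[OF f(2) h(2) y]
    by (intro add_eq_disjoint) auto
  note * = C.cmp_hom[OF x h(1)] C.cmp_hom[OF y h(1)] C.cmp_hom[OF x h(2)] C.cmp_hom[OF y h(2)]
  show "cmp C (out (X \<otimes> Y)) (cmp C (mu X Y s t) x) = cmp C (out (X \<otimes> Y)) (cmp C (mu X Y s t) y)"
    using s t * e' mu_out[OF o x y] unfolding sep_def by blast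
  assume "cmp C (mu X Y s t) x = cmp C (mu X Y s t) y"
  then have "cmp C (P1 s t) x = cmp C (P1 s t) y \<and> cmp C (P2 s t) x = cmp C (P2 s t) y"
    using mu_in[OF o x y] s t * e' unfolding sep_def by blast
  then show "x = y" using mu_sep[OF o x y] by simp
qed

lemma mor_act:
  assumes \<phi>: "\<phi> \<in> hom W X Y" and F: "mor X F m R n S"
  shows "mor Y (act_ar \<phi> F) (act_ob \<phi> m) (fcmp C R (root \<phi> m)) (act_ob \<phi> n) (fcmp C S (root \<phi> n))"
proof -
  have m: "rooted X m R" and n: "rooted X n S" and Fh: "F \<in> hom (fib A X) m n" and e: "fcmp C S (und F) = R"
    using F by (auto simp: mor_def)
  note X = hom_W_obs(1)[OF \<phi>] and Y = hom_W_obs(2)[OF \<phi>]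
  note f = rooted_obs(3)[OF n]
  have "fcmp C (fcmp C S (root \<phi> n)) (und (act_ar \<phi> F)) = fcmp C R (root \<phi> m)"
    unfolding C.fcmp_fcmp[OF f root_hom[OF \<phi> rooted_obs(2)[OF n]] fib_und_hom[OF Y act_ar_hom[OF \<phi> Fh]]]
      act_ar_root[OF \<phi> Fh]
    using C.fcmp_fcmp[OF f fib_und_hom[OF X Fh] root_hom[OF \<phi> rooted_obs(2)[OF m]]] e by simp
  then show ?thesis
    using rooted_act[OF \<phi> m] rooted_act[OF \<phi> n] act_ar_hom[OF \<phi> Fh] by (simp add: mor_def)
qed

lemma mor_mu:
  assumes F: "mor X F m R n S" and G: "mor Y G m' R' n' S'"
  shows "mor (X \<otimes> Y) (mu_ar X Y F G) (mu X Y m m') (fcmp C R (P1 m m') ++ fcmp C R' (P2 m m'))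
    (mu X Y n n') (fcmp C S (P1 n n') ++ fcmp C S' (P2 n n'))"
proof -
  have m: "rooted X m R" "rooted Y m' R'" and n: "rooted X n S" "rooted Y n' S'"
    and Fh: "F \<in> hom (fib A X) m n" and Gh: "G \<in> hom (fib A Y) m' n'"
    and e: "fcmp C S (und F) = R" "fcmp C S' (und G) = R'"
    using F G by (auto simp: mor_def)
  note X = rooted_obs(1)[OF m(1)] and Y = rooted_obs(1)[OF m(2)]
  note om = X Y rooted_obs(2)[OF m(1)] rooted_obs(2)[OF m(2)]
  note on = X Y rooted_obs(2)[OF n(1)] rooted_obs(2)[OF n(2)]
  note f = rooted_obs(3)[OF n(1)] rooted_obs(3)[OF n(2)]
  note h = mu_ar_hom[OF X Y Fh Gh]
  note u = fib_und_hom[OF ten_obs[OF X Y] h]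
  have "fcmp C (fcmp C S (P1 n n') ++ fcmp C S' (P2 n n')) (und (mu_ar X Y F G))
      = fcmp C R (P1 m m') ++ fcmp C R' (P2 m m')"
    unfolding fcmp_add C.fcmp_fcmp[OF f(1) P1_hom[OF on] u] C.fcmp_fcmp[OF f(2) P2_hom[OF on] u]
    using mu_ar_root[OF X Y Fh Gh] C.fcmp_fcmp[OF f(1) fib_und_hom[OF X Fh] P1_hom[OF om]]
      C.fcmp_fcmp[OF f(2) fib_und_hom[OF Y Gh] P2_hom[OF om]] e by simp
  then show ?thesis
    using rooted_mu[OF m] rooted_mu[OF n] h by (simp add: mor_def)
qed

end

text \<open>The braiding exchanges two factors and with them the order of \<open>++\<close>;
  disjoint labels make that order immaterial.\<close>

lemma fcmp_add_comm: "dom R \<inter> dom S = {} \<Longrightarrow> fcmp C S f ++ fcmp C R g = fcmp C R g ++ fcmp C S f"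
  by (rule map_add_comm) auto

context category
begin

lemma fcmp_fcmp3:
  assumes "family C d R" "h \<in> hom C c d" "g \<in> hom C b c" "f \<in> hom C a b"
  shows "fcmp C (fcmp C (fcmp C R h) g) f = fcmp C R (h \<cdot> (g \<cdot> f))"
  using assms fcmp_fcmp[OF assms(1-3)] fcmp_fcmp[OF assms(1) cmp_hom[OF assms(3,2)] assms(4)]
    cmp_assoc[OF assms(4,3,2)] by simp

lemma fcmp_fcmp4:
  assumes "family C e R" "k \<in> hom C d e" "h \<in> hom C c d" "g \<in> hom C b c" "f \<in> hom C a b"
  shows "fcmp C (fcmp C (fcmp C (fcmp C R k) h) g) f = fcmp C R (k \<cdot> (h \<cdot> (g \<cdot> f)))"
  using assms fcmp_fcmp3[OF assms(1-3) assms(4)] fcmp_fcmp[OF assms(1) _ assms(5), of "k \<cdot> (h \<cdot> g)"]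
    cmp_assoc[OF assms(5,4,3)] cmp_assoc[OF assms(5) cmp_hom[OF assms(4,3)] assms(2)]
    cmp_hom[OF cmp_hom[OF assms(4,3)] assms(2)] by simp

end

section \<open>Structure cells as arrows that respect roots\<close>

context span_algebra
begin

text \<open>The arrow back is only asked to respect roots. That it is an inverse is derived by
  \<open>mor_iso\<close> once both ends are separated, so the locale can state the invertibility of
  a cell as the existence of a compatible arrow in the other direction.\<close>

definition iso_mor :: "'w \<Rightarrow> 'm \<times> 'm \<times> 'm \<Rightarrow> 'm \<Rightarrow> (nat \<rightharpoonup> 'm) \<Rightarrow> 'm \<Rightarrow> (nat \<rightharpoonup> 'm) \<Rightarrow> bool" where
  "iso_mor X F m R n S \<longleftrightarrow> mor X F m R n S \<and> (\<exists>G. mor X G n S m R)"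

lemma iso_morD: "iso_mor X F m R n S \<Longrightarrow> mor X F m R n S" "iso_mor X F m R n S \<Longrightarrow> \<exists>G. mor X G n S m R"
  by (auto simp: iso_mor_def)

lemma iso_mor_is_iso: "iso_mor X F m R n S \<Longrightarrow> sep X m R \<Longrightarrow> sep X n S \<Longrightarrow> is_iso (fib A X) F"
  unfolding iso_mor_def by (blast intro: mor_iso)

text \<open>The pattern for all structure cells below: the root equation of the cell shows that it
  respects roots, the \<open>_inv\<close> assumption of the locale yields the arrow back, and
  \<open>fcmp_fcmp\<close> reassociates the composites of projections.\<close>

lemma mor_act_cmp_iso:
  assumes \<phi>: "\<phi> \<in> hom W X Y" and \<psi>: "\<psi> \<in> hom W Y Z" and r: "rooted X s R"
  shows "iso_mor Z (act_cmp A \<psi> \<phi> s) (act_ob \<psi> (act_ob \<phi> s)) (fcmp C (fcmp C R (root \<phi> s)) (root \<psi> (act_ob \<phi> s)))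
      (act_ob (\<psi> \<cdot> \<phi>) s) (fcmp C R (root (\<psi> \<cdot> \<phi>) s))" (is "iso_mor Z ?F ?m ?R ?n ?S")
proof -
  note s = rooted_obs(2)[OF r] and f = rooted_obs(3)[OF r]
  note c = cmp_hom[OF \<phi> \<psi>] and Z = hom_W_obs(2)[OF \<psi>]
  note s' = act_obs[OF \<phi> s]
  have m: "rooted Z ?m ?R" and n: "rooted Z ?n ?S"
    using \<phi> \<psi> c r by (auto intro: rooted_act)
  note h = act_cmp_hom[OF \<phi> \<psi> s]
  have "fcmp C ?S (und ?F) = ?R"
    unfolding C.fcmp_fcmp[OF f root_hom[OF c s] fib_und_hom[OF Z h]] act_cmp_root[OF \<phi> \<psi> s]
    by (rule C.fcmp_fcmp[symmetric, OF f root_hom[OF \<phi> s] root_hom[OF \<psi> s']])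
  then have F: "mor Z ?F ?m ?R ?n ?S" using m n h by (simp add: mor_def)
  obtain G where G: "G \<in> hom (fib A Z) ?n ?m"
      "cmp C (root \<phi> s) (cmp C (root \<psi> (act_ob \<phi> s)) (und G)) = root (\<psi> \<cdot> \<phi>) s"
    using act_cmp_inv[OF \<phi> \<psi> s] by blast
  have "fcmp C ?R (und G) = ?S"
    unfolding C.fcmp_fcmp3[OF f root_hom[OF \<phi> s] root_hom[OF \<psi> s'] fib_und_hom[OF Z G(1)]] G(2) ..
  then have "\<exists>G. mor Z G ?n ?S ?m ?R" using m n G(1) unfolding mor_def by blast
  with F show ?thesis by (simp add: iso_mor_def)
qed

lemma mor_act_idn_iso:
  assumes r: "rooted X s R"
  shows "iso_mor X (act_idn A X s) (act_ob (idn W X) s) (fcmp C R (root (idn W X) s)) s R" (is "iso_mor X ?F ?m ?R ?n ?S")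
proof -
  note X = rooted_obs(1)[OF r] and s = rooted_obs(2)[OF r] and f = rooted_obs(3)[OF r]
  note c = idn_hom[OF X]
  have m: "rooted X ?m ?R" using c r by (auto intro: rooted_act)
  have F: "mor X ?F ?m ?R ?n ?S" using m r act_idn_hom[OF X s] act_idn_root[OF X s] by (simp add: mor_def)
  obtain G where G: "G \<in> hom (fib A X) ?n ?m" "cmp C (root (idn W X) s) (und G) = idn C (src C s)"
    using act_idn_inv[OF X s] by blast
  have "fcmp C ?R (und G) = ?S"
    unfolding C.fcmp_fcmp[OF f root_hom[OF c s] fib_und_hom[OF X G(1)]] G(2) C.fcmp_idn[OF f] ..
  then have "\<exists>G. mor X G ?n ?S ?m ?R" using m r G(1) unfolding mor_def by blast
  with F show ?thesis by (simp add: iso_mor_def)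
qed

lemma mor_lax_nat_iso:
  assumes \<phi>: "\<phi> \<in> hom W X X'" and \<psi>: "\<psi> \<in> hom W Y Y'" and r: "rooted X s R" "rooted Y t S"
  shows "iso_mor (X' \<otimes> Y') (lax_nat A \<phi> \<psi> (s, t)) (act_ob (\<phi> \<odot> \<psi>) (mu X Y s t))
      (fcmp C (fcmp C R (P1 s t) ++ fcmp C S (P2 s t)) (root (\<phi> \<odot> \<psi>) (mu X Y s t)))
      (mu X' Y' (act_ob \<phi> s) (act_ob \<psi> t))
      (fcmp C (fcmp C R (root \<phi> s)) (P1 (act_ob \<phi> s) (act_ob \<psi> t))
        ++ fcmp C (fcmp C S (root \<psi> t)) (P2 (act_ob \<phi> s) (act_ob \<psi> t)))" (is "iso_mor ?K ?F ?m ?R ?n ?S")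
proof -
  note o = rooted_obs(1)[OF r(1)] rooted_obs(1)[OF r(2)] rooted_obs(2)[OF r(1)] rooted_obs(2)[OF r(2)]
  note o' = hom_W_obs(2)[OF \<phi>] hom_W_obs(2)[OF \<psi>] act_obs[OF \<phi> o(3)] act_obs[OF \<psi> o(4)]
  note f = rooted_obs(3)[OF r(1)] rooted_obs(3)[OF r(2)]
  note c = ten_ar_hom[OF \<phi> \<psi>] and K = ten_obs[OF o'(1,2)]
  note p = P1_hom[OF o] P2_hom[OF o] P1_hom[OF o'] P2_hom[OF o']
  note rh = root_hom[OF c mu_obs[OF o]] root_hom[OF \<phi> o(3)] root_hom[OF \<psi> o(4)]
  have m: "rooted ?K ?m ?R" and n: "rooted ?K ?n ?S"
    using rooted_act[OF c rooted_mu[OF r]] rooted_mu[OF rooted_act[OF \<phi> r(1)] rooted_act[OF \<psi> r(2)]] by auto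
  note h = lax_nat_hom[OF \<phi> \<psi> o(3,4)]
  have "fcmp C ?S (und ?F) = ?R"
    unfolding fcmp_add C.fcmp_fcmp3[OF f(1) rh(2) p(3) fib_und_hom[OF K h]]
      C.fcmp_fcmp3[OF f(2) rh(3) p(4) fib_und_hom[OF K h]]
      C.fcmp_fcmp[OF f(1) p(1) rh(1)] C.fcmp_fcmp[OF f(2) p(2) rh(1)]
    using lax_nat_root[OF \<phi> \<psi> o(3,4)] by simp
  then have F: "mor ?K ?F ?m ?R ?n ?S" using m n h by (simp add: mor_def)
  obtain G where G: "G \<in> hom (fib A ?K) ?n ?m"
      "cmp C (P1 s t) (cmp C (root (\<phi> \<odot> \<psi>) (mu X Y s t)) (und G)) = cmp C (root \<phi> s) (P1 (act_ob \<phi> s) (act_ob \<psi> t))"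
      "cmp C (P2 s t) (cmp C (root (\<phi> \<odot> \<psi>) (mu X Y s t)) (und G)) = cmp C (root \<psi> t) (P2 (act_ob \<phi> s) (act_ob \<psi> t))"
    using lax_nat_inv[OF \<phi> \<psi> o(3,4)] by blast
  have "fcmp C ?R (und G) = ?S"
    unfolding fcmp_add C.fcmp_fcmp3[OF f(1) p(1) rh(1) fib_und_hom[OF K G(1)]]
      C.fcmp_fcmp3[OF f(2) p(2) rh(1) fib_und_hom[OF K G(1)]] G(2,3)
      C.fcmp_fcmp[OF f(1) rh(2) p(3)] C.fcmp_fcmp[OF f(2) rh(3) p(4)] ..
  then have "\<exists>G. mor ?K G ?n ?S ?m ?R" using m n G(1) unfolding mor_def by blast
  with F show ?thesis by (simp add: iso_mor_def)
qed

lemma mor_lax_asc_iso: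
  assumes r: "rooted X s R" "rooted Y t S" "rooted Z u T"
  shows "iso_mor (X \<otimes> Y \<otimes> Z) (lax_asc A X Y Z ((s, t), u))
      (act_ob (asc W X Y Z) (mu (X \<otimes> Y) Z (mu X Y s t) u))
      (fcmp C (fcmp C (fcmp C R (P1 s t) ++ fcmp C S (P2 s t)) (P1 (mu X Y s t) u) ++ fcmp C T (P2 (mu X Y s t) u))
        (root (asc W X Y Z) (mu (X \<otimes> Y) Z (mu X Y s t) u)))
      (mu X (Y \<otimes> Z) s (mu Y Z t u))
      (fcmp C R (P1 s (mu Y Z t u))
        ++ fcmp C (fcmp C S (P1 t u) ++ fcmp C T (P2 t u)) (P2 s (mu Y Z t u)))" (is "iso_mor ?K ?F ?m ?R ?n ?S")
proof -
  note X = rooted_obs(1)[OF r(1)] and Y = rooted_obs(1)[OF r(2)] and Z = rooted_obs(1)[OF r(3)]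
  note s = rooted_obs(2)[OF r(1)] and t = rooted_obs(2)[OF r(2)] and u = rooted_obs(2)[OF r(3)]
  note XY = ten_obs[OF X Y] and YZ = ten_obs[OF Y Z] and st = mu_obs[OF X Y s t] and tu = mu_obs[OF Y Z t u]
  note f = rooted_obs(3)[OF r(1)] rooted_obs(3)[OF r(2)] rooted_obs(3)[OF r(3)]
  note c = asc_hom[OF X Y Z] and K = ten_obs[OF X YZ]
  note p = P1_hom[OF X Y s t] P2_hom[OF X Y s t] P1_hom[OF XY Z st u] P2_hom[OF XY Z st u]
  note q = P1_hom[OF Y Z t u] P2_hom[OF Y Z t u] P1_hom[OF X YZ s tu] P2_hom[OF X YZ s tu]
  note rh = root_hom[OF c mu_obs[OF XY Z st u]]
  have m: "rooted ?K ?m ?R" and n: "rooted ?K ?n ?S"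
    using rooted_act[OF c rooted_mu[OF rooted_mu[OF r(1,2)] r(3)]] rooted_mu[OF r(1) rooted_mu[OF r(2,3)]] by auto
  note h = lax_asc_hom[OF X Y Z s t u]
  note e = lax_asc_root[OF X Y Z s t u refl refl]
  have "fcmp C ?S (und ?F) = ?R"
    unfolding fcmp_add C.fcmp_fcmp[OF f(1) q(3) fib_und_hom[OF K h]]
      C.fcmp_fcmp3[OF f(2) q(1,4) fib_und_hom[OF K h]] C.fcmp_fcmp3[OF f(3) q(2,4) fib_und_hom[OF K h]]
      C.fcmp_fcmp3[OF f(1) p(1,3) rh] C.fcmp_fcmp3[OF f(2) p(2,3) rh] C.fcmp_fcmp[OF f(3) p(4) rh]
    using e by simp
  then have F: "mor ?K ?F ?m ?R ?n ?S" using m n h by (simp add: mor_def)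
  obtain G where G: "G \<in> hom (fib A ?K) ?n ?m"
    and g: "cmp C (P1 s t) (cmp C (P1 (mu X Y s t) u) (cmp C (root (asc W X Y Z) (mu (X \<otimes> Y) Z (mu X Y s t) u)) (und G))) = P1 s (mu Y Z t u)"
      "cmp C (P2 s t) (cmp C (P1 (mu X Y s t) u) (cmp C (root (asc W X Y Z) (mu (X \<otimes> Y) Z (mu X Y s t) u)) (und G)))
        = cmp C (P1 t u) (P2 s (mu Y Z t u))"
      "cmp C (P2 (mu X Y s t) u) (cmp C (root (asc W X Y Z) (mu (X \<otimes> Y) Z (mu X Y s t) u)) (und G)) = cmp C (P2 t u) (P2 s (mu Y Z t u))"
    using lax_asc_inv[OF X Y Z s t u refl] by blast
  have "fcmp C ?R (und G) = ?S"
    unfolding fcmp_add C.fcmp_fcmp4[OF f(1) p(1,3) rh fib_und_hom[OF K G]]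
      C.fcmp_fcmp4[OF f(2) p(2,3) rh fib_und_hom[OF K G]] C.fcmp_fcmp3[OF f(3) p(4) rh fib_und_hom[OF K G]] g
      C.fcmp_fcmp[OF f(2) q(1,4)] C.fcmp_fcmp[OF f(3) q(2,4)] by simp
  then have "\<exists>G. mor ?K G ?n ?S ?m ?R" using m n G unfolding mor_def by blast
  with F show ?thesis by (simp add: iso_mor_def)
qed

lemma mor_lax_lun_iso:
  assumes r: "rooted X s R"
  shows "iso_mor X (lax_lun A X s) (act_ob (lun W X) (mu (unt W) X (lax_unt A) s))
      (fcmp C (fcmp C Map.empty (P1 (lax_unt A) s) ++ fcmp C R (P2 (lax_unt A) s))
        (root (lun W X) (mu (unt W) X (lax_unt A) s))) s R" (is "iso_mor ?K ?F ?m ?R ?n ?S")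
proof -
  note X = rooted_obs(1)[OF r] and s = rooted_obs(2)[OF r] and f = rooted_obs(3)[OF r]
  note o = unt_obs X unt_ob s
  note c = lun_hom[OF X] and p = P2_hom[OF o]
  note rh = root_hom[OF c mu_obs[OF o]]
  have m: "rooted X ?m ?R" using rooted_act[OF c rooted_mu[OF sep_rooted[OF sep_unt] r]] by auto
  note h = lax_lun_hom[OF X s]
  have "fcmp C ?S (und ?F) = ?R"
    by (simp add: C.fcmp_fcmp[OF f p rh] lax_lun_root[OF X s])
  then have F: "mor ?K ?F ?m ?R ?n ?S" using m r h by (simp add: mor_def)
  obtain G where G: "G \<in> hom (fib A X) ?n ?m"
      "cmp C (P2 (lax_unt A) s) (cmp C (root (lun W X) (mu (unt W) X (lax_unt A) s)) (und G)) = idn C (src C s)"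
    using lax_lun_inv[OF X s] by blast
  have "fcmp C ?R (und G) = ?S"
    by (simp add: C.fcmp_fcmp3[OF f p rh fib_und_hom[OF X G(1)]] G(2) C.fcmp_idn[OF f])
  then have "\<exists>G. mor X G ?n ?S ?m ?R" using m r G(1) unfolding mor_def by blast
  with F show ?thesis by (simp add: iso_mor_def)
qed

lemma mor_lax_run_iso:
  assumes r: "rooted X s R"
  shows "iso_mor X (lax_run A X s) (act_ob (run W X) (mu X (unt W) s (lax_unt A)))
      (fcmp C (fcmp C R (P1 s (lax_unt A)) ++ fcmp C Map.empty (P2 s (lax_unt A)))
        (root (run W X) (mu X (unt W) s (lax_unt A)))) s R" (is "iso_mor ?K ?F ?m ?R ?n ?S")
proof -
  note X = rooted_obs(1)[OF r] and s = rooted_obs(2)[OF r] and f = rooted_obs(3)[OF r]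
  note o = X unt_obs s unt_ob
  note c = run_hom[OF X] and p = P1_hom[OF o]
  note rh = root_hom[OF c mu_obs[OF o]]
  have m: "rooted X ?m ?R" using rooted_act[OF c rooted_mu[OF r sep_rooted[OF sep_unt]]] by auto
  note h = lax_run_hom[OF X s]
  have "fcmp C ?S (und ?F) = ?R"
    by (simp add: C.fcmp_fcmp[OF f p rh] lax_run_root[OF X s])
  then have F: "mor ?K ?F ?m ?R ?n ?S" using m r h by (simp add: mor_def)
  obtain G where G: "G \<in> hom (fib A X) ?n ?m"
      "cmp C (P1 s (lax_unt A)) (cmp C (root (run W X) (mu X (unt W) s (lax_unt A))) (und G)) = idn C (src C s)"
    using lax_run_inv[OF X s] by blast
  have "fcmp C ?R (und G) = ?S"
    by (simp add: C.fcmp_fcmp3[OF f p rh fib_und_hom[OF X G(1)]] G(2) C.fcmp_idn[OF f])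
  then have "\<exists>G. mor X G ?n ?S ?m ?R" using m r G(1) unfolding mor_def by blast
  with F show ?thesis by (simp add: iso_mor_def)
qed

lemma mor_lax_brd_iso:
  assumes r: "rooted X s R" "rooted Y t S" and d: "dom R \<inter> dom S = {}"
  shows "iso_mor (Y \<otimes> X) (lax_brd A X Y (s, t)) (act_ob (brd W X Y) (mu X Y s t))
      (fcmp C (fcmp C R (P1 s t) ++ fcmp C S (P2 s t)) (root (brd W X Y) (mu X Y s t)))
      (mu Y X t s) (fcmp C S (P1 t s) ++ fcmp C R (P2 t s))" (is "iso_mor ?K ?F ?m ?R ?n ?S")
proof -
  note X = rooted_obs(1)[OF r(1)] and Y = rooted_obs(1)[OF r(2)]
  note s = rooted_obs(2)[OF r(1)] and t = rooted_obs(2)[OF r(2)]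
  note f = rooted_obs(3)[OF r(1)] rooted_obs(3)[OF r(2)]
  note c = brd_hom[OF X Y] and K = ten_obs[OF Y X]
  note p = P1_hom[OF X Y s t] P2_hom[OF X Y s t] P1_hom[OF Y X t s] P2_hom[OF Y X t s]
  note rh = root_hom[OF c mu_obs[OF X Y s t]]
  have m: "rooted ?K ?m ?R" and n: "rooted ?K ?n ?S"
    using rooted_act[OF c rooted_mu[OF r]] rooted_mu[OF r(2,1)] by auto
  note h = lax_brd_hom[OF X Y s t]
  have "fcmp C ?S (und ?F) = ?R"
    unfolding fcmp_add C.fcmp_fcmp[OF f(1) p(4) fib_und_hom[OF K h]] C.fcmp_fcmp[OF f(2) p(3) fib_und_hom[OF K h]]
      C.fcmp_fcmp[OF f(1) p(1) rh] C.fcmp_fcmp[OF f(2) p(2) rh]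
    using lax_brd_root[OF X Y s t] by (simp add: fcmp_add_comm[OF d])
  then have F: "mor ?K ?F ?m ?R ?n ?S" using m n h by (simp add: mor_def)
  obtain G where G: "G \<in> hom (fib A ?K) ?n ?m"
      "cmp C (P1 s t) (cmp C (root (brd W X Y) (mu X Y s t)) (und G)) = P2 t s"
      "cmp C (P2 s t) (cmp C (root (brd W X Y) (mu X Y s t)) (und G)) = P1 t s"
    using lax_brd_inv[OF X Y s t] by blast
  have "fcmp C ?R (und G) = ?S"
    unfolding fcmp_add C.fcmp_fcmp3[OF f(1) p(1) rh fib_und_hom[OF K G(1)]]
      C.fcmp_fcmp3[OF f(2) p(2) rh fib_und_hom[OF K G(1)]] G(2,3)
    by (simp add: fcmp_add_comm[OF d])
  then have "\<exists>G. mor ?K G ?n ?S ?m ?R" using m n G(1) unfolding mor_def by blast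
  with F show ?thesis by (simp add: iso_mor_def)
qed

lemmas mor_act_cmp = mor_act_cmp_iso[THEN iso_morD(1)] and mor_act_idn = mor_act_idn_iso[THEN iso_morD(1)]
  and mor_lax_nat = mor_lax_nat_iso[THEN iso_morD(1)] and mor_lax_asc = mor_lax_asc_iso[THEN iso_morD(1)]
  and mor_lax_lun = mor_lax_lun_iso[THEN iso_morD(1)] and mor_lax_run = mor_lax_run_iso[THEN iso_morD(1)]
  and mor_lax_brd = mor_lax_brd_iso[THEN iso_morD(1)]

text \<open>Taking the identity as the single root of \<open>s\<close> makes both ends of the cell
  separated, so the two arrows recorded in \<open>iso_mor\<close> are inverse to each other.\<close>

lemma act_cmp_is_iso:
  assumes \<phi>: "\<phi> \<in> hom W X Y" and \<psi>: "\<psi> \<in> hom W Y Z" and s: "s \<in> obs (fib A X)"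
  shows "is_iso (fib A Z) (act_cmp A \<psi> \<phi> s)"
proof -
  note l = sep_leaf[OF hom_W_obs(1)[OF \<phi>] s, of 0]
  show ?thesis
    by (rule iso_mor_is_iso[OF mor_act_cmp_iso[OF \<phi> \<psi> sep_rooted[OF l]]
          sep_act[OF \<psi> sep_act[OF \<phi> l]] sep_act[OF cmp_hom[OF \<phi> \<psi>] l]])
qed

lemma mor_cinv:
  "\<phi> \<in> hom W X Y \<Longrightarrow> \<psi> \<in> hom W Y Z \<Longrightarrow> rooted X s R \<Longrightarrow>
   mor Z (cinv Z \<psi> \<phi> s) (act_ob (\<psi> \<cdot> \<phi>) s) (fcmp C R (root (\<psi> \<cdot> \<phi>) s))
     (act_ob \<psi> (act_ob \<phi> s)) (fcmp C (fcmp C R (root \<phi> s)) (root \<psi> (act_ob \<phi> s)))"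
  by (rule mor_inv[OF mor_act_cmp]) (auto intro: act_cmp_is_iso rooted_obs)

lemma act_idn_is_iso:
  assumes X: "X \<in> obs W" and s: "s \<in> obs (fib A X)"
  shows "is_iso (fib A X) (act_idn A X s)"
proof -
  note l = sep_leaf[OF X s, of 0]
  show ?thesis
    by (rule iso_mor_is_iso[OF mor_act_idn_iso[OF sep_rooted[OF l]] sep_act[OF idn_hom[OF X] l] l])
qed

lemma lax_nat_is_iso:
  assumes \<phi>: "\<phi> \<in> hom W X X'" and \<psi>: "\<psi> \<in> hom W Y Y'" and s: "s \<in> obs (fib A X)" "t \<in> obs (fib A Y)"
  shows "is_iso (fib A (X' \<otimes> Y')) (lax_nat A \<phi> \<psi> (s, t))"
proof -
  \<comment> \<open>One label per span: distinct labels give the disjoint domains that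
    \<open>sep_mu\<close> requires.\<close>
  note l = sep_leaf[OF hom_W_obs(1)[OF \<phi>] s(1), of 0] sep_leaf[OF hom_W_obs(1)[OF \<psi>] s(2), of 1]
  show ?thesis
    by (rule iso_mor_is_iso[OF mor_lax_nat_iso[OF \<phi> \<psi> sep_rooted[OF l(1)] sep_rooted[OF l(2)]]
          sep_act[OF ten_ar_hom[OF \<phi> \<psi>] sep_mu[OF l]] sep_mu[OF sep_act[OF \<phi> l(1)] sep_act[OF \<psi> l(2)]]]) auto
qed

lemma lax_asc_is_iso:
  assumes X: "X \<in> obs W" "Y \<in> obs W" "Z \<in> obs W"
    and s: "s \<in> obs (fib A X)" "t \<in> obs (fib A Y)" "u \<in> obs (fib A Z)"
  shows "is_iso (fib A (X \<otimes> Y \<otimes> Z)) (lax_asc A X Y Z ((s, t), u))"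
proof -
  note l = sep_leaf[OF X(1) s(1), of 0] sep_leaf[OF X(2) s(2), of 1] sep_leaf[OF X(3) s(3), of 2]
  show ?thesis
    by (rule iso_mor_is_iso[OF mor_lax_asc_iso[OF sep_rooted[OF l(1)] sep_rooted[OF l(2)] sep_rooted[OF l(3)]]
          sep_act[OF asc_hom[OF X] sep_mu[OF sep_mu[OF l(1,2)] l(3)]] sep_mu[OF l(1) sep_mu[OF l(2,3)]]]) auto
qed

lemma lax_lun_is_iso:
  assumes X: "X \<in> obs W" and s: "s \<in> obs (fib A X)"
  shows "is_iso (fib A X) (lax_lun A X s)"
proof -
  note l = sep_leaf[OF X s, of 0]
  show ?thesis
    by (rule iso_mor_is_iso[OF mor_lax_lun_iso[OF sep_rooted[OF l]]
          sep_act[OF lun_hom[OF X] sep_mu[OF sep_unt l]] l]) simp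
qed

lemma lax_run_is_iso:
  assumes X: "X \<in> obs W" and s: "s \<in> obs (fib A X)"
  shows "is_iso (fib A X) (lax_run A X s)"
proof -
  note l = sep_leaf[OF X s, of 0]
  show ?thesis
    by (rule iso_mor_is_iso[OF mor_lax_run_iso[OF sep_rooted[OF l]]
          sep_act[OF run_hom[OF X] sep_mu[OF l sep_unt]] l]) simp
qed

lemma lax_brd_is_iso:
  assumes X: "X \<in> obs W" "Y \<in> obs W" and s: "s \<in> obs (fib A X)" "t \<in> obs (fib A Y)"
  shows "is_iso (fib A (Y \<otimes> X)) (lax_brd A X Y (s, t))"
proof -
  note l = sep_leaf[OF X(1) s(1), of 0] sep_leaf[OF X(2) s(2), of 1]
  show ?thesis
    by (rule iso_mor_is_iso[OF mor_lax_brd_iso[OF sep_rooted[OF l(1)] sep_rooted[OF l(2)]]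
          sep_act[OF brd_hom[OF X] sep_mu[OF l]] sep_mu[OF l(2,1)]]) auto
qed

text \<open>The functor laws are treated like coherence axioms: both sides respect the same roots
  and have the same separated target.\<close>

lemma act_functor:
  assumes \<phi>: "\<phi> \<in> hom W X Y"
  shows "cat_functor (fib A X) (fib A Y) (act A \<phi>)"
proof -
  note X = hom_W_obs(1)[OF \<phi>] and Y = hom_W_obs(2)[OF \<phi>]
  interpret FX: category "fib A X" using X by (rule fib_category)
  interpret FY: category "fib A Y" using Y by (rule fib_category)
  show ?thesis
  proof
    fix s assume s: "s \<in> obs (fib A X)"
    then show "act_ob \<phi> s \<in> obs (fib A Y)" using act_obs[OF \<phi>] by simp
    note l = sep_leaf[OF X s, of 0]
    show "act_ar \<phi> (idn (fib A X) s) = idn (fib A Y) (act_ob \<phi> s)"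
      by (rule mor_unique[OF mor_act[OF \<phi> mor_idn] mor_idn[OF rooted_act] sep_act])
        (rule \<phi> l sep_rooted[OF l])+
  next
    fix f s t assume f: "f \<in> hom (fib A X) s t"
    then show "act_ar \<phi> f \<in> hom (fib A Y) (act_ob \<phi> s) (act_ob \<phi> t)" using act_ar_hom[OF \<phi>] by simp
    fix g u assume g: "g \<in> hom (fib A X) t u"
    \<comment> \<open>The root is placed at the end of the chain and carried backwards along
      \<open>g\<close> and then along \<open>f\<close>, so that both arrows respect roots.\<close>
    note l = sep_leaf[OF X FX.hom_tgt_obs[OF g], of 0]
    note mg = mor_arr[OF X g sep_rooted[OF l]]
    note mf = mor_arr[OF X f mg[unfolded mor_def, THEN conjunct1]]
    show "act_ar \<phi> (cmp (fib A X) g f) = cmp (fib A Y) (act_ar \<phi> g) (act_ar \<phi> f)"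
      by (rule mor_unique[OF mor_act[OF \<phi> mor_cmp[OF mf mg]] mor_cmp[OF mor_act[OF \<phi> mf] mor_act[OF \<phi> mg]]
            sep_act[OF \<phi> l]])
  qed
qed

lemma lax_functor:
  assumes X: "X \<in> obs W" and Y: "Y \<in> obs W"
  shows "cat_functor (fib A X \<times>\<^sub>C fib A Y) (fib A (X \<otimes> Y)) (lax A X Y)"
proof -
  interpret FX: category "fib A X" using X by (rule fib_category)
  interpret FY: category "fib A Y" using Y by (rule fib_category)
  interpret P: category "fib A X \<times>\<^sub>C fib A Y" by (rule prod_category) unfold_locales
  interpret T: category "fib A (X \<otimes> Y)" using ten_obs[OF X Y] by (rule fib_category)
  show ?thesis
  proof
    fix st assume st: "st \<in> obs (fib A X \<times>\<^sub>C fib A Y)"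
    then obtain s t where [simp]: "st = (s, t)" and s: "s \<in> obs (fib A X)" and t: "t \<in> obs (fib A Y)" by auto
    show "fob (lax A X Y) st \<in> obs (fib A (X \<otimes> Y))" using mu_obs[OF X Y s t] by simp
    note l = sep_leaf[OF X s, of 0] sep_leaf[OF Y t, of 1]
    have "mu_ar X Y (idn (fib A X) s) (idn (fib A Y) t) = idn (fib A (X \<otimes> Y)) (mu X Y s t)"
      by (rule mor_unique[OF mor_mu[OF mor_idn mor_idn] mor_idn[OF rooted_mu] sep_mu], (rule l sep_rooted[OF l(1)] sep_rooted[OF l(2)])+) auto
    then show "far (lax A X Y) (idn (fib A X \<times>\<^sub>C fib A Y) st) = idn (fib A (X \<otimes> Y)) (fob (lax A X Y) st)"
      by simp
  next
    fix f p q assume f: "f \<in> hom (fib A X \<times>\<^sub>C fib A Y) p q"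
    then show "far (lax A X Y) f \<in> hom (fib A (X \<otimes> Y)) (fob (lax A X Y) p) (fob (lax A X Y) q)"
      using mu_ar_hom[OF X Y, of "fst f" "fst p" "fst q" "snd f" "snd p" "snd q"] by (simp add: hom_prod_cat)
    fix g r assume g: "g \<in> hom (fib A X \<times>\<^sub>C fib A Y) q r"
    have f': "fst f \<in> hom (fib A X) (fst p) (fst q)" "snd f \<in> hom (fib A Y) (snd p) (snd q)"
      and g': "fst g \<in> hom (fib A X) (fst q) (fst r)" "snd g \<in> hom (fib A Y) (snd q) (snd r)"
      using f g by (auto simp: hom_prod_cat)
    note l1 = sep_leaf[OF X FX.hom_tgt_obs[OF g'(1)], of 0]
    note mg1 = mor_arr[OF X g'(1) sep_rooted[OF l1]]
    note mf1 = mor_arr[OF X f'(1) mg1[unfolded mor_def, THEN conjunct1]]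
    note l2 = sep_leaf[OF Y FY.hom_tgt_obs[OF g'(2)], of 1]
    note mg2 = mor_arr[OF Y g'(2) sep_rooted[OF l2]]
    note mf2 = mor_arr[OF Y f'(2) mg2[unfolded mor_def, THEN conjunct1]]
    have "mu_ar X Y (cmp (fib A X) (fst g) (fst f)) (cmp (fib A Y) (snd g) (snd f))
        = cmp (fib A (X \<otimes> Y)) (mu_ar X Y (fst g) (snd g)) (mu_ar X Y (fst f) (snd f))"
      by (rule mor_unique[OF mor_mu[OF mor_cmp[OF mf1 mg1] mor_cmp[OF mf2 mg2]]
            mor_cmp[OF mor_mu[OF mf1 mf2] mor_mu[OF mg1 mg2]] sep_mu[OF l1 l2]]) auto
    then show "far (lax A X Y) (cmp (fib A X \<times>\<^sub>C fib A Y) g f)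
        = cmp (fib A (X \<otimes> Y)) (far (lax A X Y) g) (far (lax A X Y) f)"
      by simp
  qed
qed

end

section \<open>Naturality and coherence axioms of the algebra\<close>

context span_algebra
begin

text \<open>A calculus for the roots of composites of cells. Resolved backwards after
  \<open>mor_unique\<close>, the rules compute from the first side of an equation the families at
  both ends; the second side must then produce literally the same families, and this unification is
  the actual coherence check. The \<open>sep_rules\<close> settle the common target.\<close>

lemmas mor_rules = mor_act mor_mu mor_act_cmp mor_cinv mor_act_idn mor_lax_nat mor_lax_asc
  mor_lax_lun mor_lax_run mor_lax_brd mor_idn mor_cmp rooted_act rooted_mu
  sep_rooted[OF sep_unt] W_typing
lemmas sep_rules = sep_act sep_mu sep_unt W_typing

lemma act_cmp_nat_iso:
  assumes \<phi>: "\<phi> \<in> hom W X Y" and \<psi>: "\<psi> \<in> hom W Y Z"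
  shows "nat_iso (fib A X) (fib A Z) (act A \<psi> \<circ>\<^sub>F act A \<phi>) (act A (\<psi> \<cdot> \<phi>)) (act_cmp A \<psi> \<phi>)"
proof -
  note X = hom_W_obs(1)[OF \<phi>] and c = cmp_hom[OF \<phi> \<psi>]
  interpret F: cat_functor "fib A X" "fib A Z" "act A \<psi> \<circ>\<^sub>F act A \<phi>"
    by (rule fct_comp_functor act_functor \<phi> \<psi>)+
  interpret G: cat_functor "fib A X" "fib A Z" "act A (\<psi> \<cdot> \<phi>)" by (rule act_functor c)+
  show ?thesis
  proof
    fix s assume s: "s \<in> obs (fib A X)"
    show "act_cmp A \<psi> \<phi> s \<in> hom (fib A Z) (fob (act A \<psi> \<circ>\<^sub>F act A \<phi>) s) (act_ob (\<psi> \<cdot> \<phi>) s)"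
      using act_cmp_hom[OF \<phi> \<psi> s] by simp
    show "is_iso (fib A Z) (act_cmp A \<psi> \<phi> s)" by (rule act_cmp_is_iso[OF \<phi> \<psi> s])
  next
    fix f s t assume f: "f \<in> hom (fib A X) s t"
    note l = sep_leaf[OF X F.C.hom_tgt_obs[OF f], of 0]
    note mf = mor_arr[OF X f sep_rooted[OF l]]
    note r = mf[unfolded mor_def, THEN conjunct1]
    show "cmp (fib A Z) (act_ar (\<psi> \<cdot> \<phi>) f) (act_cmp A \<psi> \<phi> s)
        = cmp (fib A Z) (act_cmp A \<psi> \<phi> t) (far (act A \<psi> \<circ>\<^sub>F act A \<phi>) f)"
      unfolding fct_comp_simps
      by (rule mor_unique, (rule mor_rules \<phi> \<psi> mf sep_rooted[OF l] r | assumption)+)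
        (rule sep_rules \<phi> \<psi> l)+
  qed
qed

lemma act_idn_nat_iso:
  assumes X: "X \<in> obs W"
  shows "nat_iso (fib A X) (fib A X) (act A (idn W X)) fct_id (act_idn A X)"
proof -
  interpret F: cat_functor "fib A X" "fib A X" "act A (idn W X)" by (rule act_functor idn_hom X)+
  interpret G: cat_functor "fib A X" "fib A X" fct_id by (rule fct_id_functor) unfold_locales
  show ?thesis
  proof
    fix s assume s: "s \<in> obs (fib A X)"
    show "act_idn A X s \<in> hom (fib A X) (act_ob (idn W X) s) (fob fct_id s)"
      using act_idn_hom[OF X s] by simp
    show "is_iso (fib A X) (act_idn A X s)" by (rule act_idn_is_iso[OF X s])
  next
    fix f s t assume f: "f \<in> hom (fib A X) s t"
    note l = sep_leaf[OF X F.C.hom_tgt_obs[OF f], of 0]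
    note mf = mor_arr[OF X f sep_rooted[OF l]]
    note r = mf[unfolded mor_def, THEN conjunct1]
    show "cmp (fib A X) (far fct_id f) (act_idn A X s) = cmp (fib A X) (act_idn A X t) (act_ar (idn W X) f)"
      unfolding fct_basic_simps
      by (rule mor_unique, (rule mor_rules X mf sep_rooted[OF l] r | assumption)+)
        (rule sep_rules X l)+
  qed
qed

lemma pseudofunctor: "pseudofunctor W A"
proof (intro pseudofunctor.intro pseudofunctor_axioms.intro category_axioms)
  fix X Y Z V \<phi> \<psi> \<chi> s
  show "category (fib A X)" if "X \<in> obs W" using that by (rule fib_category)
  show "cat_functor (fib A X) (fib A Y) (act A \<phi>)" if "\<phi> \<in> hom W X Y" using that by (rule act_functor)
  show "nat_iso (fib A X) (fib A Z) (act A \<psi> \<circ>\<^sub>F act A \<phi>) (act A (\<psi> \<cdot> \<phi>)) (act_cmp A \<psi> \<phi>)"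
    if "\<phi> \<in> hom W X Y" "\<psi> \<in> hom W Y Z" using that by (rule act_cmp_nat_iso)
  show "nat_iso (fib A X) (fib A X) (act A (idn W X)) fct_id (act_idn A X)" if "X \<in> obs W"
    using that by (rule act_idn_nat_iso)
  assume \<phi>: "\<phi> \<in> hom W X Y" and s: "s \<in> obs (fib A X)"
  note X = hom_W_obs(1)[OF \<phi>] and Y = hom_W_obs(2)[OF \<phi>]
  note l = sep_leaf[OF X s, of 0]
  note r = sep_rooted[OF l]
  show "act_cmp A \<phi> (idn W X) s = act_ar \<phi> (act_idn A X s)"
    \<comment> \<open>This cell ends at the action along \<open>\<phi> \<cdot> idn W X\<close>. The
      unit law has to be applied inside the typing fact before both sides have the same
      target.\<close>
    using mor_act_cmp[OF idn_hom[OF X] \<phi> r]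
    unfolding idn_right[OF \<phi>]
    by (rule mor_unique) (rule mor_rules sep_rules \<phi> X r l)+
  show "act_cmp A (idn W Y) \<phi> s = act_idn A Y (act_ob \<phi> s)"
    using mor_act_cmp[OF \<phi> idn_hom[OF Y] r]
    unfolding idn_left[OF \<phi>]
    by (rule mor_unique) (rule mor_rules sep_rules \<phi> X r l)+
  assume \<psi>: "\<psi> \<in> hom W Y Z" and \<chi>: "\<chi> \<in> hom W Z V"
  show "cmp (fib A V) (act_cmp A \<chi> (\<psi> \<cdot> \<phi>) s) (act_ar \<chi> (act_cmp A \<psi> \<phi> s))
      = cmp (fib A V) (act_cmp A (\<chi> \<cdot> \<psi>) \<phi> s) (act_cmp A \<chi> \<psi> (act_ob \<phi> s))"
    using mor_cmp[OF mor_act[OF \<chi> mor_act_cmp[OF \<phi> \<psi> r]] mor_act_cmp[OF cmp_hom[OF \<phi> \<psi>] \<chi> r]]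
    unfolding cmp_assoc[OF \<phi> \<psi> \<chi>, symmetric]
    by (rule mor_unique) (rule mor_rules sep_rules \<phi> \<psi> \<chi> r l)+
qed

lemma lax_nat_nat_iso:
  assumes \<phi>: "\<phi> \<in> hom W X X'" and \<psi>: "\<psi> \<in> hom W Y Y'"
  shows "nat_iso (fib A X \<times>\<^sub>C fib A Y) (fib A (X' \<otimes> Y'))
        (act A (\<phi> \<odot> \<psi>) \<circ>\<^sub>F lax A X Y) (lax A X' Y' \<circ>\<^sub>F (act A \<phi> \<times>\<^sub>F act A \<psi>)) (lax_nat A \<phi> \<psi>)"
proof -
  note X = hom_W_obs(1)[OF \<phi>] and X' = hom_W_obs(2)[OF \<phi>]
  note Y = hom_W_obs(1)[OF \<psi>] and Y' = hom_W_obs(2)[OF \<psi>]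
  interpret F: cat_functor "fib A X \<times>\<^sub>C fib A Y" "fib A (X' \<otimes> Y')" "act A (\<phi> \<odot> \<psi>) \<circ>\<^sub>F lax A X Y"
    by (rule fct_comp_functor lax_functor act_functor ten_ar_hom X Y \<phi> \<psi>)+
  interpret G: cat_functor "fib A X \<times>\<^sub>C fib A Y" "fib A (X' \<otimes> Y')" "lax A X' Y' \<circ>\<^sub>F (act A \<phi> \<times>\<^sub>F act A \<psi>)"
    by (rule fct_comp_functor fct_prod_functor lax_functor act_functor X' Y' \<phi> \<psi>)+
  show ?thesis
  proof
    fix p assume p: "p \<in> obs (fib A X \<times>\<^sub>C fib A Y)"
    obtain s t where [simp]: "p = (s, t)" by (cases p)
    have s: "s \<in> obs (fib A X)" and t: "t \<in> obs (fib A Y)" using p by auto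
    show "lax_nat A \<phi> \<psi> p \<in> hom (fib A (X' \<otimes> Y'))
        (fob (act A (\<phi> \<odot> \<psi>) \<circ>\<^sub>F lax A X Y) p) (fob (lax A X' Y' \<circ>\<^sub>F (act A \<phi> \<times>\<^sub>F act A \<psi>)) p)"
      using lax_nat_hom[OF \<phi> \<psi> s t] by simp
    show "is_iso (fib A (X' \<otimes> Y')) (lax_nat A \<phi> \<psi> p)" using lax_nat_is_iso[OF \<phi> \<psi> s t] by simp
  next
    fix h p q assume h: "h \<in> hom (fib A X \<times>\<^sub>C fib A Y) p q"
    obtain s t s' t' f g where [simp]: "p = (s, t)" "q = (s', t')" "h = (f, g)" by (cases p, cases q, cases h)
    have f: "f \<in> hom (fib A X) s s'" and g: "g \<in> hom (fib A Y) t t'" using h by (auto simp: hom_prod_cat)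
    note ls = sep_leaf[OF X fib_hom_obs[OF X f, THEN conjunct2], of 0]
    note lt = sep_leaf[OF Y fib_hom_obs[OF Y g, THEN conjunct2], of 1]
    note mf = mor_arr[OF X f sep_rooted[OF ls]] and mg = mor_arr[OF Y g sep_rooted[OF lt]]
    note r = mf[unfolded mor_def, THEN conjunct1] mg[unfolded mor_def, THEN conjunct1]
      sep_rooted[OF ls] sep_rooted[OF lt]
    show "cmp (fib A (X' \<otimes> Y')) (far (lax A X' Y' \<circ>\<^sub>F (act A \<phi> \<times>\<^sub>F act A \<psi>)) h) (lax_nat A \<phi> \<psi> p)
        = cmp (fib A (X' \<otimes> Y')) (lax_nat A \<phi> \<psi> q) (far (act A (\<phi> \<odot> \<psi>) \<circ>\<^sub>F lax A X Y) h)"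
      apply simp
      apply (rule mor_unique)
        apply (rule mor_rules \<phi> \<psi> mf mg r)+
      apply (rule sep_rules \<phi> \<psi> ls lt)+
      apply auto
      done
  qed
qed

end

context span_algebra
begin

lemma lax_asc_nat_iso:
  assumes X: "X \<in> obs W" and Y: "Y \<in> obs W" and Z: "Z \<in> obs W"
  shows "nat_iso (fib A X \<times>\<^sub>C fib A Y \<times>\<^sub>C fib A Z) (fib A (X \<otimes> Y \<otimes> Z))
        (act A (asc W X Y Z) \<circ>\<^sub>F lax A (X \<otimes> Y) Z \<circ>\<^sub>F (lax A X Y \<times>\<^sub>F fct_id))
        (lax A X (Y \<otimes> Z) \<circ>\<^sub>F (fct_id \<times>\<^sub>F lax A Y Z) \<circ>\<^sub>F fct_assoc)
        (lax_asc A X Y Z)"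
proof -
  interpret F: cat_functor "fib A X \<times>\<^sub>C fib A Y \<times>\<^sub>C fib A Z" "fib A (X \<otimes> Y \<otimes> Z)"
      "act A (asc W X Y Z) \<circ>\<^sub>F lax A (X \<otimes> Y) Z \<circ>\<^sub>F (lax A X Y \<times>\<^sub>F fct_id)"
    by (rule fct_comp_functor fct_prod_functor fct_id_functor lax_functor act_functor fib_category W_typing X Y Z)+
  interpret G: cat_functor "fib A X \<times>\<^sub>C fib A Y \<times>\<^sub>C fib A Z" "fib A (X \<otimes> Y \<otimes> Z)"
      "lax A X (Y \<otimes> Z) \<circ>\<^sub>F (fct_id \<times>\<^sub>F lax A Y Z) \<circ>\<^sub>F fct_assoc"
    by (rule fct_comp_functor fct_assoc_functor fct_prod_functor fct_id_functor lax_functor fib_category W_typing X Y Z)+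
  show ?thesis
  proof
    fix p assume p: "p \<in> obs (fib A X \<times>\<^sub>C fib A Y \<times>\<^sub>C fib A Z)"
    obtain s t u where [simp]: "p = ((s, t), u)" by (metis surj_pair)
    have o: "s \<in> obs (fib A X)" "t \<in> obs (fib A Y)" "u \<in> obs (fib A Z)" using p by auto
    show "lax_asc A X Y Z p \<in> hom (fib A (X \<otimes> Y \<otimes> Z))
        (fob (act A (asc W X Y Z) \<circ>\<^sub>F lax A (X \<otimes> Y) Z \<circ>\<^sub>F (lax A X Y \<times>\<^sub>F fct_id)) p)
        (fob (lax A X (Y \<otimes> Z) \<circ>\<^sub>F (fct_id \<times>\<^sub>F lax A Y Z) \<circ>\<^sub>F fct_assoc) p)"
      using lax_asc_hom[OF X Y Z o] by simp
    show "is_iso (fib A (X \<otimes> Y \<otimes> Z)) (lax_asc A X Y Z p)" using lax_asc_is_iso[OF X Y Z o] by simp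
  next
    fix k p q assume k: "k \<in> hom (fib A X \<times>\<^sub>C fib A Y \<times>\<^sub>C fib A Z) p q"
    obtain s t u s' t' u' f g h where [simp]: "p = ((s, t), u)" "q = ((s', t'), u')" "k = ((f, g), h)"
      by (metis surj_pair)
    have f: "f \<in> hom (fib A X) s s'" and g: "g \<in> hom (fib A Y) t t'" and h: "h \<in> hom (fib A Z) u u'"
      using k by (auto simp: hom_prod_cat)
    note ls = sep_leaf[OF X fib_hom_obs[OF X f, THEN conjunct2], of 0]
    note lt = sep_leaf[OF Y fib_hom_obs[OF Y g, THEN conjunct2], of 1]
    note lu = sep_leaf[OF Z fib_hom_obs[OF Z h, THEN conjunct2], of 2]
    note m = mor_arr[OF X f sep_rooted[OF ls]] mor_arr[OF Y g sep_rooted[OF lt]] mor_arr[OF Z h sep_rooted[OF lu]]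
    note r = m(1)[unfolded mor_def, THEN conjunct1] m(2)[unfolded mor_def, THEN conjunct1]
      m(3)[unfolded mor_def, THEN conjunct1] sep_rooted[OF ls] sep_rooted[OF lt] sep_rooted[OF lu]
    show "cmp (fib A (X \<otimes> Y \<otimes> Z)) (far (lax A X (Y \<otimes> Z) \<circ>\<^sub>F (fct_id \<times>\<^sub>F lax A Y Z) \<circ>\<^sub>F fct_assoc) k)
          (lax_asc A X Y Z p)
        = cmp (fib A (X \<otimes> Y \<otimes> Z)) (lax_asc A X Y Z q)
          (far (act A (asc W X Y Z) \<circ>\<^sub>F lax A (X \<otimes> Y) Z \<circ>\<^sub>F (lax A X Y \<times>\<^sub>F fct_id)) k)"
      apply simp
      apply (rule mor_unique)
        apply (rule mor_rules X Y Z m r)+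
      apply (rule sep_rules X Y Z ls lt lu)+
      apply auto
      done
  qed
qed

lemma lax_lun_nat_iso:
  assumes X: "X \<in> obs W"
  shows "nat_iso (fib A X) (fib A X)
        (act A (lun W X) \<circ>\<^sub>F lax A (unt W) X \<circ>\<^sub>F fct_const_left (fib A (unt W)) (lax_unt A))
        fct_id (lax_lun A X)"
proof -
  interpret F: cat_functor "fib A X" "fib A X"
      "act A (lun W X) \<circ>\<^sub>F lax A (unt W) X \<circ>\<^sub>F fct_const_left (fib A (unt W)) (lax_unt A)"
    by (rule fct_comp_functor fct_const_left_functor lax_functor act_functor fib_category W_typing unt_ob X)+
  interpret G: cat_functor "fib A X" "fib A X" fct_id by (rule fct_id_functor fib_category X)+
  show ?thesis
  proof
    fix s assume s: "s \<in> obs (fib A X)"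
    show "lax_lun A X s \<in> hom (fib A X)
        (fob (act A (lun W X) \<circ>\<^sub>F lax A (unt W) X \<circ>\<^sub>F fct_const_left (fib A (unt W)) (lax_unt A)) s) (fob fct_id s)"
      using lax_lun_hom[OF X s] by simp
    show "is_iso (fib A X) (lax_lun A X s)" by (rule lax_lun_is_iso[OF X s])
  next
    fix f s t assume f: "f \<in> hom (fib A X) s t"
    note l = sep_leaf[OF X fib_hom_obs[OF X f, THEN conjunct2], of 0]
    note m = mor_arr[OF X f sep_rooted[OF l]]
    note r = m(1)[unfolded mor_def, THEN conjunct1] sep_rooted[OF l]
    show "cmp (fib A X) (far fct_id f) (lax_lun A X s) = cmp (fib A X) (lax_lun A X t)
      (far (act A (lun W X) \<circ>\<^sub>F lax A (unt W) X \<circ>\<^sub>F fct_const_left (fib A (unt W)) (lax_unt A)) f)"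
      unfolding fct_comp_simps fct_basic_simps
      apply (rule mor_unique)
        apply (rule mor_rules X m r)+
      apply (rule sep_rules X l)+
      done
  qed
qed

lemma lax_run_nat_iso:
  assumes X: "X \<in> obs W"
  shows "nat_iso (fib A X) (fib A X)
        (act A (run W X) \<circ>\<^sub>F lax A X (unt W) \<circ>\<^sub>F fct_const_right (fib A (unt W)) (lax_unt A))
        fct_id (lax_run A X)"
proof -
  interpret F: cat_functor "fib A X" "fib A X"
      "act A (run W X) \<circ>\<^sub>F lax A X (unt W) \<circ>\<^sub>F fct_const_right (fib A (unt W)) (lax_unt A)"
    by (rule fct_comp_functor fct_const_right_functor lax_functor act_functor fib_category W_typing unt_ob X)+
  interpret G: cat_functor "fib A X" "fib A X" fct_id by (rule fct_id_functor fib_category X)+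
  show ?thesis
  proof
    fix s assume s: "s \<in> obs (fib A X)"
    show "lax_run A X s \<in> hom (fib A X)
        (fob (act A (run W X) \<circ>\<^sub>F lax A X (unt W) \<circ>\<^sub>F fct_const_right (fib A (unt W)) (lax_unt A)) s) (fob fct_id s)"
      using lax_run_hom[OF X s] by simp
    show "is_iso (fib A X) (lax_run A X s)" by (rule lax_run_is_iso[OF X s])
  next
    fix f s t assume f: "f \<in> hom (fib A X) s t"
    note l = sep_leaf[OF X fib_hom_obs[OF X f, THEN conjunct2], of 0]
    note m = mor_arr[OF X f sep_rooted[OF l]]
    note r = m(1)[unfolded mor_def, THEN conjunct1] sep_rooted[OF l]
    show "cmp (fib A X) (far fct_id f) (lax_run A X s) = cmp (fib A X) (lax_run A X t)
      (far (act A (run W X) \<circ>\<^sub>F lax A X (unt W) \<circ>\<^sub>F fct_const_right (fib A (unt W)) (lax_unt A)) f)"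
      unfolding fct_comp_simps fct_basic_simps
      apply (rule mor_unique)
        apply (rule mor_rules X m r)+
      apply (rule sep_rules X l)+
      done
  qed
qed

lemma lax_brd_nat_iso:
  assumes X: "X \<in> obs W" and Y: "Y \<in> obs W"
  shows "nat_iso (fib A X \<times>\<^sub>C fib A Y) (fib A (Y \<otimes> X))
        (act A (brd W X Y) \<circ>\<^sub>F lax A X Y) (lax A Y X \<circ>\<^sub>F fct_swap) (lax_brd A X Y)"
proof -
  interpret F: cat_functor "fib A X \<times>\<^sub>C fib A Y" "fib A (Y \<otimes> X)" "act A (brd W X Y) \<circ>\<^sub>F lax A X Y"
    by (rule fct_comp_functor lax_functor act_functor fib_category W_typing X Y)+
  interpret G: cat_functor "fib A X \<times>\<^sub>C fib A Y" "fib A (Y \<otimes> X)" "lax A Y X \<circ>\<^sub>F fct_swap"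
    by (rule fct_comp_functor fct_swap_functor lax_functor fib_category W_typing X Y)+
  show ?thesis
  proof
    fix p assume p: "p \<in> obs (fib A X \<times>\<^sub>C fib A Y)"
    obtain s t where [simp]: "p = (s, t)" by (cases p)
    have o: "s \<in> obs (fib A X)" "t \<in> obs (fib A Y)" using p by auto
    show "lax_brd A X Y p \<in> hom (fib A (Y \<otimes> X)) (fob (act A (brd W X Y) \<circ>\<^sub>F lax A X Y) p) (fob (lax A Y X \<circ>\<^sub>F fct_swap) p)"
      using lax_brd_hom[OF X Y o] by simp
    show "is_iso (fib A (Y \<otimes> X)) (lax_brd A X Y p)" using lax_brd_is_iso[OF X Y o] by simp
  next
    fix h p q assume h: "h \<in> hom (fib A X \<times>\<^sub>C fib A Y) p q"
    obtain s t s' t' f g where [simp]: "p = (s, t)" "q = (s', t')" "h = (f, g)" by (cases p, cases q, cases h)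
    have f: "f \<in> hom (fib A X) s s'" and g: "g \<in> hom (fib A Y) t t'" using h by (auto simp: hom_prod_cat)
    note ls = sep_leaf[OF X fib_hom_obs[OF X f, THEN conjunct2], of 0]
    note lt = sep_leaf[OF Y fib_hom_obs[OF Y g, THEN conjunct2], of 1]
    note m = mor_arr[OF X f sep_rooted[OF ls]] mor_arr[OF Y g sep_rooted[OF lt]]
    note r = m(1)[unfolded mor_def, THEN conjunct1] m(2)[unfolded mor_def, THEN conjunct1]
      sep_rooted[OF ls] sep_rooted[OF lt]
    show "cmp (fib A (Y \<otimes> X)) (far (lax A Y X \<circ>\<^sub>F fct_swap) h) (lax_brd A X Y p)
        = cmp (fib A (Y \<otimes> X)) (lax_brd A X Y q) (far (act A (brd W X Y) \<circ>\<^sub>F lax A X Y) h)"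
      apply simp
      apply (rule mor_unique)
        apply (rule mor_rules X Y m r)+
         apply simp
        apply (rule mor_rules X Y m r)+
       apply simp
      apply (rule sep_rules X Y ls lt)+
      apply auto
      done
  qed
qed

text \<open>Each coherence axiom lies over one law of \<open>W\<close>: interchange, naturality,
  pentagon, triangle, hexagon or symmetry identifies the wiring diagrams that occur on the two
  sides. What remains is uniqueness of arrows that respect roots, with one leaf and one label for
  each span variable.\<close>

lemma sym_lax_monoidal: "sym_lax_monoidal W A"
proof (intro sym_lax_monoidal.intro sym_lax_monoidal_axioms.intro pseudofunctor symmetric_monoidal_category_axioms,
    goal_cases)
  case (1 X Y)
  then show ?case by (rule lax_functor)
next
  case 2
  show ?case by (rule unt_ob)
next
  case (3 \<phi> X X' \<psi> Y Y')
  then show ?case by (rule lax_nat_nat_iso)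
next
  case (4 \<phi> X X' \<phi>' X'' \<psi> Y Y' \<psi>' Y'' s t K)
  note h = 4(1-4) and o = hom_W_obs(1)[OF 4(1)] hom_W_obs(1)[OF 4(3)]
  note l = sep_leaf[OF o(1) 4(5), of 0] sep_leaf[OF o(2) 4(6), of 1]
  note r = sep_rooted[OF l(1)] sep_rooted[OF l(2)]
  show ?case unfolding 4(7)
    \<comment> \<open>The first cell ends at the action along a composite of two tensors, while
      \<open>lax_nat\<close> starts at a tensor of two composites; the interchange law makes the two
      cells composable.\<close>
    apply (rule mor_unique[OF mor_cmp[OF mor_act_cmp[OF ten_ar_hom[OF h(1,3)] ten_ar_hom[OF h(2,4)]
            rooted_mu[OF r], folded ten_ar_cmp[OF h]] mor_lax_nat[OF cmp_hom[OF h(1,2)] cmp_hom[OF h(3,4)] r]]])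
     apply (rule mor_rules h r)+
    apply (rule sep_rules h l)+
    apply auto
    done
next
  case (5 X Y s t)
  note o = 5(1,2)
  note l = sep_leaf[OF o(1) 5(3), of 0] sep_leaf[OF o(2) 5(4), of 1]
  note r = sep_rooted[OF l(1)] sep_rooted[OF l(2)]
  show ?case
    apply (rule mor_unique')
       apply (rule mor_rules o r)+
     apply (rule ten_ar_idn[OF o])
    apply (rule sep_rules o l)+
    apply auto
    done
next
  case (6 X Y Z)
  then show ?case by (rule lax_asc_nat_iso)
next
  case (7 \<phi> X X' \<psi> Y Y' \<chi> Z Z' s t u K)
  note h = 7(1-3)
  note o = hom_W_obs(1)[OF h(1)] hom_W_obs(1)[OF h(2)] hom_W_obs(1)[OF h(3)]
    hom_W_obs(2)[OF h(1)] hom_W_obs(2)[OF h(2)] hom_W_obs(2)[OF h(3)]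
  note l = sep_leaf[OF o(1) 7(4), of 0] sep_leaf[OF o(2) 7(5), of 1] sep_leaf[OF o(3) 7(6), of 2]
  note r = sep_rooted[OF l(1)] sep_rooted[OF l(2)] sep_rooted[OF l(3)]
  show ?case unfolding 7(7)
    apply (rule mor_unique')
       apply (rule mor_rules h o r)+
     apply (rule asc_natural[OF h])
    apply (rule sep_rules h o l)+
    apply auto
    done
next
  case (8 X)
  then show ?case by (rule lax_lun_nat_iso)
next
  case (9 \<phi> X Y s I K)
  note h = 9(1) and o = hom_W_obs(1)[OF 9(1)] hom_W_obs(2)[OF 9(1)]
  note l = sep_leaf[OF o(1) 9(2), of 0]
  note r = sep_rooted[OF l]
  show ?case unfolding 9(3,4)
    apply (rule mor_unique')
       apply (rule mor_rules h o r)+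
     apply (rule lun_natural[OF h])
    apply (rule sep_rules h o l)+
    done
next
  case (10 X)
  then show ?case by (rule lax_run_nat_iso)
next
  case (11 \<phi> X Y s I K)
  note h = 11(1) and o = hom_W_obs(1)[OF 11(1)] hom_W_obs(2)[OF 11(1)]
  note l = sep_leaf[OF o(1) 11(2), of 0]
  note r = sep_rooted[OF l]
  show ?case unfolding 11(3,4)
    apply (rule mor_unique')
       apply (rule mor_rules h o r)+
     apply (rule run_natural[OF h])
    apply (rule sep_rules h o l)+
    done
next
  case (12 X Y)
  then show ?case by (rule lax_brd_nat_iso)
next
  case (13 \<phi> X X' \<psi> Y Y' s t K)
  note h = 13(1,2)
  note o = hom_W_obs(1)[OF h(1)] hom_W_obs(1)[OF h(2)] hom_W_obs(2)[OF h(1)] hom_W_obs(2)[OF h(2)]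
  note l = sep_leaf[OF o(1) 13(3), of 0] sep_leaf[OF o(2) 13(4), of 1]
  note r = sep_rooted[OF l(1)] sep_rooted[OF l(2)]
  show ?case unfolding 13(5)
    apply (rule mor_unique')
       \<comment> \<open>The rule for the braiding leaves a disjointness condition on labels amid
         the typing goals; it has to be solved on the spot before resolution can continue.\<close>
       apply (rule mor_rules h o r | (simp; fail))+
     apply (rule brd_natural[OF h])
    apply (rule sep_rules h o l)+
    apply auto
    done
next
  case (14 X Y Z V s t u v K m a b c)
  note o = 14(1-4)
  note l = sep_leaf[OF o(1) 14(5), of 0] sep_leaf[OF o(2) 14(6), of 1] sep_leaf[OF o(3) 14(7), of 2]
    sep_leaf[OF o(4) 14(8), of 3]
  note r = sep_rooted[OF l(1)] sep_rooted[OF l(2)] sep_rooted[OF l(3)] sep_rooted[OF l(4)]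
  show ?case unfolding 14(9-13)
    apply (rule mor_unique')
       apply (rule mor_rules o r)+
     apply (rule pentagon[OF o])
    apply (rule sep_rules o l)+
    apply auto
    done
next
  case (15 X Y s t I K m)
  note o = 15(1,2)
  note l = sep_leaf[OF o(1) 15(3), of 0] sep_leaf[OF o(2) 15(4), of 1]
  note r = sep_rooted[OF l(1)] sep_rooted[OF l(2)]
  show ?case unfolding 15(5-7)
    apply (rule mor_unique')
       apply (rule mor_rules o r)+
     apply (rule triangle[OF o])
    apply (rule sep_rules o l)+
    apply auto
    done
next
  case (16 X Y Z s t u K m a b c a' b' c')
  note o = 16(1-3)
  note l = sep_leaf[OF o(1) 16(4), of 0] sep_leaf[OF o(2) 16(5), of 1] sep_leaf[OF o(3) 16(6), of 2]
  note r = sep_rooted[OF l(1)] sep_rooted[OF l(2)] sep_rooted[OF l(3)]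
  show ?case unfolding 16(7-14)
    apply (rule mor_unique')
       apply (rule mor_rules o r | (simp; fail))+
     apply (rule hexagon[OF o])
    apply (rule sep_rules o l)+
    apply auto
    done
next
  case (17 X Y s t K)
  note o = 17(1,2)
  note l = sep_leaf[OF o(1) 17(3), of 0] sep_leaf[OF o(2) 17(4), of 1]
  note r = sep_rooted[OF l(1)] sep_rooted[OF l(2)]
  \<comment> \<open>By symmetry the composite of the two braidings is the identity diagram, so that
    \<open>act_idn\<close> can follow this cell.\<close>
  note c = mor_act_cmp[OF brd_hom[OF o] brd_hom[OF o(2,1)] rooted_mu[OF r], unfolded symmetry[OF o]]
  show ?case unfolding 17(5)
    apply (rule mor_unique[OF _ mor_cmp[OF c mor_act_idn[OF rooted_mu[OF r]]]])
     apply (rule mor_rules o r | (simp; fail))+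
    apply (rule sep_rules o l)+
    apply auto
    done
qed

end

section \<open>Wiring diagrams\<close>

lemma Wiring_simps [simp]:
  "obs (Wiring C) = {X. is_box C X}" "arrs (Wiring C) = {\<phi>. is_wd C \<phi>}"
  "src (Wiring C) = wsrc" "tgt (Wiring C) = wtgt" "idn (Wiring C) = wd_id" "cmp (Wiring C) = wd_comp"
  "ten (Wiring C) = box_sum" "ten_ar (Wiring C) = wd_sum" "unt (Wiring C) = box_empty"
  "asc (Wiring C) X Y Z = relabel (box_sum (box_sum X Y) Z) (box_sum X (box_sum Y Z)) assocR assocL"
  "lun (Wiring C) X = relabel (box_sum box_empty X) X (port_case undefined id) InR"
  "run (Wiring C) X = relabel (box_sum X box_empty) X (port_case id undefined) InL"
  "brd (Wiring C) X Y = relabel (box_sum X Y) (box_sum Y X) swap_port swap_port"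
  by (simp_all add: Wiring_def)

lemma hom_Wiring: "\<phi> \<in> hom (Wiring C) X Y \<longleftrightarrow> is_wd C \<phi> \<and> wsrc \<phi> = X \<and> wtgt \<phi> = Y"
  by (simp add: hom_iff)

lemma is_wd_boxes: "is_wd C \<phi> \<Longrightarrow> is_box C (wsrc \<phi>)" "is_wd C \<phi> \<Longrightarrow> is_box C (wtgt \<phi>)"
  by (auto simp: is_wd_def)

lemma win_type:
  "is_wd C \<phi> \<Longrightarrow> inp (wsrc \<phi>) x = Some a \<Longrightarrow> case_sum (outp (wsrc \<phi>)) (inp (wtgt \<phi>)) (win \<phi> x) = Some a"
  unfolding is_wd_def by (metis domI)

lemma win_Inl: "is_wd C \<phi> \<Longrightarrow> inp (wsrc \<phi>) x = Some a \<Longrightarrow> win \<phi> x = Inl y \<Longrightarrow> outp (wsrc \<phi>) y = Some a"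
  using win_type by fastforce

lemma win_Inr: "is_wd C \<phi> \<Longrightarrow> inp (wsrc \<phi>) x = Some a \<Longrightarrow> win \<phi> x = Inr y \<Longrightarrow> inp (wtgt \<phi>) y = Some a"
  using win_type by fastforce

lemma wout_type: "is_wd C \<phi> \<Longrightarrow> outp (wtgt \<phi>) y = Some a \<Longrightarrow> outp (wsrc \<phi>) (wout \<phi> y) = Some a"
  unfolding is_wd_def by (metis domI)

text \<open>Away from the typed ports both maps are \<open>undefined\<close> by extensionality, so
  equality may be tested on typed ports alone.\<close>

lemma wd_eqI:
  assumes "is_wd C \<phi>" "is_wd C \<psi>" "wsrc \<phi> = wsrc \<psi>" "wtgt \<phi> = wtgt \<psi>"
    and "\<And>x a. inp (wsrc \<psi>) x = Some a \<Longrightarrow> win \<phi> x = win \<psi> x"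
    and "\<And>y a. outp (wtgt \<psi>) y = Some a \<Longrightarrow> wout \<phi> y = wout \<psi> y"
  shows "\<phi> = \<psi>"
proof -
  have "win \<phi> = win \<psi>" "wout \<phi> = wout \<psi>"
    using assms by (auto simp: is_wd_def intro!: extensionalityI[of _ "dom _"])
  then show ?thesis using assms by (intro wd.equality) auto
qed

lemma box_simps [simp]:
  "inp (box_sum X Y) = tsum (inp X) (inp Y)" "outp (box_sum X Y) = tsum (outp X) (outp Y)"
  "inp box_empty = Map.empty" "outp box_empty = Map.empty"
  by (auto simp: box_sum_def box_empty_def)

lemma tsum_Some: "tsum S T x = Some a \<longleftrightarrow> (\<exists>y. x = InL y \<and> S y = Some a) \<or> (\<exists>y. x = InR y \<and> T y = Some a)"
  by (cases x) auto

lemma is_tset_tsum: "is_tset C S \<Longrightarrow> is_tset C T \<Longrightarrow> is_tset C (tsum S T)"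
  unfolding is_tset_def dom_tsum by (auto simp: ran_def tsum_Some)

lemma is_box_sum: "is_box C X \<Longrightarrow> is_box C Y \<Longrightarrow> is_box C (box_sum X Y)"
  by (auto simp: is_box_def is_tset_tsum)

lemma is_box_empty: "is_box C box_empty"
  by (auto simp: is_box_def is_tset_def)

lemma relabel_simps [simp]:
  "wsrc (relabel X Y f g) = X" "wtgt (relabel X Y f g) = Y"
  "inp X x = Some a \<Longrightarrow> win (relabel X Y f g) x = Inr (f x)"
  "outp Y y = Some b \<Longrightarrow> wout (relabel X Y f g) y = g y"
  by (auto simp: relabel_def)

lemma is_wd_relabel:
  assumes "is_box C X" "is_box C Y"
    and "\<And>x a. inp X x = Some a \<Longrightarrow> inp Y (f x) = Some a" "\<And>y a. outp Y y = Some a \<Longrightarrow> outp X (g y) = Some a"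
  shows "is_wd C (relabel X Y f g)"
  using assms by (auto simp: is_wd_def relabel_def)

lemma wd_id_simps [simp]:
  "wsrc (wd_id X) = X" "wtgt (wd_id X) = X"
  "inp X x = Some a \<Longrightarrow> win (wd_id X) x = Inr x" "outp X y = Some b \<Longrightarrow> wout (wd_id X) y = y"
  by (auto simp: wd_id_def)

lemma is_wd_id: "is_box C X \<Longrightarrow> is_wd C (wd_id X)"
  unfolding wd_id_def by (rule is_wd_relabel) auto

lemma wd_comp_simps [simp]:
  "wsrc (wd_comp \<psi> \<phi>) = wsrc \<phi>" "wtgt (wd_comp \<psi> \<phi>) = wtgt \<psi>"
  "inp (wsrc \<phi>) x = Some a \<Longrightarrow> win (wd_comp \<psi> \<phi>) x = (case win \<phi> x of Inl x' \<Rightarrow> Inl x'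
     | Inr y \<Rightarrow> (case win \<psi> y of Inl y' \<Rightarrow> Inl (wout \<phi> y') | Inr z \<Rightarrow> Inr z))"
  "outp (wtgt \<psi>) y = Some b \<Longrightarrow> wout (wd_comp \<psi> \<phi>) y = wout \<phi> (wout \<psi> y)"
  by (auto simp: wd_comp_def)

lemma is_wd_comp:
  assumes "is_wd C \<phi>" "is_wd C \<psi>" "wtgt \<phi> = wsrc \<psi>"
  shows "is_wd C (wd_comp \<psi> \<phi>)"
  unfolding is_wd_def
proof (intro conjI ballI)
  fix x assume "x \<in> dom (inp (wsrc (wd_comp \<psi> \<phi>)))"
  then obtain a where a: "inp (wsrc \<phi>) x = Some a" by auto
  show "case_sum (outp (wsrc (wd_comp \<psi> \<phi>))) (inp (wtgt (wd_comp \<psi> \<phi>))) (win (wd_comp \<psi> \<phi>) x) = inp (wsrc (wd_comp \<psi> \<phi>)) x"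
    using assms a win_Inl[OF assms(1) a] win_Inr[OF assms(1) a] win_Inl[OF assms(2)] win_Inr[OF assms(2)]
      wout_type[OF assms(1)]
    by (auto split: sum.splits)
next
  fix y assume "y \<in> dom (outp (wtgt (wd_comp \<psi> \<phi>)))"
  then show "outp (wsrc (wd_comp \<psi> \<phi>)) (wout (wd_comp \<psi> \<phi>) y) = outp (wtgt (wd_comp \<psi> \<phi>)) y"
    using assms wout_type[OF assms(2)] wout_type[OF assms(1)] by auto
qed (use assms in \<open>auto simp: is_wd_boxes wd_comp_def\<close>)

lemma wd_sum_simps [simp]:
  "wsrc (wd_sum \<phi> \<psi>) = box_sum (wsrc \<phi>) (wsrc \<psi>)" "wtgt (wd_sum \<phi> \<psi>) = box_sum (wtgt \<phi>) (wtgt \<psi>)"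
  "inp (wsrc \<phi>) x = Some a \<Longrightarrow> win (wd_sum \<phi> \<psi>) (InL x) = map_sum InL InL (win \<phi> x)"
  "inp (wsrc \<psi>) y = Some b \<Longrightarrow> win (wd_sum \<phi> \<psi>) (InR y) = map_sum InR InR (win \<psi> y)"
  "outp (wtgt \<phi>) z = Some c \<Longrightarrow> wout (wd_sum \<phi> \<psi>) (InL z) = InL (wout \<phi> z)"
  "outp (wtgt \<psi>) w = Some d \<Longrightarrow> wout (wd_sum \<phi> \<psi>) (InR w) = InR (wout \<psi> w)"
  by (auto simp: wd_sum_def dom_tsum)

lemma is_wd_sum:
  assumes "is_wd C \<phi>" "is_wd C \<psi>"
  shows "is_wd C (wd_sum \<phi> \<psi>)"
  unfolding is_wd_def
proof (intro conjI ballI)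
  fix x assume "x \<in> dom (inp (wsrc (wd_sum \<phi> \<psi>)))"
  then consider a y where "x = InL y" "inp (wsrc \<phi>) y = Some a" | a y where "x = InR y" "inp (wsrc \<psi>) y = Some a"
    by (auto simp: dom_tsum)
  then show "case_sum (outp (wsrc (wd_sum \<phi> \<psi>))) (inp (wtgt (wd_sum \<phi> \<psi>))) (win (wd_sum \<phi> \<psi>) x) = inp (wsrc (wd_sum \<phi> \<psi>)) x"
  proof cases
    case 1
    then show ?thesis using win_type[OF assms(1) 1(2)] by (cases "win \<phi> y") auto
  next
    case 2
    then show ?thesis using win_type[OF assms(2) 2(2)] by (cases "win \<psi> y") auto
  qed
next
  fix y assume "y \<in> dom (outp (wtgt (wd_sum \<phi> \<psi>)))"
  then show "outp (wsrc (wd_sum \<phi> \<psi>)) (wout (wd_sum \<phi> \<psi>) y) = outp (wtgt (wd_sum \<phi> \<psi>)) y"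
    using wout_type[OF assms(1)] wout_type[OF assms(2)] by (auto simp: dom_tsum)
qed (use assms in \<open>auto simp: is_wd_boxes is_box_sum wd_sum_def\<close>)

lemma port_simps [simp]:
  "assocR (InL (InL x)) = InL x" "assocR (InL (InR y)) = InR (InL y)" "assocR (InR z) = InR (InR z)"
  "assocL (InL x) = InL (InL x)" "assocL (InR (InL y)) = InL (InR y)" "assocL (InR (InR z)) = InR z"
  "swap_port (InL x) = InR x" "swap_port (InR x) = InL x"
  by (auto simp: assocR_def assocL_def swap_port_def)

lemma relabel_typing:
  "is_box C X \<Longrightarrow> is_box C Y \<Longrightarrow> is_box C Z \<Longrightarrow>
    is_wd C (relabel (box_sum (box_sum X Y) Z) (box_sum X (box_sum Y Z)) assocR assocL)"
  "is_box C X \<Longrightarrow> is_box C Y \<Longrightarrow> is_box C Z \<Longrightarrow>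
    is_wd C (relabel (box_sum X (box_sum Y Z)) (box_sum (box_sum X Y) Z) assocL assocR)"
  "is_box C X \<Longrightarrow> is_wd C (relabel (box_sum box_empty X) X (port_case undefined id) InR)"
  "is_box C X \<Longrightarrow> is_wd C (relabel X (box_sum box_empty X) InR (port_case undefined id))"
  "is_box C X \<Longrightarrow> is_wd C (relabel (box_sum X box_empty) X (port_case id undefined) InL)"
  "is_box C X \<Longrightarrow> is_wd C (relabel X (box_sum X box_empty) InL (port_case id undefined))"
  "is_box C X \<Longrightarrow> is_box C Y \<Longrightarrow> is_wd C (relabel (box_sum X Y) (box_sum Y X) swap_port swap_port)"
  by (rule is_wd_relabel; auto simp: is_box_sum is_box_empty tsum_Some)+

lemmas wd_typing = relabel_typing is_wd_id is_wd_comp is_wd_sum is_box_sum is_box_empty is_wd_boxes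

section \<open>The symmetric monoidal category of wiring diagrams\<close>

lemma Wiring_category: "category (Wiring C :: (('l, 'o) box, ('l, 'o) wd) smc)"
proof
  fix f g h :: "('l, 'o) wd" and X Y Z V :: "('l, 'o) box"
  show "f \<in> arrs (Wiring C) \<Longrightarrow> src (Wiring C) f \<in> obs (Wiring C)"
    "f \<in> arrs (Wiring C) \<Longrightarrow> tgt (Wiring C) f \<in> obs (Wiring C)"
    by (simp_all add: is_wd_boxes)
  show "X \<in> obs (Wiring C) \<Longrightarrow> idn (Wiring C) X \<in> hom (Wiring C) X X"
    by (simp add: hom_Wiring is_wd_id)
  assume f: "f \<in> hom (Wiring C) X Y"
  have fw: "is_wd C f" and [simp]: "X = wsrc f" "Y = wtgt f" using f by (auto simp: hom_Wiring)
  show "cmp (Wiring C) (idn (Wiring C) Y) f = f" "cmp (Wiring C) f (idn (Wiring C) X) = f"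
    using win_Inr[OF fw] wout_type[OF fw] win_Inl[OF fw]
    by (auto intro!: wd_eqI[of C] simp: wd_typing fw split: sum.splits)
  assume g: "g \<in> hom (Wiring C) Y Z"
  have gw: "is_wd C g" and [simp]: "wsrc g = wtgt f" "Z = wtgt g" using g by (auto simp: hom_Wiring)
  show "cmp (Wiring C) g f \<in> hom (Wiring C) X Z"
    using fw gw by (simp add: hom_Wiring is_wd_comp)
  assume h: "h \<in> hom (Wiring C) Z V"
  have hw: "is_wd C h" and [simp]: "wsrc h = wtgt g" "V = wtgt h" using h by (auto simp: hom_Wiring)
  show "cmp (Wiring C) (cmp (Wiring C) h g) f = cmp (Wiring C) h (cmp (Wiring C) g f)"
    unfolding Wiring_simps
  proof (rule wd_eqI[of C])
    fix x a assume "inp (wsrc (wd_comp h (wd_comp g f))) x = Some a"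
    then have x: "inp (wsrc f) x = Some a" by simp
    show "win (wd_comp (wd_comp h g) f) x = win (wd_comp h (wd_comp g f)) x"
    \<comment> \<open>A wire is followed outward, and only one that leaves through both
      \<open>f\<close> and \<open>g\<close> reaches \<open>h\<close>. If \<open>h\<close> feeds it
      back, typing shows that the port is an output of the target of \<open>g\<close>, where
      \<open>wout\<close> of the composite may be evaluated.\<close>
    proof (cases "win f x")
      case (Inr y)
      note y = win_Inr[OF fw x Inr]
      show ?thesis
      proof (cases "win g y")
        case (Inr z)
        with win_Inr[OF gw _ Inr] y have "inp (wsrc h) z = Some a" by simp
        then show ?thesis using x y \<open>win f x = _\<close> Inr win_Inl[OF hw] by (auto split: sum.splits)
      qed (use x y Inr in simp)
    qed (use x in simp)
  next
    fix y a assume "outp (wtgt (wd_comp h (wd_comp g f))) y = Some a"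
    then show "wout (wd_comp (wd_comp h g) f) y = wout (wd_comp h (wd_comp g f)) y"
      using wout_type[OF hw] by simp
  qed (use fw gw hw in \<open>auto simp: wd_typing\<close>)
qed

text \<open>The interchange law. No wire of a sum crosses from one summand to the other, so each
  port is traced within its own half.\<close>

lemma wd_sum_comp:
  assumes w: "is_wd C f" "is_wd C f'" "is_wd C g" "is_wd C g'"
    and e: "wtgt f = wsrc g" "wtgt f' = wsrc g'"
  shows "wd_sum (wd_comp g f) (wd_comp g' f') = wd_comp (wd_sum g g') (wd_sum f f')"
proof (rule wd_eqI[of C])
  fix x a assume "inp (wsrc (wd_comp (wd_sum g g') (wd_sum f f'))) x = Some a"
  then consider y where "x = InL y" "inp (wsrc f) y = Some a" | y where "x = InR y" "inp (wsrc f') y = Some a"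
    by (auto simp: tsum_Some)
  then show "win (wd_sum (wd_comp g f) (wd_comp g' f')) x = win (wd_comp (wd_sum g g') (wd_sum f f')) x"
  proof cases
    case 1
    then show ?thesis using e win_Inr[OF w(1) 1(2)] win_Inl[OF w(3)] by (auto split: sum.splits)
  next
    case 2
    then show ?thesis using e win_Inr[OF w(2) 2(2)] win_Inl[OF w(4)] by (auto split: sum.splits)
  qed
next
  fix y a assume "outp (wtgt (wd_comp (wd_sum g g') (wd_sum f f'))) y = Some a"
  then show "wout (wd_sum (wd_comp g f) (wd_comp g' f')) y = wout (wd_comp (wd_sum g g') (wd_sum f f')) y"
    using e wout_type[OF w(3)] wout_type[OF w(4)] by (auto simp: tsum_Some)
qed (use w e in \<open>auto simp: wd_typing\<close>)

lemma wd_sum_id: "is_box C X \<Longrightarrow> is_box C Y \<Longrightarrow> wd_sum (wd_id X) (wd_id Y) = wd_id (box_sum X Y)"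
  by (intro wd_eqI[of C]) (auto simp: wd_typing tsum_Some)

lemma Wiring_ten_functor: "cat_functor (Wiring C \<times>\<^sub>C Wiring C) (Wiring C) (ten_fct (Wiring C))"
proof -
  interpret W: category "Wiring C" by (rule Wiring_category)
  interpret WW: category "Wiring C \<times>\<^sub>C Wiring C" by (rule prod_category) (rule Wiring_category)+
  show ?thesis
    by unfold_locales (auto simp: hom_prod_cat hom_Wiring wd_typing wd_sum_id wd_sum_comp)
qed

lemma relabel_comp:
  assumes "\<And>x a. inp X x = Some a \<Longrightarrow> inp Y (f x) = Some a" "\<And>y a. outp Z y = Some a \<Longrightarrow> outp Y (g' y) = Some a"
    "\<And>x a. inp X x = Some a \<Longrightarrow> f' (f x) = h x" "\<And>y a. outp Z y = Some a \<Longrightarrow> g (g' y) = k y"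
  shows "wd_comp (relabel Y Z f' g') (relabel X Y f g) = relabel X Z h k"
proof (rule wd.equality)
  show "win (wd_comp (relabel Y Z f' g') (relabel X Y f g)) = win (relabel X Z h k)"
    using assms by (fastforce simp: wd_comp_def relabel_def restrict_def fun_eq_iff)
  show "wout (wd_comp (relabel Y Z f' g') (relabel X Y f g)) = wout (relabel X Z h k)"
    using assms by (fastforce simp: wd_comp_def relabel_def restrict_def fun_eq_iff)
qed auto

text \<open>All coherence isomorphisms of \<open>Wiring\<close> are relabelings along bijections of
  typed ports; the inverse bijections give the inverse diagram. Inputs and outputs travel in
  opposite directions, hence the four functions.\<close>

lemma relabel_iso:
  assumes X: "is_box C X" and Y: "is_box C Y"
    and f: "\<And>x a. inp X x = Some a \<Longrightarrow> inp Y (f x) = Some a \<and> f' (f x) = x"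
    and g: "\<And>y a. outp Y y = Some a \<Longrightarrow> outp X (g y) = Some a \<and> g' (g y) = y"
    and f': "\<And>x a. inp Y x = Some a \<Longrightarrow> inp X (f' x) = Some a \<and> f (f' x) = x"
    and g': "\<And>y a. outp X y = Some a \<Longrightarrow> outp Y (g' y) = Some a \<and> g (g' y) = y"
  shows "is_iso (Wiring C) (relabel X Y f g)"
proof -
  interpret W: category "Wiring C" by (rule Wiring_category)
  show ?thesis
  proof (rule W.is_isoI[of _ X Y "relabel Y X f' g'"])
    show "relabel X Y f g \<in> hom (Wiring C) X Y"
      unfolding hom_Wiring using f g by (auto intro!: is_wd_relabel X Y)
    show "relabel Y X f' g' \<in> hom (Wiring C) Y X"
      unfolding hom_Wiring using f' g' by (auto intro!: is_wd_relabel X Y)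
    show "cmp (Wiring C) (relabel Y X f' g') (relabel X Y f g) = idn (Wiring C) X"
      unfolding Wiring_simps wd_id_def using f g' by (intro relabel_comp) auto
    show "cmp (Wiring C) (relabel X Y f g) (relabel Y X f' g') = idn (Wiring C) Y"
      unfolding Wiring_simps wd_id_def using f' g by (intro relabel_comp) auto
  qed
qed

text \<open>This and the three lemmas after it are the naturality squares of the associator, the two
  unitors and the braiding. Each follows a port through the relabeling on either side of the
  diagram.\<close>

lemma wd_sum_assoc:
  assumes w: "is_wd C f" "is_wd C g" "is_wd C h"
  shows "wd_comp (wd_sum f (wd_sum g h))
      (relabel (box_sum (box_sum (wsrc f) (wsrc g)) (wsrc h)) (box_sum (wsrc f) (box_sum (wsrc g) (wsrc h))) assocR assocL)
    = wd_comp (relabel (box_sum (box_sum (wtgt f) (wtgt g)) (wtgt h)) (box_sum (wtgt f) (box_sum (wtgt g) (wtgt h))) assocR assocL)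
      (wd_sum (wd_sum f g) h)" (is "?l = ?r")
proof (rule wd_eqI[of C])
  fix x a assume "inp (wsrc ?r) x = Some a"
  then consider y where "x = InL (InL y)" "inp (wsrc f) y = Some a" | y where "x = InL (InR y)" "inp (wsrc g) y = Some a"
    | y where "x = InR y" "inp (wsrc h) y = Some a"
    by (auto simp: tsum_Some)
  then show "win ?l x = win ?r x"
  proof cases
    case 1
    then show ?thesis using win_type[OF w(1) 1(2)] by (cases "win f y") auto
  next
    case 2
    then show ?thesis using win_type[OF w(2) 2(2)] by (cases "win g y") auto
  next
    case 3
    then show ?thesis using win_type[OF w(3) 3(2)] by (cases "win h y") auto
  qed
next
  fix y a assume "outp (wtgt ?r) y = Some a"
  then show "wout ?l y = wout ?r y"
    using wout_type[OF w(1)] wout_type[OF w(2)] wout_type[OF w(3)] by (auto simp: tsum_Some)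
qed (use w in \<open>auto simp: wd_typing\<close>)

lemma wd_sum_lunit:
  assumes w: "is_wd C f"
  shows "wd_comp f (relabel (box_sum box_empty (wsrc f)) (wsrc f) (port_case undefined id) InR)
    = wd_comp (relabel (box_sum box_empty (wtgt f)) (wtgt f) (port_case undefined id) InR) (wd_sum (wd_id box_empty) f)"
    (is "?l = ?r")
proof (rule wd_eqI[of C])
  fix x a assume "inp (wsrc ?r) x = Some a"
  then obtain y where y: "x = InR y" "inp (wsrc f) y = Some a" by (auto simp: tsum_Some)
  then show "win ?l x = win ?r x" using win_type[OF w y(2)] by (cases "win f y") auto
next
  fix y a assume "outp (wtgt ?r) y = Some a"
  then show "wout ?l y = wout ?r y" using wout_type[OF w] by auto
qed (use w in \<open>auto simp: wd_typing\<close>)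

lemma wd_sum_runit:
  assumes w: "is_wd C f"
  shows "wd_comp f (relabel (box_sum (wsrc f) box_empty) (wsrc f) (port_case id undefined) InL)
    = wd_comp (relabel (box_sum (wtgt f) box_empty) (wtgt f) (port_case id undefined) InL) (wd_sum f (wd_id box_empty))"
    (is "?l = ?r")
proof (rule wd_eqI[of C])
  fix x a assume "inp (wsrc ?r) x = Some a"
  then obtain y where y: "x = InL y" "inp (wsrc f) y = Some a" by (auto simp: tsum_Some)
  then show "win ?l x = win ?r x" using win_type[OF w y(2)] by (cases "win f y") auto
next
  fix y a assume "outp (wtgt ?r) y = Some a"
  then show "wout ?l y = wout ?r y" using wout_type[OF w] by auto
qed (use w in \<open>auto simp: wd_typing\<close>)

lemma wd_sum_swap:
  assumes w: "is_wd C f" "is_wd C g"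
  shows "wd_comp (wd_sum g f) (relabel (box_sum (wsrc f) (wsrc g)) (box_sum (wsrc g) (wsrc f)) swap_port swap_port)
    = wd_comp (relabel (box_sum (wtgt f) (wtgt g)) (box_sum (wtgt g) (wtgt f)) swap_port swap_port) (wd_sum f g)"
    (is "?l = ?r")
proof (rule wd_eqI[of C])
  fix x a assume "inp (wsrc ?r) x = Some a"
  then consider y where "x = InL y" "inp (wsrc f) y = Some a" | y where "x = InR y" "inp (wsrc g) y = Some a"
    by (auto simp: tsum_Some)
  then show "win ?l x = win ?r x"
  proof cases
    case 1
    then show ?thesis using win_type[OF w(1) 1(2)] by (cases "win f y") auto
  next
    case 2
    then show ?thesis using win_type[OF w(2) 2(2)] by (cases "win g y") auto
  qed
next
  fix y a assume "outp (wtgt ?r) y = Some a"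
  then show "wout ?l y = wout ?r y"
    using wout_type[OF w(1)] wout_type[OF w(2)] by (auto simp: tsum_Some)
qed (use w in \<open>auto simp: wd_typing\<close>)

lemma Wiring_asc_iso:
  "nat_iso (Wiring C \<times>\<^sub>C Wiring C \<times>\<^sub>C Wiring C) (Wiring C) (ten_fct (Wiring C) \<circ>\<^sub>F (ten_fct (Wiring C) \<times>\<^sub>F fct_id))
     (ten_fct (Wiring C) \<circ>\<^sub>F (fct_id \<times>\<^sub>F ten_fct (Wiring C)) \<circ>\<^sub>F fct_assoc) (\<lambda>((X, Y), Z). asc (Wiring C) X Y Z)"
  (is "nat_iso ?D ?W ?F ?G ?\<eta>")
proof (intro nat_iso.intro nat_iso_axioms.intro)
  show "cat_functor ?D ?W ?F" "cat_functor ?D ?W ?G"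
    by (rule fct_comp_functor fct_assoc_functor fct_prod_functor fct_id_functor Wiring_ten_functor Wiring_category)+
  fix a assume a: "a \<in> obs ?D"
  obtain X Y Z where [simp]: "a = ((X, Y), Z)" by (metis surj_pair)
  have o: "is_box C X" "is_box C Y" "is_box C Z" using a by auto
  show "?\<eta> a \<in> hom ?W (fob ?F a) (fob ?G a)" using o by (simp add: hom_Wiring wd_typing)
  show "is_iso ?W (?\<eta> a)"
    unfolding \<open>a = _\<close> prod.case Wiring_simps
    by (rule relabel_iso[where f' = assocL and g' = assocR]) (auto simp: tsum_Some o is_box_sum)
next
  fix f p q assume f: "f \<in> hom ?D p q"
  obtain u v w where [simp]: "f = ((u, v), w)" by (metis surj_pair)
  show "cmp ?W (far ?G f) (?\<eta> p) = cmp ?W (?\<eta> q) (far ?F f)"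
    using f wd_sum_assoc[of C u v w] by (cases p; cases "fst p"; cases q; cases "fst q") (simp add: hom_prod_cat hom_Wiring)
qed

lemma Wiring_lun_iso:
  "nat_iso (Wiring C) (Wiring C) (ten_fct (Wiring C) \<circ>\<^sub>F fct_const_left (Wiring C) (unt (Wiring C))) fct_id (lun (Wiring C))"
  (is "nat_iso ?W ?W ?F ?G ?\<eta>")
proof (intro nat_iso.intro nat_iso_axioms.intro)
  have e: "unt ?W \<in> obs ?W" by (simp add: is_box_empty)
  show "cat_functor ?W ?W ?F" "cat_functor ?W ?W ?G"
    by (rule fct_comp_functor fct_const_left_functor fct_id_functor Wiring_ten_functor Wiring_category e)+
  fix X assume a: "X \<in> obs ?W"
  show "?\<eta> X \<in> hom ?W (fob ?F X) (fob ?G X)" using a by (simp add: hom_Wiring wd_typing)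
  show "is_iso ?W (?\<eta> X)" using a unfolding Wiring_simps
    by (intro relabel_iso[where f' = InR and g' = "port_case undefined id"]) (auto simp: tsum_Some is_box_sum is_box_empty)
next
  fix f p q assume "f \<in> hom ?W p q"
  then show "cmp ?W (far ?G f) (?\<eta> p) = cmp ?W (?\<eta> q) (far ?F f)"
    using wd_sum_lunit[of C f] by (auto simp: hom_Wiring)
qed

lemma Wiring_run_iso:
  "nat_iso (Wiring C) (Wiring C) (ten_fct (Wiring C) \<circ>\<^sub>F fct_const_right (Wiring C) (unt (Wiring C))) fct_id (run (Wiring C))"
  (is "nat_iso ?W ?W ?F ?G ?\<eta>")
proof (intro nat_iso.intro nat_iso_axioms.intro)
  have e: "unt ?W \<in> obs ?W" by (simp add: is_box_empty)
  show "cat_functor ?W ?W ?F" "cat_functor ?W ?W ?G"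
    by (rule fct_comp_functor fct_const_right_functor fct_id_functor Wiring_ten_functor Wiring_category e)+
  fix X assume a: "X \<in> obs ?W"
  show "?\<eta> X \<in> hom ?W (fob ?F X) (fob ?G X)" using a by (simp add: hom_Wiring wd_typing)
  show "is_iso ?W (?\<eta> X)" using a unfolding Wiring_simps
    by (intro relabel_iso[where f' = InL and g' = "port_case id undefined"]) (auto simp: tsum_Some is_box_sum is_box_empty)
next
  fix f p q assume "f \<in> hom ?W p q"
  then show "cmp ?W (far ?G f) (?\<eta> p) = cmp ?W (?\<eta> q) (far ?F f)"
    using wd_sum_runit[of C f] by (auto simp: hom_Wiring)
qed

lemma Wiring_brd_iso:
  "nat_iso (Wiring C \<times>\<^sub>C Wiring C) (Wiring C) (ten_fct (Wiring C)) (ten_fct (Wiring C) \<circ>\<^sub>F fct_swap)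
     (\<lambda>(X, Y). brd (Wiring C) X Y)"
  (is "nat_iso ?D ?W ?F ?G ?\<eta>")
proof (intro nat_iso.intro nat_iso_axioms.intro)
  show "cat_functor ?D ?W ?F" "cat_functor ?D ?W ?G"
    by (rule fct_comp_functor fct_swap_functor Wiring_ten_functor Wiring_category)+
  fix a assume a: "a \<in> obs ?D"
  obtain X Y where [simp]: "a = (X, Y)" by (metis surj_pair)
  have o: "is_box C X" "is_box C Y" using a by auto
  show "?\<eta> a \<in> hom ?W (fob ?F a) (fob ?G a)" using o by (simp add: hom_Wiring wd_typing)
  show "is_iso ?W (?\<eta> a)"
    unfolding \<open>a = _\<close> prod.case Wiring_simps
    by (rule relabel_iso[where f' = swap_port and g' = swap_port]) (auto simp: tsum_Some o is_box_sum)
next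
  fix f p q assume f: "f \<in> hom ?D p q"
  obtain u v where [simp]: "f = (u, v)" by (metis surj_pair)
  show "cmp ?W (far ?G f) (?\<eta> p) = cmp ?W (?\<eta> q) (far ?F f)"
    using f wd_sum_swap[of C u v] by (cases p; cases q) (simp add: hom_prod_cat hom_Wiring)
qed

text \<open>The diagrams in the remaining axioms are built from relabelings, so after
  \<open>wd_eqI\<close> it suffices to see where each summand of the ports is sent.\<close>

lemma Wiring_symmetric_monoidal:
  "symmetric_monoidal_category (Wiring C :: (('l, 'o) box, ('l, 'o) wd) smc)"
proof (intro symmetric_monoidal_category.intro symmetric_monoidal_category_axioms.intro
    Wiring_category Wiring_ten_functor Wiring_asc_iso Wiring_lun_iso Wiring_run_iso Wiring_brd_iso)
  show "unt (Wiring C) \<in> obs (Wiring C)" by (simp add: is_box_empty)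
  fix X Y Z V :: "('l, 'o) box"
  assume "X \<in> obs (Wiring C)" "Y \<in> obs (Wiring C)"
  then have X: "is_box C X" and Y: "is_box C Y" by auto
  show "cmp (Wiring C) (ten_ar (Wiring C) (idn (Wiring C) X) (lun (Wiring C) Y)) (asc (Wiring C) X (unt (Wiring C)) Y)
      = ten_ar (Wiring C) (run (Wiring C) X) (idn (Wiring C) Y)"
    by (rule wd_eqI[of C]) (auto simp: wd_typing X Y tsum_Some)
  show "cmp (Wiring C) (brd (Wiring C) Y X) (brd (Wiring C) X Y) = idn (Wiring C) (ten (Wiring C) X Y)"
    by (rule wd_eqI[of C]) (auto simp: wd_typing X Y tsum_Some)
  assume "Z \<in> obs (Wiring C)"
  then have Z: "is_box C Z" by auto
  show "cmp (Wiring C) (asc (Wiring C) Y Z X) (cmp (Wiring C) (brd (Wiring C) X (ten (Wiring C) Y Z)) (asc (Wiring C) X Y Z))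
      = cmp (Wiring C) (ten_ar (Wiring C) (idn (Wiring C) Y) (brd (Wiring C) X Z))
          (cmp (Wiring C) (asc (Wiring C) Y X Z) (ten_ar (Wiring C) (brd (Wiring C) X Y) (idn (Wiring C) Z)))"
    by (rule wd_eqI[of C]) (auto simp: wd_typing X Y Z tsum_Some)
  assume "V \<in> obs (Wiring C)"
  then have V: "is_box C V" by auto
  show "cmp (Wiring C) (asc (Wiring C) X Y (ten (Wiring C) Z V)) (asc (Wiring C) (ten (Wiring C) X Y) Z V)
      = cmp (Wiring C) (ten_ar (Wiring C) (idn (Wiring C) X) (asc (Wiring C) Y Z V))
          (cmp (Wiring C) (asc (Wiring C) X (ten (Wiring C) Y Z) V) (ten_ar (Wiring C) (asc (Wiring C) X Y Z) (idn (Wiring C) V)))"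
    by (rule wd_eqI[of C]) (auto simp: wd_typing X Y Z V tsum_Some)
qed

section \<open>Finite limits\<close>

definition is_terminal :: "('o, 'm, 'z) cat_scheme \<Rightarrow> 'o \<Rightarrow> bool" where
  "is_terminal C t \<longleftrightarrow> t \<in> obs C \<and> (\<forall>a\<in>obs C. \<exists>!u. u \<in> hom C a t)"

text \<open>Supplies the base case of the inductions in \<open>ex_product\<close> and
  \<open>pres_product\<close>.\<close>

lemma is_terminal_iff_product: "is_terminal C t \<longleftrightarrow> is_product C Map.empty t \<pi>"
  by (auto simp: is_terminal_def is_product_def)

lemma ex1_unique: "\<exists>!x. P x \<Longrightarrow> P a \<Longrightarrow> P b \<Longrightarrow> a = b"
  by blast

context category
begin

lemma arr_cmp:
  assumes "f \<in> arrs C" "g \<in> arrs C" "tgt C f = src C g"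
  shows "g \<cdot> f \<in> arrs C" "src C (g \<cdot> f) = src C f" "tgt C (g \<cdot> f) = tgt C g"
  using cmp_hom[of f "src C f" "tgt C f" g "tgt C g"] assms by (auto simp: hom_iff)

lemma cmp_assoc':
  "f \<in> arrs C \<Longrightarrow> g \<in> arrs C \<Longrightarrow> h \<in> arrs C \<Longrightarrow> tgt C f = src C g \<Longrightarrow> tgt C g = src C h \<Longrightarrow>
    (h \<cdot> g) \<cdot> f = h \<cdot> (g \<cdot> f)"
  by (rule cmp_assoc) (auto simp: hom_iff)

lemma arr_idn: "a \<in> obs C \<Longrightarrow> idn C a \<in> arrs C" "a \<in> obs C \<Longrightarrow> src C (idn C a) = a" "a \<in> obs C \<Longrightarrow> tgt C (idn C a) = a"
  using idn_hom[of a] by (auto simp: hom_iff)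

lemma idn_cmp: "f \<in> arrs C \<Longrightarrow> tgt C f = b \<Longrightarrow> idn C b \<cdot> f = f"
  by (rule idn_left) (auto simp: hom_iff)

lemma cmp_idn: "f \<in> arrs C \<Longrightarrow> src C f = a \<Longrightarrow> f \<cdot> idn C a = f"
  by (rule idn_right) (auto simp: hom_iff)

lemma is_product_cong:
  "is_product C T P \<pi> \<Longrightarrow> (\<And>i. i \<in> dom T \<Longrightarrow> \<pi> i = \<pi>' i) \<Longrightarrow> is_product C T P \<pi>'"
  unfolding is_product_def by simp

lemma is_productD:
  assumes "is_product C T P \<pi>"
  shows "P \<in> obs C" "\<And>i a. T i = Some a \<Longrightarrow> \<pi> i \<in> hom C P a"
    and "\<And>Q q. Q \<in> obs C \<Longrightarrow> (\<And>i a. T i = Some a \<Longrightarrow> q i \<in> hom C Q a) \<Longrightarrow>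
      \<exists>!u. u \<in> hom C Q P \<and> (\<forall>i\<in>dom T. \<pi> i \<cdot> u = q i)"
proof -
  show "P \<in> obs C" using assms by (simp add: is_product_def)
  show "\<pi> i \<in> hom C P a" if "T i = Some a" for i a
    using assms[unfolded is_product_def, THEN conjunct2, THEN conjunct1, THEN bspec, OF domI[of T, OF that]] that by simp
  fix Q q assume Q: "Q \<in> obs C" and q: "\<And>i a. T i = Some a \<Longrightarrow> q i \<in> hom C Q a"
  have "Q \<in> obs C \<and> (\<forall>i\<in>dom T. q i \<in> hom C Q (the (T i)))" using Q q by auto
  from assms[unfolded is_product_def, THEN conjunct2, THEN conjunct2, THEN spec, THEN spec, THEN mp, OF this]
  show "\<exists>!u. u \<in> hom C Q P \<and> (\<forall>i\<in>dom T. \<pi> i \<cdot> u = q i)" .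
qed

lemma is_product_eqI:
  assumes "is_product C T P \<pi>" "x \<in> hom C Q P" "y \<in> hom C Q P" "\<And>i. i \<in> dom T \<Longrightarrow> \<pi> i \<cdot> x = \<pi> i \<cdot> y"
  shows "x = y"
proof -
  have "\<pi> i \<cdot> y \<in> hom C Q a" if "T i = Some a" for i a
    using cmp_hom[OF assms(3) is_productD(2)[OF assms(1) that]] .
  then have "\<exists>!u. u \<in> hom C Q P \<and> (\<forall>i\<in>dom T. \<pi> i \<cdot> u = \<pi> i \<cdot> y)"
    by (rule is_productD(3)[OF assms(1) hom_src_obs[OF assms(2)]])
  then show ?thesis by (rule ex1_unique) (simp_all add: assms(2-4))
qed

lemma is_pullbackD:
  assumes "is_pullback C f g (P, a, b)"
  shows "P \<in> obs C" "a \<in> hom C P (src C f)" "b \<in> hom C P (src C g)" "f \<cdot> a = g \<cdot> b"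
    and "x \<in> hom C Q (src C f) \<Longrightarrow> y \<in> hom C Q (src C g) \<Longrightarrow> f \<cdot> x = g \<cdot> y \<Longrightarrow>
      \<exists>!u. u \<in> hom C Q P \<and> a \<cdot> u = x \<and> b \<cdot> u = y"
  using assms by (auto simp: is_pullback_def)

lemma is_pullback_eqI:
  assumes pb: "is_pullback C f g (P, a, b)" and fg: "f \<in> hom C A Z" "g \<in> hom C B Z"
    and x: "x \<in> hom C Q P" and y: "y \<in> hom C Q P" and e: "a \<cdot> x = a \<cdot> y" "b \<cdot> x = b \<cdot> y"
  shows "x = y"
proof -
  note d = is_pullbackD(1-4)[OF pb]
  have [simp]: "src C f = A" "src C g = B" using fg by (auto simp: hom_iff)
  have "f \<cdot> (a \<cdot> y) = g \<cdot> (b \<cdot> y)"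
    using d fg cmp_assoc[OF y, of a A f Z] cmp_assoc[OF y, of b B g Z] by simp
  with is_pullbackD(5)[OF pb cmp_hom[OF y d(2)] cmp_hom[OF y d(3)]] x y e show ?thesis by blast
qed

lemma terminal_eq: "is_terminal C t \<Longrightarrow> x \<in> hom C a t \<Longrightarrow> y \<in> hom C a t \<Longrightarrow> x = y"
  unfolding is_terminal_def using hom_src_obs by blast

text \<open>One more factor is added by pulling back over a terminal object: a cone on the extended
  family is an arrow to \<open>a\<close> together with a cone on the old family, and over a terminal
  object these are automatically compatible.\<close>

lemma product_extendI:
  assumes T: "is_product C T P' \<pi>'" and i: "T i = None" and t: "is_terminal C t"
    and u: "u \<in> hom C a t" and v: "v \<in> hom C P' t" and pb: "is_pullback C u v (P, x, y)"
  shows "is_product C (T(i \<mapsto> a)) P (\<lambda>j. if j = i then x else \<pi>' j \<cdot> y)"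
  unfolding is_product_def
proof (intro conjI ballI allI impI; (elim conjE)?)
  have [simp]: "src C u = a" "src C v = P'" using u v by (auto simp: hom_iff)
  note d = is_pullbackD[OF pb, simplified]
  show "P \<in> obs C" by (rule d)
  fix j assume "j \<in> dom (T(i \<mapsto> a))"
  then show "(if j = i then x else \<pi>' j \<cdot> y) \<in> hom C P (the ((T(i \<mapsto> a)) j))"
    using d(2) cmp_hom[OF d(3) is_productD(2)[OF T]] by auto
next
  have [simp]: "src C u = a" "src C v = P'" using u v by (auto simp: hom_iff)
  note d = is_pullbackD[OF pb, simplified]
  fix Q q assume Q: "Q \<in> obs C" and "\<forall>j\<in>dom (T(i \<mapsto> a)). q j \<in> hom C Q (the ((T(i \<mapsto> a)) j))"
  then have q: "q i \<in> hom C Q a" "\<And>j b. T j = Some b \<Longrightarrow> q j \<in> hom C Q b"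
    using i by (auto split: if_splits) (metis domI domIff option.distinct(1) option.sel)
  obtain w where w: "w \<in> hom C Q P'" "\<And>j. j \<in> dom T \<Longrightarrow> \<pi>' j \<cdot> w = q j"
    using ex1_implies_ex[OF is_productD(3)[OF T Q, of q, OF q(2)]] by blast
  \<comment> \<open>The compatibility that a pullback demands is an equality of arrows into a
    terminal object.\<close>
  obtain z where z: "z \<in> hom C Q P" "x \<cdot> z = q i" "y \<cdot> z = w"
    using d(5)[OF q(1) w(1)] terminal_eq[OF t cmp_hom[OF q(1) u] cmp_hom[OF w(1) v]] by blast
  have ass: "(\<pi>' j \<cdot> y) \<cdot> k = \<pi>' j \<cdot> (y \<cdot> k)" if "k \<in> hom C Q P" "j \<in> dom T" for k j
    using cmp_assoc[OF that(1) d(3)] is_productD(2)[OF T] that(2) by blast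
  show "\<exists>!k. k \<in> hom C Q P \<and> (\<forall>j\<in>dom (T(i \<mapsto> a)). (if j = i then x else \<pi>' j \<cdot> y) \<cdot> k = q j)"
  proof (intro ex1I[of _ z] conjI ballI; (elim conjE)?)
    show "z \<in> hom C Q P" by fact
    fix j assume "j \<in> dom (T(i \<mapsto> a))"
    then show "(if j = i then x else \<pi>' j \<cdot> y) \<cdot> z = q j"
      using z(2,3) w(2)[of j] ass[OF z(1), of j] by auto
  next
    fix k assume k: "k \<in> hom C Q P" and e: "\<forall>j\<in>dom (T(i \<mapsto> a)). (if j = i then x else \<pi>' j \<cdot> y) \<cdot> k = q j"
    have "y \<cdot> k = w"
    proof (rule is_product_eqI[OF T cmp_hom[OF k d(3)] w(1)])
      fix j assume "j \<in> dom T"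
      then show "\<pi>' j \<cdot> (y \<cdot> k) = \<pi>' j \<cdot> w"
        using bspec[OF e, of j] w(2)[of j] ass[OF k, of j] i by (cases "j = i") auto
    qed
    moreover have "x \<cdot> k = q i" using e by auto
    ultimately show "k = z" using is_pullback_eqI[OF pb u v k z(1)] z by simp
  qed
qed

text \<open>The converse of \<open>product_extendI\<close>, for an arbitrary product of the extended
  family. It exposes the pullback hidden in a product, which is the only form in which a functor can
  be applied to it.\<close>

lemma product_extendD:
  assumes P: "is_product C (T(i \<mapsto> a)) P \<pi>" and T: "is_product C T P' \<pi>'" and i: "T i = None"
    and t: "is_terminal C t" and u: "u \<in> hom C a t" and v: "v \<in> hom C P' t"
  obtains y where "is_pullback C u v (P, \<pi> i, y)" "\<And>j. j \<in> dom T \<Longrightarrow> \<pi>' j \<cdot> y = \<pi> j"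
proof -
  have [simp]: "src C u = a" "src C v = P'" using u v by (auto simp: hom_iff)
  have \<pi>: "\<pi> i \<in> hom C P a" "\<And>j b. T j = Some b \<Longrightarrow> \<pi> j \<in> hom C P b"
    using is_productD(2)[OF P] i by (simp, metis fun_upd_other option.distinct(1))
  obtain y where y: "y \<in> hom C P P'" "\<And>j. j \<in> dom T \<Longrightarrow> \<pi>' j \<cdot> y = \<pi> j"
    using ex1_implies_ex[OF is_productD(3)[OF T is_productD(1)[OF P], of \<pi>, OF \<pi>(2)]] by blast
  have ass: "\<pi>' j \<cdot> (y \<cdot> k) = \<pi> j \<cdot> k" if "k \<in> hom C Q P" "j \<in> dom T" for k j Q
    using cmp_assoc[OF that(1) y(1)] is_productD(2)[OF T] that(2) y(2) by fastforce
  have "is_pullback C u v (P, \<pi> i, y)"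
    unfolding is_pullback_def prod.case
  proof (intro conjI allI impI; (elim conjE)?)
    show "P \<in> obs C" by (rule is_productD(1)[OF P])
    show "\<pi> i \<in> hom C P (src C u)" "y \<in> hom C P (src C v)" using \<pi> y by auto
    show "u \<cdot> \<pi> i = v \<cdot> y" by (rule terminal_eq[OF t cmp_hom[OF \<pi>(1) u] cmp_hom[OF y(1) v]])
    fix Q x z assume x: "x \<in> hom C Q (src C u)" and z: "z \<in> hom C Q (src C v)"
    let ?q = "\<lambda>j. if j = i then x else \<pi>' j \<cdot> z"
    have "?q j \<in> hom C Q b" if "(T(i \<mapsto> a)) j = Some b" for j b
      using that x cmp_hom[OF _ is_productD(2)[OF T]] z by (auto split: if_splits)
    then have ex: "\<exists>!l. l \<in> hom C Q P \<and> (\<forall>j\<in>dom (T(i \<mapsto> a)). \<pi> j \<cdot> l = ?q j)"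
      by (rule is_productD(3)[OF P hom_src_obs[OF x]])
    then obtain k where k: "k \<in> hom C Q P" "\<And>j. j \<in> dom (T(i \<mapsto> a)) \<Longrightarrow> \<pi> j \<cdot> k = ?q j"
      by (blast dest: ex1_implies_ex)
    have kz: "y \<cdot> k = z"
    proof (rule is_product_eqI[OF T cmp_hom[OF k(1) y(1)]])
      show "z \<in> hom C Q P'" using z by simp
      fix j assume "j \<in> dom T"
      then show "\<pi>' j \<cdot> (y \<cdot> k) = \<pi>' j \<cdot> z" using ass[OF k(1)] k(2)[of j] i by auto
    qed
    show "\<exists>!l. l \<in> hom C Q P \<and> \<pi> i \<cdot> l = x \<and> y \<cdot> l = z"
    proof (intro ex1I[of _ k])
      show "k \<in> hom C Q P \<and> \<pi> i \<cdot> k = x \<and> y \<cdot> k = z" using k(1) k(2)[of i] kz by simp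
      fix l assume l: "l \<in> hom C Q P \<and> \<pi> i \<cdot> l = x \<and> y \<cdot> l = z"
      then have "\<forall>j\<in>dom (T(i \<mapsto> a)). \<pi> j \<cdot> l = ?q j" using ass[of l Q] by auto
      with l k show "l = k" by (intro ex1_unique[OF ex]) simp_all
    qed
  qed
  then show ?thesis using y that by blast
qed

end

text \<open>Terminal objects and pullbacks generate all finite limits; the finite products needed
  for boundaries are derived in \<open>ex_product\<close>.\<close>

locale finitely_complete = category C for C :: "('o, 'm, 'z) cat_scheme" (structure) +
  assumes ex_terminal: "\<exists>t. is_terminal C t"
    and ex_pullback: "f \<in> hom C a c \<Longrightarrow> g \<in> hom C b c \<Longrightarrow> \<exists>P. is_pullback C f g P"
begin

text \<open>Induction on the set of indices: one index is removed, and its factor is put back by a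
  pullback over the terminal object.\<close>

lemma ex_product:
  assumes "finite (dom T)" "ran T \<subseteq> obs C"
  shows "\<exists>P \<pi>. is_product C T P \<pi>"
  using assms
proof (induction "dom T" arbitrary: T rule: finite_induct)
  case empty
  then have T: "T = Map.empty" by (metis dom_eq_empty_conv)
  obtain t where "is_terminal C t" using ex_terminal by blast
  then have "is_product C T t undefined" unfolding T by (rule is_terminal_iff_product[THEN iffD1])
  then show ?case by blast
next
  case (insert i D)
  let ?T = "T(i := None)"
  obtain a where a: "T i = Some a" using insert by blast
  have aT: "a \<in> obs C" using insert(5) ranI[of T, OF a] by blast
  have D: "D = dom ?T" using insert by auto
  have "ran ?T \<subseteq> obs C" using insert(5) by (auto simp: ran_def split: if_splits)
  from insert(3)[OF D this] obtain P' \<pi>' where P': "is_product C ?T P' \<pi>'" by blast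
  obtain t where t: "is_terminal C t" using ex_terminal by blast
  obtain u v where u: "u \<in> hom C a t" and v: "v \<in> hom C P' t"
    using t aT is_productD(1)[OF P'] unfolding is_terminal_def by blast
  obtain P x y where "is_pullback C u v (P, x, y)" using ex_pullback[OF u v] by (metis surj_pair)
  from product_extendI[OF P' fun_upd_same t u v this] have "\<exists>P \<pi>. is_product C (?T(i \<mapsto> a)) P \<pi>" by blast
  moreover have "?T(i \<mapsto> a) = T" using a by auto
  ultimately show ?case by simp
qed

lemma product_is_product:
  assumes "finite (dom T)" "ran T \<subseteq> obs C"
  shows "is_product C T (hat C T) (proj C T)"
proof -
  have "\<exists>z. (\<lambda>(P, \<pi>). is_product C T P \<pi>) z" using ex_product[OF assms] by auto
  then have "(\<lambda>(P, \<pi>). is_product C T P \<pi>) (product C T)"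
    unfolding product_def by (rule someI_ex)
  then show ?thesis by (simp add: hat_def proj_def split: prod.splits)
qed

lemma hat_obs: "finite (dom T) \<Longrightarrow> ran T \<subseteq> obs C \<Longrightarrow> hat C T \<in> obs C"
  using product_is_product is_productD(1) by blast

lemma arr_proj:
  assumes "finite (dom T)" "ran T \<subseteq> obs C" "i \<in> dom T"
  shows "proj C T i \<in> arrs C" "src C (proj C T i) = hat C T" "tgt C (proj C T i) = the (T i)"
  using is_productD(2)[OF product_is_product[OF assms(1,2)]] assms(3) by (auto simp: hom_iff)

lemma tuple_lemma:
  assumes T: "finite (dom T)" "ran T \<subseteq> obs C" and Q: "Q \<in> obs C"
    and q: "\<And>i. i \<in> dom T \<Longrightarrow> q i \<in> arrs C \<and> src C (q i) = Q \<and> tgt C (q i) = the (T i)"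
  shows "tuple C T Q q \<in> arrs C" "src C (tuple C T Q q) = Q" "tgt C (tuple C T Q q) = hat C T"
    "i \<in> dom T \<Longrightarrow> proj C T i \<cdot> tuple C T Q q = q i"
proof -
  have "q i \<in> hom C Q a" if "T i = Some a" for i a using q[of i] that by (auto simp: hom_iff)
  from theI'[OF is_productD(3)[OF product_is_product[OF T] Q this], folded tuple_def]
  show "tuple C T Q q \<in> arrs C" "src C (tuple C T Q q) = Q" "tgt C (tuple C T Q q) = hat C T"
    "i \<in> dom T \<Longrightarrow> proj C T i \<cdot> tuple C T Q q = q i" by (auto simp: hom_iff)
qed

lemma hat_eqI:
  assumes "finite (dom T)" "ran T \<subseteq> obs C" "x \<in> hom C Q (hat C T)" "y \<in> hom C Q (hat C T)"
    "\<And>i. i \<in> dom T \<Longrightarrow> proj C T i \<cdot> x = proj C T i \<cdot> y"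
  shows "x = y"
  using is_product_eqI[OF product_is_product] assms by blast

lemma two_ok: "a \<in> obs C \<Longrightarrow> b \<in> obs C \<Longrightarrow> finite (dom (two a b)) \<and> ran (two a b) \<subseteq> obs C"
  by (auto simp: two_def ran_def)

lemma prd_obs: "a \<in> obs C \<Longrightarrow> b \<in> obs C \<Longrightarrow> prd C a b \<in> obs C"
  unfolding prd_def using two_ok hat_obs by blast

lemma arr_pr:
  assumes "a \<in> obs C" "b \<in> obs C"
  shows "pr1 C a b \<in> arrs C" "src C (pr1 C a b) = prd C a b" "tgt C (pr1 C a b) = a"
    "pr2 C a b \<in> arrs C" "src C (pr2 C a b) = prd C a b" "tgt C (pr2 C a b) = b"
  using arr_proj[of "two a b" True] arr_proj[of "two a b" False] two_ok[OF assms]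
  by (auto simp: pr1_def pr2_def prd_def two_def)

lemma pair_lemma:
  assumes "f \<in> arrs C" "g \<in> arrs C" "src C f = src C g" "a = tgt C f" "b = tgt C g"
  shows "pair C f g \<in> arrs C" "src C (pair C f g) = src C g" "tgt C (pair C f g) = prd C a b"
    "pr1 C a b \<cdot> pair C f g = f" "pr2 C a b \<cdot> pair C f g = g"
proof -
  let ?T = "two (tgt C f) (tgt C g)"
  have o: "tgt C f \<in> obs C" "tgt C g \<in> obs C" "src C g \<in> obs C" using assms tgt_obs src_obs by auto
  have T: "finite (dom ?T)" "ran ?T \<subseteq> obs C" using two_ok[OF o(1,2)] by auto
  have q: "(if i then g else f) \<in> arrs C \<and> src C (if i then g else f) = src C g \<and> tgt C (if i then g else f) = the (?T i)"
    for i using assms by (auto simp: two_def)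
  note * = tuple_lemma[where q = "\<lambda>i. if i then g else f", OF T o(3) q]
  from *(1-3) *(4)[of True] *(4)[of False]
  show "pair C f g \<in> arrs C" "src C (pair C f g) = src C g" "tgt C (pair C f g) = prd C a b"
    "pr1 C a b \<cdot> pair C f g = f" "pr2 C a b \<cdot> pair C f g = g"
    using assms by (auto simp: pair_def pr1_def pr2_def prd_def) (auto simp: two_def)
qed

lemma prd_eqI:
  assumes "a \<in> obs C" "b \<in> obs C" "x \<in> hom C Q (prd C a b)" "y \<in> hom C Q (prd C a b)"
    "pr1 C a b \<cdot> x = pr1 C a b \<cdot> y" "pr2 C a b \<cdot> x = pr2 C a b \<cdot> y"
  shows "x = y"
proof (rule hat_eqI[of "two a b"])
  show "proj C (two a b) i \<cdot> x = proj C (two a b) i \<cdot> y" if "i \<in> dom (two a b)" for i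
    using assms by (cases i) (auto simp: pr1_def pr2_def)
qed (use two_ok assms in \<open>auto simp: prd_def\<close>)

lemma pullback_is_pullback:
  assumes "f \<in> arrs C" "g \<in> arrs C" "tgt C f = tgt C g"
  shows "is_pullback C f g (pb_ob C f g, pb1 C f g, pb2 C f g)"
proof -
  have "\<exists>P. is_pullback C f g P"
    using ex_pullback[of f "src C f" "tgt C f" g "src C g"] assms by (auto simp: hom_iff)
  then have "is_pullback C f g (pullback C f g)" unfolding pullback_def by (rule someI_ex)
  then show ?thesis by (simp add: pb_ob_def pb1_def pb2_def)
qed

lemma arr_pb:
  assumes "f \<in> arrs C" "g \<in> arrs C" "tgt C f = tgt C g"
  shows "pb_ob C f g \<in> obs C"
    "pb1 C f g \<in> arrs C" "src C (pb1 C f g) = pb_ob C f g" "tgt C (pb1 C f g) = src C f"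
    "pb2 C f g \<in> arrs C" "src C (pb2 C f g) = pb_ob C f g" "tgt C (pb2 C f g) = src C g"
    "f \<cdot> pb1 C f g = g \<cdot> pb2 C f g"
  using is_pullbackD(1-4)[OF pullback_is_pullback[OF assms]] by (auto simp: hom_iff)

lemma pb_lift_lemma:
  assumes "f \<in> arrs C" "g \<in> arrs C" "tgt C f = tgt C g"
    "x \<in> arrs C" "y \<in> arrs C" "src C x = src C y" "tgt C x = src C f" "tgt C y = src C g" "f \<cdot> x = g \<cdot> y"
  shows "pb_lift C f g x y \<in> arrs C" "src C (pb_lift C f g x y) = src C x" "tgt C (pb_lift C f g x y) = pb_ob C f g"
    "pb1 C f g \<cdot> pb_lift C f g x y = x" "pb2 C f g \<cdot> pb_lift C f g x y = y"
proof -
  have xy: "x \<in> hom C (src C x) (src C f)" "y \<in> hom C (src C x) (src C g)"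
    using assms by (auto simp: hom_iff)
  from theI'[OF is_pullbackD(5)[OF pullback_is_pullback[OF assms(1-3)] xy assms(9)], folded pb_lift_def]
  show "pb_lift C f g x y \<in> arrs C" "src C (pb_lift C f g x y) = src C x" "tgt C (pb_lift C f g x y) = pb_ob C f g"
    "pb1 C f g \<cdot> pb_lift C f g x y = x" "pb2 C f g \<cdot> pb_lift C f g x y = y" by (auto simp: hom_iff)
qed

lemma pb_eqI:
  assumes "f \<in> arrs C" "g \<in> arrs C" "tgt C f = tgt C g" "x \<in> hom C Q (pb_ob C f g)" "y \<in> hom C Q (pb_ob C f g)"
    "pb1 C f g \<cdot> x = pb1 C f g \<cdot> y" "pb2 C f g \<cdot> x = pb2 C f g \<cdot> y"
  shows "x = y"
  using is_pullback_eqI[OF pullback_is_pullback[OF assms(1-3)], of "src C f" "tgt C g" "src C g"] assms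
  by (auto simp: hom_iff)

lemma terminal_is_terminal: "is_terminal C (terminal C)"
  unfolding terminal_def
  by (rule is_terminal_iff_product[THEN iffD2], rule product_is_product) simp_all

lemma bang_hom: "a \<in> obs C \<Longrightarrow> bang C a \<in> hom C a (terminal C)"
  unfolding bang_def terminal_def using tuple_lemma[of "Map.empty :: unit \<rightharpoonup> 'o" a undefined] by (simp add: hom_iff)

end

locale lex_functor = C: finitely_complete C + D: finitely_complete D + F: cat_functor C D F
  for C :: "('o, 'm, 'z) cat_scheme" and D :: "('p, 'n, 'y) cat_scheme" and F +
  assumes pres_terminal: "is_terminal C t \<Longrightarrow> is_terminal D (fob F t)"
    and pres_pullback: "f \<in> hom C a c \<Longrightarrow> g \<in> hom C b c \<Longrightarrow> is_pullback C f g (P, x, y) \<Longrightarrow>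
      is_pullback D (far F f) (far F g) (fob F P, far F x, far F y)"
begin

text \<open>The induction of \<open>ex_product\<close> again, run on a given product:
  \<open>product_extendD\<close> exhibits it as a pullback, \<open>F\<close> preserves that
  pullback, and \<open>product_extendI\<close> reads the image as a product in
  \<open>D\<close>.\<close>

lemma pres_product:
  assumes "finite (dom T)" "ran T \<subseteq> obs C" "is_product C T P \<pi>"
  shows "is_product D (map_option (fob F) \<circ> T) (fob F P) (\<lambda>i. far F (\<pi> i))"
  using assms
proof (induction "dom T" arbitrary: T P \<pi> rule: finite_induct)
  case empty
  then have "T = Map.empty" by (metis dom_eq_empty_conv)
  then show ?case
    using empty(3) pres_terminal[of P] is_terminal_iff_product[of C P \<pi>]
      is_terminal_iff_product[of D "fob F P" "\<lambda>i. far F (\<pi> i)"] by (simp add: comp_def)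
next
  case (insert i S)
  let ?T = "T(i := None)" and ?F = "\<lambda>T. map_option (fob F) \<circ> T"
  obtain a where a: "T i = Some a" using insert by blast
  have aT: "a \<in> obs C" using insert(5) ranI[of T, OF a] by blast
  have S: "S = dom ?T" using insert by auto
  have rT: "ran ?T \<subseteq> obs C" using insert(5) by (auto simp: ran_def split: if_splits)
  have fT: "finite (dom ?T)" using insert(1) S by simp
  note P' = C.product_is_product[OF fT rT]
  have T: "T = ?T(i \<mapsto> a)" using a by auto
  obtain t where t: "is_terminal C t" using C.ex_terminal by blast
  obtain u v where u: "u \<in> hom C a t" and v: "v \<in> hom C (hat C ?T) t"
    using t aT C.is_productD(1)[OF P'] unfolding is_terminal_def by blast
  have PT: "is_product C (?T(i \<mapsto> a)) P \<pi>" using insert(6) T by simp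
  obtain y where y: "is_pullback C u v (P, \<pi> i, y)" "\<And>j. j \<in> dom ?T \<Longrightarrow> cmp C (proj C ?T j) y = \<pi> j"
    using C.product_extendD[OF PT P' _ t u v] by auto
  have yh: "y \<in> hom C P (hat C ?T)" using C.is_pullbackD(3)[OF y(1)] v by (simp add: hom_iff)
  note IH = insert(3)[OF S rT P']
  have "is_product D ((?F ?T)(i \<mapsto> fob F a)) (fob F P)
      (\<lambda>j. if j = i then far F (\<pi> i) else cmp D (far F (proj C ?T j)) (far F y))"
    by (rule D.product_extendI[OF IH _ pres_terminal[OF t] F.far_hom[OF u] F.far_hom[OF v] pres_pullback[OF u v y(1)]]) simp
  moreover have "(?F ?T)(i \<mapsto> fob F a) = ?F T" using a by (auto simp: fun_eq_iff)
  moreover have "cmp D (far F (proj C ?T j)) (far F y) = far F (\<pi> j)" if "j \<in> dom T" "j \<noteq> i" for j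
  proof -
    from that obtain b where b: "?T j = Some b" by auto
    show ?thesis using F.far_cmp[OF yh C.is_productD(2)[OF P' b]] y(2)[OF domI[of ?T, OF b]] by simp
  qed
  ultimately show ?case by (simp only:) (erule D.is_product_cong, auto)
qed

end

section \<open>Spans over boundaries\<close>

definition bi :: "('o, 'm, 'z) cat_scheme \<Rightarrow> ('l, 'o) box \<Rightarrow> 'm" where
  "bi C X = pr1 C (hat C (inp X)) (hat C (outp X))"

definition bo :: "('o, 'm, 'z) cat_scheme \<Rightarrow> ('l, 'o) box \<Rightarrow> 'm" where
  "bo C X = pr2 C (hat C (inp X)) (hat C (outp X))"

text \<open>
  \<open>x\<close> and \<open>y\<close> are generalized elements of the inner and of the outer boundary with equal values at the
  ends of each wire. Arrows into the apex of \<open>spn_act C \<phi> p\<close> amount to pairs \<open>(u, y)\<close> such that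
  \<open>p \<cdot> u\<close> and \<open>y\<close> are so related.
\<close>

definition wd_rel :: "('o, 'm, 'z) cat_scheme \<Rightarrow> ('l, 'o) wd \<Rightarrow> 'o \<Rightarrow> 'm \<Rightarrow> 'm \<Rightarrow> bool" where
  "wd_rel C \<phi> Q x y \<longleftrightarrow> x \<in> hom C Q (bound C (wsrc \<phi>)) \<and> y \<in> hom C Q (bound C (wtgt \<phi>)) \<and>
     (\<forall>i\<in>dom (inp (wsrc \<phi>)). cmp C (in_at C (wsrc \<phi>) i) x =
        (case win \<phi> i of Inl j \<Rightarrow> cmp C (out_at C (wsrc \<phi>) j) x | Inr j \<Rightarrow> cmp C (in_at C (wtgt \<phi>) j) y)) \<and>
     (\<forall>k\<in>dom (outp (wtgt \<phi>)). cmp C (out_at C (wtgt \<phi>) k) y = cmp C (out_at C (wsrc \<phi>) (wout \<phi> k)) x)"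

context finitely_complete
begin

lemma box_ok:
  assumes "is_box C X"
  shows "finite (dom (inp X))" "ran (inp X) \<subseteq> obs C" "finite (dom (outp X))" "ran (outp X) \<subseteq> obs C"
  using assms by (auto simp: is_box_def is_tset_def)

lemma box_obs:
  assumes "is_box C X"
  shows "hat C (inp X) \<in> obs C" "hat C (outp X) \<in> obs C" "bound C X \<in> obs C"
  using hat_obs box_ok[OF assms] by (auto simp: bound_def intro: prd_obs)

lemma arr_b:
  assumes "is_box C X"
  shows "bi C X \<in> arrs C" "src C (bi C X) = bound C X" "tgt C (bi C X) = hat C (inp X)"
    "bo C X \<in> arrs C" "src C (bo C X) = bound C X" "tgt C (bo C X) = hat C (outp X)"
  using arr_pr[OF box_obs(1,2)[OF assms]] by (auto simp: bi_def bo_def bound_def)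

lemma arr_box_proj:
  assumes "is_box C X"
  shows "i \<in> dom (inp X) \<Longrightarrow> proj C (inp X) i \<in> arrs C" "i \<in> dom (inp X) \<Longrightarrow> src C (proj C (inp X) i) = hat C (inp X)"
    "i \<in> dom (inp X) \<Longrightarrow> tgt C (proj C (inp X) i) = the (inp X i)"
    "k \<in> dom (outp X) \<Longrightarrow> proj C (outp X) k \<in> arrs C" "k \<in> dom (outp X) \<Longrightarrow> src C (proj C (outp X) k) = hat C (outp X)"
    "k \<in> dom (outp X) \<Longrightarrow> tgt C (proj C (outp X) k) = the (outp X k)"
  using arr_proj[OF box_ok(1,2)[OF assms]] arr_proj[OF box_ok(3,4)[OF assms]] by auto

lemma at_eq: "in_at C X i = proj C (inp X) i \<cdot> bi C X" "out_at C X k = proj C (outp X) k \<cdot> bo C X"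
  by (auto simp: in_at_def out_at_def bi_def bo_def)

lemma arr_at:
  assumes "is_box C X"
  shows "i \<in> dom (inp X) \<Longrightarrow> in_at C X i \<in> arrs C" "i \<in> dom (inp X) \<Longrightarrow> src C (in_at C X i) = bound C X"
    "i \<in> dom (inp X) \<Longrightarrow> tgt C (in_at C X i) = the (inp X i)"
    "k \<in> dom (outp X) \<Longrightarrow> out_at C X k \<in> arrs C" "k \<in> dom (outp X) \<Longrightarrow> src C (out_at C X k) = bound C X"
    "k \<in> dom (outp X) \<Longrightarrow> tgt C (out_at C X k) = the (outp X k)"
  by (auto simp: at_eq arr_cmp arr_b assms arr_box_proj)

lemma at_cmp:
  assumes "is_box C X" "x \<in> hom C Q (bound C X)"
  shows "i \<in> dom (inp X) \<Longrightarrow> in_at C X i \<cdot> x = proj C (inp X) i \<cdot> (bi C X \<cdot> x)"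
    "k \<in> dom (outp X) \<Longrightarrow> out_at C X k \<cdot> x = proj C (outp X) k \<cdot> (bo C X \<cdot> x)"
  using assms by (auto simp: at_eq cmp_assoc' arr_b arr_box_proj hom_iff)

lemma b_cmp_hom:
  assumes "is_box C X" "x \<in> hom C Q (bound C X)"
  shows "bi C X \<cdot> x \<in> hom C Q (hat C (inp X))" "bo C X \<cdot> x \<in> hom C Q (hat C (outp X))"
  using assms by (auto simp: hom_iff arr_cmp arr_b)

lemma bi_eqI:
  assumes X: "is_box C X" and x: "x \<in> hom C Q (hat C (inp X))" and y: "y \<in> hom C Q (hat C (inp X))"
    and e: "\<And>i. i \<in> dom (inp X) \<Longrightarrow> proj C (inp X) i \<cdot> x = proj C (inp X) i \<cdot> y"
  shows "x = y"
  using hat_eqI[OF box_ok(1,2)[OF X] x y e] .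

lemma bo_eqI:
  assumes X: "is_box C X" and x: "x \<in> hom C Q (hat C (outp X))" and y: "y \<in> hom C Q (hat C (outp X))"
    and e: "\<And>i. i \<in> dom (outp X) \<Longrightarrow> proj C (outp X) i \<cdot> x = proj C (outp X) i \<cdot> y"
  shows "x = y"
  using hat_eqI[OF box_ok(3,4)[OF X] x y e] .

lemma bound_eqI':
  assumes "is_box C X" "x \<in> hom C Q (bound C X)" "y \<in> hom C Q (bound C X)"
    "bi C X \<cdot> x = bi C X \<cdot> y" "bo C X \<cdot> x = bo C X \<cdot> y"
  shows "x = y"
  using prd_eqI[OF box_obs(1,2)[OF assms(1)]] assms unfolding bound_def bi_def bo_def by blast

text \<open>Reduces an equality of arrows into a boundary to single ports, the level at which
  wirings are described.\<close>

lemma bound_eqI: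
  assumes X: "is_box C X" and x: "x \<in> hom C Q (bound C X)" and y: "y \<in> hom C Q (bound C X)"
    and "\<And>i. i \<in> dom (inp X) \<Longrightarrow> in_at C X i \<cdot> x = in_at C X i \<cdot> y"
    and "\<And>k. k \<in> dom (outp X) \<Longrightarrow> out_at C X k \<cdot> x = out_at C X k \<cdot> y"
  shows "x = y"
  by (rule bound_eqI'[OF X x y], rule bi_eqI[OF X], (rule b_cmp_hom X x y)+,
      simp add: assms at_cmp[OF X x, symmetric] at_cmp[OF X y, symmetric],
      rule bo_eqI[OF X], (rule b_cmp_hom X x y)+,
      simp add: assms at_cmp[OF X x, symmetric] at_cmp[OF X y, symmetric])

lemma to_bound_lemma:
  assumes X: "is_box C X" and Q: "Q \<in> obs C"
    and f: "\<And>i. i \<in> dom (inp X) \<Longrightarrow> f i \<in> hom C Q (the (inp X i))"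
    and g: "\<And>k. k \<in> dom (outp X) \<Longrightarrow> g k \<in> hom C Q (the (outp X k))"
  shows "to_bound C X Q f g \<in> hom C Q (bound C X)"
    "i \<in> dom (inp X) \<Longrightarrow> in_at C X i \<cdot> to_bound C X Q f g = f i"
    "k \<in> dom (outp X) \<Longrightarrow> out_at C X k \<cdot> to_bound C X Q f g = g k"
proof -
  have f': "\<And>i. i \<in> dom (inp X) \<Longrightarrow> f i \<in> arrs C \<and> src C (f i) = Q \<and> tgt C (f i) = the (inp X i)"
    and g': "\<And>k. k \<in> dom (outp X) \<Longrightarrow> g k \<in> arrs C \<and> src C (g k) = Q \<and> tgt C (g k) = the (outp X k)"
    using f g by (auto simp: hom_iff)
  note 1 = tuple_lemma[where q = f, OF box_ok(1,2)[OF X] Q f']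
  note 2 = tuple_lemma[where q = g, OF box_ok(3,4)[OF X] Q g']
  note 3 = pair_lemma[of "tuple C (inp X) Q f" "tuple C (outp X) Q g" "hat C (inp X)" "hat C (outp X)"]
  show h: "to_bound C X Q f g \<in> hom C Q (bound C X)"
    using 1(1-3) 2(1-3) 3 by (auto simp: to_bound_def hom_iff bound_def)
  show "i \<in> dom (inp X) \<Longrightarrow> in_at C X i \<cdot> to_bound C X Q f g = f i"
    unfolding at_cmp(1)[OF X h] using 1 2(1-3) 3 by (simp add: to_bound_def bi_def)
  show "k \<in> dom (outp X) \<Longrightarrow> out_at C X k \<cdot> to_bound C X Q f g = g k"
    unfolding at_cmp(2)[OF X h] using 1(1-3) 2 3 by (simp add: to_bound_def bo_def)
qed

lemma wd_ports:
  assumes "is_wd C \<phi>"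
  shows "i \<in> dom (inp (wsrc \<phi>)) \<Longrightarrow> win \<phi> i = Inl j \<Longrightarrow> j \<in> dom (outp (wsrc \<phi>)) \<and> outp (wsrc \<phi>) j = inp (wsrc \<phi>) i"
    "i \<in> dom (inp (wsrc \<phi>)) \<Longrightarrow> win \<phi> i = Inr j \<Longrightarrow> j \<in> dom (inp (wtgt \<phi>)) \<and> inp (wtgt \<phi>) j = inp (wsrc \<phi>) i"
    "k \<in> dom (outp (wtgt \<phi>)) \<Longrightarrow> wout \<phi> k \<in> dom (outp (wsrc \<phi>)) \<and> outp (wsrc \<phi>) (wout \<phi> k) = outp (wtgt \<phi>) k"
  using win_Inl[OF assms] win_Inr[OF assms] wout_type[OF assms] by auto

section \<open>A single wiring diagram: legs, relation and action\<close>

context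
  fixes \<phi> :: "('l, 'o) wd"
  assumes w: "is_wd C \<phi>"
begin

lemma box_src: "is_box C (wsrc \<phi>)" and box_tgt: "is_box C (wtgt \<phi>)"
  using w by (auto simp: is_wd_boxes)

lemma arr_mid:
  "mid C \<phi> \<in> obs C"
  "mid1 C \<phi> \<in> arrs C" "src C (mid1 C \<phi>) = mid C \<phi>" "tgt C (mid1 C \<phi>) = hat C (inp (wtgt \<phi>))"
  "mid2 C \<phi> \<in> arrs C" "src C (mid2 C \<phi>) = mid C \<phi>" "tgt C (mid2 C \<phi>) = hat C (outp (wsrc \<phi>))"
  using prd_obs[OF box_obs(1)[OF box_tgt] box_obs(2)[OF box_src]] arr_pr[OF box_obs(1)[OF box_tgt] box_obs(2)[OF box_src]]
  by (auto simp: mid_def mid1_def mid2_def)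

lemma arr_hat_in:
  "hat_in C \<phi> \<in> arrs C" "src C (hat_in C \<phi>) = mid C \<phi>" "tgt C (hat_in C \<phi>) = hat C (inp (wsrc \<phi>))"
  "i \<in> dom (inp (wsrc \<phi>)) \<Longrightarrow> proj C (inp (wsrc \<phi>)) i \<cdot> hat_in C \<phi> =
     (case win \<phi> i of Inl j \<Rightarrow> proj C (outp (wsrc \<phi>)) j \<cdot> mid2 C \<phi> | Inr j \<Rightarrow> proj C (inp (wtgt \<phi>)) j \<cdot> mid1 C \<phi>)"
proof -
  let ?q = "\<lambda>i. case win \<phi> i of Inl j \<Rightarrow> proj C (outp (wsrc \<phi>)) j \<cdot> mid2 C \<phi>
    | Inr j \<Rightarrow> proj C (inp (wtgt \<phi>)) j \<cdot> mid1 C \<phi>"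
  have q: "?q i \<in> arrs C \<and> src C (?q i) = mid C \<phi> \<and> tgt C (?q i) = the (inp (wsrc \<phi>) i)"
    if "i \<in> dom (inp (wsrc \<phi>))" for i
    using wd_ports(1,2)[OF w that] arr_mid arr_box_proj[OF box_src] arr_box_proj[OF box_tgt]
    by (simp add: arr_cmp split: sum.split)
  note * = tuple_lemma[where q = ?q, OF box_ok(1,2)[OF box_src] arr_mid(1) q, folded hat_in_def]
  show "hat_in C \<phi> \<in> arrs C" "src C (hat_in C \<phi>) = mid C \<phi>" "tgt C (hat_in C \<phi>) = hat C (inp (wsrc \<phi>))"
    "i \<in> dom (inp (wsrc \<phi>)) \<Longrightarrow> proj C (inp (wsrc \<phi>)) i \<cdot> hat_in C \<phi> =
     (case win \<phi> i of Inl j \<Rightarrow> proj C (outp (wsrc \<phi>)) j \<cdot> mid2 C \<phi> | Inr j \<Rightarrow> proj C (inp (wtgt \<phi>)) j \<cdot> mid1 C \<phi>)"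
    using * by auto
qed

lemma arr_hat_out:
  "hat_out C \<phi> \<in> arrs C" "src C (hat_out C \<phi>) = hat C (outp (wsrc \<phi>))" "tgt C (hat_out C \<phi>) = hat C (outp (wtgt \<phi>))"
  "k \<in> dom (outp (wtgt \<phi>)) \<Longrightarrow> proj C (outp (wtgt \<phi>)) k \<cdot> hat_out C \<phi> = proj C (outp (wsrc \<phi>)) (wout \<phi> k)"
proof -
  have q: "proj C (outp (wsrc \<phi>)) (wout \<phi> k) \<in> arrs C \<and> src C (proj C (outp (wsrc \<phi>)) (wout \<phi> k)) = hat C (outp (wsrc \<phi>)) \<and>
      tgt C (proj C (outp (wsrc \<phi>)) (wout \<phi> k)) = the (outp (wtgt \<phi>) k)"
    if "k \<in> dom (outp (wtgt \<phi>))" for k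
    using wd_ports(3)[OF w that] arr_box_proj[OF box_src] by simp
  note * = tuple_lemma[where q = "\<lambda>k. proj C (outp (wsrc \<phi>)) (wout \<phi> k)", OF box_ok(3,4)[OF box_tgt] box_obs(2)[OF box_src] q,
    folded hat_out_def]
  show "hat_out C \<phi> \<in> arrs C" "src C (hat_out C \<phi>) = hat C (outp (wsrc \<phi>))" "tgt C (hat_out C \<phi>) = hat C (outp (wtgt \<phi>))"
    "k \<in> dom (outp (wtgt \<phi>)) \<Longrightarrow> proj C (outp (wtgt \<phi>)) k \<cdot> hat_out C \<phi> = proj C (outp (wsrc \<phi>)) (wout \<phi> k)"
    using * by auto
qed

lemma arr_leg:
  "legL C \<phi> \<in> arrs C" "src C (legL C \<phi>) = mid C \<phi>" "tgt C (legL C \<phi>) = bound C (wsrc \<phi>)"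
  "bi C (wsrc \<phi>) \<cdot> legL C \<phi> = hat_in C \<phi>" "bo C (wsrc \<phi>) \<cdot> legL C \<phi> = mid2 C \<phi>"
  "legR C \<phi> \<in> arrs C" "src C (legR C \<phi>) = mid C \<phi>" "tgt C (legR C \<phi>) = bound C (wtgt \<phi>)"
  "bi C (wtgt \<phi>) \<cdot> legR C \<phi> = mid1 C \<phi>" "bo C (wtgt \<phi>) \<cdot> legR C \<phi> = hat_out C \<phi> \<cdot> mid2 C \<phi>"
  using pair_lemma[of "hat_in C \<phi>" "mid2 C \<phi>" "hat C (inp (wsrc \<phi>))" "hat C (outp (wsrc \<phi>))"]
    pair_lemma[of "mid1 C \<phi>" "hat_out C \<phi> \<cdot> mid2 C \<phi>" "hat C (inp (wtgt \<phi>))" "hat C (outp (wtgt \<phi>))"]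
  by (simp_all add: legL_def legR_def arr_hat_in arr_hat_out arr_mid arr_cmp bi_def bo_def bound_def)

text \<open>Collected over all ports, the wirewise equations become the two familiar equations for
  \<open>hat_in\<close> and \<open>hat_out\<close>. The pair is the element of
  \<open>mid C \<phi>\<close> that consists of the outer inputs and the inner outputs.\<close>

lemma wd_rel_iff:
  assumes x: "x \<in> hom C Q (bound C (wsrc \<phi>))" and y: "y \<in> hom C Q (bound C (wtgt \<phi>))"
  shows "wd_rel C \<phi> Q x y \<longleftrightarrow>
    bi C (wsrc \<phi>) \<cdot> x = hat_in C \<phi> \<cdot> pair C (bi C (wtgt \<phi>) \<cdot> y) (bo C (wsrc \<phi>) \<cdot> x) \<and>
    bo C (wtgt \<phi>) \<cdot> y = hat_out C \<phi> \<cdot> (bo C (wsrc \<phi>) \<cdot> x)" (is "_ \<longleftrightarrow> ?I \<and> ?O")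
proof -
  note b = b_cmp_hom[OF box_src x] b_cmp_hom[OF box_tgt y]
  note b' = b[unfolded hom_iff]
  let ?m = "pair C (bi C (wtgt \<phi>) \<cdot> y) (bo C (wsrc \<phi>) \<cdot> x)"
  have m: "?m \<in> arrs C" "src C ?m = Q" "tgt C ?m = mid C \<phi>" "mid1 C \<phi> \<cdot> ?m = bi C (wtgt \<phi>) \<cdot> y"
      "mid2 C \<phi> \<cdot> ?m = bo C (wsrc \<phi>) \<cdot> x"
    using pair_lemma[of "bi C (wtgt \<phi>) \<cdot> y" "bo C (wsrc \<phi>) \<cdot> x"] b'
    by (auto simp: mid_def mid1_def mid2_def)
  have I: "proj C (inp (wsrc \<phi>)) i \<cdot> (hat_in C \<phi> \<cdot> ?m) = (case win \<phi> i of
      Inl j \<Rightarrow> out_at C (wsrc \<phi>) j \<cdot> x | Inr j \<Rightarrow> in_at C (wtgt \<phi>) j \<cdot> y)" if i: "i \<in> dom (inp (wsrc \<phi>))" for i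
  proof -
    have "proj C (inp (wsrc \<phi>)) i \<cdot> (hat_in C \<phi> \<cdot> ?m) = (proj C (inp (wsrc \<phi>)) i \<cdot> hat_in C \<phi>) \<cdot> ?m"
      using m i by (simp add: cmp_assoc' arr_hat_in(1-3) arr_box_proj[OF box_src])
    also have "\<dots> = (case win \<phi> i of Inl j \<Rightarrow> out_at C (wsrc \<phi>) j \<cdot> x | Inr j \<Rightarrow> in_at C (wtgt \<phi>) j \<cdot> y)"
      using m i wd_ports(1,2)[OF w i]
      by (auto simp: arr_hat_in(4) cmp_assoc' arr_mid arr_box_proj[OF box_src] arr_box_proj[OF box_tgt] at_cmp[OF box_src x] at_cmp[OF box_tgt y]
          split: sum.split)
    finally show ?thesis .
  qed
  have O: "proj C (outp (wtgt \<phi>)) k \<cdot> (hat_out C \<phi> \<cdot> (bo C (wsrc \<phi>) \<cdot> x)) = out_at C (wsrc \<phi>) (wout \<phi> k) \<cdot> x"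
    if k: "k \<in> dom (outp (wtgt \<phi>))" for k
  proof -
    have "proj C (outp (wtgt \<phi>)) k \<cdot> (hat_out C \<phi> \<cdot> (bo C (wsrc \<phi>) \<cdot> x))
        = (proj C (outp (wtgt \<phi>)) k \<cdot> hat_out C \<phi>) \<cdot> (bo C (wsrc \<phi>) \<cdot> x)"
      using b' k by (simp add: cmp_assoc' arr_hat_out(1-3) arr_box_proj[OF box_tgt])
    then show ?thesis using k wd_ports(3)[OF w k] by (simp add: arr_hat_out(4) at_cmp[OF box_src x])
  qed
  have mi: "hat_in C \<phi> \<cdot> ?m \<in> hom C Q (hat C (inp (wsrc \<phi>)))"
    using m by (simp add: hom_iff arr_cmp arr_hat_in)
  have mo: "hat_out C \<phi> \<cdot> (bo C (wsrc \<phi>) \<cdot> x) \<in> hom C Q (hat C (outp (wtgt \<phi>)))"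
    using b' by (simp add: hom_iff arr_cmp arr_hat_out)
  show ?thesis
  proof
    assume r: "wd_rel C \<phi> Q x y"
    have ?I
      using r by (intro bi_eqI[OF box_src b(1) mi]) (simp add: I at_cmp[OF box_src x, symmetric] wd_rel_def)
    moreover have ?O
      using r by (intro bo_eqI[OF box_tgt b(4) mo]) (simp add: O at_cmp[OF box_tgt y, symmetric] wd_rel_def)
    ultimately show "?I \<and> ?O" ..
  next
    assume "?I \<and> ?O"
    then show "wd_rel C \<phi> Q x y"
      using x y I O by (auto simp: wd_rel_def at_cmp(1)[OF box_src x] at_cmp(2)[OF box_tgt y])
  qed
qed

lemma wd_rel_homs: "wd_rel C \<phi> Q x y \<Longrightarrow> x \<in> hom C Q (bound C (wsrc \<phi>))"
  "wd_rel C \<phi> Q x y \<Longrightarrow> y \<in> hom C Q (bound C (wtgt \<phi>))"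
  by (auto simp: wd_rel_def)

text \<open>Together with \<open>wd_rel_legs\<close> this says that related pairs
  \<open>(x, y)\<close> are the same thing as elements of \<open>mid C \<phi>\<close>, seen through
  the two legs. The element is explicit because the cells of \<open>Spn\<close> are defined by
  explicit pairs.\<close>

lemma wd_rel_mid:
  assumes r: "wd_rel C \<phi> Q x y" and m: "m = pair C (bi C (wtgt \<phi>) \<cdot> y) (bo C (wsrc \<phi>) \<cdot> x)"
  shows "m \<in> hom C Q (mid C \<phi>)" "legL C \<phi> \<cdot> m = x" "legR C \<phi> \<cdot> m = y"
proof -
  note h = wd_rel_homs[OF r]
  note b = b_cmp_hom[OF box_src h(1)] b_cmp_hom[OF box_tgt h(2)]
  note b' = b[unfolded hom_iff]
  have m': "m \<in> arrs C" "src C m = Q" "tgt C m = mid C \<phi>" "mid1 C \<phi> \<cdot> m = bi C (wtgt \<phi>) \<cdot> y"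
      "mid2 C \<phi> \<cdot> m = bo C (wsrc \<phi>) \<cdot> x"
    using pair_lemma[of "bi C (wtgt \<phi>) \<cdot> y" "bo C (wsrc \<phi>) \<cdot> x"] b'
    by (auto simp: mid_def mid1_def mid2_def m)
  then show "m \<in> hom C Q (mid C \<phi>)" by (simp add: hom_iff)
  have l: "legL C \<phi> \<cdot> m \<in> hom C Q (bound C (wsrc \<phi>))" "legR C \<phi> \<cdot> m \<in> hom C Q (bound C (wtgt \<phi>))"
    using m' by (simp_all add: hom_iff arr_cmp arr_leg)
  note r' = r[unfolded wd_rel_iff[OF h], folded m]
  have 1: "bi C (wsrc \<phi>) \<cdot> (legL C \<phi> \<cdot> m) = bi C (wsrc \<phi>) \<cdot> x"
    using r' m' cmp_assoc'[of m "legL C \<phi>" "bi C (wsrc \<phi>)"] by (simp add: arr_leg arr_b[OF box_src])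
  have 2: "bo C (wsrc \<phi>) \<cdot> (legL C \<phi> \<cdot> m) = bo C (wsrc \<phi>) \<cdot> x"
    using r' m' cmp_assoc'[of m "legL C \<phi>" "bo C (wsrc \<phi>)"] by (simp add: arr_leg arr_b[OF box_src])
  have 3: "bi C (wtgt \<phi>) \<cdot> (legR C \<phi> \<cdot> m) = bi C (wtgt \<phi>) \<cdot> y"
    using r' m' cmp_assoc'[of m "legR C \<phi>" "bi C (wtgt \<phi>)"] by (simp add: arr_leg arr_b[OF box_tgt])
  have 4: "bo C (wtgt \<phi>) \<cdot> (legR C \<phi> \<cdot> m) = bo C (wtgt \<phi>) \<cdot> y"
    using r' m' cmp_assoc'[of m "legR C \<phi>" "bo C (wtgt \<phi>)"] cmp_assoc'[of m "mid2 C \<phi>" "hat_out C \<phi>"]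
    by (simp add: arr_leg arr_b[OF box_tgt] arr_mid arr_hat_out)
  show "legL C \<phi> \<cdot> m = x" by (rule bound_eqI'[OF box_src l(1) h(1) 1 2])
  show "legR C \<phi> \<cdot> m = y" by (rule bound_eqI'[OF box_tgt l(2) h(2) 3 4])
qed

lemma wd_rel_legs:
  assumes m: "m \<in> hom C Q (mid C \<phi>)"
  shows "wd_rel C \<phi> Q (legL C \<phi> \<cdot> m) (legR C \<phi> \<cdot> m)"
    "m = pair C (bi C (wtgt \<phi>) \<cdot> (legR C \<phi> \<cdot> m)) (bo C (wsrc \<phi>) \<cdot> (legL C \<phi> \<cdot> m))"
proof -
  have m': "m \<in> arrs C" "src C m = Q" "tgt C m = mid C \<phi>" using m by (auto simp: hom_iff)
  have l: "legL C \<phi> \<cdot> m \<in> hom C Q (bound C (wsrc \<phi>))" "legR C \<phi> \<cdot> m \<in> hom C Q (bound C (wtgt \<phi>))"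
    using m' by (simp_all add: hom_iff arr_cmp arr_leg)
  have e: "bi C (wsrc \<phi>) \<cdot> (legL C \<phi> \<cdot> m) = hat_in C \<phi> \<cdot> m" "bo C (wsrc \<phi>) \<cdot> (legL C \<phi> \<cdot> m) = mid2 C \<phi> \<cdot> m"
    "bi C (wtgt \<phi>) \<cdot> (legR C \<phi> \<cdot> m) = mid1 C \<phi> \<cdot> m" "bo C (wtgt \<phi>) \<cdot> (legR C \<phi> \<cdot> m) = hat_out C \<phi> \<cdot> (mid2 C \<phi> \<cdot> m)"
    using m' cmp_assoc'[of m "legL C \<phi>" "bi C (wsrc \<phi>)"] cmp_assoc'[of m "legL C \<phi>" "bo C (wsrc \<phi>)"]
      cmp_assoc'[of m "legR C \<phi>" "bi C (wtgt \<phi>)"] cmp_assoc'[of m "legR C \<phi>" "bo C (wtgt \<phi>)"]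
      cmp_assoc'[of m "mid2 C \<phi>" "hat_out C \<phi>"]
    by (simp_all add: arr_leg arr_b[OF box_src] arr_b[OF box_tgt] arr_mid arr_hat_out)
  have f: "mid1 C \<phi> \<cdot> m \<in> arrs C" "mid2 C \<phi> \<cdot> m \<in> arrs C" "src C (mid1 C \<phi> \<cdot> m) = src C (mid2 C \<phi> \<cdot> m)"
    "hat C (inp (wtgt \<phi>)) = tgt C (mid1 C \<phi> \<cdot> m)" "hat C (outp (wsrc \<phi>)) = tgt C (mid2 C \<phi> \<cdot> m)"
    "src C (mid2 C \<phi> \<cdot> m) = Q"
    using m' by (simp_all add: arr_cmp arr_mid)
  note p = pair_lemma[OF f(1-5), folded mid_def mid1_def mid2_def]
  have "pair C (mid1 C \<phi> \<cdot> m) (mid2 C \<phi> \<cdot> m) \<in> hom C Q (mid C \<phi>)"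
    using p(1-3) f(6) by (simp add: hom_iff)
  from prd_eqI[OF box_obs(1)[OF box_tgt] box_obs(2)[OF box_src], folded mid_def mid1_def mid2_def, OF m this p(4,5)[symmetric]]
  have "m = pair C (mid1 C \<phi> \<cdot> m) (mid2 C \<phi> \<cdot> m)" .
  with e show *: "m = pair C (bi C (wtgt \<phi>) \<cdot> (legR C \<phi> \<cdot> m)) (bo C (wsrc \<phi>) \<cdot> (legL C \<phi> \<cdot> m))" by simp
  show "wd_rel C \<phi> Q (legL C \<phi> \<cdot> m) (legR C \<phi> \<cdot> m)"
    unfolding wd_rel_iff[OF l] using *[symmetric] e by simp
qed

text \<open>Both \<open>x\<close> and \<open>x'\<close> are the image under \<open>legL\<close> of
  one element of \<open>mid C \<phi>\<close>, as that element is made of the inputs of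
  \<open>y\<close> and the common outputs. This becomes \<open>root_in\<close>.\<close>

lemma wd_rel_in:
  assumes r: "wd_rel C \<phi> Q x y" "wd_rel C \<phi> Q x' y" and e: "bo C (wsrc \<phi>) \<cdot> x = bo C (wsrc \<phi>) \<cdot> x'"
  shows "x = x'"
  using trans[OF wd_rel_mid(2)[OF r(1) refl, symmetric, unfolded e] wd_rel_mid(2)[OF r(2) refl]] .

text \<open>The outer outputs are \<open>hat_out\<close> applied to the inner outputs, whatever the
  inputs are. This becomes \<open>root_out\<close>.\<close>

lemma wd_rel_out:
  assumes r: "wd_rel C \<phi> Q x y" "wd_rel C \<phi> Q x' y'" and e: "bo C (wsrc \<phi>) \<cdot> x = bo C (wsrc \<phi>) \<cdot> x'"
  shows "bo C (wtgt \<phi>) \<cdot> y = bo C (wtgt \<phi>) \<cdot> y'"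
  using r[unfolded wd_rel_iff[OF wd_rel_homs[OF r(1)]] wd_rel_iff[OF wd_rel_homs[OF r(2)]]] e by simp

text \<open>Stability under precomposition is evident for elements of \<open>mid C \<phi>\<close>,
  so the relation is transported there and back.\<close>

lemma wd_rel_cmp:
  assumes r: "wd_rel C \<phi> Q x y" and e: "e \<in> hom C R Q"
  shows "wd_rel C \<phi> R (x \<cdot> e) (y \<cdot> e)"
proof -
  obtain m where m: "m \<in> hom C Q (mid C \<phi>)" "legL C \<phi> \<cdot> m = x" "legR C \<phi> \<cdot> m = y"
    using wd_rel_mid[OF r refl] by blast
  have "x \<cdot> e = legL C \<phi> \<cdot> (m \<cdot> e)" "y \<cdot> e = legR C \<phi> \<cdot> (m \<cdot> e)"
    using m(1) e unfolding m(2,3)[symmetric] by (simp_all add: cmp_assoc' arr_leg hom_iff)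
  then show ?thesis using wd_rel_legs(1)[OF cmp_hom[OF e m(1)]] by simp
qed

context
  fixes p assumes p: "p \<in> arrs C" "tgt C p = bound C (wsrc \<phi>)"
begin

lemma arr_act:
  "spn_act C \<phi> p \<in> arrs C" "src C (spn_act C \<phi> p) = pb_ob C p (legL C \<phi>)" "tgt C (spn_act C \<phi> p) = bound C (wtgt \<phi>)"
  "pb1 C p (legL C \<phi>) \<in> arrs C" "src C (pb1 C p (legL C \<phi>)) = pb_ob C p (legL C \<phi>)" "tgt C (pb1 C p (legL C \<phi>)) = src C p"
  using arr_pb[of p "legL C \<phi>"] p by (auto simp: spn_act_def arr_leg arr_cmp)

lemma act_rel:
  "wd_rel C \<phi> (src C (spn_act C \<phi> p)) (p \<cdot> pb1 C p (legL C \<phi>)) (spn_act C \<phi> p)"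
  using wd_rel_legs(1)[of "pb2 C p (legL C \<phi>)" "pb_ob C p (legL C \<phi>)"] arr_pb[of p "legL C \<phi>"] p
  by (simp add: spn_act_def arr_leg hom_iff arr_cmp)

text \<open>Brings the second projection into the form used in \<open>act_lift\<close>, so that the
  lift in the definition of \<open>spn_act_ar\<close> can be recognized as one built from boundary
  data.\<close>

lemma act_pb2:
  "pb2 C p (legL C \<phi>) = pair C (bi C (wtgt \<phi>) \<cdot> spn_act C \<phi> p) (bo C (wsrc \<phi>) \<cdot> (p \<cdot> pb1 C p (legL C \<phi>)))"
proof -
  have pb: "pb2 C p (legL C \<phi>) \<in> hom C (pb_ob C p (legL C \<phi>)) (mid C \<phi>)"
    "p \<cdot> pb1 C p (legL C \<phi>) = legL C \<phi> \<cdot> pb2 C p (legL C \<phi>)"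
    using arr_pb[of p "legL C \<phi>"] p by (auto simp: arr_leg hom_iff)
  show ?thesis unfolding pb(2) spn_act_def by (rule wd_rel_legs(2)[OF pb(1)])
qed

text \<open>The universal property of the apex, rephrased: in place of an arrow to
  \<open>mid C \<phi>\<close> it takes a boundary \<open>y\<close> related to
  \<open>p \<cdot> u\<close>, from which \<open>wd_rel_mid\<close> builds that arrow. The formula
  for \<open>v\<close> matches the cells of \<open>Spn\<close>.\<close>

lemma act_lift:
  assumes u: "u \<in> hom C Q (src C p)" and r: "wd_rel C \<phi> Q (p \<cdot> u) y"
    and v: "v = pb_lift C p (legL C \<phi>) u (pair C (bi C (wtgt \<phi>) \<cdot> y) (bo C (wsrc \<phi>) \<cdot> (p \<cdot> u)))"
  shows "v \<in> hom C Q (src C (spn_act C \<phi> p))" "pb1 C p (legL C \<phi>) \<cdot> v = u" "spn_act C \<phi> p \<cdot> v = y"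
proof -
  note m = wd_rel_mid[OF r refl]
  note l = pb_lift_lemma[of p "legL C \<phi>" u "pair C (bi C (wtgt \<phi>) \<cdot> y) (bo C (wsrc \<phi>) \<cdot> (p \<cdot> u))", folded v]
  have l': "v \<in> arrs C" "src C v = src C u" "tgt C v = pb_ob C p (legL C \<phi>)"
    "pb1 C p (legL C \<phi>) \<cdot> v = u"
    "pb2 C p (legL C \<phi>) \<cdot> v = pair C (bi C (wtgt \<phi>) \<cdot> y) (bo C (wsrc \<phi>) \<cdot> (p \<cdot> u))"
    using l m u p by (auto simp: arr_leg hom_iff)
  then show "v \<in> hom C Q (src C (spn_act C \<phi> p))" "pb1 C p (legL C \<phi>) \<cdot> v = u"
    using u by (simp_all add: hom_iff arr_act)
  have "spn_act C \<phi> p \<cdot> v = legR C \<phi> \<cdot> (pb2 C p (legL C \<phi>) \<cdot> v)"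
    using l' arr_pb[of p "legL C \<phi>"] p by (simp add: spn_act_def cmp_assoc' arr_leg)
  then show "spn_act C \<phi> p \<cdot> v = y" using l' m by simp
qed

lemma act_sep:
  assumes x: "x \<in> hom C Q (src C (spn_act C \<phi> p))" and y: "y \<in> hom C Q (src C (spn_act C \<phi> p))"
    and e: "spn_act C \<phi> p \<cdot> x = spn_act C \<phi> p \<cdot> y" "pb1 C p (legL C \<phi>) \<cdot> x = pb1 C p (legL C \<phi>) \<cdot> y"
  shows "x = y"
proof (rule pb_eqI[of p "legL C \<phi>"])
  have f: "p \<in> arrs C" "legL C \<phi> \<in> arrs C" "tgt C p = tgt C (legL C \<phi>)" using p by (auto simp: arr_leg)
  show "p \<in> arrs C" "legL C \<phi> \<in> arrs C" "tgt C p = tgt C (legL C \<phi>)" by (rule f)+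
  note pb = arr_pb[OF f]
  show "x \<in> hom C Q (pb_ob C p (legL C \<phi>))" "y \<in> hom C Q (pb_ob C p (legL C \<phi>))"
    using x y by (simp_all add: arr_act)
  show "pb1 C p (legL C \<phi>) \<cdot> x = pb1 C p (legL C \<phi>) \<cdot> y" by fact
  \<comment> \<open>An element of \<open>mid C \<phi>\<close> is determined by its images under the
    two legs. For the second projection these images are the boundary of the action and the inner
    boundary seen through the root.\<close>
  have *: "pb2 C p (legL C \<phi>) \<cdot> z = pair C (bi C (wtgt \<phi>) \<cdot> (spn_act C \<phi> p \<cdot> z)) (bo C (wsrc \<phi>) \<cdot> (p \<cdot> (pb1 C p (legL C \<phi>) \<cdot> z)))"
    if z: "z \<in> hom C Q (src C (spn_act C \<phi> p))" for z
  proof -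
    have z': "z \<in> arrs C" "src C z = Q" "tgt C z = pb_ob C p (legL C \<phi>)" using z by (auto simp: hom_iff arr_act)
    have "legR C \<phi> \<cdot> (pb2 C p (legL C \<phi>) \<cdot> z) = spn_act C \<phi> p \<cdot> z"
      using z' pb by (simp add: spn_act_def cmp_assoc' arr_leg)
    moreover have "legL C \<phi> \<cdot> (pb2 C p (legL C \<phi>) \<cdot> z) = p \<cdot> (pb1 C p (legL C \<phi>) \<cdot> z)"
      using z' pb p cmp_assoc'[of z "pb2 C p (legL C \<phi>)" "legL C \<phi>"] cmp_assoc'[of z "pb1 C p (legL C \<phi>)" p]
      by (simp add: arr_leg)
    moreover have "pb2 C p (legL C \<phi>) \<cdot> z \<in> hom C Q (mid C \<phi>)"
      using z' pb by (simp add: hom_iff arr_cmp arr_leg)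
    ultimately show ?thesis using wd_rel_legs(2)[of "pb2 C p (legL C \<phi>) \<cdot> z" Q] by simp
  qed
  show "pb2 C p (legL C \<phi>) \<cdot> x = pb2 C p (legL C \<phi>) \<cdot> y"
    unfolding *[OF x] *[OF y] e ..
qed

end

end

end

text \<open>\<open>spl\<close> and \<open>spr\<close> (split left and right) exhibit the boundary of
  a sum as a product of the two boundaries; \<open>sum_eqI\<close> and \<open>join_lemma\<close> are
  its universal property. With them laxators and sums can be treated without mentioning
  ports.\<close>

definition spl :: "('o, 'm, 'z) cat_scheme \<Rightarrow> ('l, 'o) box \<Rightarrow> ('l, 'o) box \<Rightarrow> 'm" where
  "spl C X Y = to_bound C X (bound C (box_sum X Y)) (\<lambda>i. in_at C (box_sum X Y) (InL i)) (\<lambda>k. out_at C (box_sum X Y) (InL k))"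

definition spr :: "('o, 'm, 'z) cat_scheme \<Rightarrow> ('l, 'o) box \<Rightarrow> ('l, 'o) box \<Rightarrow> 'm" where
  "spr C X Y = to_bound C Y (bound C (box_sum X Y)) (\<lambda>i. in_at C (box_sum X Y) (InR i)) (\<lambda>k. out_at C (box_sum X Y) (InR k))"

section \<open>The relation for composites, sums and coherence diagrams\<close>

context finitely_complete
begin

lemma at_hom:
  assumes "is_box C X"
  shows "i \<in> dom (inp X) \<Longrightarrow> in_at C X i \<in> hom C (bound C X) (the (inp X i))"
    "k \<in> dom (outp X) \<Longrightarrow> out_at C X k \<in> hom C (bound C X) (the (outp X k))"
  using arr_at[OF assms] by (auto simp: hom_iff)

lemma at_cmp_hom:
  assumes "is_box C X" "x \<in> hom C Q (bound C X)"
  shows "i \<in> dom (inp X) \<Longrightarrow> in_at C X i \<cdot> x \<in> hom C Q (the (inp X i))"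
    "k \<in> dom (outp X) \<Longrightarrow> out_at C X k \<cdot> x \<in> hom C Q (the (outp X k))"
  using at_hom[OF assms(1)] cmp_hom[OF assms(2)] by auto

text \<open>An inner input is traced through \<open>\<phi>\<close> and then through
  \<open>\<psi>\<close>. If \<open>\<psi>\<close> feeds it from an output of the middle box, the
  relation for \<open>\<phi>\<close> identifies that output with an output of the inner box.\<close>

lemma wd_rel_comp:
  assumes w: "is_wd C \<phi>" "is_wd C \<psi>" and e: "wtgt \<phi> = wsrc \<psi>"
    and r: "wd_rel C \<phi> Q x y" "wd_rel C \<psi> Q y z"
  shows "wd_rel C (wd_comp \<psi> \<phi>) Q x z"
  unfolding wd_rel_def
proof (intro conjI ballI)
  show "x \<in> hom C Q (bound C (wsrc (wd_comp \<psi> \<phi>)))" "z \<in> hom C Q (bound C (wtgt (wd_comp \<psi> \<phi>)))"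
    using r by (auto simp: wd_rel_def)
  fix i assume "i \<in> dom (inp (wsrc (wd_comp \<psi> \<phi>)))"
  then obtain a where a: "inp (wsrc \<phi>) i = Some a" by auto
  have i: "i \<in> dom (inp (wsrc \<phi>))" using a by auto
  show "in_at C (wsrc (wd_comp \<psi> \<phi>)) i \<cdot> x = (case win (wd_comp \<psi> \<phi>) i of
      Inl j \<Rightarrow> out_at C (wsrc (wd_comp \<psi> \<phi>)) j \<cdot> x | Inr j \<Rightarrow> in_at C (wtgt (wd_comp \<psi> \<phi>)) j \<cdot> z)"
  proof (cases "win \<phi> i")
    case (Inl j)
    then show ?thesis using r(1) a i by (simp add: wd_rel_def)
  next
    case (Inr j)
    then have j: "j \<in> dom (inp (wsrc \<psi>))" using wd_ports(2)[OF w(1) i] e by simp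
    then have "in_at C (wsrc \<phi>) i \<cdot> x = in_at C (wsrc \<psi>) j \<cdot> y" using r(1) i Inr e by (simp add: wd_rel_def)
    also have "\<dots> = (case win \<psi> j of Inl j \<Rightarrow> out_at C (wsrc \<psi>) j \<cdot> y | Inr j \<Rightarrow> in_at C (wtgt \<psi>) j \<cdot> z)"
      using r(2) j by (simp add: wd_rel_def)
    also have "\<dots> = (case win \<psi> j of Inl j \<Rightarrow> out_at C (wsrc \<phi>) (wout \<phi> j) \<cdot> x | Inr j \<Rightarrow> in_at C (wtgt \<psi>) j \<cdot> z)"
      using r(1) e wd_ports(1)[OF w(2) j] by (simp add: wd_rel_def split: sum.split)
    finally show ?thesis using a Inr by (simp split: sum.split)
  qed
next
  fix k assume "k \<in> dom (outp (wtgt (wd_comp \<psi> \<phi>)))"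
  then obtain a where a: "outp (wtgt \<psi>) k = Some a" by auto
  then show "out_at C (wtgt (wd_comp \<psi> \<phi>)) k \<cdot> z = out_at C (wsrc (wd_comp \<psi> \<phi>)) (wout (wd_comp \<psi> \<phi>) k) \<cdot> x"
    using r e wd_ports(3)[OF w(2)] by (simp add: wd_rel_def domI)
qed

text \<open>The middle boundary is forced: its outputs are read off from \<open>x\<close> along
  \<open>wout \<phi>\<close>, and its inputs, as \<open>\<psi>\<close> prescribes, either from these
  outputs or from the inputs of \<open>z\<close>.\<close>

lemma wd_rel_comp_ex:
  assumes w: "is_wd C \<phi>" "is_wd C \<psi>" and e: "wtgt \<phi> = wsrc \<psi>"
    and r: "wd_rel C (wd_comp \<psi> \<phi>) Q x z"
  obtains y where "wd_rel C \<phi> Q x y" "wd_rel C \<psi> Q y z"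
proof -
  have x: "x \<in> hom C Q (bound C (wsrc \<phi>))" and z: "z \<in> hom C Q (bound C (wtgt \<psi>))"
    using r by (auto simp: wd_rel_def)
  note X = is_wd_boxes(1)[OF w(1)] and Y = is_wd_boxes(1)[OF w(2)] and Z = is_wd_boxes(2)[OF w(2)]
  let ?g = "\<lambda>k. out_at C (wsrc \<phi>) (wout \<phi> k) \<cdot> x"
  let ?f = "\<lambda>j. case win \<psi> j of Inl k \<Rightarrow> ?g k | Inr l \<Rightarrow> in_at C (wtgt \<psi>) l \<cdot> z"
  define y where "y = to_bound C (wsrc \<psi>) Q ?f ?g"
  have g: "?g k \<in> hom C Q (the (outp (wsrc \<psi>) k))" if "k \<in> dom (outp (wsrc \<psi>))" for k
    using wd_ports(3)[OF w(1)] that e at_cmp_hom(2)[OF X x, of "wout \<phi> k"] by simp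
  have f: "?f j \<in> hom C Q (the (inp (wsrc \<psi>) j))" if "j \<in> dom (inp (wsrc \<psi>))" for j
    using wd_ports(1,2)[OF w(2) that] g at_cmp_hom(1)[OF Z z] by (simp split: sum.split) metis
  have t: "y \<in> hom C Q (bound C (wsrc \<psi>))" "\<And>j. j \<in> dom (inp (wsrc \<psi>)) \<Longrightarrow> in_at C (wsrc \<psi>) j \<cdot> y = ?f j"
    "\<And>k. k \<in> dom (outp (wsrc \<psi>)) \<Longrightarrow> out_at C (wsrc \<psi>) k \<cdot> y = ?g k"
    using to_bound_lemma[where f = ?f and g = ?g, OF Y hom_src_obs[OF x] f g] unfolding y_def by simp_all
  have "wd_rel C \<psi> Q y z"
    unfolding wd_rel_def
  proof (intro conjI ballI)
    fix j assume j: "j \<in> dom (inp (wsrc \<psi>))"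
    show "in_at C (wsrc \<psi>) j \<cdot> y = (case win \<psi> j of Inl k \<Rightarrow> out_at C (wsrc \<psi>) k \<cdot> y | Inr l \<Rightarrow> in_at C (wtgt \<psi>) l \<cdot> z)"
      using t(2)[OF j] t(3) wd_ports(1)[OF w(2) j] by (simp split: sum.split)
  next
    fix l assume l: "l \<in> dom (outp (wtgt \<psi>))"
    show "out_at C (wtgt \<psi>) l \<cdot> z = out_at C (wsrc \<psi>) (wout \<psi> l) \<cdot> y"
      using r l t(3)[of "wout \<psi> l"] wd_ports(3)[OF w(2) l] by (auto simp: wd_rel_def)
  qed (use t z in auto)
  moreover have "wd_rel C \<phi> Q x y"
    unfolding wd_rel_def
  proof (intro conjI ballI)
    fix i assume i: "i \<in> dom (inp (wsrc \<phi>))"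
    then obtain a where a: "inp (wsrc \<phi>) i = Some a" by auto
    have ri: "in_at C (wsrc \<phi>) i \<cdot> x = (case win (wd_comp \<psi> \<phi>) i of
        Inl j \<Rightarrow> out_at C (wsrc \<phi>) j \<cdot> x | Inr j \<Rightarrow> in_at C (wtgt \<psi>) j \<cdot> z)"
      using r[unfolded wd_rel_def wd_comp_simps(1,2)] i by blast
    show "in_at C (wsrc \<phi>) i \<cdot> x = (case win \<phi> i of Inl k \<Rightarrow> out_at C (wsrc \<phi>) k \<cdot> x | Inr j \<Rightarrow> in_at C (wtgt \<phi>) j \<cdot> y)"
    proof (cases "win \<phi> i")
      case (Inl j)
      then show ?thesis using ri a by simp
    next
      case (Inr j)
      then have j: "j \<in> dom (inp (wsrc \<psi>))" using wd_ports(2)[OF w(1) i] e by simp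
      show ?thesis using ri a Inr t(2)[OF j] e by (simp split: sum.splits)
    qed
  next
    fix k assume k: "k \<in> dom (outp (wtgt \<phi>))"
    show "out_at C (wtgt \<phi>) k \<cdot> y = out_at C (wsrc \<phi>) (wout \<phi> k) \<cdot> x"
      using t(3) k e by simp
  qed (use t x e in auto)
  ultimately show ?thesis using that by blast
qed

lemma wd_rel_relabel:
  "wd_rel C (relabel X Y f g) Q x y \<longleftrightarrow> x \<in> hom C Q (bound C X) \<and> y \<in> hom C Q (bound C Y) \<and>
     (\<forall>i\<in>dom (inp X). in_at C X i \<cdot> x = in_at C Y (f i) \<cdot> y) \<and>
     (\<forall>k\<in>dom (outp Y). out_at C Y k \<cdot> y = out_at C X (g k) \<cdot> x)"
  unfolding wd_rel_def by (simp add: relabel_def cong: ball_cong)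

lemma wd_rel_id: "is_box C X \<Longrightarrow> wd_rel C (wd_id X) Q x y \<longleftrightarrow> x \<in> hom C Q (bound C X) \<and> y = x"
  unfolding wd_id_def wd_rel_relabel id_apply by (metis bound_eqI)

context
  fixes X Y :: "('l, 'o) box"
  assumes X: "is_box C X" and Y: "is_box C Y"
begin

lemma spl_lemma:
  "spl C X Y \<in> hom C (bound C (box_sum X Y)) (bound C X)"
  "i \<in> dom (inp X) \<Longrightarrow> in_at C X i \<cdot> spl C X Y = in_at C (box_sum X Y) (InL i)"
  "k \<in> dom (outp X) \<Longrightarrow> out_at C X k \<cdot> spl C X Y = out_at C (box_sum X Y) (InL k)"
proof -
  note B = is_box_sum[OF X Y]
  have 1: "\<And>i. i \<in> dom (inp X) \<Longrightarrow> in_at C (box_sum X Y) (InL i) \<in> hom C (bound C (box_sum X Y)) (the (inp X i))"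
    "\<And>k. k \<in> dom (outp X) \<Longrightarrow> out_at C (box_sum X Y) (InL k) \<in> hom C (bound C (box_sum X Y)) (the (outp X k))"
    using at_hom(1)[OF B, of "InL _"] at_hom(2)[OF B, of "InL _"] by (simp_all add: dom_tsum)
  note * = to_bound_lemma[where f = "\<lambda>i. in_at C (box_sum X Y) (InL i)" and g = "\<lambda>k. out_at C (box_sum X Y) (InL k)",
    OF X box_obs(3)[OF B] 1, folded spl_def]
  show "spl C X Y \<in> hom C (bound C (box_sum X Y)) (bound C X)"
    "i \<in> dom (inp X) \<Longrightarrow> in_at C X i \<cdot> spl C X Y = in_at C (box_sum X Y) (InL i)"
    "k \<in> dom (outp X) \<Longrightarrow> out_at C X k \<cdot> spl C X Y = out_at C (box_sum X Y) (InL k)"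
    using * by auto
qed

lemma spr_lemma:
  "spr C X Y \<in> hom C (bound C (box_sum X Y)) (bound C Y)"
  "i \<in> dom (inp Y) \<Longrightarrow> in_at C Y i \<cdot> spr C X Y = in_at C (box_sum X Y) (InR i)"
  "k \<in> dom (outp Y) \<Longrightarrow> out_at C Y k \<cdot> spr C X Y = out_at C (box_sum X Y) (InR k)"
proof -
  note B = is_box_sum[OF X Y]
  have 1: "\<And>i. i \<in> dom (inp Y) \<Longrightarrow> in_at C (box_sum X Y) (InR i) \<in> hom C (bound C (box_sum X Y)) (the (inp Y i))"
    "\<And>k. k \<in> dom (outp Y) \<Longrightarrow> out_at C (box_sum X Y) (InR k) \<in> hom C (bound C (box_sum X Y)) (the (outp Y k))"
    using at_hom(1)[OF B, of "InR _"] at_hom(2)[OF B, of "InR _"] by (simp_all add: dom_tsum)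
  note * = to_bound_lemma[where f = "\<lambda>i. in_at C (box_sum X Y) (InR i)" and g = "\<lambda>k. out_at C (box_sum X Y) (InR k)",
    OF Y box_obs(3)[OF B] 1, folded spr_def]
  show "spr C X Y \<in> hom C (bound C (box_sum X Y)) (bound C Y)"
    "i \<in> dom (inp Y) \<Longrightarrow> in_at C Y i \<cdot> spr C X Y = in_at C (box_sum X Y) (InR i)"
    "k \<in> dom (outp Y) \<Longrightarrow> out_at C Y k \<cdot> spr C X Y = out_at C (box_sum X Y) (InR k)"
    using * by auto
qed

context
  fixes z Q
  assumes z: "z \<in> hom C Q (bound C (box_sum X Y))"
begin

lemma sp_hom: "spl C X Y \<cdot> z \<in> hom C Q (bound C X)" "spr C X Y \<cdot> z \<in> hom C Q (bound C Y)"
  using cmp_hom[OF z spl_lemma(1)] cmp_hom[OF z spr_lemma(1)] .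

lemma at_sp:
  "i \<in> dom (inp X) \<Longrightarrow> in_at C X i \<cdot> (spl C X Y \<cdot> z) = in_at C (box_sum X Y) (InL i) \<cdot> z"
  "k \<in> dom (outp X) \<Longrightarrow> out_at C X k \<cdot> (spl C X Y \<cdot> z) = out_at C (box_sum X Y) (InL k) \<cdot> z"
  "j \<in> dom (inp Y) \<Longrightarrow> in_at C Y j \<cdot> (spr C X Y \<cdot> z) = in_at C (box_sum X Y) (InR j) \<cdot> z"
  "l \<in> dom (outp Y) \<Longrightarrow> out_at C Y l \<cdot> (spr C X Y \<cdot> z) = out_at C (box_sum X Y) (InR l) \<cdot> z"
  using cmp_assoc[OF z spl_lemma(1) at_hom(1)[OF X]] cmp_assoc[OF z spl_lemma(1) at_hom(2)[OF X]]
    cmp_assoc[OF z spr_lemma(1) at_hom(1)[OF Y]] cmp_assoc[OF z spr_lemma(1) at_hom(2)[OF Y]]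
  by (simp_all add: spl_lemma(2,3) spr_lemma(2,3))

end

lemma sum_eqI:
  assumes "z \<in> hom C Q (bound C (box_sum X Y))" "z' \<in> hom C Q (bound C (box_sum X Y))"
    and "spl C X Y \<cdot> z = spl C X Y \<cdot> z'" "spr C X Y \<cdot> z = spr C X Y \<cdot> z'"
  shows "z = z'"
proof (rule bound_eqI[OF is_box_sum[OF X Y] assms(1,2)])
  fix i assume "i \<in> dom (inp (box_sum X Y))"
  then consider j where "i = InL j" "j \<in> dom (inp X)" | j where "i = InR j" "j \<in> dom (inp Y)"
    by (auto simp: dom_tsum)
  then show "in_at C (box_sum X Y) i \<cdot> z = in_at C (box_sum X Y) i \<cdot> z'"
    by cases (use at_sp[OF assms(1)] at_sp[OF assms(2)] assms(3,4) in simp_all)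
next
  fix i assume "i \<in> dom (outp (box_sum X Y))"
  then consider j where "i = InL j" "j \<in> dom (outp X)" | j where "i = InR j" "j \<in> dom (outp Y)"
    by (auto simp: dom_tsum)
  then show "out_at C (box_sum X Y) i \<cdot> z = out_at C (box_sum X Y) i \<cdot> z'"
    by cases (use at_sp[OF assms(1)] at_sp[OF assms(2)] assms(3,4) in simp_all)
qed

text \<open>Compares outputs only, since \<open>mu_out\<close> is applied at a stage where the
  inputs are not yet known to agree.\<close>

lemma bo_sum:
  assumes z: "z \<in> hom C Q (bound C (box_sum X Y))" and z': "z' \<in> hom C Q (bound C (box_sum X Y))"
    and e: "bo C X \<cdot> (spl C X Y \<cdot> z) = bo C X \<cdot> (spl C X Y \<cdot> z')" "bo C Y \<cdot> (spr C X Y \<cdot> z) = bo C Y \<cdot> (spr C X Y \<cdot> z')"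
  shows "bo C (box_sum X Y) \<cdot> z = bo C (box_sum X Y) \<cdot> z'"
proof (rule bo_eqI[OF is_box_sum[OF X Y]])
  note B = is_box_sum[OF X Y]
  show "bo C (box_sum X Y) \<cdot> z \<in> hom C Q (hat C (outp (box_sum X Y)))" by (rule b_cmp_hom[OF B z])
  show "bo C (box_sum X Y) \<cdot> z' \<in> hom C Q (hat C (outp (box_sum X Y)))" by (rule b_cmp_hom[OF B z'])
  fix k assume k: "k \<in> dom (outp (box_sum X Y))"
  have "out_at C (box_sum X Y) k \<cdot> z = out_at C (box_sum X Y) k \<cdot> z'"
  proof -
    from k consider j where "k = InL j" "j \<in> dom (outp X)" | j where "k = InR j" "j \<in> dom (outp Y)"
      by (auto simp: dom_tsum)
    then show ?thesis
    proof cases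
      case 1
      have "out_at C X j \<cdot> (spl C X Y \<cdot> z) = out_at C X j \<cdot> (spl C X Y \<cdot> z')"
        by (simp only: at_cmp(2)[OF X sp_hom(1)[OF z] 1(2)] at_cmp(2)[OF X sp_hom(1)[OF z'] 1(2)] e)
      then show ?thesis using at_sp(2)[OF z 1(2)] at_sp(2)[OF z' 1(2)] 1(1) by simp
    next
      case 2
      have "out_at C Y j \<cdot> (spr C X Y \<cdot> z) = out_at C Y j \<cdot> (spr C X Y \<cdot> z')"
        by (simp only: at_cmp(2)[OF Y sp_hom(2)[OF z] 2(2)] at_cmp(2)[OF Y sp_hom(2)[OF z'] 2(2)] e)
      then show ?thesis using at_sp(4)[OF z 2(2)] at_sp(4)[OF z' 2(2)] 2(1) by simp
    qed
  qed
  then show "proj C (outp (box_sum X Y)) k \<cdot> (bo C (box_sum X Y) \<cdot> z) = proj C (outp (box_sum X Y)) k \<cdot> (bo C (box_sum X Y) \<cdot> z')"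
    using at_cmp(2)[OF B z k] at_cmp(2)[OF B z' k] by simp
qed

text \<open>The existence counterpart of \<open>sum_eqI\<close>. The arrow is given by
  \<open>to_bound\<close> and \<open>port_case\<close> because this is the form in which
  \<open>spn_lax\<close> is defined.\<close>

lemma join_lemma:
  assumes x: "x \<in> hom C Q (bound C X)" and y: "y \<in> hom C Q (bound C Y)"
    and z: "z = to_bound C (box_sum X Y) Q (port_case (\<lambda>i. in_at C X i \<cdot> x) (\<lambda>i. in_at C Y i \<cdot> y))
      (port_case (\<lambda>i. out_at C X i \<cdot> x) (\<lambda>i. out_at C Y i \<cdot> y))"
  shows "z \<in> hom C Q (bound C (box_sum X Y))" "spl C X Y \<cdot> z = x" "spr C X Y \<cdot> z = y"
proof -
  note B = is_box_sum[OF X Y]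
  let ?f = "port_case (\<lambda>i. in_at C X i \<cdot> x) (\<lambda>i. in_at C Y i \<cdot> y)"
  let ?g = "port_case (\<lambda>i. out_at C X i \<cdot> x) (\<lambda>i. out_at C Y i \<cdot> y)"
  have f: "?f i \<in> hom C Q (the (inp (box_sum X Y) i))" if "i \<in> dom (inp (box_sum X Y))" for i
    using that[unfolded box_simps dom_tsum] at_cmp_hom(1)[OF X x] at_cmp_hom(1)[OF Y y] by (elim UnE imageE) simp_all
  have g: "?g i \<in> hom C Q (the (outp (box_sum X Y) i))" if "i \<in> dom (outp (box_sum X Y))" for i
    using that[unfolded box_simps dom_tsum] at_cmp_hom(2)[OF X x] at_cmp_hom(2)[OF Y y] by (elim UnE imageE) simp_all
  have t: "z \<in> hom C Q (bound C (box_sum X Y))" "\<And>i. i \<in> dom (inp (box_sum X Y)) \<Longrightarrow> in_at C (box_sum X Y) i \<cdot> z = ?f i"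
    "\<And>k. k \<in> dom (outp (box_sum X Y)) \<Longrightarrow> out_at C (box_sum X Y) k \<cdot> z = ?g k"
    using to_bound_lemma[where f = ?f and g = ?g, OF B hom_src_obs[OF x] f g] unfolding z by simp_all
  show h: "z \<in> hom C Q (bound C (box_sum X Y))" by (rule t)
  show "spl C X Y \<cdot> z = x"
    by (rule bound_eqI[OF X sp_hom(1)[OF h] x]) (simp_all add: at_sp[OF h] t(2,3) dom_tsum)
  show "spr C X Y \<cdot> z = y"
    by (rule bound_eqI[OF Y sp_hom(2)[OF h] y]) (simp_all add: at_sp[OF h] t(2,3) dom_tsum)
qed

lemma spn_lax_lemma:
  assumes p: "p \<in> arrs C" "tgt C p = bound C X" and q: "q \<in> arrs C" "tgt C q = bound C Y"
  shows "spn_lax C X Y (p, q) \<in> hom C (prd C (src C p) (src C q)) (bound C (box_sum X Y))"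
    "spl C X Y \<cdot> spn_lax C X Y (p, q) = p \<cdot> pr1 C (src C p) (src C q)"
    "spr C X Y \<cdot> spn_lax C X Y (p, q) = q \<cdot> pr2 C (src C p) (src C q)"
proof -
  note a = arr_pr[OF src_obs[OF p(1)] src_obs[OF q(1)]]
  have x: "p \<cdot> pr1 C (src C p) (src C q) \<in> hom C (prd C (src C p) (src C q)) (bound C X)"
    and y: "q \<cdot> pr2 C (src C p) (src C q) \<in> hom C (prd C (src C p) (src C q)) (bound C Y)"
    using a p q by (auto simp: hom_iff arr_cmp)
  note j = join_lemma[OF x y refl]
  show "spn_lax C X Y (p, q) \<in> hom C (prd C (src C p) (src C q)) (bound C (box_sum X Y))"
    "spl C X Y \<cdot> spn_lax C X Y (p, q) = p \<cdot> pr1 C (src C p) (src C q)"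
    "spr C X Y \<cdot> spn_lax C X Y (p, q) = q \<cdot> pr2 C (src C p) (src C q)"
    unfolding spn_lax_def prod.case Let_def using j by auto
qed

end

text \<open>No wire of \<open>wd_sum\<close> connects the two summands, so the port equations fall
  into two independent groups.\<close>

lemma wd_rel_sum:
  assumes w: "is_wd C \<phi>" "is_wd C \<psi>" and x: "x \<in> hom C Q (bound C (box_sum (wsrc \<phi>) (wsrc \<psi>)))"
    and y: "y \<in> hom C Q (bound C (box_sum (wtgt \<phi>) (wtgt \<psi>)))"
  shows "wd_rel C (wd_sum \<phi> \<psi>) Q x y \<longleftrightarrow>
     wd_rel C \<phi> Q (spl C (wsrc \<phi>) (wsrc \<psi>) \<cdot> x) (spl C (wtgt \<phi>) (wtgt \<psi>) \<cdot> y) \<and>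
     wd_rel C \<psi> Q (spr C (wsrc \<phi>) (wsrc \<psi>) \<cdot> x) (spr C (wtgt \<phi>) (wtgt \<psi>) \<cdot> y)" (is "?l \<longleftrightarrow> ?r1 \<and> ?r2")
proof -
  note X = is_wd_boxes(1)[OF w(1)] is_wd_boxes(1)[OF w(2)] and Y = is_wd_boxes(2)[OF w(1)] is_wd_boxes(2)[OF w(2)]
  note ax = at_sp[OF X x] and ay = at_sp[OF Y y]
  have I1: "in_at C (box_sum (wsrc \<phi>) (wsrc \<psi>)) (InL i) \<cdot> x = (case win (wd_sum \<phi> \<psi>) (InL i) of
        Inl j \<Rightarrow> out_at C (box_sum (wsrc \<phi>) (wsrc \<psi>)) j \<cdot> x | Inr j \<Rightarrow> in_at C (box_sum (wtgt \<phi>) (wtgt \<psi>)) j \<cdot> y)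
      \<longleftrightarrow> in_at C (wsrc \<phi>) i \<cdot> (spl C (wsrc \<phi>) (wsrc \<psi>) \<cdot> x) = (case win \<phi> i of
        Inl j \<Rightarrow> out_at C (wsrc \<phi>) j \<cdot> (spl C (wsrc \<phi>) (wsrc \<psi>) \<cdot> x)
      | Inr j \<Rightarrow> in_at C (wtgt \<phi>) j \<cdot> (spl C (wtgt \<phi>) (wtgt \<psi>) \<cdot> y))" if i: "i \<in> dom (inp (wsrc \<phi>))" for i
    using i wd_ports(1,2)[OF w(1) i] ax ay by (cases "win \<phi> i") auto
  have I2: "in_at C (box_sum (wsrc \<phi>) (wsrc \<psi>)) (InR i) \<cdot> x = (case win (wd_sum \<phi> \<psi>) (InR i) of
        Inl j \<Rightarrow> out_at C (box_sum (wsrc \<phi>) (wsrc \<psi>)) j \<cdot> x | Inr j \<Rightarrow> in_at C (box_sum (wtgt \<phi>) (wtgt \<psi>)) j \<cdot> y)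
      \<longleftrightarrow> in_at C (wsrc \<psi>) i \<cdot> (spr C (wsrc \<phi>) (wsrc \<psi>) \<cdot> x) = (case win \<psi> i of
        Inl j \<Rightarrow> out_at C (wsrc \<psi>) j \<cdot> (spr C (wsrc \<phi>) (wsrc \<psi>) \<cdot> x)
      | Inr j \<Rightarrow> in_at C (wtgt \<psi>) j \<cdot> (spr C (wtgt \<phi>) (wtgt \<psi>) \<cdot> y))" if i: "i \<in> dom (inp (wsrc \<psi>))" for i
    using i wd_ports(1,2)[OF w(2) i] ax ay by (cases "win \<psi> i") auto
  have O1: "out_at C (box_sum (wtgt \<phi>) (wtgt \<psi>)) (InL k) \<cdot> y = out_at C (box_sum (wsrc \<phi>) (wsrc \<psi>)) (wout (wd_sum \<phi> \<psi>) (InL k)) \<cdot> x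
      \<longleftrightarrow> out_at C (wtgt \<phi>) k \<cdot> (spl C (wtgt \<phi>) (wtgt \<psi>) \<cdot> y) = out_at C (wsrc \<phi>) (wout \<phi> k) \<cdot> (spl C (wsrc \<phi>) (wsrc \<psi>) \<cdot> x)"
    if k: "k \<in> dom (outp (wtgt \<phi>))" for k
    using k wd_ports(3)[OF w(1) k] ax ay by auto
  have O2: "out_at C (box_sum (wtgt \<phi>) (wtgt \<psi>)) (InR k) \<cdot> y = out_at C (box_sum (wsrc \<phi>) (wsrc \<psi>)) (wout (wd_sum \<phi> \<psi>) (InR k)) \<cdot> x
      \<longleftrightarrow> out_at C (wtgt \<psi>) k \<cdot> (spr C (wtgt \<phi>) (wtgt \<psi>) \<cdot> y) = out_at C (wsrc \<psi>) (wout \<psi> k) \<cdot> (spr C (wsrc \<phi>) (wsrc \<psi>) \<cdot> x)"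
    if k: "k \<in> dom (outp (wtgt \<psi>))" for k
    using k wd_ports(3)[OF w(2) k] ax ay by auto
  show ?thesis
    unfolding wd_rel_def[of C "wd_sum \<phi> \<psi>"] wd_sum_simps(1,2) box_simps dom_tsum ball_Un ball_simps(9)
    using x y sp_hom[OF X x] sp_hom[OF Y y] by (simp add: I1 I2 O1 O2 wd_rel_def conj_ac cong: ball_cong)
qed

text \<open>For the coherence diagrams the relation turns into equations between halves of the two
  boundaries, which is the form that \<open>mu_sp\<close> computes for laxators. The unitors and the
  associator below are treated alike.\<close>

lemma wd_rel_brd:
  assumes X: "is_box C X" and Y: "is_box C Y"
    and x: "x \<in> hom C Q (bound C (box_sum X Y))" and y: "y \<in> hom C Q (bound C (box_sum Y X))"
  shows "wd_rel C (relabel (box_sum X Y) (box_sum Y X) swap_port swap_port) Q x y \<longleftrightarrow>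
    spl C X Y \<cdot> x = spr C Y X \<cdot> y \<and> spr C X Y \<cdot> x = spl C Y X \<cdot> y" (is "?l \<longleftrightarrow> ?r")
proof
  note sx = sp_hom[OF X Y x] and sy = sp_hom[OF Y X y]
  note ax = at_sp[OF X Y x] and ay = at_sp[OF Y X y]
  show ?l if r: ?r
    using x y by (simp add: wd_rel_relabel dom_tsum ball_Un ax[symmetric] ay[symmetric] r cong: ball_cong)
  assume ?l
  then have *: "\<And>i. i \<in> dom (inp X) \<Longrightarrow> in_at C (box_sum X Y) (InL i) \<cdot> x = in_at C (box_sum Y X) (InR i) \<cdot> y"
    "\<And>i. i \<in> dom (inp Y) \<Longrightarrow> in_at C (box_sum X Y) (InR i) \<cdot> x = in_at C (box_sum Y X) (InL i) \<cdot> y"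
    "\<And>i. i \<in> dom (outp X) \<Longrightarrow> out_at C (box_sum X Y) (InL i) \<cdot> x = out_at C (box_sum Y X) (InR i) \<cdot> y"
    "\<And>i. i \<in> dom (outp Y) \<Longrightarrow> out_at C (box_sum X Y) (InR i) \<cdot> x = out_at C (box_sum Y X) (InL i) \<cdot> y"
    by (simp_all add: wd_rel_relabel dom_tsum ball_Un)
  have "spl C X Y \<cdot> x = spr C Y X \<cdot> y"
    by (rule bound_eqI[OF X sx(1) sy(2)]) (simp_all add: ax ay *)
  moreover have "spr C X Y \<cdot> x = spl C Y X \<cdot> y"
    by (rule bound_eqI[OF Y sx(2) sy(1)]) (simp_all add: ax ay *)
  ultimately show ?r ..
qed

lemma wd_rel_lun:
  assumes X: "is_box C X"
    and x: "x \<in> hom C Q (bound C (box_sum box_empty X))" and y: "y \<in> hom C Q (bound C X)"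
  shows "wd_rel C (relabel (box_sum box_empty X) X (port_case undefined id) InR) Q x y \<longleftrightarrow> spr C box_empty X \<cdot> x = y"
    (is "?l \<longleftrightarrow> ?r")
proof
  note sx = sp_hom[OF is_box_empty X x] and ax = at_sp[OF is_box_empty X x]
  show ?l if r: ?r
    using x y by (simp add: wd_rel_relabel dom_tsum ball_Un ax r[symmetric] cong: ball_cong)
  assume ?l
  then have *: "\<And>i. i \<in> dom (inp X) \<Longrightarrow> in_at C (box_sum box_empty X) (InR i) \<cdot> x = in_at C X i \<cdot> y"
    "\<And>i. i \<in> dom (outp X) \<Longrightarrow> out_at C (box_sum box_empty X) (InR i) \<cdot> x = out_at C X i \<cdot> y"
    by (simp_all add: wd_rel_relabel dom_tsum ball_Un)
  show ?r by (rule bound_eqI[OF X sx(2) y]) (simp_all add: ax *)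
qed

lemma wd_rel_run:
  assumes X: "is_box C X"
    and x: "x \<in> hom C Q (bound C (box_sum X box_empty))" and y: "y \<in> hom C Q (bound C X)"
  shows "wd_rel C (relabel (box_sum X box_empty) X (port_case id undefined) InL) Q x y \<longleftrightarrow> spl C X box_empty \<cdot> x = y"
    (is "?l \<longleftrightarrow> ?r")
proof
  note sx = sp_hom[OF X is_box_empty x] and ax = at_sp[OF X is_box_empty x]
  show ?l if r: ?r
    using x y by (simp add: wd_rel_relabel dom_tsum ball_Un ax r[symmetric] cong: ball_cong)
  assume ?l
  then have *: "\<And>i. i \<in> dom (inp X) \<Longrightarrow> in_at C (box_sum X box_empty) (InL i) \<cdot> x = in_at C X i \<cdot> y"
    "\<And>i. i \<in> dom (outp X) \<Longrightarrow> out_at C (box_sum X box_empty) (InL i) \<cdot> x = out_at C X i \<cdot> y"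
    by (simp_all add: wd_rel_relabel dom_tsum ball_Un)
  show ?r by (rule bound_eqI[OF X sx(1) y]) (simp_all add: ax *)
qed

lemma wd_rel_asc:
  assumes X: "is_box C X" and Y: "is_box C Y" and Z: "is_box C Z"
    and x: "x \<in> hom C Q (bound C (box_sum (box_sum X Y) Z))" and y: "y \<in> hom C Q (bound C (box_sum X (box_sum Y Z)))"
  shows "wd_rel C (relabel (box_sum (box_sum X Y) Z) (box_sum X (box_sum Y Z)) assocR assocL) Q x y \<longleftrightarrow>
    spl C X Y \<cdot> (spl C (box_sum X Y) Z \<cdot> x) = spl C X (box_sum Y Z) \<cdot> y \<and>
    spr C X Y \<cdot> (spl C (box_sum X Y) Z \<cdot> x) = spl C Y Z \<cdot> (spr C X (box_sum Y Z) \<cdot> y) \<and>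
    spr C (box_sum X Y) Z \<cdot> x = spr C Y Z \<cdot> (spr C X (box_sum Y Z) \<cdot> y)"
    (is "?l \<longleftrightarrow> ?r")
proof
  note XY = is_box_sum[OF X Y] and YZ = is_box_sum[OF Y Z]
  note x1 = sp_hom[OF XY Z x] and y1 = sp_hom[OF X YZ y]
  note x2 = sp_hom[OF X Y x1(1)] and y2 = sp_hom[OF Y Z y1(2)]
  note ax = at_sp[OF XY Z x] at_sp[OF X Y x1(1)] and ay = at_sp[OF X YZ y] at_sp[OF Y Z y1(2)]
  show ?l if r: ?r
    using x y by (simp add: wd_rel_relabel dom_tsum ball_Un ax[symmetric] ay[symmetric] r cong: ball_cong)
  assume ?l
  then have *: "\<And>i. i \<in> dom (inp X) \<Longrightarrow> in_at C (box_sum (box_sum X Y) Z) (InL (InL i)) \<cdot> x = in_at C (box_sum X (box_sum Y Z)) (InL i) \<cdot> y"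
    "\<And>i. i \<in> dom (inp Y) \<Longrightarrow> in_at C (box_sum (box_sum X Y) Z) (InL (InR i)) \<cdot> x = in_at C (box_sum X (box_sum Y Z)) (InR (InL i)) \<cdot> y"
    "\<And>i. i \<in> dom (inp Z) \<Longrightarrow> in_at C (box_sum (box_sum X Y) Z) (InR i) \<cdot> x = in_at C (box_sum X (box_sum Y Z)) (InR (InR i)) \<cdot> y"
    "\<And>i. i \<in> dom (outp X) \<Longrightarrow> out_at C (box_sum (box_sum X Y) Z) (InL (InL i)) \<cdot> x = out_at C (box_sum X (box_sum Y Z)) (InL i) \<cdot> y"
    "\<And>i. i \<in> dom (outp Y) \<Longrightarrow> out_at C (box_sum (box_sum X Y) Z) (InL (InR i)) \<cdot> x = out_at C (box_sum X (box_sum Y Z)) (InR (InL i)) \<cdot> y"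
    "\<And>i. i \<in> dom (outp Z) \<Longrightarrow> out_at C (box_sum (box_sum X Y) Z) (InR i) \<cdot> x = out_at C (box_sum X (box_sum Y Z)) (InR (InR i)) \<cdot> y"
    by (simp_all add: wd_rel_relabel dom_tsum ball_Un)
  have "spl C X Y \<cdot> (spl C (box_sum X Y) Z \<cdot> x) = spl C X (box_sum Y Z) \<cdot> y"
    by (rule bound_eqI[OF X x2(1) y1(1)]) (simp_all add: ax ay * dom_tsum)
  moreover have "spr C X Y \<cdot> (spl C (box_sum X Y) Z \<cdot> x) = spl C Y Z \<cdot> (spr C X (box_sum Y Z) \<cdot> y)"
    by (rule bound_eqI[OF Y x2(2) y2(1)]) (simp_all add: ax ay * dom_tsum)
  moreover have "spr C (box_sum X Y) Z \<cdot> x = spr C Y Z \<cdot> (spr C X (box_sum Y Z) \<cdot> y)"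
    by (rule bound_eqI[OF Z x1(2) y2(2)]) (simp_all add: ax ay * dom_tsum)
  ultimately show ?r by blast
qed

end

section \<open>The structure cells of \<open>Spn\<close>\<close>

lemma Spn_simps:
  fixes C :: "('o, 'm, 'z) cat_scheme"
  defines "A \<equiv> Spn C :: (('l, 'o) box, ('l, 'o) wd, 'm, 'm \<times> 'm \<times> 'm) alg"
  shows "fib A X = slice C (bound C X)" "fob (act A \<phi>) = spn_act C \<phi>" "far (act A \<phi>) = spn_act_ar C \<phi>"
    "act_cmp A = spn_act_cmp C" "act_idn A X p = spn_cell C (wd_id X) p (\<lambda>a. a) p"
    "fob (lax A X Y) = spn_lax C X Y" "far (lax A X Y) = spn_lax_ar C X Y"
    "lax_unt A = spn_lax_unt C TYPE('l)" "lax_nat A = spn_lax_nat C"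
    "lax_asc A X Y Z ((p, q), r) =
       spn_cell C (relabel (box_sum (box_sum X Y) Z) (box_sum X (box_sum Y Z)) assocR assocL)
         (spn_lax C (box_sum X Y) Z (spn_lax C X Y (p, q), r))
         (\<lambda>a. pair C (cmp C (pr1 C (src C p) (src C q)) (cmp C (pr1 C (src C (spn_lax C X Y (p, q))) (src C r)) a))
            (pair C (cmp C (pr2 C (src C p) (src C q)) (cmp C (pr1 C (src C (spn_lax C X Y (p, q))) (src C r)) a))
               (cmp C (pr2 C (src C (spn_lax C X Y (p, q))) (src C r)) a)))
         (spn_lax C X (box_sum Y Z) (p, spn_lax C Y Z (q, r)))"
    "lax_lun A X p = spn_cell C (relabel (box_sum box_empty X) X (port_case undefined id) InR)
       (spn_lax C box_empty X (spn_lax_unt C TYPE('l), p))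
       (cmp C (pr2 C (src C (spn_lax_unt C TYPE('l))) (src C p))) p"
    "lax_run A X p = spn_cell C (relabel (box_sum X box_empty) X (port_case id undefined) InL)
       (spn_lax C X box_empty (p, spn_lax_unt C TYPE('l)))
       (cmp C (pr1 C (src C p) (src C (spn_lax_unt C TYPE('l))))) p"
    "lax_brd A X Y (p, q) = spn_cell C (relabel (box_sum X Y) (box_sum Y X) swap_port swap_port) (spn_lax C X Y (p, q))
       (\<lambda>a. pair C (cmp C (pr2 C (src C p) (src C q)) a) (cmp C (pr1 C (src C p) (src C q)) a)) (spn_lax C Y X (q, p))"
  by (simp_all add: A_def Spn_def Let_def)

lemma slice_homI:
  "m \<in> obs (slice C b) \<Longrightarrow> n \<in> obs (slice C b) \<Longrightarrow> f \<in> hom C (src C m) (src C n) \<Longrightarrow> cmp C n f = m \<Longrightarrow>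
    (m, f, n) \<in> hom (slice C b) m n"
  by (simp add: hom_slice)

context finitely_complete
begin

lemma ob_hom: "p \<in> obs (slice C b) \<Longrightarrow> p \<in> hom C (src C p) b"
  by (simp add: hom_iff)

lemma hom_ob: "p \<in> hom C a b \<Longrightarrow> p \<in> obs (slice C b)"
  by (simp add: hom_iff)

context
  fixes \<phi> :: "('l, 'o) wd" and p
  assumes w: "is_wd C \<phi>" and p: "p \<in> obs (slice C (bound C (wsrc \<phi>)))"
begin

lemma act_ob: "spn_act C \<phi> p \<in> obs (slice C (bound C (wtgt \<phi>)))"
  using arr_act[OF w] p by simp

lemma rt_hom: "pb1 C p (legL C \<phi>) \<in> hom C (src C (spn_act C \<phi> p)) (src C p)"
  using arr_act[OF w] p by (simp add: hom_iff)

lemma rt_rel: "wd_rel C \<phi> (src C (spn_act C \<phi> p)) (p \<cdot> pb1 C p (legL C \<phi>)) (spn_act C \<phi> p)"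
  using act_rel[OF w] p by simp

lemma rt_rel_cmp:
  assumes x: "x \<in> hom C Q (src C (spn_act C \<phi> p))"
  shows "wd_rel C \<phi> Q (p \<cdot> (pb1 C p (legL C \<phi>) \<cdot> x)) (spn_act C \<phi> p \<cdot> x)"
  using wd_rel_cmp[OF w rt_rel x] cmp_assoc[OF x rt_hom ob_hom[OF p]] by simp

lemma act_lift_slice:
  assumes t: "t \<in> obs (slice C (bound C (wtgt \<phi>)))" and u: "u \<in> hom C (src C t) (src C p)"
    and r: "wd_rel C \<phi> (src C t) (p \<cdot> u) t"
    and v: "v = pb_lift C p (legL C \<phi>) u (pair C (bi C (wtgt \<phi>) \<cdot> t) (bo C (wsrc \<phi>) \<cdot> (p \<cdot> u)))"
  shows "(t, v, spn_act C \<phi> p) \<in> hom (slice C (bound C (wtgt \<phi>))) t (spn_act C \<phi> p)" "pb1 C p (legL C \<phi>) \<cdot> v = u"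
proof -
  have p': "p \<in> arrs C" "tgt C p = bound C (wsrc \<phi>)" using p by auto
  note l = act_lift[OF w p' u r v]
  show "(t, v, spn_act C \<phi> p) \<in> hom (slice C (bound C (wtgt \<phi>))) t (spn_act C \<phi> p)" "pb1 C p (legL C \<phi>) \<cdot> v = u"
    using slice_homI[OF t act_ob l(1,3)] l(2) .
qed

lemma act_lift_ex:
  assumes "t \<in> obs (slice C (bound C (wtgt \<phi>)))" "u \<in> hom C (src C t) (src C p)" "wd_rel C \<phi> (src C t) (p \<cdot> u) t"
  shows "\<exists>G \<in> hom (slice C (bound C (wtgt \<phi>))) t (spn_act C \<phi> p). pb1 C p (legL C \<phi>) \<cdot> und G = u"
  using act_lift_slice[OF assms refl] by (intro bexI) auto

lemma act_mid:
  "pb2 C p (legL C \<phi>) \<in> hom C (src C (spn_act C \<phi> p)) (mid C \<phi>)"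
  "legL C \<phi> \<cdot> pb2 C p (legL C \<phi>) = p \<cdot> pb1 C p (legL C \<phi>)" "legR C \<phi> \<cdot> pb2 C p (legL C \<phi>) = spn_act C \<phi> p"
  "mid1 C \<phi> \<cdot> pb2 C p (legL C \<phi>) = bi C (wtgt \<phi>) \<cdot> spn_act C \<phi> p"
  "mid2 C \<phi> \<cdot> pb2 C p (legL C \<phi>) = bo C (wsrc \<phi>) \<cdot> (p \<cdot> pb1 C p (legL C \<phi>))"
proof -
  have pb: "pb2 C p (legL C \<phi>) \<in> arrs C" "src C (pb2 C p (legL C \<phi>)) = pb_ob C p (legL C \<phi>)"
    "tgt C (pb2 C p (legL C \<phi>)) = mid C \<phi>" "p \<cdot> pb1 C p (legL C \<phi>) = legL C \<phi> \<cdot> pb2 C p (legL C \<phi>)"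
    using arr_pb[of p "legL C \<phi>"] p by (auto simp: arr_leg[OF w])
  then show "pb2 C p (legL C \<phi>) \<in> hom C (src C (spn_act C \<phi> p)) (mid C \<phi>)"
    "legL C \<phi> \<cdot> pb2 C p (legL C \<phi>) = p \<cdot> pb1 C p (legL C \<phi>)" "legR C \<phi> \<cdot> pb2 C p (legL C \<phi>) = spn_act C \<phi> p"
    using arr_act[OF w] p by (simp_all add: hom_iff spn_act_def)
  show "mid1 C \<phi> \<cdot> pb2 C p (legL C \<phi>) = bi C (wtgt \<phi>) \<cdot> spn_act C \<phi> p"
    using cmp_assoc'[of "pb2 C p (legL C \<phi>)" "legR C \<phi>" "bi C (wtgt \<phi>)"] pb
    by (simp add: arr_leg[OF w] arr_b is_wd_boxes[OF w] spn_act_def)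
  show "mid2 C \<phi> \<cdot> pb2 C p (legL C \<phi>) = bo C (wsrc \<phi>) \<cdot> (p \<cdot> pb1 C p (legL C \<phi>))"
    using cmp_assoc'[of "pb2 C p (legL C \<phi>)" "legL C \<phi>" "bo C (wsrc \<phi>)"] pb
    by (simp add: arr_leg[OF w] arr_b is_wd_boxes[OF w])
qed

end

lemma act_ar_lemma:
  assumes w: "is_wd C \<phi>" and f: "f \<in> hom (slice C (bound C (wsrc \<phi>))) p q"
  shows "spn_act_ar C \<phi> f \<in> hom (slice C (bound C (wtgt \<phi>))) (spn_act C \<phi> p) (spn_act C \<phi> q)"
    "pb1 C q (legL C \<phi>) \<cdot> und (spn_act_ar C \<phi> f) = und f \<cdot> pb1 C p (legL C \<phi>)"
proof -
  have p: "p \<in> obs (slice C (bound C (wsrc \<phi>)))" and q: "q \<in> obs (slice C (bound C (wsrc \<phi>)))"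
    and h: "und f \<in> hom C (src C p) (src C q)" "q \<cdot> und f = p" and f': "f = (p, und f, q)"
    using f by (auto simp: hom_slice intro!: prod_eqI)
  note rh = rt_hom[OF w p]
  have e: "q \<cdot> (und f \<cdot> pb1 C p (legL C \<phi>)) = p \<cdot> pb1 C p (legL C \<phi>)"
    using cmp_assoc[OF rh h(1) ob_hom[OF q]] h(2) by simp
  have m: "pb2 C p (legL C \<phi>) = pair C (bi C (wtgt \<phi>) \<cdot> spn_act C \<phi> p) (bo C (wsrc \<phi>) \<cdot> (q \<cdot> (und f \<cdot> pb1 C p (legL C \<phi>))))"
    using act_pb2[OF w, of p] p e by simp
  note l = act_lift_slice[OF w q act_ob[OF w p] cmp_hom[OF rh h(1)] rt_rel[OF w p, folded e] arg_cong[where f = "pb_lift C q (legL C \<phi>) (und f \<cdot> pb1 C p (legL C \<phi>))", OF m]]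
  have "spn_act_ar C \<phi> f = (spn_act C \<phi> p, pb_lift C q (legL C \<phi>) (und f \<cdot> pb1 C p (legL C \<phi>)) (pb2 C p (legL C \<phi>)), spn_act C \<phi> q)"
    by (subst f') (simp add: spn_act_ar_def)
  then show "spn_act_ar C \<phi> f \<in> hom (slice C (bound C (wtgt \<phi>))) (spn_act C \<phi> p) (spn_act C \<phi> q)"
    "pb1 C q (legL C \<phi>) \<cdot> und (spn_act_ar C \<phi> f) = und f \<cdot> pb1 C p (legL C \<phi>)"
    using l by simp_all
qed

lemma act_cmp_lemma:
  assumes w: "is_wd C \<phi>" "is_wd C \<psi>" and e: "wtgt \<phi> = wsrc \<psi>" and p: "p \<in> obs (slice C (bound C (wsrc \<phi>)))"
  shows "spn_act_cmp C \<psi> \<phi> p \<in> hom (slice C (bound C (wtgt \<psi>))) (spn_act C \<psi> (spn_act C \<phi> p)) (spn_act C (wd_comp \<psi> \<phi>) p)"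
    "pb1 C p (legL C (wd_comp \<psi> \<phi>)) \<cdot> und (spn_act_cmp C \<psi> \<phi> p)
      = pb1 C p (legL C \<phi>) \<cdot> pb1 C (spn_act C \<phi> p) (legL C \<psi>)"
    "\<exists>G \<in> hom (slice C (bound C (wtgt \<psi>))) (spn_act C (wd_comp \<psi> \<phi>) p) (spn_act C \<psi> (spn_act C \<phi> p)).
      pb1 C p (legL C \<phi>) \<cdot> (pb1 C (spn_act C \<phi> p) (legL C \<psi>) \<cdot> und G) = pb1 C p (legL C (wd_comp \<psi> \<phi>))"
proof -
  note w' = is_wd_comp[OF w e]
  note q = act_ob[OF w(1) p, unfolded e]
  note r1 = rt_hom[OF w(1) p] and r2 = rt_hom[OF w(2) q]
  have t: "spn_act C \<psi> (spn_act C \<phi> p) \<in> obs (slice C (bound C (wtgt (wd_comp \<psi> \<phi>))))"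
    using act_ob[OF w(2) q] by simp
  have p': "p \<in> obs (slice C (bound C (wsrc (wd_comp \<psi> \<phi>))))" using p by simp
  let ?u = "pb1 C p (legL C \<phi>) \<cdot> pb1 C (spn_act C \<phi> p) (legL C \<psi>)"
  have r: "wd_rel C (wd_comp \<psi> \<phi>) (src C (spn_act C \<psi> (spn_act C \<phi> p))) (p \<cdot> ?u) (spn_act C \<psi> (spn_act C \<phi> p))"
    using wd_rel_comp[OF w e rt_rel_cmp[OF w(1) p r2] rt_rel[OF w(2) q]] .
  \<comment> \<open>Identifies the second entry of the pair in the definition of
    \<open>spn_act_cmp\<close> with the inner outputs of \<open>p\<close>, as the lifting lemma
    expects.\<close>
  have b: "mid2 C \<phi> \<cdot> (pb2 C p (legL C \<phi>) \<cdot> pb1 C (spn_act C \<phi> p) (legL C \<psi>)) = bo C (wsrc \<phi>) \<cdot> (p \<cdot> ?u)"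
  proof -
    note m = act_mid[OF w(1) p]
    have "mid2 C \<phi> \<cdot> (pb2 C p (legL C \<phi>) \<cdot> pb1 C (spn_act C \<phi> p) (legL C \<psi>))
        = (mid2 C \<phi> \<cdot> pb2 C p (legL C \<phi>)) \<cdot> pb1 C (spn_act C \<phi> p) (legL C \<psi>)"
      using m(1) r2 by (simp add: cmp_assoc' hom_iff arr_mid[OF w(1)])
    also have "\<dots> = bo C (wsrc \<phi>) \<cdot> (p \<cdot> ?u)"
      using p r1 r2 unfolding m(5) by (simp add: cmp_assoc' arr_cmp hom_iff arr_b is_wd_boxes[OF w(1)])
    finally show ?thesis .
  qed
  have v: "und (spn_act_cmp C \<psi> \<phi> p) = pb_lift C p (legL C (wd_comp \<psi> \<phi>)) ?u
      (pair C (bi C (wtgt (wd_comp \<psi> \<phi>)) \<cdot> spn_act C \<psi> (spn_act C \<phi> p)) (bo C (wsrc (wd_comp \<psi> \<phi>)) \<cdot> (p \<cdot> ?u)))"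
    by (simp add: spn_act_cmp_def Let_def b act_mid[OF w(2) q])
  note l = act_lift_slice[OF w' p' t cmp_hom[OF r2 r1] _ v] r
  have "spn_act_cmp C \<psi> \<phi> p = (spn_act C \<psi> (spn_act C \<phi> p), und (spn_act_cmp C \<psi> \<phi> p), spn_act C (wd_comp \<psi> \<phi>) p)"
    by (simp add: spn_act_cmp_def Let_def)
  then show "spn_act_cmp C \<psi> \<phi> p \<in> hom (slice C (bound C (wtgt \<psi>))) (spn_act C \<psi> (spn_act C \<phi> p)) (spn_act C (wd_comp \<psi> \<phi>) p)"
    "pb1 C p (legL C (wd_comp \<psi> \<phi>)) \<cdot> und (spn_act_cmp C \<psi> \<phi> p)
      = pb1 C p (legL C \<phi>) \<cdot> pb1 C (spn_act C \<phi> p) (legL C \<psi>)"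
    using l by simp_all
  let ?s = "spn_act C (wd_comp \<psi> \<phi>) p"
  \<comment> \<open>For the arrow back, the boundary between the two diagrams is reconstructed; it
    permits a lift along \<open>\<phi>\<close> first and then along \<open>\<psi>\<close>.\<close>
  obtain y where y: "wd_rel C \<phi> (src C ?s) (p \<cdot> pb1 C p (legL C (wd_comp \<psi> \<phi>))) y" "wd_rel C \<psi> (src C ?s) y ?s"
    using wd_rel_comp_ex[OF w e rt_rel[OF w' p']] .
  have pa: "p \<in> arrs C" "tgt C p = bound C (wsrc \<phi>)" using p by auto
  obtain v where v: "v \<in> hom C (src C ?s) (src C (spn_act C \<phi> p))" "pb1 C p (legL C \<phi>) \<cdot> v = pb1 C p (legL C (wd_comp \<psi> \<phi>))"
      "spn_act C \<phi> p \<cdot> v = y"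
    using act_lift[OF w(1) pa rt_hom[OF w' p'] y(1) refl] by blast
  have s: "?s \<in> obs (slice C (bound C (wtgt \<psi>)))" using act_ob[OF w' p'] by simp
  show "\<exists>G \<in> hom (slice C (bound C (wtgt \<psi>))) (spn_act C (wd_comp \<psi> \<phi>) p) (spn_act C \<psi> (spn_act C \<phi> p)).
      pb1 C p (legL C \<phi>) \<cdot> (pb1 C (spn_act C \<phi> p) (legL C \<psi>) \<cdot> und G) = pb1 C p (legL C (wd_comp \<psi> \<phi>))"
    using act_lift_ex[OF w(2) q s v(1) y(2)[folded v(3)]] v(2) by auto
qed

lemma act_idn_lemma:
  assumes X: "is_box C X" and p: "p \<in> obs (slice C (bound C X))"
  shows "spn_cell C (wd_id X) p (\<lambda>a. a) p \<in> hom (slice C (bound C X)) (spn_act C (wd_id X) p) p"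
    "\<exists>G \<in> hom (slice C (bound C X)) p (spn_act C (wd_id X) p). pb1 C p (legL C (wd_id X)) \<cdot> und G = idn C (src C p)"
proof -
  note w = is_wd_id[OF X]
  have p': "p \<in> obs (slice C (bound C (wsrc (wd_id X))))" using p by simp
  have e: "p \<cdot> pb1 C p (legL C (wd_id X)) = spn_act C (wd_id X) p"
    using rt_rel[OF w p'] wd_rel_id[OF X] by simp
  show "spn_cell C (wd_id X) p (\<lambda>a. a) p \<in> hom (slice C (bound C X)) (spn_act C (wd_id X) p) p"
    unfolding spn_cell_def using act_ob[OF w p'] rt_hom[OF w p'] e p by (intro slice_homI) simp_all
  have i: "idn C (src C p) \<in> hom C (src C p) (src C p)" using p by (simp add: idn_hom src_obs)
  have "wd_rel C (wd_id X) (src C p) (p \<cdot> idn C (src C p)) p"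
    using p wd_rel_id[OF X] by (simp add: cmp_idn hom_iff)
  then show "\<exists>G \<in> hom (slice C (bound C X)) p (spn_act C (wd_id X) p). pb1 C p (legL C (wd_id X)) \<cdot> und G = idn C (src C p)"
    using act_lift_ex[OF w p' _ i] p by simp
qed

lemma pair_hom: "u \<in> hom C Q a \<Longrightarrow> v \<in> hom C Q b \<Longrightarrow> pair C u v \<in> hom C Q (prd C a b)"
  and pr_pair: "u \<in> hom C Q a \<Longrightarrow> v \<in> hom C Q b \<Longrightarrow> pr1 C a b \<cdot> pair C u v = u"
    "u \<in> hom C Q a \<Longrightarrow> v \<in> hom C Q b \<Longrightarrow> pr2 C a b \<cdot> pair C u v = v"
  using pair_lemma[of u v a b] by (auto simp: hom_iff)

lemma pr_hom: "a \<in> obs C \<Longrightarrow> b \<in> obs C \<Longrightarrow> pr1 C a b \<in> hom C (prd C a b) a"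
  "a \<in> obs C \<Longrightarrow> b \<in> obs C \<Longrightarrow> pr2 C a b \<in> hom C (prd C a b) b"
  by (auto simp: arr_pr hom_iff)

context
  fixes X Y :: "('l, 'o) box" and p q
  assumes X: "is_box C X" and Y: "is_box C Y"
    and p: "p \<in> obs (slice C (bound C X))" and q: "q \<in> obs (slice C (bound C Y))"
begin

lemma mu_hom: "spn_lax C X Y (p, q) \<in> hom C (prd C (src C p) (src C q)) (bound C (box_sum X Y))"
  using spn_lax_lemma[OF X Y, of p q] p q by simp

lemma mu_ob: "spn_lax C X Y (p, q) \<in> obs (slice C (bound C (box_sum X Y)))"
  and src_mu: "src C (spn_lax C X Y (p, q)) = prd C (src C p) (src C q)"
  using mu_hom by (auto simp: hom_iff)

lemma mu_pr_hom: "pr1 C (src C p) (src C q) \<in> hom C (src C (spn_lax C X Y (p, q))) (src C p)"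
  "pr2 C (src C p) (src C q) \<in> hom C (src C (spn_lax C X Y (p, q))) (src C q)"
  using p q by (auto simp: src_mu intro!: pr_hom src_obs)

lemma mu_sp:
  assumes z: "z \<in> hom C Q (src C (spn_lax C X Y (p, q)))"
  shows "spl C X Y \<cdot> (spn_lax C X Y (p, q) \<cdot> z) = p \<cdot> (pr1 C (src C p) (src C q) \<cdot> z)"
    "spr C X Y \<cdot> (spn_lax C X Y (p, q) \<cdot> z) = q \<cdot> (pr2 C (src C p) (src C q) \<cdot> z)"
  using spn_lax_lemma[OF X Y, of p q] p q
    cmp_assoc[OF z ob_hom[OF mu_ob] spl_lemma(1)[OF X Y]] cmp_assoc[OF z ob_hom[OF mu_ob] spr_lemma(1)[OF X Y]]
    cmp_assoc[OF z mu_pr_hom(1) ob_hom[OF p]] cmp_assoc[OF z mu_pr_hom(2) ob_hom[OF q]]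
  by simp_all

lemma mu_sp0:
  "spl C X Y \<cdot> spn_lax C X Y (p, q) = p \<cdot> pr1 C (src C p) (src C q)"
  "spr C X Y \<cdot> spn_lax C X Y (p, q) = q \<cdot> pr2 C (src C p) (src C q)"
  using spn_lax_lemma[OF X Y, of p q] p q by simp_all

text \<open>The universal property of the apex of a laxator over a prescribed boundary; equality
  with \<open>y\<close> is tested on the two halves by \<open>sum_eqI\<close>.\<close>

lemma mu_pair:
  assumes u: "u \<in> hom C Q (src C p)" and v: "v \<in> hom C Q (src C q)" and y: "y \<in> hom C Q (bound C (box_sum X Y))"
    and e: "spl C X Y \<cdot> y = p \<cdot> u" "spr C X Y \<cdot> y = q \<cdot> v"
  shows "pair C u v \<in> hom C Q (src C (spn_lax C X Y (p, q)))" "spn_lax C X Y (p, q) \<cdot> pair C u v = y"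
    "pr1 C (src C p) (src C q) \<cdot> pair C u v = u" "pr2 C (src C p) (src C q) \<cdot> pair C u v = v"
proof -
  show h: "pair C u v \<in> hom C Q (src C (spn_lax C X Y (p, q)))" using pair_hom[OF u v] by (simp add: src_mu)
  show pr: "pr1 C (src C p) (src C q) \<cdot> pair C u v = u" "pr2 C (src C p) (src C q) \<cdot> pair C u v = v"
    using pr_pair[OF u v] by auto
  show "spn_lax C X Y (p, q) \<cdot> pair C u v = y"
    by (rule sum_eqI[OF X Y cmp_hom[OF h ob_hom[OF mu_ob]] y]) (simp_all add: mu_sp[OF h] pr e)
qed

lemma mu_sep:
  assumes x: "x \<in> hom C Q (src C (spn_lax C X Y (p, q)))" and y: "y \<in> hom C Q (src C (spn_lax C X Y (p, q)))"
    and e: "pr1 C (src C p) (src C q) \<cdot> x = pr1 C (src C p) (src C q) \<cdot> y" "pr2 C (src C p) (src C q) \<cdot> x = pr2 C (src C p) (src C q) \<cdot> y"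
  shows "x = y"
  using prd_eqI[of "src C p" "src C q" x Q y] x y e p q by (simp add: src_mu src_obs)

end

lemma mu_ar_lemma:
  assumes X: "is_box C X" and Y: "is_box C Y"
    and f: "f \<in> hom (slice C (bound C X)) p p'" and g: "g \<in> hom (slice C (bound C Y)) q q'"
  shows "spn_lax_ar C X Y (f, g) \<in> hom (slice C (bound C (box_sum X Y))) (spn_lax C X Y (p, q)) (spn_lax C X Y (p', q'))"
    "pr1 C (src C p') (src C q') \<cdot> und (spn_lax_ar C X Y (f, g)) = und f \<cdot> pr1 C (src C p) (src C q)"
    "pr2 C (src C p') (src C q') \<cdot> und (spn_lax_ar C X Y (f, g)) = und g \<cdot> pr2 C (src C p) (src C q)"
proof -
  have p: "p \<in> obs (slice C (bound C X))" "p' \<in> obs (slice C (bound C X))"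
    and q: "q \<in> obs (slice C (bound C Y))" "q' \<in> obs (slice C (bound C Y))"
    and h: "und f \<in> hom C (src C p) (src C p')" "p' \<cdot> und f = p" "und g \<in> hom C (src C q) (src C q')" "q' \<cdot> und g = q"
    and f': "f = (p, und f, p')" "g = (q, und g, q')"
    using f g by (auto simp: hom_slice intro!: prod_eqI)
  note pr = mu_pr_hom[OF X Y p(1) q(1)]
  have e: "spl C X Y \<cdot> spn_lax C X Y (p, q) = p' \<cdot> (und f \<cdot> pr1 C (src C p) (src C q))"
    "spr C X Y \<cdot> spn_lax C X Y (p, q) = q' \<cdot> (und g \<cdot> pr2 C (src C p) (src C q))"
    using mu_sp0[OF X Y p(1) q(1)] cmp_assoc[OF pr(1) h(1) ob_hom[OF p(2)]] cmp_assoc[OF pr(2) h(3) ob_hom[OF q(2)]] h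
    by simp_all
  note m = mu_pair[OF X Y p(2) q(2) cmp_hom[OF pr(1) h(1)] cmp_hom[OF pr(2) h(3)] ob_hom[OF mu_ob[OF X Y p(1) q(1)]] e]
  have "spn_lax_ar C X Y (f, g) = (spn_lax C X Y (p, q),
      pair C (und f \<cdot> pr1 C (src C p) (src C q)) (und g \<cdot> pr2 C (src C p) (src C q)), spn_lax C X Y (p', q'))"
    by (subst f'(1), subst f'(2)) (simp add: spn_lax_ar_def)
  then show "spn_lax_ar C X Y (f, g) \<in> hom (slice C (bound C (box_sum X Y))) (spn_lax C X Y (p, q)) (spn_lax C X Y (p', q'))"
    "pr1 C (src C p') (src C q') \<cdot> und (spn_lax_ar C X Y (f, g)) = und f \<cdot> pr1 C (src C p) (src C q)"
    "pr2 C (src C p') (src C q') \<cdot> und (spn_lax_ar C X Y (f, g)) = und g \<cdot> pr2 C (src C p) (src C q)"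
    using m by (simp_all add: slice_homI[OF mu_ob[OF X Y p(1) q(1)] mu_ob[OF X Y p(2) q(2)]])
qed

end

context finitely_complete
begin

text \<open>Treats both halves at once: \<open>i\<close> and \<open>\<chi>\<close> are later
  \<open>InL\<close> and \<open>\<phi>\<close>, or \<open>InR\<close> and \<open>\<psi>\<close>. The
  point is that \<open>mid_split\<close>, applied to an element of \<open>mid\<close> of the sum,
  yields the element of \<open>mid C \<chi>\<close> belonging to the corresponding halves of the
  boundaries.\<close>

lemma mid_split_cmp:
  fixes \<phi> \<psi> \<chi> :: "('l, 'o) wd"
  assumes w: "is_wd C \<phi>" "is_wd C \<psi>" and m: "m \<in> hom C Q (mid C (wd_sum \<phi> \<psi>))"
    and \<chi>: "is_wd C \<chi>" and y: "y \<in> hom C Q (bound C (wtgt \<chi>))" and x: "x \<in> hom C Q (bound C (wsrc \<chi>))"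
    and i: "\<And>j. j \<in> dom (inp (wtgt \<chi>)) \<Longrightarrow> i j \<in> dom (inp (wtgt (wd_sum \<phi> \<psi>))) \<and>
        inp (wtgt (wd_sum \<phi> \<psi>)) (i j) = inp (wtgt \<chi>) j \<and>
        in_at C (wtgt (wd_sum \<phi> \<psi>)) (i j) \<cdot> (legR C (wd_sum \<phi> \<psi>) \<cdot> m) = in_at C (wtgt \<chi>) j \<cdot> y"
    and k: "\<And>j. j \<in> dom (outp (wsrc \<chi>)) \<Longrightarrow> i j \<in> dom (outp (wsrc (wd_sum \<phi> \<psi>))) \<and>
        outp (wsrc (wd_sum \<phi> \<psi>)) (i j) = outp (wsrc \<chi>) j \<and>
        out_at C (wsrc (wd_sum \<phi> \<psi>)) (i j) \<cdot> (legL C (wd_sum \<phi> \<psi>) \<cdot> m) = out_at C (wsrc \<chi>) j \<cdot> x"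
  shows "mid_split C \<phi> \<psi> i \<chi> \<cdot> m = pair C (bi C (wtgt \<chi>) \<cdot> y) (bo C (wsrc \<chi>) \<cdot> x)"
proof -
  let ?s = "wd_sum \<phi> \<psi>"
  note s = is_wd_sum[OF w]
  note T = is_wd_boxes(2)[OF s] and S = is_wd_boxes(1)[OF s] and Y = is_wd_boxes(2)[OF \<chi>] and X = is_wd_boxes(1)[OF \<chi>]
  note am = arr_mid[OF s] and al = arr_leg[OF s]
  have m': "m \<in> arrs C" "src C m = Q" "tgt C m = mid C ?s" using m by (auto simp: hom_iff)
  have lR: "legR C ?s \<cdot> m \<in> hom C Q (bound C (wtgt ?s))" and lL: "legL C ?s \<cdot> m \<in> hom C Q (bound C (wsrc ?s))"
    using m' al by (auto simp: hom_iff arr_cmp)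
  let ?f = "\<lambda>j. proj C (inp (wtgt ?s)) (i j) \<cdot> mid1 C ?s" and ?g = "\<lambda>j. proj C (outp (wsrc ?s)) (i j) \<cdot> mid2 C ?s"
  have f: "?f j \<in> arrs C \<and> src C (?f j) = mid C ?s \<and> tgt C (?f j) = the (inp (wtgt \<chi>) j)" if "j \<in> dom (inp (wtgt \<chi>))" for j
    using i[OF that] arr_box_proj[OF T] am by (simp add: arr_cmp)
  have g: "?g j \<in> arrs C \<and> src C (?g j) = mid C ?s \<and> tgt C (?g j) = the (outp (wsrc \<chi>) j)" if "j \<in> dom (outp (wsrc \<chi>))" for j
    using k[OF that] arr_box_proj[OF S] am by (simp add: arr_cmp)
  let ?tf = "tuple C (inp (wtgt \<chi>)) (mid C ?s) ?f" and ?tg = "tuple C (outp (wsrc \<chi>)) (mid C ?s) ?g"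
  note tf = tuple_lemma[where q = ?f, OF box_ok(1,2)[OF Y] am(1) f]
  note tg = tuple_lemma[where q = ?g, OF box_ok(3,4)[OF X] am(1) g]
  have pf: "proj C (inp (wtgt \<chi>)) j \<cdot> (?tf \<cdot> m) = in_at C (wtgt \<chi>) j \<cdot> y" if j: "j \<in> dom (inp (wtgt \<chi>))" for j
  proof -
    have "proj C (inp (wtgt \<chi>)) j \<cdot> (?tf \<cdot> m) = (proj C (inp (wtgt \<chi>)) j \<cdot> ?tf) \<cdot> m"
      using tf(1-3) m' arr_box_proj[OF Y] j by (simp add: cmp_assoc')
    also have "\<dots> = proj C (inp (wtgt ?s)) (i j) \<cdot> (mid1 C ?s \<cdot> m)"
      using tf(4) j m' am arr_box_proj[OF T] i[OF j] by (simp add: cmp_assoc')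
    also have "\<dots> = proj C (inp (wtgt ?s)) (i j) \<cdot> (bi C (wtgt ?s) \<cdot> (legR C ?s \<cdot> m))"
      using cmp_assoc'[of m "legR C ?s" "bi C (wtgt ?s)"] al m' arr_b[OF T] by simp
    also have "\<dots> = in_at C (wtgt \<chi>) j \<cdot> y" using i[OF j] at_cmp(1)[OF T lR, of "i j"] by simp
    finally show ?thesis .
  qed
  have pg: "proj C (outp (wsrc \<chi>)) j \<cdot> (?tg \<cdot> m) = out_at C (wsrc \<chi>) j \<cdot> x" if j: "j \<in> dom (outp (wsrc \<chi>))" for j
  proof -
    have "proj C (outp (wsrc \<chi>)) j \<cdot> (?tg \<cdot> m) = (proj C (outp (wsrc \<chi>)) j \<cdot> ?tg) \<cdot> m"
      using tg(1-3) m' arr_box_proj[OF X] j by (simp add: cmp_assoc')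
    also have "\<dots> = proj C (outp (wsrc ?s)) (i j) \<cdot> (mid2 C ?s \<cdot> m)"
      using tg(4) j m' am arr_box_proj[OF S] k[OF j] by (simp add: cmp_assoc')
    also have "\<dots> = proj C (outp (wsrc ?s)) (i j) \<cdot> (bo C (wsrc ?s) \<cdot> (legL C ?s \<cdot> m))"
      using cmp_assoc'[of m "legL C ?s" "bo C (wsrc ?s)"] al m' arr_b[OF S] by simp
    also have "\<dots> = out_at C (wsrc \<chi>) j \<cdot> x" using k[OF j] at_cmp(2)[OF S lL, of "i j"] by simp
    finally show ?thesis .
  qed
  have hf: "?tf \<cdot> m \<in> hom C Q (hat C (inp (wtgt \<chi>)))" and hg: "?tg \<cdot> m \<in> hom C Q (hat C (outp (wsrc \<chi>)))"
    using tf(1-3) tg(1-3) m' by (auto simp: hom_iff arr_cmp)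
  have ef: "?tf \<cdot> m = bi C (wtgt \<chi>) \<cdot> y"
    using pf at_cmp(1)[OF Y y] by (intro bi_eqI[OF Y hf b_cmp_hom(1)[OF Y y]]) simp
  have eg: "?tg \<cdot> m = bo C (wsrc \<chi>) \<cdot> x"
    using pg at_cmp(2)[OF X x] by (intro bo_eqI[OF X hg b_cmp_hom(2)[OF X x]]) simp
  have ms: "mid_split C \<phi> \<psi> i \<chi> = pair C ?tf ?tg" by (simp add: mid_split_def Let_def)
  have th: "?tf \<in> hom C (mid C ?s) (hat C (inp (wtgt \<chi>)))" "?tg \<in> hom C (mid C ?s) (hat C (outp (wsrc \<chi>)))"
    using tf(1-3) tg(1-3) by (auto simp: hom_iff)
  note ph = pair_hom[OF th] and pp = pr_pair[OF th]
  note pq = pr_pair[OF hf hg] and pqh = pair_hom[OF hf hg]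
  note o = box_obs(1)[OF Y] box_obs(2)[OF X]
  have "pair C ?tf ?tg \<cdot> m = pair C (?tf \<cdot> m) (?tg \<cdot> m)"
    using cmp_assoc[OF m ph pr_hom(1)[OF o]] cmp_assoc[OF m ph pr_hom(2)[OF o]] pp pq
    by (intro prd_eqI[OF o cmp_hom[OF m ph] pqh]) simp_all
  then show ?thesis unfolding ms ef eg .
qed

text \<open>Forwards, the relation for \<open>wd_sum\<close> splits into two, each half is lifted
  into its own action, and the lifts are paired. Backwards, the two roots are paired first, and the
  relations of the factors join to one for \<open>wd_sum\<close>, which permits the lift.\<close>

lemma lax_nat_lemma:
  assumes w: "is_wd C \<phi>" "is_wd C \<psi>"
    and p: "p \<in> obs (slice C (bound C (wsrc \<phi>)))" and q: "q \<in> obs (slice C (bound C (wsrc \<psi>)))"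
    and r: "r = spn_lax C (wsrc \<phi>) (wsrc \<psi>) (p, q)"
    and n: "n = spn_lax C (wtgt \<phi>) (wtgt \<psi>) (spn_act C \<phi> p, spn_act C \<psi> q)"
    and S: "S = src C (spn_act C \<phi> p)" and T: "T = src C (spn_act C \<psi> q)"
  shows "spn_lax_nat C \<phi> \<psi> (p, q) \<in> hom (slice C (bound C (box_sum (wtgt \<phi>) (wtgt \<psi>)))) (spn_act C (wd_sum \<phi> \<psi>) r) n"
    "pb1 C p (legL C \<phi>) \<cdot> (pr1 C S T \<cdot> und (spn_lax_nat C \<phi> \<psi> (p, q))) = pr1 C (src C p) (src C q) \<cdot> pb1 C r (legL C (wd_sum \<phi> \<psi>))"
    "pb1 C q (legL C \<psi>) \<cdot> (pr2 C S T \<cdot> und (spn_lax_nat C \<phi> \<psi> (p, q))) = pr2 C (src C p) (src C q) \<cdot> pb1 C r (legL C (wd_sum \<phi> \<psi>))"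
    "\<exists>G \<in> hom (slice C (bound C (box_sum (wtgt \<phi>) (wtgt \<psi>)))) n (spn_act C (wd_sum \<phi> \<psi>) r).
       pr1 C (src C p) (src C q) \<cdot> (pb1 C r (legL C (wd_sum \<phi> \<psi>)) \<cdot> und G) = pb1 C p (legL C \<phi>) \<cdot> pr1 C S T \<and>
       pr2 C (src C p) (src C q) \<cdot> (pb1 C r (legL C (wd_sum \<phi> \<psi>)) \<cdot> und G) = pb1 C q (legL C \<psi>) \<cdot> pr2 C S T"
proof -
  let ?s = "wd_sum \<phi> \<psi>"
  note s = is_wd_sum[OF w]
  note X = is_wd_boxes(1)[OF w(1)] is_wd_boxes(1)[OF w(2)] and Y = is_wd_boxes(2)[OF w(1)] is_wd_boxes(2)[OF w(2)]
  have rob: "r \<in> obs (slice C (bound C (wsrc ?s)))" using mu_ob[OF X p q] by (simp add: r)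
  note ap = act_ob[OF w(1) p] and aq = act_ob[OF w(2) q] and ar = act_ob[OF s rob]
  have nob: "n \<in> obs (slice C (bound C (box_sum (wtgt \<phi>) (wtgt \<psi>))))" using mu_ob[OF Y ap aq] by (simp add: n)
  let ?t = "spn_act C ?s r" and ?rt = "pb1 C r (legL C ?s)"
  have t: "?t \<in> hom C (src C ?t) (bound C (box_sum (wtgt \<phi>) (wtgt \<psi>)))" using ob_hom[OF ar] by simp
  note rt = rt_hom[OF s rob]
  have rt': "?rt \<in> hom C (src C ?t) (src C (spn_lax C (wsrc \<phi>) (wsrc \<psi>) (p, q)))" using rt by (simp add: r)
  note pr = mu_pr_hom[OF X p q]
  let ?u = "pr1 C (src C p) (src C q) \<cdot> ?rt" and ?v = "pr2 C (src C p) (src C q) \<cdot> ?rt"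
  have u: "?u \<in> hom C (src C ?t) (src C p)" and v: "?v \<in> hom C (src C ?t) (src C q)"
    using cmp_hom[OF rt' pr(1)] cmp_hom[OF rt' pr(2)] .
  have rr: "r \<cdot> ?rt \<in> hom C (src C ?t) (bound C (box_sum (wsrc \<phi>) (wsrc \<psi>)))"
    using cmp_hom[OF rt ob_hom[OF rob]] by simp
  have sp: "spl C (wsrc \<phi>) (wsrc \<psi>) \<cdot> (r \<cdot> ?rt) = p \<cdot> ?u" "spr C (wsrc \<phi>) (wsrc \<psi>) \<cdot> (r \<cdot> ?rt) = q \<cdot> ?v"
    using mu_sp[OF X p q rt'] by (simp_all add: r)
  note st = sp_hom[OF Y t]
  have rel: "wd_rel C \<phi> (src C ?t) (p \<cdot> ?u) (spl C (wtgt \<phi>) (wtgt \<psi>) \<cdot> ?t)"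
    "wd_rel C \<psi> (src C ?t) (q \<cdot> ?v) (spr C (wtgt \<phi>) (wtgt \<psi>) \<cdot> ?t)"
    using rt_rel[OF s rob] unfolding wd_rel_sum[OF w rr t] sp by auto
  have pa: "p \<in> arrs C" "tgt C p = bound C (wsrc \<phi>)" and qa: "q \<in> arrs C" "tgt C q = bound C (wsrc \<psi>)" using p q by auto
  let ?b = "pb2 C r (legL C ?s)"
  note am = act_mid[OF s rob]
  \<comment> \<open>Together with \<open>ms2\<close> this puts the lifts in the definition of
    \<open>spn_lax_nat\<close> into the form of \<open>act_lift\<close>.\<close>
  have ms1: "mid_split C \<phi> \<psi> InL \<phi> \<cdot> ?b = pair C (bi C (wtgt \<phi>) \<cdot> (spl C (wtgt \<phi>) (wtgt \<psi>) \<cdot> ?t)) (bo C (wsrc \<phi>) \<cdot> (p \<cdot> ?u))"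
  proof (rule mid_split_cmp[OF w am(1) w(1) st(1) cmp_hom[OF u ob_hom[OF p]]])
    fix j assume "j \<in> dom (inp (wtgt \<phi>))"
    then show "InL j \<in> dom (inp (wtgt ?s)) \<and> inp (wtgt ?s) (InL j) = inp (wtgt \<phi>) j \<and>
        in_at C (wtgt ?s) (InL j) \<cdot> (legR C ?s \<cdot> ?b) = in_at C (wtgt \<phi>) j \<cdot> (spl C (wtgt \<phi>) (wtgt \<psi>) \<cdot> ?t)"
      using at_sp[OF Y t] by (simp add: am dom_tsum)
  next
    fix j assume "j \<in> dom (outp (wsrc \<phi>))"
    then show "InL j \<in> dom (outp (wsrc ?s)) \<and> outp (wsrc ?s) (InL j) = outp (wsrc \<phi>) j \<and>
        out_at C (wsrc ?s) (InL j) \<cdot> (legL C ?s \<cdot> ?b) = out_at C (wsrc \<phi>) j \<cdot> (p \<cdot> ?u)"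
      using at_sp[OF X rr] by (simp add: am dom_tsum sp)
  qed
  have ms2: "mid_split C \<phi> \<psi> InR \<psi> \<cdot> ?b = pair C (bi C (wtgt \<psi>) \<cdot> (spr C (wtgt \<phi>) (wtgt \<psi>) \<cdot> ?t)) (bo C (wsrc \<psi>) \<cdot> (q \<cdot> ?v))"
  proof (rule mid_split_cmp[OF w am(1) w(2) st(2) cmp_hom[OF v ob_hom[OF q]]])
    fix j assume "j \<in> dom (inp (wtgt \<psi>))"
    then show "InR j \<in> dom (inp (wtgt ?s)) \<and> inp (wtgt ?s) (InR j) = inp (wtgt \<psi>) j \<and>
        in_at C (wtgt ?s) (InR j) \<cdot> (legR C ?s \<cdot> ?b) = in_at C (wtgt \<psi>) j \<cdot> (spr C (wtgt \<phi>) (wtgt \<psi>) \<cdot> ?t)"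
      using at_sp[OF Y t] by (simp add: am dom_tsum)
  next
    fix j assume "j \<in> dom (outp (wsrc \<psi>))"
    then show "InR j \<in> dom (outp (wsrc ?s)) \<and> outp (wsrc ?s) (InR j) = outp (wsrc \<psi>) j \<and>
        out_at C (wsrc ?s) (InR j) \<cdot> (legL C ?s \<cdot> ?b) = out_at C (wsrc \<psi>) j \<cdot> (q \<cdot> ?v)"
      using at_sp[OF X rr] by (simp add: am dom_tsum sp)
  qed
  let ?f = "pb_lift C p (legL C \<phi>) ?u (mid_split C \<phi> \<psi> InL \<phi> \<cdot> ?b)"
  let ?g = "pb_lift C q (legL C \<psi>) ?v (mid_split C \<phi> \<psi> InR \<psi> \<cdot> ?b)"
  note f = act_lift[OF w(1) pa u rel(1) refl, folded ms1] and g = act_lift[OF w(2) qa v rel(2) refl, folded ms2]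
  note m = mu_pair[OF Y ap aq f(1) g(1) t f(3)[symmetric] g(3)[symmetric]]
  have F: "spn_lax_nat C \<phi> \<psi> (p, q) = (?t, pair C ?f ?g, n)"
    by (simp add: spn_lax_nat_def Let_def r n)
  have "(?t, pair C ?f ?g, n) \<in> hom (slice C (bound C (box_sum (wtgt \<phi>) (wtgt \<psi>)))) ?t n"
    using m ar by (intro slice_homI[OF _ nob]) (simp_all add: n)
  then show "spn_lax_nat C \<phi> \<psi> (p, q) \<in> hom (slice C (bound C (box_sum (wtgt \<phi>) (wtgt \<psi>)))) (spn_act C (wd_sum \<phi> \<psi>) r) n"
    by (simp add: F)
  show "pb1 C p (legL C \<phi>) \<cdot> (pr1 C S T \<cdot> und (spn_lax_nat C \<phi> \<psi> (p, q))) = ?u"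
    "pb1 C q (legL C \<psi>) \<cdot> (pr2 C S T \<cdot> und (spn_lax_nat C \<phi> \<psi> (p, q))) = ?v"
    using m(3,4) f(2) g(2) by (simp_all add: F S T)
  note pr' = mu_pr_hom[OF Y ap aq, folded n, folded S T]
  note rp = rt_hom[OF w(1) p, folded S] and rq = rt_hom[OF w(2) q, folded T]
  let ?x = "pb1 C p (legL C \<phi>) \<cdot> pr1 C S T" and ?y = "pb1 C q (legL C \<psi>) \<cdot> pr2 C S T"
  have x: "?x \<in> hom C (src C n) (src C p)" and y: "?y \<in> hom C (src C n) (src C q)"
    using cmp_hom[OF pr'(1) rp] cmp_hom[OF pr'(2) rq] .
  have xy: "pair C ?x ?y \<in> hom C (src C n) (src C r)"
    using pair_hom[OF x y] src_mu[OF X p q] by (simp add: r)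
  note pp = pr_pair[OF x y]
  have nh: "n \<in> hom C (src C n) (bound C (box_sum (wtgt \<phi>) (wtgt \<psi>)))" by (rule ob_hom[OF nob])
  have rxy: "r \<cdot> pair C ?x ?y \<in> hom C (src C n) (bound C (box_sum (wsrc \<phi>) (wsrc \<psi>)))"
    using cmp_hom[OF xy ob_hom[OF rob]] by simp
  have sr: "spl C (wsrc \<phi>) (wsrc \<psi>) \<cdot> (r \<cdot> pair C ?x ?y) = p \<cdot> ?x" "spr C (wsrc \<phi>) (wsrc \<psi>) \<cdot> (r \<cdot> pair C ?x ?y) = q \<cdot> ?y"
    using mu_sp[OF X p q, of "pair C ?x ?y"] xy pp by (simp_all add: r)
  have sn: "spl C (wtgt \<phi>) (wtgt \<psi>) \<cdot> n = spn_act C \<phi> p \<cdot> pr1 C S T" "spr C (wtgt \<phi>) (wtgt \<psi>) \<cdot> n = spn_act C \<psi> q \<cdot> pr2 C S T"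
    using mu_sp0[OF Y ap aq] by (simp_all add: n S T)
  have "wd_rel C ?s (src C n) (r \<cdot> pair C ?x ?y) n"
    unfolding wd_rel_sum[OF w rxy nh] sr sn
    using rt_rel_cmp[OF w(1) p, folded S, OF pr'(1)] rt_rel_cmp[OF w(2) q, folded T, OF pr'(2)] by simp
  then obtain G where "G \<in> hom (slice C (bound C (box_sum (wtgt \<phi>) (wtgt \<psi>)))) n ?t" "?rt \<cdot> und G = pair C ?x ?y"
    using act_lift_ex[OF s rob _ xy] nob unfolding wd_sum_simps(2) by blast
  then show "\<exists>G \<in> hom (slice C (bound C (box_sum (wtgt \<phi>) (wtgt \<psi>)))) n (spn_act C (wd_sum \<phi> \<psi>) r).
       pr1 C (src C p) (src C q) \<cdot> (pb1 C r (legL C (wd_sum \<phi> \<psi>)) \<cdot> und G) = pb1 C p (legL C \<phi>) \<cdot> pr1 C S T \<and>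
       pr2 C (src C p) (src C q) \<cdot> (pb1 C r (legL C (wd_sum \<phi> \<psi>)) \<cdot> und G) = pb1 C q (legL C \<psi>) \<cdot> pr2 C S T"
    using pp by (intro bexI[of _ G]) simp_all
qed

text \<open>The nested pair is built from the inside out: \<open>wd_rel_asc\<close> first provides
  the boundary equations for the factors over \<open>Y\<close> and \<open>Z\<close>, and then the
  one for \<open>X\<close> that the outer pair needs. The arrow back regroups in the same
  manner.\<close>

lemma lax_asc_lemma:
  assumes X: "is_box C X" and Y: "is_box C Y" and Z: "is_box C Z"
    and p: "p \<in> obs (slice C (bound C X))" and q: "q \<in> obs (slice C (bound C Y))" and r: "r \<in> obs (slice C (bound C Z))"
    and a: "a = relabel (box_sum (box_sum X Y) Z) (box_sum X (box_sum Y Z)) assocR assocL"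
    and pq: "pq = spn_lax C X Y (p, q)" and m: "m = spn_lax C (box_sum X Y) Z (pq, r)"
    and qr: "qr = spn_lax C Y Z (q, r)" and n: "n = spn_lax C X (box_sum Y Z) (p, qr)"
    and rt: "rt = pb1 C m (legL C a)"
    and F: "F = spn_cell C a m (\<lambda>a. pair C (pr1 C (src C p) (src C q) \<cdot> (pr1 C (src C pq) (src C r) \<cdot> a))
            (pair C (pr2 C (src C p) (src C q) \<cdot> (pr1 C (src C pq) (src C r) \<cdot> a)) (pr2 C (src C pq) (src C r) \<cdot> a))) n"
  shows "F \<in> hom (slice C (bound C (box_sum X (box_sum Y Z)))) (spn_act C a m) n" (is ?h)
    "pr1 C (src C p) (src C qr) \<cdot> und F = pr1 C (src C p) (src C q) \<cdot> (pr1 C (src C pq) (src C r) \<cdot> rt)" (is ?a)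
    "pr1 C (src C q) (src C r) \<cdot> (pr2 C (src C p) (src C qr) \<cdot> und F) = pr2 C (src C p) (src C q) \<cdot> (pr1 C (src C pq) (src C r) \<cdot> rt)" (is ?b)
    "pr2 C (src C q) (src C r) \<cdot> (pr2 C (src C p) (src C qr) \<cdot> und F) = pr2 C (src C pq) (src C r) \<cdot> rt" (is ?c)
    "\<exists>G \<in> hom (slice C (bound C (box_sum X (box_sum Y Z)))) n (spn_act C a m).
      pr1 C (src C p) (src C q) \<cdot> (pr1 C (src C pq) (src C r) \<cdot> (rt \<cdot> und G)) = pr1 C (src C p) (src C qr) \<and>
      pr2 C (src C p) (src C q) \<cdot> (pr1 C (src C pq) (src C r) \<cdot> (rt \<cdot> und G)) = pr1 C (src C q) (src C r) \<cdot> pr2 C (src C p) (src C qr) \<and>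
      pr2 C (src C pq) (src C r) \<cdot> (rt \<cdot> und G) = pr2 C (src C q) (src C r) \<cdot> pr2 C (src C p) (src C qr)"
proof -
  note XY = is_box_sum[OF X Y] and YZ = is_box_sum[OF Y Z]
  have pqo: "pq \<in> obs (slice C (bound C (box_sum X Y)))" and qro: "qr \<in> obs (slice C (bound C (box_sum Y Z)))"
    using mu_ob[OF X Y p q] mu_ob[OF Y Z q r] by (auto simp: pq qr)
  have w: "is_wd C a" unfolding a by (rule wd_typing X Y Z)+
  have as: "wsrc a = box_sum (box_sum X Y) Z" "wtgt a = box_sum X (box_sum Y Z)" by (simp_all add: a)
  have mo: "m \<in> obs (slice C (bound C (wsrc a)))" and no: "n \<in> obs (slice C (bound C (box_sum X (box_sum Y Z))))"
    using mu_ob[OF XY Z pqo r] mu_ob[OF X YZ p qro] by (auto simp: m n as)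
  let ?t = "spn_act C a m"
  have t: "?t \<in> obs (slice C (bound C (box_sum X (box_sum Y Z))))" using act_ob[OF w mo] by (simp add: as)
  note th = ob_hom[OF t]
  have rth: "rt \<in> hom C (src C ?t) (src C m)" unfolding rt by (rule rt_hom[OF w mo])
  note prm = mu_pr_hom[OF XY Z pqo r, folded m] and prpq = mu_pr_hom[OF X Y p q, folded pq]
  note prqr = mu_pr_hom[OF Y Z q r, folded qr] and prn = mu_pr_hom[OF X YZ p qro, folded n]
  let ?d = "pr1 C (src C pq) (src C r) \<cdot> rt" and ?w = "pr2 C (src C pq) (src C r) \<cdot> rt"
  let ?u = "pr1 C (src C p) (src C q) \<cdot> ?d" and ?v = "pr2 C (src C p) (src C q) \<cdot> ?d"
  have d: "?d \<in> hom C (src C ?t) (src C pq)" and hw: "?w \<in> hom C (src C ?t) (src C r)"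
    using cmp_hom[OF rth prm(1)] cmp_hom[OF rth prm(2)] .
  have u: "?u \<in> hom C (src C ?t) (src C p)" and v: "?v \<in> hom C (src C ?t) (src C q)"
    using cmp_hom[OF d prpq(1)] cmp_hom[OF d prpq(2)] .
  have mrt: "m \<cdot> rt \<in> hom C (src C ?t) (bound C (box_sum (box_sum X Y) Z))"
    using cmp_hom[OF rth ob_hom[OF mo]] by (simp add: as)
  have rel: "wd_rel C (relabel (box_sum (box_sum X Y) Z) (box_sum X (box_sum Y Z)) assocR assocL) (src C ?t) (m \<cdot> rt) ?t"
    using rt_rel[OF w mo] by (simp add: rt a)
  note e = rel[unfolded wd_rel_asc[OF X Y Z mrt th]]
  note sm = mu_sp[OF XY Z pqo r, folded m, OF rth] and spq = mu_sp[OF X Y p q, folded pq, OF d]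
  note st = sp_hom[OF X YZ th]
  note in1 = mu_pair[OF Y Z q r v hw st(2), folded qr]
  have i: "spl C Y Z \<cdot> (spr C X (box_sum Y Z) \<cdot> ?t) = q \<cdot> ?v" "spr C Y Z \<cdot> (spr C X (box_sum Y Z) \<cdot> ?t) = r \<cdot> ?w"
    and j: "spl C X (box_sum Y Z) \<cdot> ?t = p \<cdot> ?u"
    using e sm spq by simp_all
  note k = in1[OF i]
  note l = mu_pair[OF X YZ p qro u k(1) th j k(2)[symmetric], folded n]
  have F': "F = (?t, pair C ?u (pair C ?v ?w), n)" unfolding F spn_cell_def rt ..
  show ?h unfolding F' by (rule slice_homI[OF t no l(1,2)])
  show ?a ?b ?c using l(3,4) k(3,4) by (simp_all add: F')
  let ?p = "pr1 C (src C p) (src C qr)" and ?e = "pr2 C (src C p) (src C qr)"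
  have q1: "pr1 C (src C q) (src C r) \<cdot> ?e \<in> hom C (src C n) (src C q)" and r1: "pr2 C (src C q) (src C r) \<cdot> ?e \<in> hom C (src C n) (src C r)"
    using cmp_hom[OF prn(2) prqr(1)] cmp_hom[OF prn(2) prqr(2)] .
  let ?i = "pair C ?p (pr1 C (src C q) (src C r) \<cdot> ?e)"
  have ih: "?i \<in> hom C (src C n) (src C pq)"
    using pair_hom[OF prn(1) q1] src_mu[OF X Y p q] by (simp add: pq)
  let ?o = "pair C ?i (pr2 C (src C q) (src C r) \<cdot> ?e)"
  have oh: "?o \<in> hom C (src C n) (src C m)"
    using pair_hom[OF ih r1] src_mu[OF XY Z pqo r] by (simp add: m)
  note po = pr_pair[OF ih r1] and pi = pr_pair[OF prn(1) q1]
  have mo': "m \<cdot> ?o \<in> hom C (src C n) (bound C (box_sum (box_sum X Y) Z))"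
    using cmp_hom[OF oh ob_hom[OF mo]] by (simp add: as)
  have "wd_rel C a (src C n) (m \<cdot> ?o) n"
    unfolding a wd_rel_asc[OF X Y Z mo' ob_hom[OF no]]
    using mu_sp[OF XY Z pqo r, folded m, OF oh] mu_sp[OF X Y p q, folded pq, OF ih] po pi
      mu_sp0[OF X YZ p qro, folded n] mu_sp[OF Y Z q r, folded qr, OF prn(2)] by simp
  then obtain G where "G \<in> hom (slice C (bound C (box_sum X (box_sum Y Z)))) n (spn_act C a m)" "rt \<cdot> und G = ?o"
    using act_lift_ex[OF w mo _ oh] no unfolding as rt by blast
  then show "\<exists>G \<in> hom (slice C (bound C (box_sum X (box_sum Y Z)))) n (spn_act C a m).
      pr1 C (src C p) (src C q) \<cdot> (pr1 C (src C pq) (src C r) \<cdot> (rt \<cdot> und G)) = pr1 C (src C p) (src C qr) \<and>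
      pr2 C (src C p) (src C q) \<cdot> (pr1 C (src C pq) (src C r) \<cdot> (rt \<cdot> und G)) = pr1 C (src C q) (src C r) \<cdot> pr2 C (src C p) (src C qr) \<and>
      pr2 C (src C pq) (src C r) \<cdot> (rt \<cdot> und G) = pr2 C (src C q) (src C r) \<cdot> pr2 C (src C p) (src C qr)"
    using po pi by (intro bexI[of _ G]) simp_all
qed

lemma lax_unt_lemma:
  "spn_lax_unt C TYPE('l) \<in> hom C (terminal C) (bound C (box_empty :: ('l, 'o) box))"
  unfolding spn_lax_unt_def
  using terminal_is_terminal by (intro to_bound_lemma is_box_empty) (auto simp: is_terminal_def)

lemma lax_lun_lemma:
  fixes X :: "('l, 'o) box"
  assumes X: "is_box C X" and p: "p \<in> obs (slice C (bound C X))" and l: "l = relabel (box_sum box_empty X) X (port_case undefined id) InR"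
    and \<epsilon>: "\<epsilon> = spn_lax_unt C TYPE('l)" and m: "m = spn_lax C box_empty X (\<epsilon>, p)"
  shows "spn_cell C l m (cmp C (pr2 C (src C \<epsilon>) (src C p))) p \<in> hom (slice C (bound C X)) (spn_act C l m) p" (is ?h)
    "\<exists>G \<in> hom (slice C (bound C X)) p (spn_act C l m).
      pr2 C (src C \<epsilon>) (src C p) \<cdot> (pb1 C m (legL C l) \<cdot> und G) = idn C (src C p)" (is ?g)
proof -
  note E = is_box_empty
  have \<epsilon>o: "\<epsilon> \<in> obs (slice C (bound C (box_empty :: ('l, 'o) box)))" and \<epsilon>s: "src C \<epsilon> = terminal C"
    using lax_unt_lemma by (auto simp: \<epsilon> hom_iff)
  have w: "is_wd C l" unfolding l by (rule wd_typing X)+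
  have ls: "wsrc l = box_sum box_empty X" "wtgt l = X" by (simp_all add: l)
  have mo: "m \<in> obs (slice C (bound C (wsrc l)))"
    using mu_ob[OF E X \<epsilon>o p] by (simp add: m ls)
  have t: "spn_act C l m \<in> obs (slice C (bound C X))" using act_ob[OF w mo] by (simp add: ls)
  note rth = rt_hom[OF w mo] and pr = mu_pr_hom[OF E X \<epsilon>o p, folded m]
  have mrt: "m \<cdot> pb1 C m (legL C l) \<in> hom C (src C (spn_act C l m)) (bound C (box_sum box_empty X))"
    using cmp_hom[OF rth ob_hom[OF mo]] by (simp add: ls)
  have "spr C box_empty X \<cdot> (m \<cdot> pb1 C m (legL C l)) = spn_act C l m"
    using rt_rel[OF w mo] wd_rel_lun[OF X mrt ob_hom[OF t]] by (simp add: l)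
  then have "p \<cdot> (pr2 C (src C \<epsilon>) (src C p) \<cdot> pb1 C m (legL C l)) = spn_act C l m"
    using mu_sp(2)[OF E X \<epsilon>o p, folded m, OF rth] by simp
  then show ?h unfolding spn_cell_def by (intro slice_homI t p cmp_hom[OF rth pr(2)])
  have so: "src C p \<in> obs C" using p by (simp add: src_obs)
  \<comment> \<open>The arrow back has to supply an element of the apex of the unit; that apex is
    terminal, so \<open>bang\<close> is the only candidate.\<close>
  let ?o = "pair C (bang C (src C p)) (idn C (src C p))"
  have bh: "bang C (src C p) \<in> hom C (src C p) (src C \<epsilon>)" using bang_hom[OF so] by (simp add: \<epsilon>s)
  have oh: "?o \<in> hom C (src C p) (src C m)"
    using pair_hom[OF bh idn_hom[OF so]] src_mu[OF E X \<epsilon>o p] by (simp add: m)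
  note po = pr_pair[OF bh idn_hom[OF so]]
  have mo': "m \<cdot> ?o \<in> hom C (src C p) (bound C (box_sum box_empty X))"
    using cmp_hom[OF oh ob_hom[OF mo]] by (simp add: ls)
  have "wd_rel C l (src C p) (m \<cdot> ?o) p"
    unfolding l wd_rel_lun[OF X mo' ob_hom[OF p]]
    using mu_sp(2)[OF E X \<epsilon>o p, folded m, OF oh] po idn_right[OF ob_hom[OF p]] by simp
  then obtain G where "G \<in> hom (slice C (bound C X)) p (spn_act C l m)" "pb1 C m (legL C l) \<cdot> und G = ?o"
    using act_lift_ex[OF w mo _ oh] p unfolding ls by blast
  then show ?g using po by (intro bexI[of _ G]) simp_all
qed

lemma lax_run_lemma:
  fixes X :: "('l, 'o) box"
  assumes X: "is_box C X" and p: "p \<in> obs (slice C (bound C X))" and l: "l = relabel (box_sum X box_empty) X (port_case id undefined) InL"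
    and \<epsilon>: "\<epsilon> = spn_lax_unt C TYPE('l)" and m: "m = spn_lax C X box_empty (p, \<epsilon>)"
  shows "spn_cell C l m (cmp C (pr1 C (src C p) (src C \<epsilon>))) p \<in> hom (slice C (bound C X)) (spn_act C l m) p" (is ?h)
    "\<exists>G \<in> hom (slice C (bound C X)) p (spn_act C l m).
      pr1 C (src C p) (src C \<epsilon>) \<cdot> (pb1 C m (legL C l) \<cdot> und G) = idn C (src C p)" (is ?g)
proof -
  note E = is_box_empty
  have \<epsilon>o: "\<epsilon> \<in> obs (slice C (bound C (box_empty :: ('l, 'o) box)))" and \<epsilon>s: "src C \<epsilon> = terminal C"
    using lax_unt_lemma by (auto simp: \<epsilon> hom_iff)
  have w: "is_wd C l" unfolding l by (rule wd_typing X)+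
  have ls: "wsrc l = box_sum X box_empty" "wtgt l = X" by (simp_all add: l)
  have mo: "m \<in> obs (slice C (bound C (wsrc l)))"
    using mu_ob[OF X E p \<epsilon>o] by (simp add: m ls)
  have t: "spn_act C l m \<in> obs (slice C (bound C X))" using act_ob[OF w mo] by (simp add: ls)
  note rth = rt_hom[OF w mo] and pr = mu_pr_hom[OF X E p \<epsilon>o, folded m]
  have mrt: "m \<cdot> pb1 C m (legL C l) \<in> hom C (src C (spn_act C l m)) (bound C (box_sum X box_empty))"
    using cmp_hom[OF rth ob_hom[OF mo]] by (simp add: ls)
  have "spl C X box_empty \<cdot> (m \<cdot> pb1 C m (legL C l)) = spn_act C l m"
    using rt_rel[OF w mo] wd_rel_run[OF X mrt ob_hom[OF t]] by (simp add: l)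
  then have "p \<cdot> (pr1 C (src C p) (src C \<epsilon>) \<cdot> pb1 C m (legL C l)) = spn_act C l m"
    using mu_sp(1)[OF X E p \<epsilon>o, folded m, OF rth] by simp
  then show ?h unfolding spn_cell_def by (intro slice_homI t p cmp_hom[OF rth pr(1)])
  have so: "src C p \<in> obs C" using p by (simp add: src_obs)
  let ?o = "pair C (idn C (src C p)) (bang C (src C p))"
  have bh: "bang C (src C p) \<in> hom C (src C p) (src C \<epsilon>)" using bang_hom[OF so] by (simp add: \<epsilon>s)
  have oh: "?o \<in> hom C (src C p) (src C m)"
    using pair_hom[OF idn_hom[OF so] bh] src_mu[OF X E p \<epsilon>o] by (simp add: m)
  note po = pr_pair[OF idn_hom[OF so] bh]
  have mo': "m \<cdot> ?o \<in> hom C (src C p) (bound C (box_sum X box_empty))"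
    using cmp_hom[OF oh ob_hom[OF mo]] by (simp add: ls)
  have "wd_rel C l (src C p) (m \<cdot> ?o) p"
    unfolding l wd_rel_run[OF X mo' ob_hom[OF p]]
    using mu_sp(1)[OF X E p \<epsilon>o, folded m, OF oh] po idn_right[OF ob_hom[OF p]] by simp
  then obtain G where "G \<in> hom (slice C (bound C X)) p (spn_act C l m)" "pb1 C m (legL C l) \<cdot> und G = ?o"
    using act_lift_ex[OF w mo _ oh] p unfolding ls by blast
  then show ?g using po by (intro bexI[of _ G]) simp_all
qed

lemma lax_brd_lemma:
  assumes X: "is_box C X" and Y: "is_box C Y" and p: "p \<in> obs (slice C (bound C X))" and q: "q \<in> obs (slice C (bound C Y))"
    and b: "b = relabel (box_sum X Y) (box_sum Y X) swap_port swap_port" and m: "m = spn_lax C X Y (p, q)" and n: "n = spn_lax C Y X (q, p)"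
    and rt: "rt = pb1 C m (legL C b)"
    and F: "F = spn_cell C b m (\<lambda>a. pair C (pr2 C (src C p) (src C q) \<cdot> a) (pr1 C (src C p) (src C q) \<cdot> a)) n"
  shows "F \<in> hom (slice C (bound C (box_sum Y X))) (spn_act C b m) n" (is ?h)
    "pr1 C (src C q) (src C p) \<cdot> und F = pr2 C (src C p) (src C q) \<cdot> rt" (is ?a)
    "pr2 C (src C q) (src C p) \<cdot> und F = pr1 C (src C p) (src C q) \<cdot> rt" (is ?b)
    "\<exists>G \<in> hom (slice C (bound C (box_sum Y X))) n (spn_act C b m).
      pr1 C (src C p) (src C q) \<cdot> (rt \<cdot> und G) = pr2 C (src C q) (src C p) \<and>
      pr2 C (src C p) (src C q) \<cdot> (rt \<cdot> und G) = pr1 C (src C q) (src C p)" (is ?g)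
proof -
  have w: "is_wd C b" unfolding b by (rule wd_typing X Y)+
  have bs: "wsrc b = box_sum X Y" "wtgt b = box_sum Y X" by (simp_all add: b)
  have mo: "m \<in> obs (slice C (bound C (wsrc b)))" and no: "n \<in> obs (slice C (bound C (box_sum Y X)))"
    using mu_ob[OF X Y p q] mu_ob[OF Y X q p] by (auto simp: m n bs)
  let ?t = "spn_act C b m"
  have t: "?t \<in> obs (slice C (bound C (box_sum Y X)))" using act_ob[OF w mo] by (simp add: bs)
  have rth: "rt \<in> hom C (src C ?t) (src C m)" unfolding rt by (rule rt_hom[OF w mo])
  note prm = mu_pr_hom[OF X Y p q, folded m] and prn = mu_pr_hom[OF Y X q p, folded n]
  have mrt: "m \<cdot> rt \<in> hom C (src C ?t) (bound C (box_sum X Y))"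
    using cmp_hom[OF rth ob_hom[OF mo]] by (simp add: bs)
  have e: "spl C X Y \<cdot> (m \<cdot> rt) = spr C Y X \<cdot> ?t \<and> spr C X Y \<cdot> (m \<cdot> rt) = spl C Y X \<cdot> ?t"
    using rt_rel[OF w mo] wd_rel_brd[OF X Y mrt ob_hom[OF t]] by (simp add: b rt)
  note sm = mu_sp[OF X Y p q, folded m, OF rth]
  have e': "spl C Y X \<cdot> ?t = q \<cdot> (pr2 C (src C p) (src C q) \<cdot> rt)" "spr C Y X \<cdot> ?t = p \<cdot> (pr1 C (src C p) (src C q) \<cdot> rt)"
    using e sm by simp_all
  note k = mu_pair[OF Y X q p cmp_hom[OF rth prm(2)] cmp_hom[OF rth prm(1)] ob_hom[OF t] e', folded n]
  have F': "F = (?t, pair C (pr2 C (src C p) (src C q) \<cdot> rt) (pr1 C (src C p) (src C q) \<cdot> rt), n)"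
    unfolding F spn_cell_def rt ..
  show ?h unfolding F' by (rule slice_homI[OF t no k(1,2)])
  show ?a ?b using k(3,4) by (simp_all add: F')
  let ?o = "pair C (pr2 C (src C q) (src C p)) (pr1 C (src C q) (src C p))"
  have oh: "?o \<in> hom C (src C n) (src C m)"
    using pair_hom[OF prn(2,1)] src_mu[OF X Y p q] by (simp add: m)
  note po = pr_pair[OF prn(2,1)]
  have mo': "m \<cdot> ?o \<in> hom C (src C n) (bound C (box_sum X Y))"
    using cmp_hom[OF oh ob_hom[OF mo]] by (simp add: bs)
  have "wd_rel C b (src C n) (m \<cdot> ?o) n"
    unfolding b wd_rel_brd[OF X Y mo' ob_hom[OF no]]
    using mu_sp[OF X Y p q, folded m, OF oh] po mu_sp0[OF Y X q p, folded n] by simp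
  then obtain G where "G \<in> hom (slice C (bound C (box_sum Y X))) n (spn_act C b m)" "rt \<cdot> und G = ?o"
    using act_lift_ex[OF w mo _ oh] no unfolding bs rt by blast
  then show ?g using po by (intro bexI[of _ G]) simp_all
qed

end

section \<open>Change of types along a functor\<close>

abbreviation wmap :: "('o, 'm, 'p, 'n) fct \<Rightarrow> ('l, 'o) wd \<Rightarrow> ('l, 'p) wd" where
  "wmap F \<equiv> far (Wiring_fct F)"

lemma retype_simps [simp]:
  "inp (retype F X) = map_option (fob F) \<circ> inp X" "outp (retype F X) = map_option (fob F) \<circ> outp X"
  by (simp_all add: retype_def)

lemma wmap_simps [simp]:
  "wsrc (wmap F \<phi>) = retype F (wsrc \<phi>)" "wtgt (wmap F \<phi>) = retype F (wtgt \<phi>)"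
  "win (wmap F \<phi>) = win \<phi>" "wout (wmap F \<phi>) = wout \<phi>"
  by (simp_all add: Wiring_fct_def)

lemma Wiring_fct_plain:
  "fob (Wiring_fct F) = retype F"
  "retype F (box_sum X Y) = box_sum (retype F X) (retype F Y)" "retype F box_empty = box_empty"
  "wmap F (wd_sum \<phi> \<psi>) = wd_sum (wmap F \<phi>) (wmap F \<psi>)"
  "wmap F (wd_comp \<psi> \<phi>) = wd_comp (wmap F \<psi>) (wmap F \<phi>)"
  "wmap F (wd_id X) = wd_id (retype F X)"
  "wmap F (relabel X Y f g) = relabel (retype F X) (retype F Y) f g"
proof -
  show "fob (Wiring_fct F) = retype F" by (simp add: Wiring_fct_def)
  show "wmap F (relabel X Y f g) = relabel (retype F X) (retype F Y) f g"
    by (simp add: relabel_def Wiring_fct_def dom_retype)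
qed (use Wiring_fct_strict[where F = F] in \<open>simp_all add: Wiring_fct_def\<close>)

lemma is_tset_retype:
  assumes F: "\<And>a. a \<in> obs C \<Longrightarrow> fob F a \<in> obs D" and T: "is_tset C T"
  shows "is_tset D (map_option (fob F) \<circ> T)"
  using T F unfolding is_tset_def dom_retype by (auto simp: ran_def)

lemma is_box_retype:
  assumes "\<And>a. a \<in> obs C \<Longrightarrow> fob F a \<in> obs D" "is_box C X"
  shows "is_box D (retype F X)"
  using assms is_tset_retype[where F = F] by (auto simp: is_box_def)

lemma is_wd_wmap:
  assumes F: "\<And>a. a \<in> obs C \<Longrightarrow> fob F a \<in> obs D" and w: "is_wd C \<phi>"
  shows "is_wd D (wmap F \<phi>)"
  unfolding is_wd_def wmap_simps retype_simps dom_retype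
proof (intro conjI ballI)
  show "is_box D (retype F (wsrc \<phi>))" "is_box D (retype F (wtgt \<phi>))"
    using is_box_retype[where F = F, OF F] is_wd_boxes[OF w] by auto
  fix x assume "x \<in> dom (inp (wsrc \<phi>))"
  then have "case_sum (outp (wsrc \<phi>)) (inp (wtgt \<phi>)) (win \<phi> x) = inp (wsrc \<phi>) x" using w by (auto simp: is_wd_def)
  then show "case_sum (map_option (fob F) \<circ> outp (wsrc \<phi>)) (map_option (fob F) \<circ> inp (wtgt \<phi>)) (win \<phi> x)
      = (map_option (fob F) \<circ> inp (wsrc \<phi>)) x"
    by (cases "win \<phi> x") auto
qed (use w in \<open>auto simp: is_wd_def\<close>)

lemma restrict_alg_simps:
  "fib (restrict_alg G B) X = fib B (fob G X)" "act (restrict_alg G B) \<phi> = act B (far G \<phi>)"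
  "act_cmp (restrict_alg G B) \<psi> \<phi> = act_cmp B (far G \<psi>) (far G \<phi>)" "act_idn (restrict_alg G B) X = act_idn B (fob G X)"
  "lax (restrict_alg G B) X Y = lax B (fob G X) (fob G Y)" "lax_unt (restrict_alg G B) = lax_unt B"
  "lax_nat (restrict_alg G B) \<phi> \<psi> = lax_nat B (far G \<phi>) (far G \<psi>)"
  "lax_asc (restrict_alg G B) X Y Z = lax_asc B (fob G X) (fob G Y) (fob G Z)"
  "lax_lun (restrict_alg G B) X = lax_lun B (fob G X)" "lax_run (restrict_alg G B) X = lax_run B (fob G X)"
  "lax_brd (restrict_alg G B) X Y = lax_brd B (fob G X) (fob G Y)"
  by (simp_all add: restrict_alg_def)

lemma Wiring_fct_id: "retype fct_id = (\<lambda>X. X)" "wmap fct_id = (\<lambda>\<phi>. \<phi>)"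
proof -
  show e: "retype fct_id = (\<lambda>X. X)" by (auto simp: retype_def fct_id_def option.map_ident comp_def)
  show "wmap fct_id = (\<lambda>\<phi>. \<phi>)" by (rule ext, rule wd.equality) (simp_all add: e)
qed

text \<open>Presents \<open>Spn C\<close> itself as a restriction, so that one verification of the
  axioms serves both ends of an algebra map.\<close>

lemma restrict_alg_id: "restrict_alg (Wiring_fct fct_id) A = A"
  by (simp add: restrict_alg_def Wiring_fct_plain Wiring_fct_id)

context finitely_complete
begin

text \<open>
  For \<open>F = fct_id\<close> this is \<open>Spn C\<close> itself; a general \<open>F\<close> is needed for the target of an algebra map.
\<close>

lemma Spn_span_algebra:
  fixes C0 :: "('p, 'n, 'y) cat_scheme" and F :: "('p, 'n, 'o, 'm) fct"
  assumes F: "\<And>a. a \<in> obs C0 \<Longrightarrow> fob F a \<in> obs C"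
  shows "span_algebra (Wiring C0 :: (('l, 'p) box, ('l, 'p) wd) smc)
    (restrict_alg (Wiring_fct F) (Spn C)) C (\<lambda>X. bound C (retype F X)) (\<lambda>X. bo C (retype F X))
    (\<lambda>\<phi> s. pb1 C s (legL C (wmap F \<phi>))) (\<lambda>s t. pr1 C (src C s) (src C t)) (\<lambda>s t. pr2 C (src C s) (src C t))"
proof -
  note sim = restrict_alg_simps Spn_simps Wiring_simps Wiring_fct_plain hom_Wiring
  have B: "is_box C (retype F X)" if "is_box C0 X" for X :: "('l, 'p) box" using F that by (rule is_box_retype)
  have WD: "is_wd C (wmap F \<phi>)" if "is_wd C0 \<phi>" for \<phi> :: "('l, 'p) wd" using F that by (rule is_wd_wmap)
  show ?thesis
  proof (intro span_algebra.intro span_algebra_axioms.intro Wiring_symmetric_monoidal category_axioms, goal_cases)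
    case (1 X)
    show ?case by (simp add: sim)
  next
    case (2 \<phi> X Y s)
    then show ?case using act_ob[OF WD[of \<phi>], of s] by (auto simp: sim)
  next
    case (3 \<phi> X Y s)
    then show ?case using rt_hom[OF WD[of \<phi>], of s] by (auto simp: sim)
  next
    case (4 \<phi> X Y s x Q y)
    then show ?case using act_sep[OF WD[of \<phi>], of s x Q y] by (auto simp: sim)
  next
    case (5 \<phi> X Y s x Q y)
    have w: "is_wd C (wmap F \<phi>)" and s: "s \<in> obs (slice C (bound C (wsrc (wmap F \<phi>))))"
      and h: "x \<in> hom C Q (src C (spn_act C (wmap F \<phi>) s))" "y \<in> hom C Q (src C (spn_act C (wmap F \<phi>) s))"
      and e: "spn_act C (wmap F \<phi>) s \<cdot> x = spn_act C (wmap F \<phi>) s \<cdot> y"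
      using 5 WD[of \<phi>] by (auto simp: sim)
    show ?case
      \<comment> \<open>Rewriting with \<open>e\<close> makes both inner boundaries related to one
        and the same outer boundary.\<close>
      using wd_rel_in[OF w rt_rel_cmp[OF w s h(1)] rt_rel_cmp[OF w s h(2), folded e]] 5 by (auto simp: sim)
  next
    case (6 \<phi> X Y s x Q y)
    have w: "is_wd C (wmap F \<phi>)" and s: "s \<in> obs (slice C (bound C (wsrc (wmap F \<phi>))))"
      and h: "x \<in> hom C Q (src C (spn_act C (wmap F \<phi>) s))" "y \<in> hom C Q (src C (spn_act C (wmap F \<phi>) s))"
      using 6 WD[of \<phi>] by (auto simp: sim)
    show ?case
      using wd_rel_out[OF w rt_rel_cmp[OF w s h(1)] rt_rel_cmp[OF w s h(2)]] 6 by (auto simp: sim)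
  next
    case (7 \<phi> X Y f s t)
    then show ?case using act_ar_lemma(1)[OF WD[of \<phi>], of f s t] by (auto simp: sim)
  next
    case (8 \<phi> X Y f s t)
    then show ?case using act_ar_lemma(2)[OF WD[of \<phi>], of f s t] by (auto simp: sim)
  next
    case (9 X Y s t)
    then show ?case using mu_ob[OF B[of X] B[of Y], of s t] by (simp add: sim)
  next
    case (10 X Y s t)
    then show ?case using mu_pr_hom(1)[OF B[of X] B[of Y], of s t] by (simp add: sim)
  next
    case (11 X Y s t)
    then show ?case using mu_pr_hom(2)[OF B[of X] B[of Y], of s t] by (simp add: sim)
  next
    case (12 X Y s t x Q y)
    then show ?case using mu_sep[OF B[of X] B[of Y], of s t x Q y] by (simp add: sim)
  next
    case (13 X Y s t x Q y)
    then show ?case using mu_sp[OF B[of X] B[of Y], of s t x Q] mu_sp[OF B[of X] B[of Y], of s t y Q] by (simp add: sim)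
  next
    case (14 X Y s t x Q y)
    have b: "is_box C (retype F X)" "is_box C (retype F Y)"
      and s: "s \<in> obs (slice C (bound C (retype F X)))" "t \<in> obs (slice C (bound C (retype F Y)))"
      and x: "x \<in> hom C Q (src C (spn_lax C (retype F X) (retype F Y) (s, t)))"
      and y: "y \<in> hom C Q (src C (spn_lax C (retype F X) (retype F Y) (s, t)))"
      using 14 B[of X] B[of Y] by (auto simp: sim)
    note m = ob_hom[OF mu_ob[OF b s]]
    show ?case
      using bo_sum[OF b cmp_hom[OF x m] cmp_hom[OF y m]] mu_sp[OF b s x] mu_sp[OF b s y] 14 by (simp add: sim)
  next
    case (15 X Y f s s' g t t')
    then show ?case using mu_ar_lemma(1)[OF B[of X] B[of Y], of f s s' g t t'] by (simp add: sim)
  next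
    case (16 X Y f s s' g t t')
    then show ?case using mu_ar_lemma(2,3)[OF B[of X] B[of Y], of f s s' g t t'] by (simp add: sim)
  next
    case 17
    show ?case using lax_unt_lemma[where 'l = 'l] by (simp add: sim hom_iff)
  next
    case (18 x Q y)
    then show ?case using lax_unt_lemma[where 'l = 'l] terminal_eq[OF terminal_is_terminal, of x Q y]
      by (simp add: sim hom_iff)
  next
    case (19 \<phi> X Y \<psi> Z s)
    then show ?case using act_cmp_lemma(1)[OF WD[of \<phi>] WD[of \<psi>], of s] by (auto simp: sim)
  next
    case (20 \<phi> X Y \<psi> Z s)
    then show ?case using act_cmp_lemma(2)[OF WD[of \<phi>] WD[of \<psi>], of s] by (auto simp: sim)
  next
    case (21 \<phi> X Y \<psi> Z s)
    then show ?case using act_cmp_lemma(3)[OF WD[of \<phi>] WD[of \<psi>], of s] by (auto simp: sim)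
  next
    case (22 X s)
    then show ?case using act_idn_lemma(1)[OF B[of X], of s] by (simp add: sim)
  next
    case (23 X s)
    then show ?case by (simp add: sim spn_cell_def)
  next
    case (24 X s)
    then show ?case using act_idn_lemma(2)[OF B[of X], of s] by (simp add: sim)
  next
    case (25 \<phi> X X' \<psi> Y Y' s t)
    then show ?case using lax_nat_lemma(1)[OF WD[of \<phi>] WD[of \<psi>], of s t, OF _ _ _ _ refl refl refl refl] by (auto simp: sim)
  next
    case (26 \<phi> X X' \<psi> Y Y' s t)
    then show ?case using lax_nat_lemma(2,3)[OF WD[of \<phi>] WD[of \<psi>], of s t, OF _ _ _ _ refl refl refl refl] by (auto simp: sim)
  next
    case (27 \<phi> X X' \<psi> Y Y' s t)
    then show ?case using lax_nat_lemma(4)[OF WD[of \<phi>] WD[of \<psi>], of s t, OF _ _ _ _ refl refl refl refl] by (auto simp: sim)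
  next
    case (28 X Y Z s t u)
    then show ?case using lax_asc_lemma(1)[OF B[of X] B[of Y] B[of Z], of s t u, OF _ _ _ _ _ _ refl refl refl refl refl refl refl]
      by (simp add: sim)
  next
    case (29 X Y Z s t u m F)
    then show ?case using lax_asc_lemma(2-4)[OF B[of X] B[of Y] B[of Z], of s t u, OF _ _ _ _ _ _ refl refl refl refl refl refl refl]
      by (simp add: sim)
  next
    case (30 X Y Z s t u m)
    then show ?case using lax_asc_lemma(5)[OF B[of X] B[of Y] B[of Z], of s t u, OF _ _ _ _ _ _ refl refl refl refl refl refl refl]
      by (simp add: sim)
  next
    case (31 X s)
    then show ?case using lax_lun_lemma(1)[OF B[of X], of s, OF _ _ refl refl refl] by (simp add: sim)
  next
    case (32 X s)
    then show ?case by (simp add: sim spn_cell_def)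
  next
    case (33 X s)
    then show ?case using lax_lun_lemma(2)[OF B[of X], of s, OF _ _ refl refl refl] by (simp add: sim)
  next
    case (34 X s)
    then show ?case using lax_run_lemma(1)[OF B[of X], of s, OF _ _ refl refl refl] by (simp add: sim)
  next
    case (35 X s)
    then show ?case by (simp add: sim spn_cell_def)
  next
    case (36 X s)
    then show ?case using lax_run_lemma(2)[OF B[of X], of s, OF _ _ refl refl refl] by (simp add: sim)
  next
    case (37 X Y s t)
    then show ?case using lax_brd_lemma(1)[OF B[of X] B[of Y], of s t, OF _ _ _ _ refl refl refl refl refl] by (simp add: sim)
  next
    case (38 X Y s t)
    then show ?case using lax_brd_lemma(2,3)[OF B[of X] B[of Y], of s t, OF _ _ _ _ refl refl refl refl refl] by (simp add: sim)
  next
    case (39 X Y s t)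
    then show ?case using lax_brd_lemma(4)[OF B[of X] B[of Y], of s t, OF _ _ _ _ refl refl refl refl refl] by (simp add: sim)
  qed
qed

lemma Spn_span_algebra_id:
  "span_algebra (Wiring C :: (('l, 'o) box, ('l, 'o) wd) smc) (Spn C) C (bound C) (bo C)
    (\<lambda>\<phi> s. pb1 C s (legL C \<phi>)) (\<lambda>s t. pr1 C (src C s) (src C t)) (\<lambda>s t. pr2 C (src C s) (src C t))"
  using Spn_span_algebra[of C "fct_id :: ('o, 'm, 'o, 'm) fct"] by (simp add: restrict_alg_id Wiring_fct_id)

end

section \<open>Functors preserving finite limits\<close>

definition fmap :: "('o, 'm, 'p, 'n) fct \<Rightarrow> (nat \<rightharpoonup> 'm) \<Rightarrow> (nat \<rightharpoonup> 'n)" where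
  "fmap F R = map_option (far F) \<circ> R"

lemma dom_fmap [simp]: "dom (fmap F R) = dom R"
  by (auto simp: fmap_def dom_def)

lemma fmap_empty [simp]: "fmap F Map.empty = Map.empty"
  by (auto simp: fmap_def)

lemma fmap_add: "fmap F (R ++ S) = fmap F R ++ fmap F S"
  by (auto simp: fmap_def map_add_def fun_eq_iff split: option.splits)

context cat_functor
begin

lemma family_fmap: "family C a R \<Longrightarrow> family D (fob F a) (fmap F R)"
  using far_hom by (fastforce simp: family_def fmap_def ran_def hom_iff)

lemma fmap_fcmp:
  assumes "family C b R" "f \<in> hom C a b"
  shows "fmap F (fcmp C R f) = fcmp D (fmap F R) (far F f)"
proof
  fix i show "fmap F (fcmp C R f) i = fcmp D (fmap F R) (far F f) i"
    using assms far_cmp[OF assms(2)] by (cases "R i") (auto simp: fmap_def fcmp_def family_def ran_def hom_iff)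
qed

end

text \<open>The image of a separated family under \<open>F\<close> need not be separated, so
  separation of the images of actions, products and the unit is required explicitly in
  \<open>nat_sep\<close>, \<open>lx_sep\<close> and \<open>unt_sep'\<close>; preservation of finite
  limits will provide it. As before, the arrows back for actions and products are only asked to be
  compatible with projections.\<close>

locale span_map = A: span_algebra W A C bdA outA rootA PA1 PA2 + B: span_algebra W B D bdB outB rootB PB1 PB2 +
    F: cat_functor C D F
  for W :: "('w, 'v, 'z) smc_scheme" (structure)
    and A :: "('w, 'v, 'm, 'm \<times> 'm \<times> 'm) alg" and C :: "('o, 'm, 'y) cat_scheme" and bdA outA rootA PA1 PA2
    and B :: "('w, 'v, 'n, 'n \<times> 'n \<times> 'n) alg" and D :: "('p, 'n, 'x) cat_scheme" and bdB outB rootB PB1 PB2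
    and F :: "('o, 'm, 'p, 'n) fct" +
  fixes \<theta> :: "('w, 'v, 'm, 'm \<times> 'm \<times> 'm, 'n, 'n \<times> 'n \<times> 'n) transf"
  assumes cpt_obs: "X \<in> obs W \<Longrightarrow> s \<in> obs (fib A X) \<Longrightarrow> fob (cpt \<theta> X) s \<in> obs (fib B X)"
    and cpt_src: "X \<in> obs W \<Longrightarrow> s \<in> obs (fib A X) \<Longrightarrow> src D (fob (cpt \<theta> X) s) = fob F (src C s)"
    and cpt_ar_hom: "X \<in> obs W \<Longrightarrow> f \<in> hom (fib A X) s t \<Longrightarrow>
      far (cpt \<theta> X) f \<in> hom (fib B X) (fob (cpt \<theta> X) s) (fob (cpt \<theta> X) t)"
    and cpt_ar_und: "X \<in> obs W \<Longrightarrow> f \<in> hom (fib A X) s t \<Longrightarrow> und (far (cpt \<theta> X) f) = far F (und f)"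
    and nat_hom: "\<phi> \<in> hom W X Y \<Longrightarrow> s \<in> obs (fib A X) \<Longrightarrow>
      cpt_nat \<theta> \<phi> s \<in> hom (fib B Y) (fob (cpt \<theta> Y) (A.act_ob \<phi> s)) (B.act_ob \<phi> (fob (cpt \<theta> X) s))"
    and nat_root: "\<phi> \<in> hom W X Y \<Longrightarrow> s \<in> obs (fib A X) \<Longrightarrow>
      cmp D (rootB \<phi> (fob (cpt \<theta> X) s)) (und (cpt_nat \<theta> \<phi> s)) = far F (rootA \<phi> s)"
    and nat_inv: "\<phi> \<in> hom W X Y \<Longrightarrow> s \<in> obs (fib A X) \<Longrightarrow>
      \<exists>G \<in> hom (fib B Y) (B.act_ob \<phi> (fob (cpt \<theta> X) s)) (fob (cpt \<theta> Y) (A.act_ob \<phi> s)).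
        cmp D (far F (rootA \<phi> s)) (und G) = rootB \<phi> (fob (cpt \<theta> X) s)"
    and nat_sep: "\<phi> \<in> hom W X Y \<Longrightarrow> s \<in> obs (fib A X) \<Longrightarrow>
      x \<in> hom D Q (fob F (src C (A.act_ob \<phi> s))) \<Longrightarrow> y \<in> hom D Q (fob F (src C (A.act_ob \<phi> s))) \<Longrightarrow>
      cmp D (fob (cpt \<theta> Y) (A.act_ob \<phi> s)) x = cmp D (fob (cpt \<theta> Y) (A.act_ob \<phi> s)) y \<Longrightarrow>
      cmp D (far F (rootA \<phi> s)) x = cmp D (far F (rootA \<phi> s)) y \<Longrightarrow> x = y"
    and lx_hom: "X \<in> obs W \<Longrightarrow> Y \<in> obs W \<Longrightarrow> s \<in> obs (fib A X) \<Longrightarrow> t \<in> obs (fib A Y) \<Longrightarrow>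
      cpt_lax \<theta> X Y (s, t) \<in> hom (fib B (X \<otimes> Y)) (fob (cpt \<theta> (X \<otimes> Y)) (A.mu X Y s t))
        (B.mu X Y (fob (cpt \<theta> X) s) (fob (cpt \<theta> Y) t))"
    and lx_root: "X \<in> obs W \<Longrightarrow> Y \<in> obs W \<Longrightarrow> s \<in> obs (fib A X) \<Longrightarrow> t \<in> obs (fib A Y) \<Longrightarrow>
      cmp D (PB1 (fob (cpt \<theta> X) s) (fob (cpt \<theta> Y) t)) (und (cpt_lax \<theta> X Y (s, t))) = far F (PA1 s t) \<and>
      cmp D (PB2 (fob (cpt \<theta> X) s) (fob (cpt \<theta> Y) t)) (und (cpt_lax \<theta> X Y (s, t))) = far F (PA2 s t)"
    and lx_inv: "X \<in> obs W \<Longrightarrow> Y \<in> obs W \<Longrightarrow> s \<in> obs (fib A X) \<Longrightarrow> t \<in> obs (fib A Y) \<Longrightarrow>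
      \<exists>G \<in> hom (fib B (X \<otimes> Y)) (B.mu X Y (fob (cpt \<theta> X) s) (fob (cpt \<theta> Y) t)) (fob (cpt \<theta> (X \<otimes> Y)) (A.mu X Y s t)).
        cmp D (far F (PA1 s t)) (und G) = PB1 (fob (cpt \<theta> X) s) (fob (cpt \<theta> Y) t) \<and>
        cmp D (far F (PA2 s t)) (und G) = PB2 (fob (cpt \<theta> X) s) (fob (cpt \<theta> Y) t)"
    and lx_sep: "X \<in> obs W \<Longrightarrow> Y \<in> obs W \<Longrightarrow> s \<in> obs (fib A X) \<Longrightarrow> t \<in> obs (fib A Y) \<Longrightarrow>
      x \<in> hom D Q (fob F (src C (A.mu X Y s t))) \<Longrightarrow> y \<in> hom D Q (fob F (src C (A.mu X Y s t))) \<Longrightarrow>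
      cmp D (far F (PA1 s t)) x = cmp D (far F (PA1 s t)) y \<Longrightarrow>
      cmp D (far F (PA2 s t)) x = cmp D (far F (PA2 s t)) y \<Longrightarrow> x = y"
    and unt_hom: "cpt_unt \<theta> \<in> hom (fib B (unt W)) (fob (cpt \<theta> (unt W)) (lax_unt A)) (lax_unt B)"
    and unt_inv: "\<exists>G. G \<in> hom (fib B (unt W)) (lax_unt B) (fob (cpt \<theta> (unt W)) (lax_unt A))"
    and unt_sep': "x \<in> hom D Q (fob F (src C (lax_unt A))) \<Longrightarrow> y \<in> hom D Q (fob F (src C (lax_unt A))) \<Longrightarrow> x = y"
begin

abbreviation tob :: "'w \<Rightarrow> 'm \<Rightarrow> 'n" where "tob X s \<equiv> fob (cpt \<theta> X) s"

lemma rooted_cpt: "A.rooted X s R \<Longrightarrow> B.rooted X (tob X s) (fmap F R)"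
  unfolding A.rooted_def B.rooted_def using cpt_obs cpt_src F.family_fmap by metis

text \<open>The image of an identity root is an identity root, so leaves stay leaves. This is enough
  for the coherence axioms, whose targets are built by \<open>B\<close> from images of
  leaves.\<close>

lemma sep_cpt:
  assumes "X \<in> obs W" "s \<in> obs (fib A X)"
  shows "B.sep X (tob X s) (fmap F [i \<mapsto> idn C (src C s)])"
proof -
  have o: "src C s \<in> obs C" using A.C.hom_src_obs[OF A.fib_ob_hom[OF assms]] .
  have "fmap F [i \<mapsto> idn C (src C s)] = [i \<mapsto> idn D (src D (tob X s))]"
    using F.far_idn[OF o] cpt_src[OF assms] by (auto simp: fmap_def)
  then show ?thesis using B.sep_leaf[OF assms(1) cpt_obs[OF assms]] by simp
qed

lemma mor_cpt:
  assumes m: "A.mor X f m R n S"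
  shows "B.mor X (far (cpt \<theta> X) f) (tob X m) (fmap F R) (tob X n) (fmap F S)"
proof -
  have X: "X \<in> obs W" and r: "A.rooted X m R" "A.rooted X n S" and f: "f \<in> hom (fib A X) m n" and e: "fcmp C S (und f) = R"
    using m by (auto simp: A.mor_def A.rooted_def)
  have "fcmp D (fmap F S) (far F (und f)) = fmap F R"
    using F.fmap_fcmp[OF A.rooted_obs(3)[OF r(2)] A.fib_und_hom[OF X f]] e by simp
  then show ?thesis
    using rooted_cpt[OF r(1)] rooted_cpt[OF r(2)] cpt_ar_hom[OF X f] cpt_ar_und[OF X f] by (simp add: B.mor_def)
qed

lemma mor_nat:
  assumes \<phi>: "\<phi> \<in> hom W X Y" and r: "A.rooted X s R"
  shows "B.mor Y (cpt_nat \<theta> \<phi> s) (tob Y (A.act_ob \<phi> s)) (fmap F (fcmp C R (rootA \<phi> s)))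
    (B.act_ob \<phi> (tob X s)) (fcmp D (fmap F R) (rootB \<phi> (tob X s)))"
proof -
  note X = A.hom_W_obs(1)[OF \<phi>] and Y = A.hom_W_obs(2)[OF \<phi>]
  note s = A.rooted_obs(2)[OF r] and fr = A.rooted_obs(3)[OF r]
  note r' = rooted_cpt[OF r]
  note rh = B.root_hom[OF \<phi> B.rooted_obs(2)[OF r']] and h = nat_hom[OF \<phi> s]
  have "fcmp D (fcmp D (fmap F R) (rootB \<phi> (tob X s))) (und (cpt_nat \<theta> \<phi> s)) = fmap F (fcmp C R (rootA \<phi> s))"
    unfolding B.C.fcmp_fcmp[OF B.rooted_obs(3)[OF r'] rh B.fib_und_hom[OF Y h]] nat_root[OF \<phi> s]
    using F.fmap_fcmp[OF fr A.root_hom[OF \<phi> s]] by simp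
  then show ?thesis
    using rooted_cpt[OF A.rooted_act[OF \<phi> r]] B.rooted_act[OF \<phi> r'] h by (simp add: B.mor_def)
qed

lemma mor_lx:
  assumes r: "A.rooted X s R" "A.rooted Y t S"
  shows "B.mor (X \<otimes> Y) (cpt_lax \<theta> X Y (s, t)) (tob (X \<otimes> Y) (A.mu X Y s t))
    (fmap F (fcmp C R (PA1 s t) ++ fcmp C S (PA2 s t))) (B.mu X Y (tob X s) (tob Y t))
    (fcmp D (fmap F R) (PB1 (tob X s) (tob Y t)) ++ fcmp D (fmap F S) (PB2 (tob X s) (tob Y t)))"
proof -
  note X = A.rooted_obs(1)[OF r(1)] and Y = A.rooted_obs(1)[OF r(2)]
  note s = A.rooted_obs(2)[OF r(1)] and t = A.rooted_obs(2)[OF r(2)]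
  note f = A.rooted_obs(3)[OF r(1)] A.rooted_obs(3)[OF r(2)]
  note r' = rooted_cpt[OF r(1)] rooted_cpt[OF r(2)]
  note f' = B.rooted_obs(3)[OF r'(1)] B.rooted_obs(3)[OF r'(2)]
  note o' = B.rooted_obs(2)[OF r'(1)] B.rooted_obs(2)[OF r'(2)]
  note h = lx_hom[OF X Y s t] and K = A.ten_obs[OF X Y]
  have "fcmp D (fcmp D (fmap F R) (PB1 (tob X s) (tob Y t)) ++ fcmp D (fmap F S) (PB2 (tob X s) (tob Y t)))
      (und (cpt_lax \<theta> X Y (s, t))) = fmap F (fcmp C R (PA1 s t) ++ fcmp C S (PA2 s t))"
    unfolding fcmp_add fmap_add B.C.fcmp_fcmp[OF f'(1) B.P1_hom[OF X Y o'] B.fib_und_hom[OF K h]]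
      B.C.fcmp_fcmp[OF f'(2) B.P2_hom[OF X Y o'] B.fib_und_hom[OF K h]]
      F.fmap_fcmp[OF f(1) A.P1_hom[OF X Y s t]] F.fmap_fcmp[OF f(2) A.P2_hom[OF X Y s t]]
    using lx_root[OF X Y s t] by simp
  then show ?thesis
    using rooted_cpt[OF A.rooted_mu[OF r]] B.rooted_mu[OF r'] h by (simp add: B.mor_def)
qed

lemma mor_unt: "B.mor (unt W) (cpt_unt \<theta>) (tob (unt W) (lax_unt A)) (fmap F Map.empty) (lax_unt B) Map.empty"
  using rooted_cpt[OF A.sep_rooted[OF A.sep_unt]] B.sep_rooted[OF B.sep_unt] unt_hom by (simp add: B.mor_def)

lemma fib_isoI:
  assumes X: "X \<in> obs W" and f: "f \<in> hom (fib B X) m n" and g: "g \<in> hom (fib B X) n m"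
    and "cmp D (und g) (und f) = idn D (src D m)" "cmp D (und f) (und g) = idn D (src D n)"
  shows "is_iso (fib B X) f"
proof -
  interpret K: category "fib B X" using X by (rule B.fib_category)
  have *: "m \<in> obs (fib B X)" "n \<in> obs (fib B X)" using K.hom_src_obs[OF f] K.hom_tgt_obs[OF f] .
  show ?thesis
  proof (rule K.is_isoI[OF f g])
    show "cmp (fib B X) g f = idn (fib B X) m"
      using K.cmp_hom[OF f g] K.idn_hom[OF *(1)] assms(4) unfolding B.fib_eq[OF X] by (elim slice_eqI) simp_all
    show "cmp (fib B X) f g = idn (fib B X) n"
      using K.cmp_hom[OF g f] K.idn_hom[OF *(2)] assms(5) unfolding B.fib_eq[OF X] by (elim slice_eqI) simp_all
  qed
qed

text \<open>\<open>B.sep\<close> says nothing about the source of the cell, which is the image of an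
  action performed in \<open>A\<close>. The composite on that side is therefore recognized as an
  identity by \<open>nat_sep\<close>, and the other composite by \<open>B.root_sep\<close>.\<close>

lemma nat_is_iso:
  assumes \<phi>: "\<phi> \<in> hom W X Y" and s: "s \<in> obs (fib A X)"
  shows "is_iso (fib B Y) (cpt_nat \<theta> \<phi> s)"
proof -
  note X = A.hom_W_obs(1)[OF \<phi>] and Y = A.hom_W_obs(2)[OF \<phi>]
  note f = nat_hom[OF \<phi> s] and r = nat_root[OF \<phi> s] and o = cpt_obs[OF X s]
  obtain G where G: "G \<in> hom (fib B Y) (B.act_ob \<phi> (tob X s)) (tob Y (A.act_ob \<phi> s))"
    and e: "cmp D (far F (rootA \<phi> s)) (und G) = rootB \<phi> (tob X s)" using nat_inv[OF \<phi> s] by blast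
  note uf = B.fib_und_hom[OF Y f] and uG = B.fib_und_hom[OF Y G]
  note of = B.fib_und_over[OF Y f] and oG = B.fib_und_over[OF Y G]
  note as = A.act_obs[OF \<phi> s] note ao = cpt_obs[OF Y as] and aB = B.act_obs[OF \<phi> o]
  note src = cpt_src[OF Y as]
  have rA: "far F (rootA \<phi> s) \<in> hom D (src D (tob Y (A.act_ob \<phi> s))) (src D (tob X s))"
    using F.far_hom[OF A.root_hom[OF \<phi> s]] by (simp add: src cpt_src[OF X s])
  note rB = B.root_hom[OF \<phi> o]
  note mh = B.fib_ob_hom[OF Y ao] and nh = B.fib_ob_hom[OF Y aB]
  have "cmp D (und G) (und (cpt_nat \<theta> \<phi> s)) = idn D (src D (tob Y (A.act_ob \<phi> s)))"
  proof (rule nat_sep[OF \<phi> s])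
    show "cmp D (und G) (und (cpt_nat \<theta> \<phi> s)) \<in> hom D (src D (tob Y (A.act_ob \<phi> s))) (fob F (src C (A.act_ob \<phi> s)))"
      using B.C.cmp_hom[OF uf uG] by (simp add: src)
    show "idn D (src D (tob Y (A.act_ob \<phi> s))) \<in> hom D (src D (tob Y (A.act_ob \<phi> s))) (fob F (src C (A.act_ob \<phi> s)))"
      using B.C.idn_hom[OF B.C.hom_src_obs[OF uf]] by (simp add: src)
    show "cmp D (tob Y (A.act_ob \<phi> s)) (cmp D (und G) (und (cpt_nat \<theta> \<phi> s)))
        = cmp D (tob Y (A.act_ob \<phi> s)) (idn D (src D (tob Y (A.act_ob \<phi> s))))"
      using B.C.cmp_assoc[OF uf uG mh] B.C.idn_right[OF mh] of oG by simp
    show "cmp D (far F (rootA \<phi> s)) (cmp D (und G) (und (cpt_nat \<theta> \<phi> s)))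
        = cmp D (far F (rootA \<phi> s)) (idn D (src D (tob Y (A.act_ob \<phi> s))))"
      using B.C.cmp_assoc[OF uf uG rA] B.C.idn_right[OF rA] e r by simp
  qed
  moreover have "cmp D (und (cpt_nat \<theta> \<phi> s)) (und G) = idn D (src D (B.act_ob \<phi> (tob X s)))"
  proof (rule B.root_sep[OF \<phi> o])
    show "cmp D (und (cpt_nat \<theta> \<phi> s)) (und G) \<in> hom D (src D (B.act_ob \<phi> (tob X s))) (src D (B.act_ob \<phi> (tob X s)))"
      using B.C.cmp_hom[OF uG uf] .
    show "idn D (src D (B.act_ob \<phi> (tob X s))) \<in> hom D (src D (B.act_ob \<phi> (tob X s))) (src D (B.act_ob \<phi> (tob X s)))"
      using B.C.idn_hom[OF B.C.hom_src_obs[OF uG]] .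
    show "cmp D (B.act_ob \<phi> (tob X s)) (cmp D (und (cpt_nat \<theta> \<phi> s)) (und G))
        = cmp D (B.act_ob \<phi> (tob X s)) (idn D (src D (B.act_ob \<phi> (tob X s))))"
      using B.C.cmp_assoc[OF uG uf nh] B.C.idn_right[OF nh] of oG by simp
    show "cmp D (rootB \<phi> (tob X s)) (cmp D (und (cpt_nat \<theta> \<phi> s)) (und G))
        = cmp D (rootB \<phi> (tob X s)) (idn D (src D (B.act_ob \<phi> (tob X s))))"
      using B.C.cmp_assoc[OF uG uf rB] B.C.idn_right[OF rB] e r by simp
  qed
  ultimately show ?thesis by (rule fib_isoI[OF Y f G])
qed

lemma lx_is_iso:
  assumes X: "X \<in> obs W" and Y: "Y \<in> obs W" and s: "s \<in> obs (fib A X)" and t: "t \<in> obs (fib A Y)"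
  shows "is_iso (fib B (X \<otimes> Y)) (cpt_lax \<theta> X Y (s, t))"
proof -
  note K = A.ten_obs[OF X Y]
  note f = lx_hom[OF X Y s t] and r = lx_root[OF X Y s t]
  note o = cpt_obs[OF X s] cpt_obs[OF Y t]
  obtain G where G: "G \<in> hom (fib B (X \<otimes> Y)) (B.mu X Y (tob X s) (tob Y t)) (tob (X \<otimes> Y) (A.mu X Y s t))"
    and e: "cmp D (far F (PA1 s t)) (und G) = PB1 (tob X s) (tob Y t)" "cmp D (far F (PA2 s t)) (und G) = PB2 (tob X s) (tob Y t)"
    using lx_inv[OF X Y s t] by blast
  note uf = B.fib_und_hom[OF K f] and uG = B.fib_und_hom[OF K G]
  note src = cpt_src[OF K A.mu_obs[OF X Y s t]]
  have pA: "far F (PA1 s t) \<in> hom D (src D (tob (X \<otimes> Y) (A.mu X Y s t))) (src D (tob X s))"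
    "far F (PA2 s t) \<in> hom D (src D (tob (X \<otimes> Y) (A.mu X Y s t))) (src D (tob Y t))"
    using F.far_hom[OF A.P1_hom[OF X Y s t]] F.far_hom[OF A.P2_hom[OF X Y s t]]
    by (simp_all add: src cpt_src[OF X s] cpt_src[OF Y t])
  note pB = B.P1_hom[OF X Y o] B.P2_hom[OF X Y o]
  have "cmp D (und G) (und (cpt_lax \<theta> X Y (s, t))) = idn D (src D (tob (X \<otimes> Y) (A.mu X Y s t)))"
  proof (rule lx_sep[OF X Y s t])
    show "cmp D (und G) (und (cpt_lax \<theta> X Y (s, t))) \<in> hom D (src D (tob (X \<otimes> Y) (A.mu X Y s t))) (fob F (src C (A.mu X Y s t)))"
      using B.C.cmp_hom[OF uf uG] by (simp add: src)
    show "idn D (src D (tob (X \<otimes> Y) (A.mu X Y s t))) \<in> hom D (src D (tob (X \<otimes> Y) (A.mu X Y s t))) (fob F (src C (A.mu X Y s t)))"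
      using B.C.idn_hom[OF B.C.hom_src_obs[OF uf]] by (simp add: src)
  qed (use B.C.cmp_assoc[OF uf uG pA(1)] B.C.idn_right[OF pA(1)] B.C.cmp_assoc[OF uf uG pA(2)] B.C.idn_right[OF pA(2)] e r
      in simp_all)
  moreover have "cmp D (und (cpt_lax \<theta> X Y (s, t))) (und G) = idn D (src D (B.mu X Y (tob X s) (tob Y t)))"
    using B.C.cmp_assoc[OF uG uf pB(1)] B.C.idn_right[OF pB(1)] B.C.cmp_assoc[OF uG uf pB(2)] B.C.idn_right[OF pB(2)] e r
    by (intro B.mu_sep[OF X Y o B.C.cmp_hom[OF uG uf] B.C.idn_hom[OF B.C.hom_src_obs[OF uG]]]) simp_all
  ultimately show ?thesis by (rule fib_isoI[OF K f G])
qed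

lemma unt_is_iso: "is_iso (fib B (unt W)) (cpt_unt \<theta>)"
proof -
  note I = A.unt_obs
  obtain G where G: "G \<in> hom (fib B (unt W)) (lax_unt B) (tob (unt W) (lax_unt A))" using unt_inv by blast
  note uf = B.fib_und_hom[OF I unt_hom] and uG = B.fib_und_hom[OF I G]
  note src = cpt_src[OF I A.unt_ob]
  have "cmp D (und G) (und (cpt_unt \<theta>)) = idn D (src D (tob (unt W) (lax_unt A)))"
    using unt_sep'[OF B.C.cmp_hom[OF uf uG, unfolded src] B.C.idn_hom[OF B.C.hom_src_obs[OF uf], unfolded src]]
    by (simp add: src)
  moreover have "cmp D (und (cpt_unt \<theta>)) (und G) = idn D (src D (lax_unt B))"
    using B.unt_sep[OF B.C.cmp_hom[OF uG uf] B.C.idn_hom[OF B.C.hom_src_obs[OF uG]]] .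
  ultimately show ?thesis by (rule fib_isoI[OF I unt_hom G])
qed

lemma cpt_functor:
  assumes X: "X \<in> obs W"
  shows "cat_functor (fib A X) (fib B X) (cpt \<theta> X)"
proof -
  interpret FX: category "fib A X" using X by (rule A.fib_category)
  interpret FY: category "fib B X" using X by (rule B.fib_category)
  show ?thesis
  proof
    fix s assume s: "s \<in> obs (fib A X)"
    then show "tob X s \<in> obs (fib B X)" by (rule cpt_obs[OF X])
    note l = A.sep_leaf[OF X s, of 0]
    show "far (cpt \<theta> X) (idn (fib A X) s) = idn (fib B X) (tob X s)"
      by (rule B.mor_unique[OF mor_cpt[OF A.mor_idn[OF A.sep_rooted[OF l]]] B.mor_idn[OF B.sep_rooted[OF sep_cpt[OF X s]]] sep_cpt[OF X s]])
  next
    fix f s t assume f: "f \<in> hom (fib A X) s t"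
    then show "far (cpt \<theta> X) f \<in> hom (fib B X) (tob X s) (tob X t)" by (rule cpt_ar_hom[OF X])
    fix g u assume g: "g \<in> hom (fib A X) t u"
    note u = FX.hom_tgt_obs[OF g]
    note l = A.sep_leaf[OF X u, of 0]
    note mg = A.mor_arr[OF X g A.sep_rooted[OF l]]
    note mf = A.mor_arr[OF X f mg[unfolded A.mor_def, THEN conjunct1]]
    show "far (cpt \<theta> X) (cmp (fib A X) g f) = cmp (fib B X) (far (cpt \<theta> X) g) (far (cpt \<theta> X) f)"
      by (rule B.mor_unique[OF mor_cpt[OF A.mor_cmp[OF mf mg]] B.mor_cmp[OF mor_cpt[OF mf] mor_cpt[OF mg]] sep_cpt[OF X u]])
  qed
qed

lemmas map_rules = mor_cpt mor_nat mor_lx mor_unt rooted_cpt B.mor_act B.mor_mu B.mor_act_cmp B.mor_cinv B.mor_act_idn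
  B.mor_lax_nat B.mor_lax_asc B.mor_lax_lun B.mor_lax_run B.mor_lax_brd B.mor_idn B.mor_cmp B.rooted_act B.rooted_mu
  A.mor_rules
lemmas map_sep_rules = B.sep_act B.sep_mu A.W_typing

lemma nat_nat_iso:
  assumes \<phi>: "\<phi> \<in> hom W X Y"
  shows "nat_iso (fib A X) (fib B Y) (cpt \<theta> Y \<circ>\<^sub>F act A \<phi>) (act B \<phi> \<circ>\<^sub>F cpt \<theta> X) (cpt_nat \<theta> \<phi>)"
proof -
  note X = A.hom_W_obs(1)[OF \<phi>] and Y = A.hom_W_obs(2)[OF \<phi>]
  interpret F: cat_functor "fib A X" "fib B Y" "cpt \<theta> Y \<circ>\<^sub>F act A \<phi>"
    by (rule fct_comp_functor cpt_functor A.act_functor \<phi> Y)+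
  interpret G: cat_functor "fib A X" "fib B Y" "act B \<phi> \<circ>\<^sub>F cpt \<theta> X"
    by (rule fct_comp_functor[OF cpt_functor[OF X] B.act_functor[OF \<phi>]])
  show ?thesis
  proof
    fix s assume s: "s \<in> obs (fib A X)"
    show "cpt_nat \<theta> \<phi> s \<in> hom (fib B Y) (fob (cpt \<theta> Y \<circ>\<^sub>F act A \<phi>) s) (fob (act B \<phi> \<circ>\<^sub>F cpt \<theta> X) s)"
      using nat_hom[OF \<phi> s] by simp
    show "is_iso (fib B Y) (cpt_nat \<theta> \<phi> s)" by (rule nat_is_iso[OF \<phi> s])
  next
    fix f s t assume f: "f \<in> hom (fib A X) s t"
    note t = A.fib_hom_obs[OF X f, THEN conjunct2]
    note l = A.sep_leaf[OF X t, of 0]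
    note mf = A.mor_arr[OF X f A.sep_rooted[OF l]]
    note r = mf[unfolded A.mor_def, THEN conjunct1] A.sep_rooted[OF l]
    show "cmp (fib B Y) (far (act B \<phi> \<circ>\<^sub>F cpt \<theta> X) f) (cpt_nat \<theta> \<phi> s)
        = cmp (fib B Y) (cpt_nat \<theta> \<phi> t) (far (cpt \<theta> Y \<circ>\<^sub>F act A \<phi>) f)"
      unfolding fct_comp_simps
      apply (rule B.mor_unique)
        apply (rule map_rules \<phi> mf r)+
      apply (rule map_sep_rules \<phi> sep_cpt X t)+
      done
  qed
qed

lemma lx_nat_iso:
  assumes X: "X \<in> obs W" and Y: "Y \<in> obs W"
  shows "nat_iso (fib A X \<times>\<^sub>C fib A Y) (fib B (X \<otimes> Y))
        (cpt \<theta> (X \<otimes> Y) \<circ>\<^sub>F lax A X Y) (lax B X Y \<circ>\<^sub>F (cpt \<theta> X \<times>\<^sub>F cpt \<theta> Y)) (cpt_lax \<theta> X Y)"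
proof -
  interpret F: cat_functor "fib A X \<times>\<^sub>C fib A Y" "fib B (X \<otimes> Y)" "cpt \<theta> (X \<otimes> Y) \<circ>\<^sub>F lax A X Y"
    by (rule fct_comp_functor cpt_functor A.lax_functor A.ten_obs X Y)+
  interpret G: cat_functor "fib A X \<times>\<^sub>C fib A Y" "fib B (X \<otimes> Y)" "lax B X Y \<circ>\<^sub>F (cpt \<theta> X \<times>\<^sub>F cpt \<theta> Y)"
    by (rule fct_comp_functor[OF fct_prod_functor[OF cpt_functor[OF X] cpt_functor[OF Y]] B.lax_functor[OF X Y]])
  show ?thesis
  proof
    fix p assume p: "p \<in> obs (fib A X \<times>\<^sub>C fib A Y)"
    obtain s t where [simp]: "p = (s, t)" by (cases p)
    have o: "s \<in> obs (fib A X)" "t \<in> obs (fib A Y)" using p by auto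
    show "cpt_lax \<theta> X Y p \<in> hom (fib B (X \<otimes> Y)) (fob (cpt \<theta> (X \<otimes> Y) \<circ>\<^sub>F lax A X Y) p)
        (fob (lax B X Y \<circ>\<^sub>F (cpt \<theta> X \<times>\<^sub>F cpt \<theta> Y)) p)"
      using lx_hom[OF X Y o] by simp
    show "is_iso (fib B (X \<otimes> Y)) (cpt_lax \<theta> X Y p)" using lx_is_iso[OF X Y o] by simp
  next
    fix h p q assume h: "h \<in> hom (fib A X \<times>\<^sub>C fib A Y) p q"
    obtain s t s' t' f g where [simp]: "p = (s, t)" "q = (s', t')" "h = (f, g)" by (cases p, cases q, cases h)
    have f: "f \<in> hom (fib A X) s s'" and g: "g \<in> hom (fib A Y) t t'" using h by (auto simp: hom_prod_cat)
    note s' = A.fib_hom_obs[OF X f, THEN conjunct2] and t' = A.fib_hom_obs[OF Y g, THEN conjunct2]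
    note ls = A.sep_leaf[OF X s', of 0] and lt = A.sep_leaf[OF Y t', of 1]
    note m = A.mor_arr[OF X f A.sep_rooted[OF ls]] A.mor_arr[OF Y g A.sep_rooted[OF lt]]
    note r = m(1)[unfolded A.mor_def, THEN conjunct1] m(2)[unfolded A.mor_def, THEN conjunct1]
      A.sep_rooted[OF ls] A.sep_rooted[OF lt]
    show "cmp (fib B (X \<otimes> Y)) (far (lax B X Y \<circ>\<^sub>F (cpt \<theta> X \<times>\<^sub>F cpt \<theta> Y)) h) (cpt_lax \<theta> X Y p)
        = cmp (fib B (X \<otimes> Y)) (cpt_lax \<theta> X Y q) (far (cpt \<theta> (X \<otimes> Y) \<circ>\<^sub>F lax A X Y) h)"
      apply simp
      apply (rule B.mor_unique)
        apply (rule map_rules X Y m r)+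
      apply (rule map_sep_rules sep_cpt X Y s' t')+
      apply auto
      done
  qed
qed

text \<open>Both sides of every equation end at a span that \<open>B\<close> builds from images of
  leaves, so \<open>B.mor_unique\<close> applies throughout; \<open>map_rules\<close> also track
  roots through \<open>\<theta>\<close>.\<close>

lemma algebra_map: "algebra_map W A B \<theta>"
proof (intro algebra_map.intro algebra_map_axioms.intro A.sym_lax_monoidal B.sym_lax_monoidal, goal_cases)
  case (1 X)
  then show ?case by (rule cpt_functor)
next
  case (2 \<phi> X Y)
  then show ?case by (rule nat_nat_iso)
next
  case (3 \<phi> X Y \<psi> Z s K)
  note h = 3(1,2) and X = A.hom_W_obs(1)[OF 3(1)] and s = 3(3)
  note r = A.sep_rooted[OF A.sep_leaf[OF X s, of 0]]
  show ?case unfolding 3(4)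
    apply (rule B.mor_unique)
      apply (rule map_rules h r)+
    apply (rule map_sep_rules sep_cpt h X s)+
    done
next
  case (4 X s)
  note r = A.sep_rooted[OF A.sep_leaf[OF 4, of 0]]
  show ?case
    apply (rule B.mor_unique)
      apply (rule map_rules 4 r)+
    apply (rule map_sep_rules sep_cpt 4)+
    done
next
  case (5 X Y)
  then show ?case by (rule lx_nat_iso)
next
  case (6 \<phi> X X' \<psi> Y Y' s t K)
  note h = 6(1,2) and o = A.hom_W_obs(1)[OF 6(1)] A.hom_W_obs(1)[OF 6(2)] 6(3,4)
  note r = A.sep_rooted[OF A.sep_leaf[OF o(1,3), of 0]] A.sep_rooted[OF A.sep_leaf[OF o(2,4), of 1]]
  show ?case unfolding 6(5)
    apply (rule B.mor_unique)
      apply (rule map_rules h r)+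
    apply (rule map_sep_rules sep_cpt h o)+
    apply auto
    done
next
  case 7
  show ?case by (rule unt_hom)
next
  case 8
  show ?case by (rule unt_is_iso)
next
  case (9 X Y Z s t u K a)
  note o = 9(1-6)
  note r = A.sep_rooted[OF A.sep_leaf[OF o(1,4), of 0]] A.sep_rooted[OF A.sep_leaf[OF o(2,5), of 1]]
    A.sep_rooted[OF A.sep_leaf[OF o(3,6), of 2]]
  show ?case unfolding 9(7,8)
    apply (rule B.mor_unique)
      apply (rule map_rules o r)+
    apply (rule map_sep_rules sep_cpt o)+
    apply auto
    done
next
  case (10 X s I K l)
  note o = 10(1,2)
  note r = A.sep_rooted[OF A.sep_leaf[OF o, of 0]]
  show ?case unfolding 10(3-5)
    apply (rule B.mor_unique)
      apply (rule map_rules o r)+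
    apply (rule map_sep_rules sep_cpt o)+
    done
next
  case (11 X s I K l)
  note o = 11(1,2)
  note r = A.sep_rooted[OF A.sep_leaf[OF o, of 0]]
  show ?case unfolding 11(3-5)
    apply (rule B.mor_unique)
      apply (rule map_rules o r)+
    apply (rule map_sep_rules sep_cpt o)+
    done
next
  case (12 X Y s t K b)
  note o = 12(1-4)
  note r = A.sep_rooted[OF A.sep_leaf[OF o(1,3), of 0]] A.sep_rooted[OF A.sep_leaf[OF o(2,4), of 1]]
  show ?case unfolding 12(5,6)
    apply (rule B.mor_unique)
      apply (rule map_rules o r | (simp; fail))+
    apply (rule map_sep_rules sep_cpt o)+
    apply auto
    done
qed

end

section \<open>Images of products, boundaries and actions under a functor\<close>

context lex_functor
begin

lemma box_retype: "is_box C X \<Longrightarrow> is_box D (retype F X)"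
  by (rule is_box_retype[where C = C]) (rule F.fob_obs)

lemma wd_wmap: "is_wd C \<phi> \<Longrightarrow> is_wd D (wmap F \<phi>)"
  by (rule is_wd_wmap[where C = C]) (rule F.fob_obs)

text \<open>\<open>fob F (hat C T)\<close> is a product in \<open>D\<close>, but not necessarily the
  chosen one, so \<open>tuple\<close> does not apply to it. Its universal property is split into
  this lemma and \<open>hat_mono\<close>.\<close>

lemma hat_lift:
  assumes T: "finite (dom T)" "ran T \<subseteq> obs C" and Q: "Q \<in> obs D"
    and q: "\<And>i. i \<in> dom T \<Longrightarrow> q i \<in> hom D Q (fob F (the (T i)))"
  obtains u where "u \<in> hom D Q (fob F (hat C T))" "\<And>i. i \<in> dom T \<Longrightarrow> cmp D (far F (proj C T i)) u = q i"
proof -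
  note P = pres_product[OF T C.product_is_product[OF T]]
  have "q i \<in> hom D Q a" if "(map_option (fob F) \<circ> T) i = Some a" for i a
    using that q[OF domI[of T i]] by auto
  from ex1_implies_ex[OF D.is_productD(3)[OF P Q, of q, OF this]] that show ?thesis
    unfolding dom_retype by blast
qed

lemma hat_mono:
  assumes T: "finite (dom T)" "ran T \<subseteq> obs C" and "x \<in> hom D Q (fob F (hat C T))" "y \<in> hom D Q (fob F (hat C T))"
    "\<And>i. i \<in> dom T \<Longrightarrow> cmp D (far F (proj C T i)) x = cmp D (far F (proj C T i)) y"
  shows "x = y"
  using D.is_product_eqI[OF pres_product[OF T C.product_is_product[OF T]]] assms(3-5) unfolding dom_retype by blast

lemma prd_lift:
  assumes "a \<in> obs C" "b \<in> obs C" "x \<in> hom D Q (fob F a)" "y \<in> hom D Q (fob F b)"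
  obtains u where "u \<in> hom D Q (fob F (prd C a b))" "cmp D (far F (pr1 C a b)) u = x" "cmp D (far F (pr2 C a b)) u = y"
proof -
  have q: "(if i then y else x) \<in> hom D Q (fob F (the (two a b i)))" for i
    using assms by (simp add: two_def)
  have T: "finite (dom (two a b))" "ran (two a b) \<subseteq> obs C" using C.two_ok[OF assms(1,2)] by auto
  obtain u where u: "u \<in> hom D Q (fob F (hat C (two a b)))"
      "\<And>i. i \<in> dom (two a b) \<Longrightarrow> cmp D (far F (proj C (two a b) i)) u = (if i then y else x)"
    using hat_lift[OF T D.hom_src_obs[OF assms(3)], of "\<lambda>i. if i then y else x", OF q] by blast
  show ?thesis
    using that[of u] u(1) u(2)[of True] u(2)[of False] by (simp add: prd_def pr1_def pr2_def two_def dom_def)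
qed

lemma prd_mono:
  assumes "a \<in> obs C" "b \<in> obs C" "x \<in> hom D Q (fob F (prd C a b))" "y \<in> hom D Q (fob F (prd C a b))"
    "cmp D (far F (pr1 C a b)) x = cmp D (far F (pr1 C a b)) y" "cmp D (far F (pr2 C a b)) x = cmp D (far F (pr2 C a b)) y"
  shows "x = y"
proof (rule hat_mono[of "two a b"])
  show "cmp D (far F (proj C (two a b) i)) x = cmp D (far F (proj C (two a b) i)) y" for i
    using assms by (cases i) (auto simp: pr1_def pr2_def)
qed (use C.two_ok[OF assms(1,2)] assms in \<open>auto simp: prd_def\<close>)

abbreviation \<kappa> :: "('l, 'o) box \<Rightarrow> 'n" where "\<kappa> X \<equiv> compare C D F X"

context
  fixes X :: "('l, 'o) box"
  assumes X: "is_box C X"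
begin

lemma compare_lemma:
  "\<kappa> X \<in> hom D (fob F (bound C X)) (bound D (retype F X))"
  "i \<in> dom (inp X) \<Longrightarrow> cmp D (in_at D (retype F X) i) (\<kappa> X) = far F (in_at C X i)"
  "k \<in> dom (outp X) \<Longrightarrow> cmp D (out_at D (retype F X) k) (\<kappa> X) = far F (out_at C X k)"
proof -
  have f: "far F (in_at C X i) \<in> hom D (fob F (bound C X)) (the (inp (retype F X) i))" if "i \<in> dom (inp (retype F X))" for i
    using that F.far_hom[OF C.at_hom(1)[OF X], of i] by (auto simp: dom_retype)
  have g: "far F (out_at C X i) \<in> hom D (fob F (bound C X)) (the (outp (retype F X) i))" if "i \<in> dom (outp (retype F X))" for i
    using that F.far_hom[OF C.at_hom(2)[OF X], of i] by (auto simp: dom_retype)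
  note t = D.to_bound_lemma[where f = "\<lambda>i. far F (in_at C X i)" and g = "\<lambda>i. far F (out_at C X i)",
    OF box_retype[OF X] F.fob_obs[OF C.box_obs(3)[OF X]] f g, folded compare_def]
  show "\<kappa> X \<in> hom D (fob F (bound C X)) (bound D (retype F X))"
    "i \<in> dom (inp X) \<Longrightarrow> cmp D (in_at D (retype F X) i) (\<kappa> X) = far F (in_at C X i)"
    "k \<in> dom (outp X) \<Longrightarrow> cmp D (out_at D (retype F X) k) (\<kappa> X) = far F (out_at C X k)"
    using t by (simp_all add: dom_retype)
qed

lemma at_compare:
  assumes z: "z \<in> hom D Q (fob F (bound C X))"
  shows "i \<in> dom (inp X) \<Longrightarrow> cmp D (in_at D (retype F X) i) (cmp D (\<kappa> X) z) = cmp D (far F (in_at C X i)) z"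
    "k \<in> dom (outp X) \<Longrightarrow> cmp D (out_at D (retype F X) k) (cmp D (\<kappa> X) z) = cmp D (far F (out_at C X k)) z"
  using D.cmp_assoc[OF z compare_lemma(1) D.at_hom(1)[OF box_retype[OF X]]]
    D.cmp_assoc[OF z compare_lemma(1) D.at_hom(2)[OF box_retype[OF X]]] compare_lemma(2,3)
  by (simp_all add: dom_retype)

lemma at_compare_far:
  assumes z: "z \<in> hom C Q (bound C X)"
  shows "i \<in> dom (inp X) \<Longrightarrow> cmp D (in_at D (retype F X) i) (cmp D (\<kappa> X) (far F z)) = far F (cmp C (in_at C X i) z)"
    "k \<in> dom (outp X) \<Longrightarrow> cmp D (out_at D (retype F X) k) (cmp D (\<kappa> X) (far F z)) = far F (cmp C (out_at C X k) z)"
  using at_compare[OF F.far_hom[OF z]] F.far_cmp[OF z C.at_hom(1)[OF X]] F.far_cmp[OF z C.at_hom(2)[OF X]] by simp_all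

lemma far_b:
  "far F (bi C X) \<in> hom D (fob F (bound C X)) (fob F (hat C (inp X)))"
  "far F (bo C X) \<in> hom D (fob F (bound C X)) (fob F (hat C (outp X)))"
  by (rule F.far_hom, simp add: hom_iff C.arr_b X)+

lemma far_at_cmp:
  assumes z: "z \<in> hom D Q (fob F (bound C X))"
  shows "i \<in> dom (inp X) \<Longrightarrow> cmp D (far F (in_at C X i)) z = cmp D (far F (proj C (inp X) i)) (cmp D (far F (bi C X)) z)"
    "k \<in> dom (outp X) \<Longrightarrow> cmp D (far F (out_at C X k)) z = cmp D (far F (proj C (outp X) k)) (cmp D (far F (bo C X)) z)"
proof -
  assume i: "i \<in> dom (inp X)"
  have p: "proj C (inp X) i \<in> hom C (hat C (inp X)) (the (inp X i))" and b: "bi C X \<in> hom C (bound C X) (hat C (inp X))"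
    using i X by (auto simp: hom_iff C.arr_box_proj C.arr_b)
  show "cmp D (far F (in_at C X i)) z = cmp D (far F (proj C (inp X) i)) (cmp D (far F (bi C X)) z)"
    unfolding C.at_eq F.far_cmp[OF b p] by (rule D.cmp_assoc[OF z F.far_hom[OF b] F.far_hom[OF p]])
next
  assume i: "k \<in> dom (outp X)"
  have p: "proj C (outp X) k \<in> hom C (hat C (outp X)) (the (outp X k))" and b: "bo C X \<in> hom C (bound C X) (hat C (outp X))"
    using i X by (auto simp: hom_iff C.arr_box_proj C.arr_b)
  show "cmp D (far F (out_at C X k)) z = cmp D (far F (proj C (outp X) k)) (cmp D (far F (bo C X)) z)"
    unfolding C.at_eq F.far_cmp[OF b p] by (rule D.cmp_assoc[OF z F.far_hom[OF b] F.far_hom[OF p]])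
qed

text \<open>Cancellation is the uniqueness half of the fact that the comparison map is invertible;
  the existence half enters through \<open>in_lift\<close> and \<open>prd_lift\<close>. Arrows are
  compared at single ports, separately for inputs and outputs.\<close>

lemma compare_mono:
  assumes z: "z \<in> hom D Q (fob F (bound C X))" and z': "z' \<in> hom D Q (fob F (bound C X))"
    and e: "cmp D (\<kappa> X) z = cmp D (\<kappa> X) z'"
  shows "z = z'"
proof (rule prd_mono[OF C.box_obs(1,2)[OF X]])
  show "z \<in> hom D Q (fob F (prd C (hat C (inp X)) (hat C (outp X))))" "z' \<in> hom D Q (fob F (prd C (hat C (inp X)) (hat C (outp X))))"
    using z z' by (auto simp: bound_def)
  show "cmp D (far F (pr1 C (hat C (inp X)) (hat C (outp X)))) z = cmp D (far F (pr1 C (hat C (inp X)) (hat C (outp X)))) z'"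
    unfolding bi_def[symmetric]
  proof (rule hat_mono[OF C.box_ok(1,2)[OF X] D.cmp_hom[OF z far_b(1)] D.cmp_hom[OF z' far_b(1)]])
    fix i assume i: "i \<in> dom (inp X)"
    show "cmp D (far F (proj C (inp X) i)) (cmp D (far F (bi C X)) z) = cmp D (far F (proj C (inp X) i)) (cmp D (far F (bi C X)) z')"
      using far_at_cmp(1)[OF z i] far_at_cmp(1)[OF z' i] at_compare(1)[OF z i] at_compare(1)[OF z' i] e by simp
  qed
  show "cmp D (far F (pr2 C (hat C (inp X)) (hat C (outp X)))) z = cmp D (far F (pr2 C (hat C (inp X)) (hat C (outp X)))) z'"
    unfolding bo_def[symmetric]
  proof (rule hat_mono[OF C.box_ok(3,4)[OF X] D.cmp_hom[OF z far_b(2)] D.cmp_hom[OF z' far_b(2)]])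
    fix i assume i: "i \<in> dom (outp X)"
    show "cmp D (far F (proj C (outp X) i)) (cmp D (far F (bo C X)) z) = cmp D (far F (proj C (outp X) i)) (cmp D (far F (bo C X)) z')"
      using far_at_cmp(2)[OF z i] far_at_cmp(2)[OF z' i] at_compare(2)[OF z i] at_compare(2)[OF z' i] e by simp
  qed
qed

lemma in_lift:
  assumes y: "y \<in> hom D Q (bound D (retype F X))"
  obtains u where "u \<in> hom D Q (fob F (hat C (inp X)))"
    "\<And>i. i \<in> dom (inp X) \<Longrightarrow> cmp D (far F (proj C (inp X) i)) u = cmp D (in_at D (retype F X) i) y"
proof -
  have "cmp D (in_at D (retype F X) i) y \<in> hom D Q (fob F (the (inp X i)))" if "i \<in> dom (inp X)" for i
    using D.at_cmp_hom(1)[OF box_retype[OF X] y, of i] that by (auto simp: dom_retype)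
  from hat_lift[OF C.box_ok(1,2)[OF X] D.hom_src_obs[OF y], of "\<lambda>i. cmp D (in_at D (retype F X) i) y", OF this] that
  show ?thesis by blast
qed

end

text \<open>Evaluation at a port turns \<open>\<kappa>\<close> into \<open>F\<close> by
  \<open>at_compare_far\<close>, and \<open>wmap\<close> keeps all wires, so every port equation is
  the image under \<open>F\<close> of an old one.\<close>

lemma wd_rel_far:
  assumes w: "is_wd C \<phi>" and r: "wd_rel C \<phi> Q x y"
  shows "wd_rel D (wmap F \<phi>) (fob F Q) (cmp D (\<kappa> (wsrc \<phi>)) (far F x)) (cmp D (\<kappa> (wtgt \<phi>)) (far F y))"
  unfolding wd_rel_def
proof (intro conjI ballI)
  note X = is_wd_boxes(1)[OF w] and Y = is_wd_boxes(2)[OF w]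
  note h = C.wd_rel_homs[OF w r]
  note ax = at_compare_far[OF X h(1)] and ay = at_compare_far[OF Y h(2)]
  show "cmp D (\<kappa> (wsrc \<phi>)) (far F x) \<in> hom D (fob F Q) (bound D (wsrc (wmap F \<phi>)))"
    "cmp D (\<kappa> (wtgt \<phi>)) (far F y) \<in> hom D (fob F Q) (bound D (wtgt (wmap F \<phi>)))"
    using D.cmp_hom[OF F.far_hom[OF h(1)] compare_lemma(1)[OF X]] D.cmp_hom[OF F.far_hom[OF h(2)] compare_lemma(1)[OF Y]]
    by simp_all
  fix i assume "i \<in> dom (inp (wsrc (wmap F \<phi>)))"
  then have i: "i \<in> dom (inp (wsrc \<phi>))" by (simp add: dom_retype)
  then show "cmp D (in_at D (wsrc (wmap F \<phi>)) i) (cmp D (\<kappa> (wsrc \<phi>)) (far F x)) = (case win (wmap F \<phi>) i of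
      Inl j \<Rightarrow> cmp D (out_at D (wsrc (wmap F \<phi>)) j) (cmp D (\<kappa> (wsrc \<phi>)) (far F x))
    | Inr j \<Rightarrow> cmp D (in_at D (wtgt (wmap F \<phi>)) j) (cmp D (\<kappa> (wtgt \<phi>)) (far F y)))"
    using r C.wd_ports(1,2)[OF w i] ax ay by (simp add: wd_rel_def split: sum.split)
next
  note X = is_wd_boxes(1)[OF w] and Y = is_wd_boxes(2)[OF w]
  note h = C.wd_rel_homs[OF w r]
  note ax = at_compare_far[OF X h(1)] and ay = at_compare_far[OF Y h(2)]
  fix k assume "k \<in> dom (outp (wtgt (wmap F \<phi>)))"
  then have k: "k \<in> dom (outp (wtgt \<phi>))" by (simp add: dom_retype)
  then show "cmp D (out_at D (wtgt (wmap F \<phi>)) k) (cmp D (\<kappa> (wtgt \<phi>)) (far F y))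
      = cmp D (out_at D (wsrc (wmap F \<phi>)) (wout (wmap F \<phi>) k)) (cmp D (\<kappa> (wsrc \<phi>)) (far F x))"
    using r C.wd_ports(3)[OF w k] ax ay by (simp add: wd_rel_def)
qed

lemma spl_compare:
  assumes X: "is_box C X" and Y: "is_box C Y" and z: "z \<in> hom C Q (bound C (box_sum X Y))"
  shows "cmp D (spl D (retype F X) (retype F Y)) (cmp D (\<kappa> (box_sum X Y)) (far F z)) = cmp D (\<kappa> X) (far F (cmp C (spl C X Y) z))"
    "cmp D (spr D (retype F X) (retype F Y)) (cmp D (\<kappa> (box_sum X Y)) (far F z)) = cmp D (\<kappa> Y) (far F (cmp C (spr C X Y) z))"
proof -
  note B = is_box_sum[OF X Y]
  note X' = box_retype[OF X] and Y' = box_retype[OF Y]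
  have h: "cmp D (\<kappa> (box_sum X Y)) (far F z) \<in> hom D (fob F Q) (bound D (box_sum (retype F X) (retype F Y)))"
    using D.cmp_hom[OF F.far_hom[OF z] compare_lemma(1)[OF B]] by (simp add: Wiring_fct_plain)
  note a = D.at_sp[OF X' Y' h] and c = at_compare_far[OF B z, unfolded Wiring_fct_plain]
  note sz = C.sp_hom[OF X Y z]
  note cl = at_compare_far[OF X sz(1)] and cr = at_compare_far[OF Y sz(2)] and as = C.at_sp[OF X Y z]
  show "cmp D (spl D (retype F X) (retype F Y)) (cmp D (\<kappa> (box_sum X Y)) (far F z)) = cmp D (\<kappa> X) (far F (cmp C (spl C X Y) z))"
    by (rule D.bound_eqI[OF X' D.sp_hom(1)[OF X' Y' h] D.cmp_hom[OF F.far_hom[OF sz(1)] compare_lemma(1)[OF X]]])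
      (simp_all add: a cl as c dom_retype dom_tsum)
  show "cmp D (spr D (retype F X) (retype F Y)) (cmp D (\<kappa> (box_sum X Y)) (far F z)) = cmp D (\<kappa> Y) (far F (cmp C (spr C X Y) z))"
    by (rule D.bound_eqI[OF Y' D.sp_hom(2)[OF X' Y' h] D.cmp_hom[OF F.far_hom[OF sz(2)] compare_lemma(1)[OF Y]]])
      (simp_all add: a cr as c dom_retype dom_tsum)
qed

definition span_ob :: "('l, 'o) box \<Rightarrow> 'm \<Rightarrow> 'n" where
  "span_ob X p = cmp D (\<kappa> X) (far F p)"

lemma span_ob_lemma:
  assumes X: "is_box C X" and p: "p \<in> obs (slice C (bound C X))"
  shows "span_ob X p \<in> obs (slice D (bound D (retype F X)))" "src D (span_ob X p) = fob F (src C p)"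
  using D.cmp_hom[OF F.far_hom[OF C.ob_hom[OF p]] compare_lemma(1)[OF X]] by (auto simp: span_ob_def hom_iff)

lemma span_ob_cmp:
  assumes X: "is_box C X" and p: "p \<in> obs (slice C (bound C X))" and z: "z \<in> hom D Q (fob F (src C p))"
  shows "cmp D (span_ob X p) z = cmp D (\<kappa> X) (cmp D (far F p) z)"
  unfolding span_ob_def by (rule D.cmp_assoc[OF z F.far_hom[OF C.ob_hom[OF p]] compare_lemma(1)[OF X]])

lemma span_ob_cmp_far:
  assumes X: "is_box C X" and p: "p \<in> obs (slice C (bound C X))" and z: "z \<in> hom C Q (src C p)"
  shows "cmp D (span_ob X p) (far F z) = cmp D (\<kappa> X) (far F (cmp C p z))"
  using span_ob_cmp[OF X p F.far_hom[OF z]] F.far_cmp[OF z C.ob_hom[OF p]] by simp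

context
  fixes \<phi> :: "('l, 'o) wd" and p
  assumes w: "is_wd C \<phi>" and p: "p \<in> obs (slice C (bound C (wsrc \<phi>)))"
begin

lemma act_far_pullback:
  "is_pullback D (far F p) (far F (legL C \<phi>)) (fob F (src C (spn_act C \<phi> p)), far F (pb1 C p (legL C \<phi>)), far F (pb2 C p (legL C \<phi>)))"
proof -
  have l: "legL C \<phi> \<in> hom C (mid C \<phi>) (bound C (wsrc \<phi>))" by (simp add: hom_iff C.arr_leg[OF w])
  have "is_pullback C p (legL C \<phi>) (pb_ob C p (legL C \<phi>), pb1 C p (legL C \<phi>), pb2 C p (legL C \<phi>))"
    using p C.arr_leg[OF w] by (intro C.pullback_is_pullback) auto
  from pres_pullback[OF C.ob_hom[OF p] l this] show ?thesis
    using C.arr_act[OF w] p by simp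
qed

text \<open>The counterpart of \<open>act_lift\<close> for the image of an apex. The relation is
  given in \<open>D\<close>, whereas the pullback to be used is the image of one in
  \<open>C\<close>; hence an element \<open>m\<close> of \<open>fob F (mid C \<phi>)\<close> has to
  be assembled first, from the outer inputs contained in \<open>y\<close> and the inner outputs
  contained in \<open>u\<close>.\<close>

lemma act_far_lift:
  assumes u: "u \<in> hom D Q (fob F (src C p))" and r: "wd_rel D (wmap F \<phi>) Q (cmp D (span_ob (wsrc \<phi>) p) u) y"
  obtains v where "v \<in> hom D Q (fob F (src C (spn_act C \<phi> p)))" "cmp D (far F (pb1 C p (legL C \<phi>))) v = u"
    "cmp D (span_ob (wtgt \<phi>) (spn_act C \<phi> p)) v = y"
proof -
  note X = is_wd_boxes(1)[OF w] and Y = is_wd_boxes(2)[OF w]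
  note am = C.arr_mid[OF w] and al = C.arr_leg[OF w]
  have lL: "legL C \<phi> \<in> hom C (mid C \<phi>) (bound C (wsrc \<phi>))" and lR: "legR C \<phi> \<in> hom C (mid C \<phi>) (bound C (wtgt \<phi>))"
    and m1: "mid1 C \<phi> \<in> hom C (mid C \<phi>) (hat C (inp (wtgt \<phi>)))" and m2: "mid2 C \<phi> \<in> hom C (mid C \<phi>) (hat C (outp (wsrc \<phi>)))"
    using am al by (auto simp: hom_iff)
  have y: "y \<in> hom D Q (bound D (retype F (wtgt \<phi>)))" using r by (simp add: wd_rel_def)
  have pu: "cmp D (far F p) u \<in> hom D Q (fob F (bound C (wsrc \<phi>)))" using D.cmp_hom[OF u F.far_hom[OF C.ob_hom[OF p]]] .
  obtain y1 where y1: "y1 \<in> hom D Q (fob F (hat C (inp (wtgt \<phi>))))"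
      "\<And>i. i \<in> dom (inp (wtgt \<phi>)) \<Longrightarrow> cmp D (far F (proj C (inp (wtgt \<phi>)) i)) y1 = cmp D (in_at D (retype F (wtgt \<phi>)) i) y"
    using in_lift[OF Y y] by blast
  let ?x2 = "cmp D (far F (bo C (wsrc \<phi>))) (cmp D (far F p) u)"
  have x2: "?x2 \<in> hom D Q (fob F (hat C (outp (wsrc \<phi>))))" using D.cmp_hom[OF pu far_b(2)[OF X]] .
  obtain m where m: "m \<in> hom D Q (fob F (mid C \<phi>))" "cmp D (far F (mid1 C \<phi>)) m = y1" "cmp D (far F (mid2 C \<phi>)) m = ?x2"
    using prd_lift[OF C.box_obs(1)[OF Y] C.box_obs(2)[OF X] y1(1) x2] unfolding mid_def mid1_def mid2_def by blast
  have e: "cmp D (span_ob (wsrc \<phi>) p) u = cmp D (\<kappa> (wsrc \<phi>)) (cmp D (far F p) u)" by (rule span_ob_cmp[OF X p u])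
  note apu = at_compare[OF X pu, folded e]
  have pi: "proj C (inp (wtgt \<phi>)) j \<in> hom C (hat C (inp (wtgt \<phi>))) (the (inp (wtgt \<phi>) j))" if "j \<in> dom (inp (wtgt \<phi>))" for j
    using that C.arr_box_proj[OF Y] by (auto simp: hom_iff)
  have po: "proj C (outp (wsrc \<phi>)) j \<in> hom C (hat C (outp (wsrc \<phi>))) (the (outp (wsrc \<phi>) j))" if "j \<in> dom (outp (wsrc \<phi>))" for j
    using that C.arr_box_proj[OF X] by (auto simp: hom_iff)
  have fi: "cmp D (far F (cmp C (proj C (inp (wtgt \<phi>)) j) (mid1 C \<phi>))) m = cmp D (in_at D (retype F (wtgt \<phi>)) j) y"
    if j: "j \<in> dom (inp (wtgt \<phi>))" for j
    unfolding F.far_cmp[OF m1 pi[OF j]] D.cmp_assoc[OF m(1) F.far_hom[OF m1] F.far_hom[OF pi[OF j]]] m(2) by (rule y1(2)[OF j])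
  have fo: "cmp D (far F (cmp C (proj C (outp (wsrc \<phi>)) j) (mid2 C \<phi>))) m
      = cmp D (out_at D (retype F (wsrc \<phi>)) j) (cmp D (span_ob (wsrc \<phi>) p) u)"
    if j: "j \<in> dom (outp (wsrc \<phi>))" for j
    unfolding F.far_cmp[OF m2 po[OF j]] D.cmp_assoc[OF m(1) F.far_hom[OF m2] F.far_hom[OF po[OF j]]] m(3)
    using far_at_cmp(2)[OF X pu j] apu(2)[OF j] by simp
  have rF: "\<And>i. i \<in> dom (inp (wsrc \<phi>)) \<Longrightarrow> cmp D (in_at D (retype F (wsrc \<phi>)) i) (cmp D (span_ob (wsrc \<phi>) p) u) = (case win \<phi> i of
        Inl j \<Rightarrow> cmp D (out_at D (retype F (wsrc \<phi>)) j) (cmp D (span_ob (wsrc \<phi>) p) u)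
      | Inr j \<Rightarrow> cmp D (in_at D (retype F (wtgt \<phi>)) j) y)"
    "\<And>k. k \<in> dom (outp (wtgt \<phi>)) \<Longrightarrow> cmp D (out_at D (retype F (wtgt \<phi>)) k) y
      = cmp D (out_at D (retype F (wsrc \<phi>)) (wout \<phi> k)) (cmp D (span_ob (wsrc \<phi>) p) u)"
    using r[unfolded wd_rel_def wmap_simps retype_simps dom_retype] by blast+
  have Lm: "cmp D (far F (legL C \<phi>)) m \<in> hom D Q (fob F (bound C (wsrc \<phi>)))" and Rm: "cmp D (far F (legR C \<phi>)) m \<in> hom D Q (fob F (bound C (wtgt \<phi>)))"
    using D.cmp_hom[OF m(1) F.far_hom[OF lL]] D.cmp_hom[OF m(1) F.far_hom[OF lR]] .
  \<comment> \<open>With the identity of \<open>mid C \<phi>\<close> as element, the relation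
    describes the legs themselves; it yields the values of \<open>legR\<close> at output
    ports.\<close>
  note idn_rel = C.wd_rel_legs(1)[OF w C.idn_hom[OF am(1)], unfolded C.idn_right[OF lL] C.idn_right[OF lR]]
  have Lat: "cmp C (in_at C (wsrc \<phi>) i) (legL C \<phi>) = (case win \<phi> i of
      Inl j \<Rightarrow> cmp C (proj C (outp (wsrc \<phi>)) j) (mid2 C \<phi>) | Inr j \<Rightarrow> cmp C (proj C (inp (wtgt \<phi>)) j) (mid1 C \<phi>))"
    if i: "i \<in> dom (inp (wsrc \<phi>))" for i
    using C.at_cmp(1)[OF X lL i] C.arr_hat_in(4)[OF w i] al(4) by simp
  have Lout: "cmp C (out_at C (wsrc \<phi>) k) (legL C \<phi>) = cmp C (proj C (outp (wsrc \<phi>)) k) (mid2 C \<phi>)"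
    if k: "k \<in> dom (outp (wsrc \<phi>))" for k
    using C.at_cmp(2)[OF X lL k] al(5) by simp
  have Rat: "cmp C (in_at C (wtgt \<phi>) i) (legR C \<phi>) = cmp C (proj C (inp (wtgt \<phi>)) i) (mid1 C \<phi>)"
    if i: "i \<in> dom (inp (wtgt \<phi>))" for i
    using C.at_cmp(1)[OF Y lR i] al(9) by simp
  have Rout: "cmp C (out_at C (wtgt \<phi>) k) (legR C \<phi>) = cmp C (proj C (outp (wsrc \<phi>)) (wout \<phi> k)) (mid2 C \<phi>)"
    if k: "k \<in> dom (outp (wtgt \<phi>))" for k
    using idn_rel k C.wd_ports(3)[OF w k] Lout by (simp add: wd_rel_def)
  have aL: "cmp D (far F (in_at C (wsrc \<phi>) i)) (cmp D (far F (legL C \<phi>)) m) = cmp D (far F (cmp C (in_at C (wsrc \<phi>) i) (legL C \<phi>))) m"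
    if "i \<in> dom (inp (wsrc \<phi>))" for i
    using D.cmp_assoc[OF m(1) F.far_hom[OF lL] F.far_hom[OF C.at_hom(1)[OF X that]]] F.far_cmp[OF lL C.at_hom(1)[OF X that]] by simp
  have oL: "cmp D (far F (out_at C (wsrc \<phi>) i)) (cmp D (far F (legL C \<phi>)) m) = cmp D (far F (cmp C (out_at C (wsrc \<phi>) i) (legL C \<phi>))) m"
    if "i \<in> dom (outp (wsrc \<phi>))" for i
    using D.cmp_assoc[OF m(1) F.far_hom[OF lL] F.far_hom[OF C.at_hom(2)[OF X that]]] F.far_cmp[OF lL C.at_hom(2)[OF X that]] by simp
  have aR: "cmp D (far F (in_at C (wtgt \<phi>) i)) (cmp D (far F (legR C \<phi>)) m) = cmp D (far F (cmp C (in_at C (wtgt \<phi>) i) (legR C \<phi>))) m"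
    if "i \<in> dom (inp (wtgt \<phi>))" for i
    using D.cmp_assoc[OF m(1) F.far_hom[OF lR] F.far_hom[OF C.at_hom(1)[OF Y that]]] F.far_cmp[OF lR C.at_hom(1)[OF Y that]] by simp
  have oR: "cmp D (far F (out_at C (wtgt \<phi>) i)) (cmp D (far F (legR C \<phi>)) m) = cmp D (far F (cmp C (out_at C (wtgt \<phi>) i) (legR C \<phi>))) m"
    if "i \<in> dom (outp (wtgt \<phi>))" for i
    using D.cmp_assoc[OF m(1) F.far_hom[OF lR] F.far_hom[OF C.at_hom(2)[OF Y that]]] F.far_cmp[OF lR C.at_hom(2)[OF Y that]] by simp
  note X' = box_retype[OF X] and Y' = box_retype[OF Y]
  \<comment> \<open>Port by port, \<open>u\<close> and \<open>m\<close> agree after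
    \<open>\<kappa>\<close>; cancelling \<open>\<kappa>\<close> makes them a cone over the preserved
    pullback.\<close>
  have "cmp D (\<kappa> (wsrc \<phi>)) (cmp D (far F (legL C \<phi>)) m) = cmp D (\<kappa> (wsrc \<phi>)) (cmp D (far F p) u)"
  proof (rule D.bound_eqI[OF X' D.cmp_hom[OF Lm compare_lemma(1)[OF X]] D.cmp_hom[OF pu compare_lemma(1)[OF X]]])
    fix i assume "i \<in> dom (inp (retype F (wsrc \<phi>)))"
    then have i: "i \<in> dom (inp (wsrc \<phi>))" by (simp add: dom_retype)
    show "cmp D (in_at D (retype F (wsrc \<phi>)) i) (cmp D (\<kappa> (wsrc \<phi>)) (cmp D (far F (legL C \<phi>)) m))
        = cmp D (in_at D (retype F (wsrc \<phi>)) i) (cmp D (\<kappa> (wsrc \<phi>)) (cmp D (far F p) u))"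
      unfolding e[symmetric] rF(1)[OF i] at_compare(1)[OF X Lm i] aL[OF i] Lat[OF i]
      using fi fo C.wd_ports(1,2)[OF w i] by (simp split: sum.split)
  next
    fix k assume "k \<in> dom (outp (retype F (wsrc \<phi>)))"
    then have k: "k \<in> dom (outp (wsrc \<phi>))" by (simp add: dom_retype)
    show "cmp D (out_at D (retype F (wsrc \<phi>)) k) (cmp D (\<kappa> (wsrc \<phi>)) (cmp D (far F (legL C \<phi>)) m))
        = cmp D (out_at D (retype F (wsrc \<phi>)) k) (cmp D (\<kappa> (wsrc \<phi>)) (cmp D (far F p) u))"
      unfolding e[symmetric] at_compare(2)[OF X Lm k] oL[OF k] Lout[OF k] by (rule fo[OF k])
  qed
  then have eq: "cmp D (far F p) u = cmp D (far F (legL C \<phi>)) m" by (rule compare_mono[OF X Lm pu, symmetric])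
  note pb = act_far_pullback
  have uh: "u \<in> hom D Q (src D (far F p))" "m \<in> hom D Q (src D (far F (legL C \<phi>)))"
    using u m(1) F.far_hom[OF C.ob_hom[OF p]] F.far_hom[OF lL] by (simp_all add: hom_iff)
  obtain v where v: "v \<in> hom D Q (fob F (src C (spn_act C \<phi> p)))" "cmp D (far F (pb1 C p (legL C \<phi>))) v = u"
      "cmp D (far F (pb2 C p (legL C \<phi>))) v = m"
    using ex1_implies_ex[OF D.is_pullbackD(5)[OF pb uh eq]] by blast
  note p2 = C.act_mid[OF w p]
  note ao = C.act_ob[OF w p]
  have "cmp D (far F (spn_act C \<phi> p)) v = cmp D (far F (legR C \<phi>)) m"
    using D.cmp_assoc[OF v(1) F.far_hom[OF p2(1)] F.far_hom[OF lR]] F.far_cmp[OF p2(1) lR] p2(3) v(3) by simp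
  then have "cmp D (span_ob (wtgt \<phi>) (spn_act C \<phi> p)) v = cmp D (\<kappa> (wtgt \<phi>)) (cmp D (far F (legR C \<phi>)) m)"
    using span_ob_cmp[OF Y ao v(1)] by simp
  also have "\<dots> = y"
  proof (rule D.bound_eqI[OF Y' D.cmp_hom[OF Rm compare_lemma(1)[OF Y]] y])
    fix i assume "i \<in> dom (inp (retype F (wtgt \<phi>)))"
    then have i: "i \<in> dom (inp (wtgt \<phi>))" by (simp add: dom_retype)
    show "cmp D (in_at D (retype F (wtgt \<phi>)) i) (cmp D (\<kappa> (wtgt \<phi>)) (cmp D (far F (legR C \<phi>)) m))
        = cmp D (in_at D (retype F (wtgt \<phi>)) i) y"
      unfolding at_compare(1)[OF Y Rm i] aR[OF i] Rat[OF i] by (rule fi[OF i])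
  next
    fix k assume "k \<in> dom (outp (retype F (wtgt \<phi>)))"
    then have k: "k \<in> dom (outp (wtgt \<phi>))" by (simp add: dom_retype)
    show "cmp D (out_at D (retype F (wtgt \<phi>)) k) (cmp D (\<kappa> (wtgt \<phi>)) (cmp D (far F (legR C \<phi>)) m))
        = cmp D (out_at D (retype F (wtgt \<phi>)) k) y"
      unfolding at_compare(2)[OF Y Rm k] oR[OF k] Rout[OF k] rF(2)[OF k] using fo C.wd_ports(3)[OF w k] by simp
  qed
  finally show ?thesis using that v by blast
qed

text \<open>In \<open>C\<close> the components of the second projection are expressed by the
  boundary map and the root (\<open>act_mid\<close>). These identities survive \<open>F\<close>, so
  the two given equalities fix both projections of the preserved pullback.\<close>

lemma act_far_mono:
  assumes x: "x \<in> hom D Q (fob F (src C (spn_act C \<phi> p)))" and y: "y \<in> hom D Q (fob F (src C (spn_act C \<phi> p)))"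
    and e: "cmp D (span_ob (wtgt \<phi>) (spn_act C \<phi> p)) x = cmp D (span_ob (wtgt \<phi>) (spn_act C \<phi> p)) y"
      "cmp D (far F (pb1 C p (legL C \<phi>))) x = cmp D (far F (pb1 C p (legL C \<phi>))) y"
  shows "x = y"
proof -
  note X = is_wd_boxes(1)[OF w] and Y = is_wd_boxes(2)[OF w]
  note am = C.arr_mid[OF w] and al = C.arr_leg[OF w]
  have lL: "legL C \<phi> \<in> hom C (mid C \<phi>) (bound C (wsrc \<phi>))"
    and m1: "mid1 C \<phi> \<in> hom C (mid C \<phi>) (hat C (inp (wtgt \<phi>)))" and m2: "mid2 C \<phi> \<in> hom C (mid C \<phi>) (hat C (outp (wsrc \<phi>)))"
    using am al by (auto simp: hom_iff)
  note p2 = C.act_mid[OF w p] and ao = C.act_ob[OF w p] and rh = C.rt_hom[OF w p]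
  have ah: "spn_act C \<phi> p \<in> hom C (src C (spn_act C \<phi> p)) (bound C (wtgt \<phi>))" by (rule C.ob_hom[OF ao])
  have Fa: "cmp D (far F (spn_act C \<phi> p)) x = cmp D (far F (spn_act C \<phi> p)) y"
    using e(1) unfolding span_ob_cmp[OF Y ao x] span_ob_cmp[OF Y ao y]
    by (rule compare_mono[OF Y D.cmp_hom[OF x F.far_hom[OF ah]] D.cmp_hom[OF y F.far_hom[OF ah]]])
  have bY: "bi C (wtgt \<phi>) \<in> hom C (bound C (wtgt \<phi>)) (hat C (inp (wtgt \<phi>)))"
    and bX: "bo C (wsrc \<phi>) \<in> hom C (bound C (wsrc \<phi>)) (hat C (outp (wsrc \<phi>)))"
    using C.arr_b[OF X] C.arr_b[OF Y] by (auto simp: hom_iff)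
  have 1: "cmp D (far F (mid1 C \<phi>)) (cmp D (far F (pb2 C p (legL C \<phi>))) z) = cmp D (far F (bi C (wtgt \<phi>))) (cmp D (far F (spn_act C \<phi> p)) z)"
    if z: "z \<in> hom D Q (fob F (src C (spn_act C \<phi> p)))" for z
    using D.cmp_assoc[OF z F.far_hom[OF p2(1)] F.far_hom[OF m1]] D.cmp_assoc[OF z F.far_hom[OF ah] F.far_hom[OF bY]]
      F.far_cmp[OF p2(1) m1] F.far_cmp[OF ah bY] p2(4) by simp
  have 2: "cmp D (far F (mid2 C \<phi>)) (cmp D (far F (pb2 C p (legL C \<phi>))) z)
      = cmp D (far F (cmp C (bo C (wsrc \<phi>)) p)) (cmp D (far F (pb1 C p (legL C \<phi>))) z)"
    if z: "z \<in> hom D Q (fob F (src C (spn_act C \<phi> p)))" for z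
    using D.cmp_assoc[OF z F.far_hom[OF p2(1)] F.far_hom[OF m2]]
      D.cmp_assoc[OF z F.far_hom[OF rh] F.far_hom[OF C.cmp_hom[OF C.ob_hom[OF p] bX]]]
      F.far_cmp[OF p2(1) m2] F.far_cmp[OF rh C.cmp_hom[OF C.ob_hom[OF p] bX]] p2(5)
      C.cmp_assoc[OF rh C.ob_hom[OF p] bX] by simp
  have "cmp D (far F (pb2 C p (legL C \<phi>))) x = cmp D (far F (pb2 C p (legL C \<phi>))) y"
  proof (rule prd_mono[OF C.box_obs(1)[OF Y] C.box_obs(2)[OF X], folded mid_def mid1_def mid2_def,
        OF D.cmp_hom[OF x F.far_hom[OF p2(1)]] D.cmp_hom[OF y F.far_hom[OF p2(1)]]])
    show "cmp D (far F (mid1 C \<phi>)) (cmp D (far F (pb2 C p (legL C \<phi>))) x)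
        = cmp D (far F (mid1 C \<phi>)) (cmp D (far F (pb2 C p (legL C \<phi>))) y)" unfolding 1[OF x] 1[OF y] Fa ..
    show "cmp D (far F (mid2 C \<phi>)) (cmp D (far F (pb2 C p (legL C \<phi>))) x)
        = cmp D (far F (mid2 C \<phi>)) (cmp D (far F (pb2 C p (legL C \<phi>))) y)" unfolding 2[OF x] 2[OF y] e(2) ..
  qed
  with e(2) show ?thesis
    by (intro D.is_pullback_eqI[OF act_far_pullback F.far_hom[OF C.ob_hom[OF p]] F.far_hom[OF lL] x y])
qed

end

end

section \<open>The algebra map induced by a functor preserving finite limits\<close>

context lex_functor
begin

text \<open>Only the components \<open>cpt\<close> are prescribed. The cells for actions and
  laxators are the arrows forced by the requirement that projections in \<open>D\<close> correspond
  to \<open>F\<close> of projections in \<open>C\<close>, written out with the lifts of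
  \<open>D\<close>; the unit cell is the unique arrow to the terminal object.\<close>

definition Spn_transf ::
    "(('l, 'o) box, ('l, 'o) wd, 'm, 'm \<times> 'm \<times> 'm, 'n, 'n \<times> 'n \<times> 'n) transf" where
  "Spn_transf = \<lparr>
     cpt = Spn_fct C D F,
     cpt_nat = (\<lambda>\<phi> s. let t = span_ob (wtgt \<phi>) (spn_act C \<phi> s); s' = span_ob (wsrc \<phi>) s; r = far F (pb1 C s (legL C \<phi>))
       in (t, pb_lift D s' (legL D (wmap F \<phi>)) r
               (pair D (cmp D (bi D (wtgt (wmap F \<phi>))) t) (cmp D (bo D (wsrc (wmap F \<phi>))) (cmp D s' r))),
           spn_act D (wmap F \<phi>) s')),
     cpt_lax = (\<lambda>X Y (s, t). (span_ob (box_sum X Y) (spn_lax C X Y (s, t)),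
       pair D (far F (pr1 C (src C s) (src C t))) (far F (pr2 C (src C s) (src C t))),
       spn_lax D (retype F X) (retype F Y) (span_ob X s, span_ob Y t))),
     cpt_unt = (span_ob (box_empty :: ('l, 'o) box) (spn_lax_unt C TYPE('l)), bang D (fob F (terminal C)), spn_lax_unt D TYPE('l)) \<rparr>"

lemma Spn_fct_simps:
  "fob (Spn_fct C D F X) p = span_ob X p"
  "far (Spn_fct C D F X) f = (span_ob X (fst f), far F (und f), span_ob X (snd (snd f)))"
  by (auto simp: Spn_fct_def Let_def span_ob_def split: prod.split)

text \<open>Forwards, the relation of the action in \<open>C\<close> is carried to \<open>D\<close>
  by \<open>wd_rel_far\<close> and lifted into the pullback of \<open>D\<close>. Backwards, the
  relation of the action in \<open>D\<close> is lifted into the image of the pullback of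
  \<open>C\<close> by \<open>act_far_lift\<close>.\<close>

lemma nat_lemma:
  assumes w: "is_wd C \<phi>" and p: "p \<in> obs (slice C (bound C (wsrc \<phi>)))"
  shows "cpt_nat Spn_transf \<phi> p \<in> hom (slice D (bound D (retype F (wtgt \<phi>))))
      (span_ob (wtgt \<phi>) (spn_act C \<phi> p)) (spn_act D (wmap F \<phi>) (span_ob (wsrc \<phi>) p))"
    "cmp D (pb1 D (span_ob (wsrc \<phi>) p) (legL D (wmap F \<phi>))) (und (cpt_nat Spn_transf \<phi> p)) = far F (pb1 C p (legL C \<phi>))"
    "\<exists>G \<in> hom (slice D (bound D (retype F (wtgt \<phi>)))) (spn_act D (wmap F \<phi>) (span_ob (wsrc \<phi>) p)) (span_ob (wtgt \<phi>) (spn_act C \<phi> p)).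
      cmp D (far F (pb1 C p (legL C \<phi>))) (und G) = pb1 D (span_ob (wsrc \<phi>) p) (legL D (wmap F \<phi>))"
proof -
  note X = is_wd_boxes(1)[OF w] and Y = is_wd_boxes(2)[OF w] and w' = wd_wmap[OF w]
  note rh = C.rt_hom[OF w p] and ao = C.act_ob[OF w p]
  note p' = span_ob_lemma[OF X p] and a' = span_ob_lemma[OF Y ao]
  have q: "span_ob (wsrc \<phi>) p \<in> obs (slice D (bound D (wsrc (wmap F \<phi>))))" using p'(1) by simp
  have t: "span_ob (wtgt \<phi>) (spn_act C \<phi> p) \<in> obs (slice D (bound D (wtgt (wmap F \<phi>))))" using a'(1) by simp
  have u: "far F (pb1 C p (legL C \<phi>)) \<in> hom D (src D (span_ob (wtgt \<phi>) (spn_act C \<phi> p))) (src D (span_ob (wsrc \<phi>) p))"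
    using F.far_hom[OF rh] by (simp add: p' a')
  have r: "wd_rel D (wmap F \<phi>) (src D (span_ob (wtgt \<phi>) (spn_act C \<phi> p)))
      (cmp D (span_ob (wsrc \<phi>) p) (far F (pb1 C p (legL C \<phi>)))) (span_ob (wtgt \<phi>) (spn_act C \<phi> p))"
    using wd_rel_far[OF w C.rt_rel[OF w p]] span_ob_cmp_far[OF X p rh] unfolding a'(2) by (simp add: span_ob_def)
  note l = D.act_lift_slice[OF w' q t u r refl]
  show "cpt_nat Spn_transf \<phi> p \<in> hom (slice D (bound D (retype F (wtgt \<phi>))))
      (span_ob (wtgt \<phi>) (spn_act C \<phi> p)) (spn_act D (wmap F \<phi>) (span_ob (wsrc \<phi>) p))"
    "cmp D (pb1 D (span_ob (wsrc \<phi>) p) (legL D (wmap F \<phi>))) (und (cpt_nat Spn_transf \<phi> p)) = far F (pb1 C p (legL C \<phi>))"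
    using l by (simp_all add: Spn_transf_def Let_def)
  let ?a = "spn_act D (wmap F \<phi>) (span_ob (wsrc \<phi>) p)" and ?r = "pb1 D (span_ob (wsrc \<phi>) p) (legL D (wmap F \<phi>))"
  have aD: "?a \<in> obs (slice D (bound D (retype F (wtgt \<phi>))))" using D.act_ob[OF w' q] by simp
  have rh': "?r \<in> hom D (src D ?a) (fob F (src C p))" using D.rt_hom[OF w' q] by (simp add: p')
  obtain v where v: "v \<in> hom D (src D ?a) (fob F (src C (spn_act C \<phi> p)))" "cmp D (far F (pb1 C p (legL C \<phi>))) v = ?r"
    "cmp D (span_ob (wtgt \<phi>) (spn_act C \<phi> p)) v = ?a"
    using act_far_lift[OF w p rh' D.rt_rel[OF w' q]] by blast
  have "(?a, v, span_ob (wtgt \<phi>) (spn_act C \<phi> p)) \<in> hom (slice D (bound D (retype F (wtgt \<phi>)))) ?a (span_ob (wtgt \<phi>) (spn_act C \<phi> p))"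
    using v by (intro slice_homI aD a'(1)) (simp_all add: a'(2))
  with v(2) show "\<exists>G \<in> hom (slice D (bound D (retype F (wtgt \<phi>)))) ?a (span_ob (wtgt \<phi>) (spn_act C \<phi> p)).
      cmp D (far F (pb1 C p (legL C \<phi>))) (und G) = ?r" by (intro bexI) simp_all
qed

lemma lax_lemma:
  assumes X: "is_box C X" and Y: "is_box C Y" and p: "p \<in> obs (slice C (bound C X))" and q: "q \<in> obs (slice C (bound C Y))"
    and S: "S = src D (span_ob X p)" and T: "T = src D (span_ob Y q)"
  shows "cpt_lax Spn_transf X Y (p, q) \<in> hom (slice D (bound D (retype F (box_sum X Y))))
      (span_ob (box_sum X Y) (spn_lax C X Y (p, q))) (spn_lax D (retype F X) (retype F Y) (span_ob X p, span_ob Y q))"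
    "cmp D (pr1 D S T) (und (cpt_lax Spn_transf X Y (p, q))) = far F (pr1 C (src C p) (src C q))"
    "cmp D (pr2 D S T) (und (cpt_lax Spn_transf X Y (p, q))) = far F (pr2 C (src C p) (src C q))"
    "\<exists>G \<in> hom (slice D (bound D (retype F (box_sum X Y))))
      (spn_lax D (retype F X) (retype F Y) (span_ob X p, span_ob Y q)) (span_ob (box_sum X Y) (spn_lax C X Y (p, q))).
      cmp D (far F (pr1 C (src C p) (src C q))) (und G) = pr1 D S T \<and>
      cmp D (far F (pr2 C (src C p) (src C q))) (und G) = pr2 D S T"
proof -
  note B = is_box_sum[OF X Y] and X' = box_retype[OF X] and Y' = box_retype[OF Y]
  note mo = C.mu_ob[OF X Y p q] and pr = C.mu_pr_hom[OF X Y p q] and s0 = C.mu_sp0[OF X Y p q]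
  note mh = C.ob_hom[OF mo]
  note p' = span_ob_lemma[OF X p] and q' = span_ob_lemma[OF Y q] and m' = span_ob_lemma[OF B mo]
  note Fpr = F.far_hom[OF pr(1)] F.far_hom[OF pr(2)]
  let ?m = "span_ob (box_sum X Y) (spn_lax C X Y (p, q))"
  let ?n = "spn_lax D (retype F X) (retype F Y) (span_ob X p, span_ob Y q)"
  have u: "far F (pr1 C (src C p) (src C q)) \<in> hom D (src D ?m) (src D (span_ob X p))"
    and v: "far F (pr2 C (src C p) (src C q)) \<in> hom D (src D ?m) (src D (span_ob Y q))"
    using Fpr by (simp_all add: p' q' m')
  have m: "?m \<in> hom D (src D ?m) (bound D (box_sum (retype F X) (retype F Y)))"
    using D.ob_hom[OF m'(1)] by (simp add: Wiring_fct_plain)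
  have e: "cmp D (spl D (retype F X) (retype F Y)) ?m = cmp D (span_ob X p) (far F (pr1 C (src C p) (src C q)))"
    "cmp D (spr D (retype F X) (retype F Y)) ?m = cmp D (span_ob Y q) (far F (pr2 C (src C p) (src C q)))"
    using spl_compare[OF X Y mh, folded span_ob_def] unfolding s0 span_ob_cmp_far[OF X p pr(1)] span_ob_cmp_far[OF Y q pr(2)]
    by (simp_all add: span_ob_def)
  note k = D.mu_pair[OF X' Y' p'(1) q'(1) u v m e]
  note no = D.mu_ob[OF X' Y' p'(1) q'(1)]
  have mo': "?m \<in> obs (slice D (bound D (box_sum (retype F X) (retype F Y))))" using m'(1) by (simp add: Wiring_fct_plain)
  show "cpt_lax Spn_transf X Y (p, q) \<in> hom (slice D (bound D (retype F (box_sum X Y)))) ?m ?n"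
    using slice_homI[OF mo' no k(1,2)] by (simp add: Spn_transf_def Wiring_fct_plain)
  show "cmp D (pr1 D S T) (und (cpt_lax Spn_transf X Y (p, q))) = far F (pr1 C (src C p) (src C q))"
    "cmp D (pr2 D S T) (und (cpt_lax Spn_transf X Y (p, q))) = far F (pr2 C (src C p) (src C q))"
    using k(3,4) by (simp_all add: Spn_transf_def S T)
  note pn = D.mu_pr_hom[OF X' Y' p'(1) q'(1), folded S T]
  have o: "src C p \<in> obs C" "src C q \<in> obs C" using p q C.src_obs by auto
  \<comment> \<open>The arrow back exists because \<open>F\<close> preserves the product of the two
    apexes.\<close>
  obtain z where z: "z \<in> hom D (src D ?n) (fob F (prd C (src C p) (src C q)))"
      "cmp D (far F (pr1 C (src C p) (src C q))) z = pr1 D S T" "cmp D (far F (pr2 C (src C p) (src C q))) z = pr2 D S T"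
    using prd_lift[OF o, of "pr1 D S T" "src D ?n" "pr2 D S T"] pn by (auto simp: S T p' q')
  have zh: "z \<in> hom D (src D ?n) (src D ?m)" using z(1) by (simp add: m' C.src_mu[OF X Y p q])
  have uh: "far F (pr1 C (src C p) (src C q)) \<in> hom D (src D ?m) (src D (span_ob X p))" by (rule u)
  have "cmp D ?m z = ?n"
  proof (rule D.sum_eqI[OF X' Y' D.cmp_hom[OF zh m] D.ob_hom[OF no]])
    show "cmp D (spl D (retype F X) (retype F Y)) (cmp D ?m z) = cmp D (spl D (retype F X) (retype F Y)) ?n"
      using D.cmp_assoc[OF zh m D.spl_lemma(1)[OF X' Y']] D.cmp_assoc[OF zh u D.ob_hom[OF p'(1)]] e(1) z(2)
        D.mu_sp0(1)[OF X' Y' p'(1) q'(1)] by (simp add: S T)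
    show "cmp D (spr D (retype F X) (retype F Y)) (cmp D ?m z) = cmp D (spr D (retype F X) (retype F Y)) ?n"
      using D.cmp_assoc[OF zh m D.spr_lemma(1)[OF X' Y']] D.cmp_assoc[OF zh v D.ob_hom[OF q'(1)]] e(2) z(3)
        D.mu_sp0(2)[OF X' Y' p'(1) q'(1)] by (simp add: S T)
  qed
  from slice_homI[OF no mo' zh this] z(2,3)
  show "\<exists>G \<in> hom (slice D (bound D (retype F (box_sum X Y)))) ?n ?m.
      cmp D (far F (pr1 C (src C p) (src C q))) (und G) = pr1 D S T \<and>
      cmp D (far F (pr2 C (src C p) (src C q))) (und G) = pr2 D S T"
    by (intro bexI[of _ "(?n, z, ?m)"]) (simp_all add: Wiring_fct_plain)
qed

lemma unt_lemma:
  fixes F_eps D_eps defines "F_eps \<equiv> span_ob (box_empty :: ('l, 'o) box) (spn_lax_unt C TYPE('l))"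
    and "D_eps \<equiv> spn_lax_unt D TYPE('l)"
  shows "(F_eps, bang D (fob F (terminal C)), D_eps) \<in> hom (slice D (bound D (box_empty :: ('l, 'p) box))) F_eps D_eps"
    "\<exists>G. G \<in> hom (slice D (bound D (box_empty :: ('l, 'p) box))) D_eps F_eps"
proof -
  have E: "is_box C (box_empty :: ('l, 'o) box)" and E': "is_box D (box_empty :: ('l, 'p) box)" by (rule is_box_empty)+
  note c = C.lax_unt_lemma[where 'l = 'l] and d = D.lax_unt_lemma[where 'l = 'l]
  have co: "spn_lax_unt C TYPE('l) \<in> obs (slice C (bound C (box_empty :: ('l, 'o) box)))" by (rule C.hom_ob[OF c])
  note f = span_ob_lemma[OF E co]
  have fo: "F_eps \<in> obs (slice D (bound D (box_empty :: ('l, 'p) box)))" and fs: "src D F_eps = fob F (terminal C)"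
    using f c by (simp_all add: F_eps_def Wiring_fct_plain hom_iff)
  have do: "D_eps \<in> obs (slice D (bound D (box_empty :: ('l, 'p) box)))" and ds: "src D D_eps = terminal D"
    using d by (simp_all add: D_eps_def hom_iff)
  have t: "is_terminal D (fob F (terminal C))" by (rule pres_terminal[OF C.terminal_is_terminal])
  have b: "bang D (fob F (terminal C)) \<in> hom D (src D F_eps) (src D D_eps)"
    using D.bang_hom[of "fob F (terminal C)"] t by (simp add: fs ds is_terminal_def)
  \<comment> \<open>The empty box has no ports at which two arrows into its boundary could
    differ.\<close>
  have eq: "x = y" if "x \<in> hom D Q (bound D (box_empty :: ('l, 'p) box))" "y \<in> hom D Q (bound D (box_empty :: ('l, 'p) box))" for x y Q
    by (rule D.bound_eqI[OF E' that]) simp_all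
  show "(F_eps, bang D (fob F (terminal C)), D_eps) \<in> hom (slice D (bound D (box_empty :: ('l, 'p) box))) F_eps D_eps"
    by (rule slice_homI[OF fo do b eq[OF D.cmp_hom[OF b D.ob_hom[OF do]] D.ob_hom[OF fo]]])
  obtain z where z: "z \<in> hom D (src D D_eps) (src D F_eps)"
    using t D.terminal_is_terminal unfolding is_terminal_def fs ds by blast
  show "\<exists>G. G \<in> hom (slice D (bound D (box_empty :: ('l, 'p) box))) D_eps F_eps"
    using slice_homI[OF do fo z eq[OF D.cmp_hom[OF z D.ob_hom[OF fo]] D.ob_hom[OF do]]] by blast
qed

lemma Spn_span_map:
  "span_map (Wiring C :: (('l, 'o) box, ('l, 'o) wd) smc) (Spn C) C (bound C) (bo C)
    (\<lambda>\<phi> s. pb1 C s (legL C \<phi>)) (\<lambda>s t. pr1 C (src C s) (src C t)) (\<lambda>s t. pr2 C (src C s) (src C t))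
    (restrict_alg (Wiring_fct F) (Spn D)) D (\<lambda>X. bound D (retype F X)) (\<lambda>X. bo D (retype F X))
    (\<lambda>\<phi> s. pb1 D s (legL D (wmap F \<phi>))) (\<lambda>s t. pr1 D (src D s) (src D t)) (\<lambda>s t. pr2 D (src D s) (src D t))
    F Spn_transf"
proof -
  note sim = restrict_alg_simps Spn_simps Wiring_simps Wiring_fct_plain hom_Wiring Spn_fct_simps
  have [simp]: "cpt (Spn_transf :: (('l, 'o) box, _, _, _, _, _) transf) = Spn_fct C D F" by (simp add: Spn_transf_def)
  show ?thesis
  proof (intro span_map.intro span_map_axioms.intro C.Spn_span_algebra_id F.cat_functor_axioms, goal_cases)
    case 1
    show ?case by (rule D.Spn_span_algebra[of C F]) (rule F.fob_obs)
  next
    case (2 X s)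
    then show ?case using span_ob_lemma(1)[of X s] by (simp add: sim)
  next
    case (3 X s)
    then show ?case using span_ob_lemma(2)[of X s] by (simp add: sim)
  next
    case (4 X f s t)
    then have X: "is_box C X" and h: "s \<in> obs (slice C (bound C X))" "t \<in> obs (slice C (bound C X))"
        "und f \<in> hom C (src C s) (src C t)" "cmp C t (und f) = s" "fst f = s" "snd (snd f) = t"
      by (auto simp: sim hom_slice)
    then show ?case
      using span_ob_cmp_far[OF X h(2,3)] span_ob_lemma[OF X h(1)] span_ob_lemma[OF X h(2)] F.far_hom[OF h(3)]
      by (simp add: sim hom_slice span_ob_def)
  next
    case (5 X f s t)
    then show ?case by (simp add: sim)
  next
    case (6 \<phi> X Y s)
    then show ?case using nat_lemma(1)[of \<phi> s] by (auto simp: sim)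
  next
    case (7 \<phi> X Y s)
    then show ?case using nat_lemma(2)[of \<phi> s] by (auto simp: sim)
  next
    case (8 \<phi> X Y s)
    then show ?case using nat_lemma(3)[of \<phi> s] by (auto simp: sim)
  next
    case (9 \<phi> X Y s x Q y)
    then show ?case using act_far_mono[of \<phi> s x Q y] by (auto simp: sim)
  next
    case (10 X Y s t)
    then show ?case using lax_lemma(1)[of X Y s t, OF _ _ _ _ refl refl] by (simp add: sim)
  next
    case (11 X Y s t)
    then show ?case using lax_lemma(2,3)[of X Y s t, OF _ _ _ _ refl refl] by (simp add: sim)
  next
    case (12 X Y s t)
    then show ?case using lax_lemma(4)[of X Y s t, OF _ _ _ _ refl refl] by (simp add: sim)
  next
    case (13 X Y s t x Q y)
    then have o: "is_box C X" "is_box C Y" "s \<in> obs (slice C (bound C X))" "t \<in> obs (slice C (bound C Y))" by (auto simp: sim)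
    then have "src C s \<in> obs C" "src C t \<in> obs C" using C.src_obs by auto
    then show ?case using 13 prd_mono[of "src C s" "src C t" x Q y] C.src_mu[OF o] by (simp add: sim)
  next
    case 14
    show ?case using unt_lemma(1)[where 'l = 'l] by (simp add: sim) (simp add: Spn_transf_def)
  next
    case 15
    show ?case using unt_lemma(2)[where 'l = 'l] by (simp add: sim)
  next
    case (16 x Q y)
    then show ?case using C.lax_unt_lemma[where 'l = 'l] D.terminal_eq[OF pres_terminal[OF C.terminal_is_terminal], of x Q y]
      by (simp add: sim hom_iff)
  qed
qed

theorem Spn_algebra_map:
  "\<exists>\<theta>. algebra_map (Wiring C) (Spn C :: (('l, 'o) box, ('l, 'o) wd, 'm, 'm \<times> 'm \<times> 'm) alg)
      (restrict_alg (Wiring_fct F) (Spn D)) \<theta> \<and> (\<forall>X \<in> obs (Wiring C). cpt \<theta> X = Spn_fct C D F X)"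
  using span_map.algebra_map[OF Spn_span_map] by (intro exI[of _ Spn_transf]) (simp add: Spn_transf_def)

end

section \<open>Slices and base change\<close>

text \<open>Pullbacks in a slice may be tested in \<open>C\<close>: the mediating arrow found there
  lies over \<open>b\<close> because its composite with \<open>und A\<close> does.\<close>

lemma (in category) slice_pullbackI:
  assumes F: "F \<in> hom (slice C b) p r" and G: "G \<in> hom (slice C b) q r"
    and A: "A \<in> hom (slice C b) P p" and B: "B \<in> hom (slice C b) P q"
    and pb: "is_pullback C (und F) (und G) (src C P, und A, und B)"
  shows "is_pullback (slice C b) F G (P, A, B)"
  unfolding is_pullback_def prod.case
proof (intro conjI allI impI; (elim conjE)?)
  interpret S: category "slice C b" by (rule slice_category)
  note f = F[unfolded hom_slice] and g = G[unfolded hom_slice] and a = A[unfolded hom_slice] and bb = B[unfolded hom_slice]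
  have fg: "und F \<in> hom C (src C p) (src C r)" "und G \<in> hom C (src C q) (src C r)" using f g by auto
  show "P \<in> obs (slice C b)" using a by blast
  show "A \<in> hom (slice C b) P (src (slice C b) F)" "B \<in> hom (slice C b) P (src (slice C b) G)"
    using A B f g by auto
  have "und F \<cdot> und A = und G \<cdot> und B" using is_pullbackD(4)[OF pb] .
  then show "cmp (slice C b) F A = cmp (slice C b) G B" using f g a bb by simp
  fix Q x y assume x: "x \<in> hom (slice C b) Q (src (slice C b) F)" and y: "y \<in> hom (slice C b) Q (src (slice C b) G)"
    and e: "cmp (slice C b) F x = cmp (slice C b) G y"
  have sF: "src (slice C b) F = p" "src (slice C b) G = q" using f g by auto
  note x' = x[unfolded hom_slice sF] and y' = y[unfolded hom_slice sF]
  have ux: "und x \<in> hom C (src C Q) (src C p)" and uy: "und y \<in> hom C (src C Q) (src C q)" using x' y' by auto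
  have e': "und F \<cdot> und x = und G \<cdot> und y" using e by simp
  have s: "src C (und F) = src C p" "src C (und G) = src C q" using fg by (auto simp: hom_iff)
  obtain u where u: "u \<in> hom C (src C Q) (src C P)" "und A \<cdot> u = und x" "und B \<cdot> u = und y"
    using is_pullbackD(5)[OF pb, unfolded s, OF ux uy e'] by blast
  have Pu: "P \<cdot> u = Q"
  proof -
    have ph: "p \<in> hom C (src C p) b" and ah: "und A \<in> hom C (src C P) (src C p)" "p \<cdot> und A = P"
      using a by (auto simp: hom_iff)
    show ?thesis using cmp_assoc[OF u(1) ah(1) ph] ah(2) u(2) x' by simp
  qed
  have U: "(Q, u, P) \<in> hom (slice C b) Q P" using u(1) Pu x' a by (simp add: hom_slice)
  show "\<exists>!U. U \<in> hom (slice C b) Q P \<and> cmp (slice C b) A U = x \<and> cmp (slice C b) B U = y"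
  proof (intro ex1I[of _ "(Q, u, P)"] conjI)
    show "(Q, u, P) \<in> hom (slice C b) Q P" by fact
    show "cmp (slice C b) A (Q, u, P) = x"
      using S.cmp_hom[OF U A] x sF u(2) by (intro slice_eqI) auto
    show "cmp (slice C b) B (Q, u, P) = y"
      using S.cmp_hom[OF U B] y sF u(3) by (intro slice_eqI) auto
  next
    fix V assume V: "V \<in> hom (slice C b) Q P \<and> cmp (slice C b) A V = x \<and> cmp (slice C b) B V = y"
    then have v: "und V \<in> hom C (src C Q) (src C P)" "und A \<cdot> und V = und x" "und B \<cdot> und V = und y"
      by (auto simp: hom_slice)
    have "und V = u" using is_pullback_eqI[OF pb fg v(1) u(1)] v u by simp
    then show "V = (Q, u, P)" using V U by (intro slice_eqI) auto
  qed
qed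

context finitely_complete
begin

lemma slice_terminalI:
  assumes i: "i \<in> obs (slice C b)" and "\<And>p. p \<in> obs (slice C b) \<Longrightarrow> \<exists>!u. u \<in> hom C (src C p) (src C i) \<and> i \<cdot> u = p"
  shows "is_terminal (slice C b) i"
  unfolding is_terminal_def
proof (intro conjI ballI)
  show "i \<in> obs (slice C b)" by fact
  fix p assume p: "p \<in> obs (slice C b)"
  from assms(2)[OF p] obtain u where u: "u \<in> hom C (src C p) (src C i)" "i \<cdot> u = p"
    and uu: "\<And>v. v \<in> hom C (src C p) (src C i) \<Longrightarrow> i \<cdot> v = p \<Longrightarrow> v = u" by auto
  show "\<exists>!U. U \<in> hom (slice C b) p i"
  proof (intro ex1I[of _ "(p, u, i)"])
    show "(p, u, i) \<in> hom (slice C b) p i" by (rule slice_homI[OF p i u])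
    fix V assume V: "V \<in> hom (slice C b) p i"
    then have "und V = u" using uu by (auto simp: hom_slice)
    then show "V = (p, u, i)" using V by (metis slice_arr_eq)
  qed
qed

lemma slice_finitely_complete:
  assumes b: "b \<in> obs C"
  shows "finitely_complete (slice C b)"
proof -
  interpret S: category "slice C b" by (rule slice_category)
  show ?thesis
  proof
    have "is_terminal (slice C b) (idn C b)"
    proof (rule slice_terminalI)
      show "idn C b \<in> obs (slice C b)" using arr_idn[OF b] by simp
      show "\<exists>!u. u \<in> hom C (src C p) (src C (idn C b)) \<and> idn C b \<cdot> u = p" if "p \<in> obs (slice C b)" for p
        using that arr_idn[OF b] idn_left[of _ _ b] by (intro ex1I[of _ p]) (auto simp: hom_iff idn_cmp)
    qed
    then show "\<exists>t. is_terminal (slice C b) t" ..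
  next
    fix F G p q r assume F: "F \<in> hom (slice C b) p r" and G: "G \<in> hom (slice C b) q r"
    note f = F[unfolded hom_slice] and g = G[unfolded hom_slice]
    have fg: "und F \<in> hom C (src C p) (src C r)" "und G \<in> hom C (src C q) (src C r)" using f g by auto
    obtain P x y where pb: "is_pullback C (und F) (und G) (P, x, y)" using ex_pullback[OF fg] by (metis surj_pair)
    note d = is_pullbackD[OF pb]
    have xy: "x \<in> hom C P (src C p)" "y \<in> hom C P (src C q)" using d(2,3) fg by (auto simp: hom_iff)
    have ph: "p \<in> hom C (src C p) b" and qh: "q \<in> hom C (src C q) b" and rh: "r \<in> hom C (src C r) b"
      using f g by (auto simp: hom_iff)
    have px: "p \<cdot> x \<in> hom C P b" by (rule cmp_hom[OF xy(1) ph])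
    have "q \<cdot> y = p \<cdot> x"
      using cmp_assoc[OF xy(1) fg(1) rh] cmp_assoc[OF xy(2) fg(2) rh] f g d(4) by simp
    then have "(p \<cdot> x, x, p) \<in> hom (slice C b) (p \<cdot> x) p" "(p \<cdot> x, y, q) \<in> hom (slice C b) (p \<cdot> x) q"
      using slice_homI[OF hom_ob[OF px] hom_ob[OF ph], of x] slice_homI[OF hom_ob[OF px] hom_ob[OF qh], of y] xy src_hom[OF px]
      by simp_all
    from slice_pullbackI[OF F G this] pb src_hom[OF px]
    have "is_pullback (slice C b) F G (p \<cdot> x, (p \<cdot> x, x, p), (p \<cdot> x, y, q))" by simp
    then show "\<exists>P. is_pullback (slice C b) F G P" by blast
  qed
qed

text \<open>\<open>Delta_Sync\<close> in the generality of an arbitrary finitely complete category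
  and base object \<open>b\<close>.\<close>

definition base_change :: "'o \<Rightarrow> ('o, 'm, 'm, 'm \<times> 'm \<times> 'm) fct" where
  "base_change b = \<lparr> fob = (\<lambda>a. pr2 C a b),
     far = (\<lambda>h. (pr2 C (src C h) b, pair C (h \<cdot> pr1 C (src C h) b) (pr2 C (src C h) b), pr2 C (tgt C h) b)) \<rparr>"

context
  fixes b assumes b: "b \<in> obs C"
begin

abbreviation times :: "'m \<Rightarrow> 'm" where
  "times h \<equiv> pair C (h \<cdot> pr1 C (src C h) b) (pr2 C (src C h) b)"

lemma times_lemma:
  assumes h: "h \<in> hom C x y"
  shows "times h \<in> hom C (prd C x b) (prd C y b)" "pr1 C y b \<cdot> times h = h \<cdot> pr1 C x b" "pr2 C y b \<cdot> times h = pr2 C x b"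
proof -
  note p = pr_hom[OF hom_src_obs[OF h] b]
  have s: "src C h = x" using h by (simp add: hom_iff)
  show "times h \<in> hom C (prd C x b) (prd C y b)" "pr1 C y b \<cdot> times h = h \<cdot> pr1 C x b" "pr2 C y b \<cdot> times h = pr2 C x b"
    unfolding s using pair_hom[OF cmp_hom[OF p(1) h] p(2)] pr_pair[OF cmp_hom[OF p(1) h] p(2)] by auto
qed

lemma times_cmp:
  assumes h: "h \<in> hom C x y" and z: "z \<in> hom C Q (prd C x b)"
  shows "pr1 C y b \<cdot> (times h \<cdot> z) = h \<cdot> (pr1 C x b \<cdot> z)" "pr2 C y b \<cdot> (times h \<cdot> z) = pr2 C x b \<cdot> z"
  using times_lemma[OF h] cmp_assoc[OF z times_lemma(1)[OF h] pr_hom(1)[OF hom_tgt_obs[OF h] b]]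
    cmp_assoc[OF z times_lemma(1)[OF h] pr_hom(2)[OF hom_tgt_obs[OF h] b]]
    cmp_assoc[OF z pr_hom(1)[OF hom_src_obs[OF h] b] h] by simp_all

lemma base_change_functor: "cat_functor C (slice C b) (base_change b)"
proof -
  interpret S: category "slice C b" by (rule slice_category)
  show ?thesis
  proof
    fix a assume a: "a \<in> obs C"
    note p = pr_hom[OF a b] and i = arr_idn[OF a]
    show o: "fob (base_change b) a \<in> obs (slice C b)" using p(2) by (simp add: base_change_def hom_iff)
    have "times (idn C a) = idn C (prd C a b)"
      using times_lemma[OF idn_hom[OF a]] p idn_left[OF p(1)] idn_right[OF p(1)] idn_right[OF p(2)]
      by (intro prd_eqI[OF a b _ idn_hom[OF prd_obs[OF a b]]]) simp_all
    then show "far (base_change b) (idn C a) = idn (slice C b) (fob (base_change b) a)"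
      using i p by (simp add: base_change_def hom_iff)
  next
    fix f x y assume f: "f \<in> hom C x y"
    have s: "src C f = x" "tgt C f = y" using f by (auto simp: hom_iff)
    note px = pr_hom[OF hom_src_obs[OF f] b] and py = pr_hom[OF hom_tgt_obs[OF f] b]
    show "far (base_change b) f \<in> hom (slice C b) (fob (base_change b) x) (fob (base_change b) y)"
      using slice_homI[OF hom_ob[OF px(2)] hom_ob[OF py(2)], of "times f"] times_lemma[OF f] src_hom[OF px(2)] src_hom[OF py(2)]
      by (simp add: base_change_def s)
    fix g z assume g: "g \<in> hom C y z"
    have sg: "src C g = y" "tgt C g = z" using g by (auto simp: hom_iff)
    note gf = cmp_hom[OF f g]
    have sgf: "src C (g \<cdot> f) = x" "tgt C (g \<cdot> f) = z" using gf by (auto simp: hom_iff)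
    have "times (g \<cdot> f) = times g \<cdot> times f"
      using times_lemma[OF gf] times_lemma[OF f] times_cmp[OF g times_lemma(1)[OF f]] cmp_assoc[OF px(1) f g]
      by (intro prd_eqI[OF hom_tgt_obs[OF g] b times_lemma(1)[OF gf] cmp_hom[OF times_lemma(1)[OF f] times_lemma(1)[OF g]]]) simp_all
    then show "far (base_change b) (g \<cdot> f) = cmp (slice C b) (far (base_change b) g) (far (base_change b) f)"
      by (simp add: base_change_def s sg sgf)
  qed
qed

text \<open>A cone over \<open>times f\<close> and \<open>times g\<close> amounts to a cone over
  \<open>f\<close> and \<open>g\<close> together with one arrow to \<open>b\<close>: both arrows act
  as the identity on the second component, so the two second components of the cone
  coincide.\<close>

lemma times_pullback:
  assumes f: "f \<in> hom C x z" and g: "g \<in> hom C y z" and pb: "is_pullback C f g (P, p, q)"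
  shows "is_pullback C (times f) (times g) (prd C P b, times p, times q)"
  unfolding is_pullback_def prod.case
proof (intro conjI allI impI; (elim conjE)?)
  have s: "src C f = x" "src C g = y" using f g by (auto simp: hom_iff)
  note d = is_pullbackD(1-4)[OF pb, unfolded s]
  note o = hom_src_obs[OF f] hom_src_obs[OF g] hom_tgt_obs[OF f]
  note tf = times_lemma[OF f] and tg = times_lemma[OF g] and tp = times_lemma[OF d(2)] and tq = times_lemma[OF d(3)]
  have st: "src C (times f) = prd C x b" "src C (times g) = prd C y b" using tf(1) tg(1) by (auto simp: hom_iff)
  note pP = pr_hom[OF d(1) b]
  show "prd C P b \<in> obs C" by (rule prd_obs[OF d(1) b])
  show "times p \<in> hom C (prd C P b) (src C (times f))" "times q \<in> hom C (prd C P b) (src C (times g))"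
    unfolding st by (rule tp tq)+
  show "times f \<cdot> times p = times g \<cdot> times q"
    using times_cmp[OF f tp(1)] times_cmp[OF g tq(1)] tp tq cmp_assoc[OF pP(1) d(2) f] cmp_assoc[OF pP(1) d(3) g] d(4)
    by (intro prd_eqI[OF o(3) b cmp_hom[OF tp(1) tf(1)] cmp_hom[OF tq(1) tg(1)]]) simp_all
  fix Q u v assume u: "u \<in> hom C Q (src C (times f))" and v: "v \<in> hom C Q (src C (times g))" and e: "times f \<cdot> u = times g \<cdot> v"
  note u = u[unfolded st] and v = v[unfolded st]
  note px = pr_hom[OF o(1) b] and py = pr_hom[OF o(2) b]
  have e1: "f \<cdot> (pr1 C x b \<cdot> u) = g \<cdot> (pr1 C y b \<cdot> v)" and e2: "pr2 C x b \<cdot> u = pr2 C y b \<cdot> v"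
    using times_cmp[OF f u] times_cmp[OF g v] e by simp_all
  obtain w where w: "w \<in> hom C Q P" "p \<cdot> w = pr1 C x b \<cdot> u" "q \<cdot> w = pr1 C y b \<cdot> v"
    using is_pullbackD(5)[OF pb, unfolded s, OF cmp_hom[OF u px(1)] cmp_hom[OF v py(1)] e1] by blast
  let ?k = "pair C w (pr2 C x b \<cdot> u)"
  note k = pair_hom[OF w(1) cmp_hom[OF u px(2)]] and pk = pr_pair[OF w(1) cmp_hom[OF u px(2)]]
  show "\<exists>!k. k \<in> hom C Q (prd C P b) \<and> times p \<cdot> k = u \<and> times q \<cdot> k = v"
  proof (intro ex1I[of _ ?k] conjI)
    show "?k \<in> hom C Q (prd C P b)" by (rule k)
    show "times p \<cdot> ?k = u"
      using times_cmp[OF d(2) k] pk w(2) by (intro prd_eqI[OF o(1) b cmp_hom[OF k tp(1)] u]) simp_all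
    show "times q \<cdot> ?k = v"
      using times_cmp[OF d(3) k] pk w(3) e2 by (intro prd_eqI[OF o(2) b cmp_hom[OF k tq(1)] v]) simp_all
  next
    fix l assume l: "l \<in> hom C Q (prd C P b) \<and> times p \<cdot> l = u \<and> times q \<cdot> l = v"
    then have lh: "l \<in> hom C Q (prd C P b)" and lu: "times p \<cdot> l = u" and lv: "times q \<cdot> l = v" by auto
    note c = times_cmp[OF d(2) lh, unfolded lu] times_cmp[OF d(3) lh, unfolded lv]
    have "pr1 C P b \<cdot> l = w"
      by (rule is_pullback_eqI[OF pb f g cmp_hom[OF lh pP(1)] w(1)]) (simp_all add: w c)
    then show "l = ?k" using pk c by (intro prd_eqI[OF d(1) b lh k]) simp_all
  qed
qed

text \<open>For a terminal \<open>t\<close>, an arrow over \<open>b\<close> into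
  \<open>prd C t b\<close> is a pair whose second component is prescribed and whose first one is
  forced. For pullbacks, \<open>slice_pullbackI\<close> reduces the claim to
  \<open>times_pullback\<close>.\<close>

lemma base_change_lex: "lex_functor C (slice C b) (base_change b)"
proof -
  interpret S: finitely_complete "slice C b" by (rule slice_finitely_complete[OF b])
  interpret F: cat_functor C "slice C b" "base_change b" by (rule base_change_functor)
  show ?thesis
  proof
    fix t assume t: "is_terminal C t"
    then have o: "t \<in> obs C" by (simp add: is_terminal_def)
    note p = pr_hom[OF o b]
    have "is_terminal (slice C b) (pr2 C t b)"
    proof (rule slice_terminalI)
      show "pr2 C t b \<in> obs (slice C b)" using p by (simp add: hom_iff)
      fix q assume q: "q \<in> obs (slice C b)"
      note qh = ob_hom[OF q]
      have s: "src C (pr2 C t b) = prd C t b" using p by (simp add: hom_iff)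
      obtain u where u: "u \<in> hom C (src C q) t" using t hom_src_obs[OF qh] by (auto simp: is_terminal_def)
      show "\<exists>!u. u \<in> hom C (src C q) (src C (pr2 C t b)) \<and> pr2 C t b \<cdot> u = q"
        unfolding s
      proof (intro ex1I[of _ "pair C u q"] conjI)
        show "pair C u q \<in> hom C (src C q) (prd C t b)" "pr2 C t b \<cdot> pair C u q = q"
          using pair_hom[OF u qh] pr_pair[OF u qh] by auto
        fix v assume v: "v \<in> hom C (src C q) (prd C t b) \<and> pr2 C t b \<cdot> v = q"
        then have vh: "v \<in> hom C (src C q) (prd C t b)" by blast
        show "v = pair C u q"
          using v pr_pair[OF u qh] terminal_eq[OF t cmp_hom[OF vh p(1)] u]
          by (intro prd_eqI[OF o b vh pair_hom[OF u qh]]) simp_all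
      qed
    qed
    then show "is_terminal (slice C b) (fob (base_change b) t)" by (simp add: base_change_def)
  next
    fix f x z g y P p q
    assume f: "f \<in> hom C x z" and g: "g \<in> hom C y z" and pb: "is_pullback C f g (P, p, q)"
    have s: "src C f = x" "src C g = y" using f g by (auto simp: hom_iff)
    note d = is_pullbackD(1-3)[OF pb, unfolded s]
    have "is_pullback C (und (far (base_change b) f)) (und (far (base_change b) g))
        (src C (fob (base_change b) P), und (far (base_change b) p), und (far (base_change b) q))"
      using times_pullback[OF f g pb] pr_hom(2)[OF d(1) b] by (simp add: base_change_def hom_iff)
    from slice_pullbackI[OF F.far_hom[OF f] F.far_hom[OF g] F.far_hom[OF d(2)] F.far_hom[OF d(3)] this]
    show "is_pullback (slice C b) (far (base_change b) f) (far (base_change b) g)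
        (fob (base_change b) P, far (base_change b) p, far (base_change b) q)" .
  qed
qed

end

end

section \<open>Interval sheaves\<close>

lemma is_Tr_nonneg: "is_Tr l' p (l :: 't::linordered_semidom) \<Longrightarrow> 0 \<le> l' \<and> 0 \<le> p \<and> 0 \<le> l"
  unfolding is_Tr_def by (meson add_nonneg_nonneg order_trans)

lemma is_Tr_trans: "is_Tr l' p (l :: 't::linordered_semidom) \<Longrightarrow> is_Tr l'' q l' \<Longrightarrow> is_Tr l'' (p + q) l"
  unfolding is_Tr_def by (metis add.assoc add_left_mono add_nonneg_nonneg order_trans)

lemma is_Tr_simps [simp]:
  "0 \<le> l \<Longrightarrow> is_Tr l 0 l" "0 \<le> l \<Longrightarrow> is_Tr 0 0 l" "0 \<le> l \<Longrightarrow> is_Tr 0 l l"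
  "0 \<le> l1 \<Longrightarrow> 0 \<le> l2 \<Longrightarrow> is_Tr l1 0 (l1 + l2)" "0 \<le> l1 \<Longrightarrow> 0 \<le> l2 \<Longrightarrow> is_Tr l2 l1 (l1 + (l2 :: 't::linordered_semidom))"
  by (auto simp: is_Tr_def)

lemma presheafI:
  fixes X :: "('t::linordered_semidom, 'u) psh"
  assumes "\<And>l x. x \<in> sec X l \<Longrightarrow> 0 \<le> l"
    and res: "\<And>l p l'. res X l p l' = (if is_Tr l' p l then restrict (r l p l') (sec X l) else (\<lambda>_. undefined))"
    and type: "\<And>l p l' x. is_Tr l' p l \<Longrightarrow> x \<in> sec X l \<Longrightarrow> r l p l' x \<in> sec X l'"
    and "\<And>l x. 0 \<le> l \<Longrightarrow> x \<in> sec X l \<Longrightarrow> r l 0 l x = x"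
    and "\<And>l p l' q l'' x. is_Tr l' p l \<Longrightarrow> is_Tr l'' q l' \<Longrightarrow> x \<in> sec X l \<Longrightarrow> r l' q l'' (r l p l' x) = r l (p + q) l'' x"
  shows "presheaf X"
  unfolding presheaf_def
proof (intro conjI allI impI; (elim conjE)?)
  show "sec X l = {}" if "\<not> 0 \<le> l" for l using assms(1) that by blast
  show "res X l p l' \<in> sec X l \<rightarrow>\<^sub>E sec X l'" if "is_Tr l' p l" for l p l'
    using type that by (auto simp: res)
  show "res X l p l' = (\<lambda>_. undefined)" if "\<not> is_Tr l' p l" for l p l' using that by (simp add: res)
  show "res X l 0 l x = x" if "x \<in> sec X l" for l x using assms(1)[OF that] assms(4) that by (simp add: res)
  show "res X l' q l'' (res X l p l' x) = res X l (p + q) l'' x"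
    if "is_Tr l' p l" "is_Tr l'' q l'" "x \<in> sec X l" for l p l' q l'' x
    using that is_Tr_trans[OF that(1,2)] type[OF that(1,3)] assms(5) by (simp add: res)
qed

context
  fixes X :: "('t::linordered_semidom, 'u) psh"
  assumes X: "presheaf X"
begin

lemma sec_nonneg: "x \<in> sec X l \<Longrightarrow> 0 \<le> l"
  using X unfolding presheaf_def by (metis empty_iff)

lemma res_sec: "is_Tr l' p l \<Longrightarrow> x \<in> sec X l \<Longrightarrow> res X l p l' x \<in> sec X l'"
  using X unfolding presheaf_def by (meson PiE_mem)

lemma res_id: "x \<in> sec X l \<Longrightarrow> res X l 0 l x = x"
  using X by (simp add: presheaf_def)

lemma res_res: "is_Tr l' p l \<Longrightarrow> is_Tr l'' q l' \<Longrightarrow> x \<in> sec X l \<Longrightarrow> res X l' q l'' (res X l p l' x) = res X l (p + q) l'' x"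
  using X by (simp add: presheaf_def)

end

lemma sheaf_presheaf: "sheaf X \<Longrightarrow> presheaf X"
  by (simp add: sheaf_def)

lemma sheaf_glue:
  assumes "sheaf X" "x1 \<in> sec X l1" "x2 \<in> sec X l2" "res X l1 l1 0 x1 = res X l2 0 0 x2"
  obtains x where "x \<in> sec X (l1 + l2)" "res X (l1 + l2) 0 l1 x = x1" "res X (l1 + l2) l1 l2 x = x2"
  using assms unfolding sheaf_def by blast

text \<open>The uniqueness half of gluing. The matching condition comes for free, as both pieces are
  restrictions of the single section \<open>y\<close> and meet at \<open>l1\<close>.\<close>

lemma sheaf_eqI:
  assumes X: "sheaf X" and x: "x \<in> sec X (l1 + l2)" and y: "y \<in> sec X (l1 + l2)" and l: "0 \<le> l1" "0 \<le> l2"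
    and e: "res X (l1 + l2) 0 l1 x = res X (l1 + l2) 0 l1 y" "res X (l1 + l2) l1 l2 x = res X (l1 + l2) l1 l2 y"
  shows "x = y"
proof -
  note P = sheaf_presheaf[OF X]
  have 1: "res X (l1 + l2) 0 l1 y \<in> sec X l1" and 2: "res X (l1 + l2) l1 l2 y \<in> sec X l2"
    using res_sec[OF P _ y] l by auto
  have "res X l1 l1 0 (res X (l1 + l2) 0 l1 y) = res X l2 0 0 (res X (l1 + l2) l1 l2 y)"
    using res_res[OF P _ _ y] l by simp
  then have "\<exists>!z. z \<in> sec X (l1 + l2) \<and> res X (l1 + l2) 0 l1 z = res X (l1 + l2) 0 l1 y \<and>
      res X (l1 + l2) l1 l2 z = res X (l1 + l2) l1 l2 y"
    using X 1 2 unfolding sheaf_def by blast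
  then show ?thesis by (rule ex1_unique) (simp_all add: x y e)
qed

lemma sheafI:
  assumes "presheaf X"
    and "\<And>l1 l2 x1 x2. 0 \<le> l1 \<Longrightarrow> 0 \<le> l2 \<Longrightarrow> x1 \<in> sec X l1 \<Longrightarrow> x2 \<in> sec X l2 \<Longrightarrow> res X l1 l1 0 x1 = res X l2 0 0 x2 \<Longrightarrow>
      \<exists>!x. x \<in> sec X (l1 + l2) \<and> res X (l1 + l2) 0 l1 x = x1 \<and> res X (l1 + l2) l1 l2 x = x2"
  shows "sheaf X"
  using assms sec_nonneg[OF assms(1)] unfolding sheaf_def by blast

section \<open>The category of interval sheaves\<close>

lemma Sheaves_simps [simp]:
  "obs Sheaves = {X. sheaf X}" "arrs Sheaves = {h. is_shmap h}" "src Sheaves = smsrc" "tgt Sheaves = smtgt"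
  by (simp_all add: Sheaves_def)

lemma hom_Sheaves: "h \<in> hom Sheaves X Y \<longleftrightarrow> is_shmap h \<and> smsrc h = X \<and> smtgt h = Y"
  by (simp add: hom_iff)

lemma shmapD:
  assumes "h \<in> hom Sheaves X Y"
  shows "sheaf X" "sheaf Y" "x \<in> sec X l \<Longrightarrow> smap h l x \<in> sec Y l"
    "is_Tr l' p l \<Longrightarrow> x \<in> sec X l \<Longrightarrow> smap h l' (res X l p l' x) = res Y l p l' (smap h l x)"
    "x \<notin> sec X l \<Longrightarrow> smap h l x = undefined" "smsrc h = X" "smtgt h = Y"
  using assms by (auto simp: hom_Sheaves is_shmap_def PiE_def extensional_def)

lemma shmap_eqI:
  assumes "h \<in> hom Sheaves X Y" "k \<in> hom Sheaves X Y" "\<And>l x. x \<in> sec X l \<Longrightarrow> smap h l x = smap k l x"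
  shows "h = k"
proof -
  have "smap h = smap k"
  proof (intro ext)
    show "smap h l x = smap k l x" for l x
      using assms(3)[of x l] shmapD(5)[OF assms(1)] shmapD(5)[OF assms(2)] by metis
  qed
  then show ?thesis using assms(1,2) by (auto simp: hom_Sheaves)
qed

lemma shmapI:
  assumes "sheaf X" "sheaf Y" "\<And>l x. x \<in> sec X l \<Longrightarrow> u l x \<in> sec Y l"
    "\<And>l p l' x. is_Tr l' p l \<Longrightarrow> x \<in> sec X l \<Longrightarrow> u l' (res X l p l' x) = res Y l p l' (u l x)"
  shows "\<lparr>smsrc = X, smtgt = Y, smap = (\<lambda>l. restrict (u l) (sec X l))\<rparr> \<in> hom Sheaves X Y"
  using assms res_sec[OF sheaf_presheaf[OF assms(1)]] by (auto simp: hom_Sheaves is_shmap_def)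

lemma smap_idn: "x \<in> sec X l \<Longrightarrow> smap (idn Sheaves X) l x = x"
  by (simp add: Sheaves_def)

lemma smap_cmp: "x \<in> sec (smsrc f) l \<Longrightarrow> smap (cmp Sheaves g f) l x = smap g l (smap f l x)"
  by (simp add: Sheaves_def)

lemma cmp_Sheaves_hom:
  assumes f: "f \<in> hom Sheaves X Y" and g: "g \<in> hom Sheaves Y Z"
  shows "cmp Sheaves g f \<in> hom Sheaves X Z"
proof -
  note f' = shmapD[OF f] and g' = shmapD[OF g]
  have "\<lparr>smsrc = X, smtgt = Z, smap = (\<lambda>l. restrict (smap g l \<circ> smap f l) (sec X l))\<rparr> \<in> hom Sheaves X Z"
    by (rule shmapI) (use f' g' in auto)
  then show ?thesis using f' g' by (simp add: Sheaves_def)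
qed

lemma Sheaves_category: "category (Sheaves :: (('t::linordered_semidom, 'u) psh, ('t, 'u) shmap) cat)"
proof
  fix f g h :: "('t, 'u) shmap" and X Y Z V :: "('t, 'u) psh"
  show "f \<in> arrs Sheaves \<Longrightarrow> src Sheaves f \<in> obs Sheaves" "f \<in> arrs Sheaves \<Longrightarrow> tgt Sheaves f \<in> obs Sheaves"
    by (auto simp: is_shmap_def)
  have idn: "idn Sheaves X \<in> hom Sheaves X X" if "sheaf X" for X :: "('t, 'u) psh"
    using shmapI[OF that that, of "\<lambda>_ x. x"] by (simp add: Sheaves_def id_def)
  then show "X \<in> obs Sheaves \<Longrightarrow> idn Sheaves X \<in> hom Sheaves X X" by simp
  assume f: "f \<in> hom Sheaves X Y"
  note f' = shmapD[OF f]
  show "cmp Sheaves (idn Sheaves Y) f = f"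
    by (rule shmap_eqI[OF cmp_Sheaves_hom[OF f idn] f]) (simp_all add: f' smap_cmp smap_idn)
  show "cmp Sheaves f (idn Sheaves X) = f"
    using shmapD(6)[OF idn[of X]] f'
    by (intro shmap_eqI[OF cmp_Sheaves_hom[OF idn f] f]) (simp_all add: smap_cmp smap_idn)
  assume g: "g \<in> hom Sheaves Y Z"
  show gf: "cmp Sheaves g f \<in> hom Sheaves X Z" by (rule cmp_Sheaves_hom[OF f g])
  assume h: "h \<in> hom Sheaves Z V"
  note hg = cmp_Sheaves_hom[OF g h]
  show "cmp Sheaves (cmp Sheaves h g) f = cmp Sheaves h (cmp Sheaves g f)"
    by (rule shmap_eqI[OF cmp_Sheaves_hom[OF f hg] cmp_Sheaves_hom[OF gf h]])
      (simp add: smap_cmp f' shmapD(6)[OF g] shmapD(6)[OF gf] shmapD(6)[OF f])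
qed

text \<open>Uniqueness makes a sectionwise choice natural: the restriction of the chosen section
  satisfies the relation for the restricted argument, hence it is the section chosen there.\<close>

lemma shmap_ex:
  assumes Q: "sheaf Q" and P: "sheaf P"
    and ex: "\<And>l q. q \<in> sec Q l \<Longrightarrow> \<exists>!z. z \<in> sec P l \<and> R l q z"
    and nat: "\<And>l p l' q z. is_Tr l' p l \<Longrightarrow> q \<in> sec Q l \<Longrightarrow> z \<in> sec P l \<Longrightarrow> R l q z \<Longrightarrow> R l' (res Q l p l' q) (res P l p l' z)"
  obtains u where "u \<in> hom Sheaves Q P" "\<And>l q. q \<in> sec Q l \<Longrightarrow> R l q (smap u l q)"
proof -
  define v where "v l q = (THE z. z \<in> sec P l \<and> R l q z)" for l q
  have v: "v l q \<in> sec P l \<and> R l q (v l q)" if "q \<in> sec Q l" for l q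
    unfolding v_def using theI'[OF ex[OF that]] .
  have "\<lparr>smsrc = Q, smtgt = P, smap = (\<lambda>l. restrict (v l) (sec Q l))\<rparr> \<in> hom Sheaves Q P"
  proof (rule shmapI[OF Q P])
    fix l p l' q assume t: "is_Tr l' p l" and q: "q \<in> sec Q l"
    note q' = res_sec[OF sheaf_presheaf[OF Q] t q]
    show "v l' (res Q l p l' q) = res P l p l' (v l q)"
      by (rule ex1_unique[OF ex[OF q']]) (use v[OF q'] v[OF q] nat[OF t q] res_sec[OF sheaf_presheaf[OF P] t] in auto)
  qed (use v in blast)
  from that[OF this] v show ?thesis by simp
qed

section \<open>Sectionwise computation of limits of sheaves\<close>

lemma pointwise_pullback:
  assumes f: "f \<in> hom Sheaves X Z" and g: "g \<in> hom Sheaves Y Z"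
    and a: "a \<in> hom Sheaves P X" and b: "b \<in> hom Sheaves P Y"
    and e: "\<And>l z. z \<in> sec P l \<Longrightarrow> smap f l (smap a l z) = smap g l (smap b l z)"
    and u: "\<And>l x y. x \<in> sec X l \<Longrightarrow> y \<in> sec Y l \<Longrightarrow> smap f l x = smap g l y \<Longrightarrow>
      \<exists>!z. z \<in> sec P l \<and> smap a l z = x \<and> smap b l z = y"
  shows "is_pullback Sheaves f g (P, a, b)"
  unfolding is_pullback_def prod.case
proof (intro conjI allI impI; (elim conjE)?)
  note f' = shmapD[OF f] and g' = shmapD[OF g] and a' = shmapD[OF a] and b' = shmapD[OF b]
  show "P \<in> obs Sheaves" using a' by simp
  show "a \<in> hom Sheaves P (src Sheaves f)" "b \<in> hom Sheaves P (src Sheaves g)" using a b f' g' by auto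
  show "cmp Sheaves f a = cmp Sheaves g b"
    by (rule shmap_eqI[OF cmp_Sheaves_hom[OF a f] cmp_Sheaves_hom[OF b g]]) (simp add: smap_cmp a' b' e)
  fix Q x y assume x: "x \<in> hom Sheaves Q (src Sheaves f)" and y: "y \<in> hom Sheaves Q (src Sheaves g)"
    and xy: "cmp Sheaves f x = cmp Sheaves g y"
  have x: "x \<in> hom Sheaves Q X" and y: "y \<in> hom Sheaves Q Y" using x y f' g' by auto
  note x' = shmapD[OF x] and y' = shmapD[OF y]
  have ee: "smap f l (smap x l q) = smap g l (smap y l q)" if "q \<in> sec Q l" for l q
    using arg_cong[OF xy, of "\<lambda>h. smap h l q"] that by (simp add: smap_cmp x' y')
  have "\<exists>!z. z \<in> sec P l \<and> smap a l z = smap x l q \<and> smap b l z = smap y l q" if "q \<in> sec Q l" for l q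
    using u[OF x'(3)[OF that] y'(3)[OF that] ee[OF that]] .
  \<comment> \<open>The mediating map is chosen section by section; its compatibility with
    restriction is inherited from the four given maps.\<close>
  then obtain w where w: "w \<in> hom Sheaves Q P" "\<And>l q. q \<in> sec Q l \<Longrightarrow> smap a l (smap w l q) = smap x l q \<and> smap b l (smap w l q) = smap y l q"
    by (rule shmap_ex[where R = "\<lambda>l q z. smap a l z = smap x l q \<and> smap b l z = smap y l q", OF x'(1) a'(1)])
      (simp_all add: a' b' x' y')
  show "\<exists>!w. w \<in> hom Sheaves Q P \<and> cmp Sheaves a w = x \<and> cmp Sheaves b w = y"
  proof (intro ex1I[of _ w] conjI)
    show "w \<in> hom Sheaves Q P" by fact
    show "cmp Sheaves a w = x"
      by (rule shmap_eqI[OF cmp_Sheaves_hom[OF w(1) a] x]) (simp add: smap_cmp shmapD(6)[OF w(1)] w(2))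
    show "cmp Sheaves b w = y"
      by (rule shmap_eqI[OF cmp_Sheaves_hom[OF w(1) b] y]) (simp add: smap_cmp shmapD(6)[OF w(1)] w(2))
  next
    fix v assume "v \<in> hom Sheaves Q P \<and> cmp Sheaves a v = x \<and> cmp Sheaves b v = y"
    then have v: "v \<in> hom Sheaves Q P" and vx: "cmp Sheaves a v = x" and vy: "cmp Sheaves b v = y" by auto
    show "v = w"
    proof (rule shmap_eqI[OF v w(1)])
      fix l q assume q: "q \<in> sec Q l"
      have "smap a l (smap v l q) = smap x l q \<and> smap b l (smap v l q) = smap y l q"
        using q by (simp add: vx[symmetric] vy[symmetric] smap_cmp shmapD(6)[OF v])
      then show "smap v l q = smap w l q"
        using w(2)[OF q] shmapD(3)[OF v q] shmapD(3)[OF w(1) q]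
        by (intro ex1_unique[OF u[OF x'(3)[OF q] y'(3)[OF q] ee[OF q]]]) auto
    qed
  qed
qed

text \<open>An explicit pullback, which exists because \<open>univ\<close> is closed under pairing.
  It shows that pullbacks exist and serves as the standard of comparison in
  \<open>pullback_pointwise\<close>.\<close>

definition pair_sheaf :: "('t::linordered_semidom, 'a univ) shmap \<Rightarrow> ('t, 'a univ) shmap \<Rightarrow> ('t, 'a univ) psh" where
  "pair_sheaf f g = (let S = (\<lambda>l. {Pr x y | x y. x \<in> sec (smsrc f) l \<and> y \<in> sec (smsrc g) l \<and> smap f l x = smap g l y}) in \<lparr>
     sec = S,
     res = (\<lambda>l p l'. if is_Tr l' p l
       then restrict (\<lambda>z. case z of Pr x y \<Rightarrow> Pr (res (smsrc f) l p l' x) (res (smsrc g) l p l' y)) (S l)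
       else (\<lambda>_. undefined)) \<rparr>)"

definition pair_sheaf_pr :: "('t::linordered_semidom, 'a univ) shmap \<Rightarrow> ('t, 'a univ) shmap \<Rightarrow> bool \<Rightarrow> ('t, 'a univ) shmap" where
  "pair_sheaf_pr f g i = \<lparr> smsrc = pair_sheaf f g, smtgt = (if i then smsrc g else smsrc f),
     smap = (\<lambda>l. restrict (\<lambda>z. case z of Pr x y \<Rightarrow> if i then y else x) (sec (pair_sheaf f g) l)) \<rparr>"

context
  fixes f g :: "('t::linordered_semidom, 'a univ) shmap" and X Y Z
  assumes f: "f \<in> hom Sheaves X Z" and g: "g \<in> hom Sheaves Y Z"
begin

lemma sec_pair_sheaf:
  "z \<in> sec (pair_sheaf f g) l \<longleftrightarrow> (\<exists>x y. z = Pr x y \<and> x \<in> sec X l \<and> y \<in> sec Y l \<and> smap f l x = smap g l y)"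
  using shmapD(6)[OF f] shmapD(6)[OF g] by (auto simp: pair_sheaf_def Let_def)

lemma res_pair_sheaf:
  "is_Tr l' p l \<Longrightarrow> Pr x y \<in> sec (pair_sheaf f g) l \<Longrightarrow> res (pair_sheaf f g) l p l' (Pr x y) = Pr (res X l p l' x) (res Y l p l' y)"
  using shmapD(6)[OF f] shmapD(6)[OF g] by (simp add: pair_sheaf_def Let_def)

lemma pair_sheaf_sheaf: "sheaf (pair_sheaf f g)"
proof (rule sheafI)
  note f' = shmapD[OF f] and g' = shmapD[OF g]
  note X = f'(1) and Y = g'(1) and Z = f'(2)
  note pX = sheaf_presheaf[OF X] and pY = sheaf_presheaf[OF Y] and pZ = sheaf_presheaf[OF Z]
  let ?r = "\<lambda>l p l' z. case z of Pr x y \<Rightarrow> Pr (res X l p l' x) (res Y l p l' y)"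
  show "presheaf (pair_sheaf f g)"
  proof (rule presheafI[where r = ?r])
    show "res (pair_sheaf f g) l p l' = (if is_Tr l' p l then restrict (?r l p l') (sec (pair_sheaf f g) l) else (\<lambda>_. undefined))"
      for l p l' using f'(6) g'(6) by (simp add: pair_sheaf_def Let_def)
    show "0 \<le> l" if "x \<in> sec (pair_sheaf f g) l" for l x
      using that sec_nonneg[OF pX] by (auto simp: sec_pair_sheaf)
    show "?r l p l' x \<in> sec (pair_sheaf f g) l'" if "is_Tr l' p l" "x \<in> sec (pair_sheaf f g) l" for l p l' x
      using that res_sec[OF pX that(1)] res_sec[OF pY that(1)] f'(4)[OF that(1)] g'(4)[OF that(1)] by (auto simp: sec_pair_sheaf)
    show "?r l 0 l x = x" if "x \<in> sec (pair_sheaf f g) l" for l x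
      using that res_id[OF pX] res_id[OF pY] by (auto simp: sec_pair_sheaf)
    show "?r l' q l'' (?r l p l' x) = ?r l (p + q) l'' x" if "is_Tr l' p l" "is_Tr l'' q l'" "x \<in> sec (pair_sheaf f g) l"
      for l p l' q l'' x
      using that res_res[OF pX that(1,2)] res_res[OF pY that(1,2)] by (auto simp: sec_pair_sheaf)
  qed
  fix l1 l2 z1 z2
  assume l: "0 \<le> l1" "0 \<le> l2" and z1: "z1 \<in> sec (pair_sheaf f g) l1" and z2: "z2 \<in> sec (pair_sheaf f g) l2"
    and e: "res (pair_sheaf f g) l1 l1 0 z1 = res (pair_sheaf f g) l2 0 0 z2"
  obtain x1 y1 where 1: "z1 = Pr x1 y1" "x1 \<in> sec X l1" "y1 \<in> sec Y l1" "smap f l1 x1 = smap g l1 y1"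
    using z1 by (auto simp: sec_pair_sheaf)
  obtain x2 y2 where 2: "z2 = Pr x2 y2" "x2 \<in> sec X l2" "y2 \<in> sec Y l2" "smap f l2 x2 = smap g l2 y2"
    using z2 by (auto simp: sec_pair_sheaf)
  have ex: "res X l1 l1 0 x1 = res X l2 0 0 x2" and ey: "res Y l1 l1 0 y1 = res Y l2 0 0 y2"
    using e res_pair_sheaf[OF _ z1[unfolded 1]] res_pair_sheaf[OF _ z2[unfolded 2]] l 1(1) 2(1) by auto
  obtain x where x: "x \<in> sec X (l1 + l2)" "res X (l1 + l2) 0 l1 x = x1" "res X (l1 + l2) l1 l2 x = x2"
    using sheaf_glue[OF X 1(2) 2(2) ex] .
  obtain y where y: "y \<in> sec Y (l1 + l2)" "res Y (l1 + l2) 0 l1 y = y1" "res Y (l1 + l2) l1 l2 y = y2"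
    using sheaf_glue[OF Y 1(3) 2(3) ey] .
  \<comment> \<open>The components are glued separately. Their images in \<open>Z\<close> agree on
    both pieces, and uniqueness of gluing in \<open>Z\<close> makes them agree as a whole.\<close>
  have "smap f (l1 + l2) x = smap g (l1 + l2) y"
  proof (rule sheaf_eqI[OF Z f'(3)[OF x(1)] g'(3)[OF y(1)] l])
    show "res Z (l1 + l2) 0 l1 (smap f (l1 + l2) x) = res Z (l1 + l2) 0 l1 (smap g (l1 + l2) y)"
      using f'(4)[OF _ x(1), of l1 0] g'(4)[OF _ y(1), of l1 0] l x y 1 by simp
    show "res Z (l1 + l2) l1 l2 (smap f (l1 + l2) x) = res Z (l1 + l2) l1 l2 (smap g (l1 + l2) y)"
      using f'(4)[OF _ x(1), of l2 l1] g'(4)[OF _ y(1), of l2 l1] l x y 2 by simp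
  qed
  with x y have z: "Pr x y \<in> sec (pair_sheaf f g) (l1 + l2)" by (auto simp: sec_pair_sheaf)
  show "\<exists>!z. z \<in> sec (pair_sheaf f g) (l1 + l2) \<and> res (pair_sheaf f g) (l1 + l2) 0 l1 z = z1 \<and> res (pair_sheaf f g) (l1 + l2) l1 l2 z = z2"
  proof (intro ex1I[of _ "Pr x y"] conjI)
    show "res (pair_sheaf f g) (l1 + l2) 0 l1 (Pr x y) = z1" "res (pair_sheaf f g) (l1 + l2) l1 l2 (Pr x y) = z2"
      using res_pair_sheaf[OF _ z, of l1 0] res_pair_sheaf[OF _ z, of l2 l1] l x y 1(1) 2(1) by auto
    fix w assume w: "w \<in> sec (pair_sheaf f g) (l1 + l2) \<and> res (pair_sheaf f g) (l1 + l2) 0 l1 w = z1 \<and>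
        res (pair_sheaf f g) (l1 + l2) l1 l2 w = z2"
    then obtain x' y' where w': "w = Pr x' y'" "x' \<in> sec X (l1 + l2)" "y' \<in> sec Y (l1 + l2)" by (auto simp: sec_pair_sheaf)
    have "Pr x' y' \<in> sec (pair_sheaf f g) (l1 + l2)" using w w' by simp
    note r = res_pair_sheaf[OF _ this, of l1 0] res_pair_sheaf[OF _ this, of l2 l1]
    have "x' = x" by (rule sheaf_eqI[OF X w'(2) x(1) l]) (use r w w' x 1(1) 2(1) l in auto)
    moreover have "y' = y" by (rule sheaf_eqI[OF Y w'(3) y(1) l]) (use r w w' y 1(1) 2(1) l in auto)
    ultimately show "w = Pr x y" using w' by simp
  qed (use z in simp)
qed

lemma pair_sheaf_pr_hom:
  "pair_sheaf_pr f g False \<in> hom Sheaves (pair_sheaf f g) X" "pair_sheaf_pr f g True \<in> hom Sheaves (pair_sheaf f g) Y"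
proof -
  note f' = shmapD[OF f] and g' = shmapD[OF g]
  have "pair_sheaf_pr f g i \<in> hom Sheaves (pair_sheaf f g) (if i then Y else X)" for i
    unfolding pair_sheaf_pr_def f'(6) g'(6)
    by (rule shmapI[OF pair_sheaf_sheaf]) (use f' g' in \<open>auto simp: sec_pair_sheaf res_pair_sheaf\<close>)
  from this[of False] this[of True] show "pair_sheaf_pr f g False \<in> hom Sheaves (pair_sheaf f g) X"
    "pair_sheaf_pr f g True \<in> hom Sheaves (pair_sheaf f g) Y" by auto
qed

lemma pair_sheaf_pullback: "is_pullback Sheaves f g (pair_sheaf f g, pair_sheaf_pr f g False, pair_sheaf_pr f g True)"
proof (rule pointwise_pullback[OF f g pair_sheaf_pr_hom])
  fix l z assume "z \<in> sec (pair_sheaf f g) l"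
  then show "smap f l (smap (pair_sheaf_pr f g False) l z) = smap g l (smap (pair_sheaf_pr f g True) l z)"
    by (auto simp: pair_sheaf_pr_def sec_pair_sheaf)
next
  fix l x y assume "x \<in> sec X l" "y \<in> sec Y l" "smap f l x = smap g l y"
  then show "\<exists>!z. z \<in> sec (pair_sheaf f g) l \<and> smap (pair_sheaf_pr f g False) l z = x \<and> smap (pair_sheaf_pr f g True) l z = y"
    by (intro ex1I[of _ "Pr x y"]) (auto simp: pair_sheaf_pr_def sec_pair_sheaf)
qed

text \<open>Preservation of pullbacks concerns arbitrary ones, not only \<open>pair_sheaf\<close>.
  The given pullback is therefore compared with the explicit one, where the claim is visible, along
  the arrows \<open>u\<close> and \<open>v\<close> provided by the two universal properties.\<close>

lemma pullback_pointwise: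
  assumes pb: "is_pullback Sheaves f g (P, a, b)" and xy: "x \<in> sec X l" "y \<in> sec Y l" "smap f l x = smap g l y"
  shows "\<exists>!z. z \<in> sec P l \<and> smap a l z = x \<and> smap b l z = y"
proof -
  interpret S: category "Sheaves :: (('t, 'a univ) psh, ('t, 'a univ) shmap) cat" by (rule Sheaves_category)
  note f' = shmapD[OF f] and g' = shmapD[OF g]
  let ?P = "pair_sheaf f g" and ?a = "pair_sheaf_pr f g False" and ?b = "pair_sheaf_pr f g True"
  note pb' = pair_sheaf_pullback
  have s: "src Sheaves f = X" "src Sheaves g = Y" using f' g' by auto
  note d = S.is_pullbackD[OF pb, unfolded s] and d' = S.is_pullbackD[OF pb', unfolded s]
  obtain u where u: "u \<in> hom Sheaves ?P P" "cmp Sheaves a u = ?a" "cmp Sheaves b u = ?b"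
    using d(5)[OF d'(2,3,4)] by blast
  obtain v where v: "v \<in> hom Sheaves P ?P" "cmp Sheaves ?a v = a" "cmp Sheaves ?b v = b"
    using d'(5)[OF d(2,3,4)] by blast
  have P: "P \<in> obs Sheaves" by (rule d(1))
  \<comment> \<open>This identity gives uniqueness: a section \<open>z\<close> is recovered by
    \<open>u\<close> from its image under \<open>v\<close>, and that image can only be
    \<open>Pr x y\<close>.\<close>
  have uv: "cmp Sheaves u v = idn Sheaves P"
    using S.cmp_assoc[OF v(1) u(1) d(2)] S.cmp_assoc[OF v(1) u(1) d(3)] u v S.idn_right[OF d(2)] S.idn_right[OF d(3)]
    by (intro S.is_pullback_eqI[OF pb f g S.cmp_hom[OF v(1) u(1)] S.idn_hom[OF P]]) simp_all
  have xyP: "Pr x y \<in> sec ?P l" using xy by (auto simp: sec_pair_sheaf)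
  have au: "smap a l (smap u l w) = smap ?a l w" "smap b l (smap u l w) = smap ?b l w" if "w \<in> sec ?P l" for w
    using that shmapD(6)[OF u(1)] by (simp_all add: u(2,3)[symmetric] smap_cmp)
  have av: "smap ?a l (smap v l z) = smap a l z" "smap ?b l (smap v l z) = smap b l z" if "z \<in> sec P l" for z
    using that shmapD(6)[OF v(1)] by (simp_all only: v(2,3)[symmetric] smap_cmp)
  show ?thesis
  proof (intro ex1I[of _ "smap u l (Pr x y)"] conjI)
    show "smap u l (Pr x y) \<in> sec P l" by (rule shmapD(3)[OF u(1) xyP])
    show "smap a l (smap u l (Pr x y)) = x" "smap b l (smap u l (Pr x y)) = y"
      using au[OF xyP] xyP by (auto simp: pair_sheaf_pr_def)
    fix z assume z: "z \<in> sec P l \<and> smap a l z = x \<and> smap b l z = y"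
    then have vz: "smap v l z \<in> sec ?P l" using shmapD(3)[OF v(1)] by blast
    then obtain x' y' where w: "smap v l z = Pr x' y'" by (auto simp: sec_pair_sheaf)
    then have "x' = x" "y' = y" using av[of z] z vz by (simp_all add: pair_sheaf_pr_def)
    with w have "smap v l z = Pr x y" by simp
    moreover have "smap u l (smap v l z) = z"
      using arg_cong[OF uv, of "\<lambda>h. smap h l z"] z shmapD(6)[OF v(1)] by (simp add: smap_cmp smap_idn)
    ultimately show "z = smap u l (Pr x y)" by simp
  qed
qed

end

text \<open>\<open>Num 0\<close> stands for an arbitrary fixed element of
  \<open>univ\<close>.\<close>

definition unit_sheaf :: "('t::linordered_semidom, 'a univ) psh" where
  "unit_sheaf = \<lparr> sec = (\<lambda>l. if 0 \<le> l then {Num 0} else {}),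
     res = (\<lambda>l p l'. if is_Tr l' p l then restrict (\<lambda>x. x) {Num 0} else (\<lambda>_. undefined)) \<rparr>"

lemma unit_sheaf_sheaf: "sheaf (unit_sheaf :: ('t::linordered_semidom, 'a univ) psh)"
proof (rule sheafI)
  have s: "x \<in> sec unit_sheaf l \<longleftrightarrow> 0 \<le> l \<and> x = Num 0" for x :: "'a univ" and l :: 't by (simp add: unit_sheaf_def)
  show "presheaf (unit_sheaf :: ('t, 'a univ) psh)"
  proof (rule presheafI[where r = "\<lambda>_ _ _ x. x"])
    show "res unit_sheaf l p l' = (if is_Tr l' p l then restrict (\<lambda>x. x) (sec unit_sheaf l) else (\<lambda>_ :: 'a univ. undefined))"
      for l p l' :: 't using is_Tr_nonneg[of l' p l] by (simp add: unit_sheaf_def)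
  qed (auto simp: s dest: is_Tr_nonneg)
  show "\<exists>!x. x \<in> sec unit_sheaf (l1 + l2) \<and> res unit_sheaf (l1 + l2) 0 l1 x = x1 \<and> res unit_sheaf (l1 + l2) l1 l2 x = x2"
    if "0 \<le> l1" "0 \<le> l2" "x1 \<in> sec unit_sheaf l1" "x2 \<in> sec unit_sheaf l2" for l1 l2 :: 't and x1 x2 :: "'a univ"
    using that by (intro ex1I[of _ "Num 0"]) (auto simp: unit_sheaf_def)
qed

lemma pointwise_terminal:
  fixes T :: "('t::linordered_semidom, 'u) psh"
  assumes T: "sheaf T" and s: "\<And>l. 0 \<le> l \<Longrightarrow> \<exists>!x. x \<in> sec T l"
  shows "is_terminal Sheaves T"
  unfolding is_terminal_def
proof (intro conjI ballI)
  show "T \<in> obs Sheaves" using T by simp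
  fix Q :: "('t, 'u) psh" assume "Q \<in> obs Sheaves"
  then have Q: "sheaf Q" by simp
  have ex: "\<exists>!z. z \<in> sec T l \<and> True" if "q \<in> sec Q l" for l :: 't and q :: 'u
    using s[OF sec_nonneg[OF sheaf_presheaf[OF Q] that]] by simp
  obtain u where u: "u \<in> hom Sheaves Q T" by (rule shmap_ex[where R = "\<lambda>_ _ _. True", OF Q T ex]) auto
  show "\<exists>!u. u \<in> hom Sheaves Q T"
  proof (intro ex1I[of _ u] u)
    fix v assume v: "v \<in> hom Sheaves Q T"
    show "v = u"
      by (rule shmap_eqI[OF v u]) (rule ex1_unique[OF ex], use shmapD(3)[OF v] shmapD(3)[OF u] in auto)
  qed
qed

lemma unit_sheaf_terminal: "is_terminal Sheaves unit_sheaf"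
  by (rule pointwise_terminal[OF unit_sheaf_sheaf]) (simp add: unit_sheaf_def)

text \<open>As for pullbacks: an arbitrary terminal sheaf is isomorphic to
  \<open>unit_sheaf\<close>, and an isomorphism is bijective on sections of each length.\<close>

lemma terminal_pointwise:
  fixes T :: "('t::linordered_semidom, 'a univ) psh"
  assumes T: "is_terminal Sheaves T" and l: "0 \<le> l"
  shows "\<exists>!x. x \<in> sec T l"
proof -
  interpret S: category "Sheaves :: (('t, 'a univ) psh, ('t, 'a univ) shmap) cat" by (rule Sheaves_category)
  have To: "T \<in> obs Sheaves" and Uo: "(unit_sheaf :: ('t, 'a univ) psh) \<in> obs Sheaves"
    using T unit_sheaf_sheaf by (auto simp: is_terminal_def)
  obtain u v where u: "u \<in> hom Sheaves T unit_sheaf" and v: "v \<in> hom Sheaves unit_sheaf T"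
    using T unit_sheaf_terminal To Uo unfolding is_terminal_def by metis
  have vu: "cmp Sheaves v u = idn Sheaves T" by (rule S.terminal_eq[OF T S.cmp_hom[OF u v] S.idn_hom[OF To]])
  have s: "x \<in> sec unit_sheaf l \<longleftrightarrow> x = Num 0" for x :: "'a univ" using l by (simp add: unit_sheaf_def)
  show ?thesis
  proof (intro ex1I[of _ "smap v l (Num 0)"])
    show "smap v l (Num 0) \<in> sec T l" using shmapD(3)[OF v] s by simp
    fix x assume x: "x \<in> sec T l"
    have "smap u l x = Num 0" using shmapD(3)[OF u x] s by simp
    moreover have "smap v l (smap u l x) = x"
      using arg_cong[OF vu, of "\<lambda>h. smap h l x"] x shmapD(6)[OF u] by (simp add: smap_cmp smap_idn)
    ultimately show "x = smap v l (Num 0)" by simp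
  qed
qed

lemma Sheaves_finitely_complete: "finitely_complete (Sheaves :: (('t::linordered_semidom, 'a univ) psh, ('t, 'a univ) shmap) cat)"
proof -
  interpret S: category "Sheaves :: (('t, 'a univ) psh, ('t, 'a univ) shmap) cat" by (rule Sheaves_category)
  show ?thesis
    by unfold_locales (use unit_sheaf_terminal pair_sheaf_pullback in blast)+
qed

section \<open>Synchronous sheaves\<close>

lemma rmod1_class_eq: "rmod1 `` {r} = rmod1 `` {s} \<longleftrightarrow> r - s \<in> \<int>"
proof
  assume "rmod1 `` {r} = rmod1 `` {s}"
  moreover have "r \<in> rmod1 `` {r}" by (simp add: rmod1_def)
  ultimately have "s - r \<in> \<int>" by (simp add: rmod1_def)
  then show "r - s \<in> \<int>" using Ints_minus by fastforce
next
  assume rs: "r - s \<in> \<int>"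
  have "r - x \<in> \<int> \<longleftrightarrow> s - x \<in> \<int>" for x
    using Ints_add[OF rs, of "s - x"] Ints_diff[of "r - x" "r - s"] rs by (auto simp: algebra_simps)
  then show "rmod1 `` {r} = rmod1 `` {s}" by (auto simp: rmod1_def)
qed

lemma rmod1_class_shift: "(\<lambda>t. t + p) ` (rmod1 `` {r}) = rmod1 `` {r + p}"
proof -
  have "x \<in> (\<lambda>t. t + p) ` (rmod1 `` {r})" if "x \<in> rmod1 `` {r + p}" for x
    using that by (intro image_eqI[of _ _ "x - p"]) (simp_all add: rmod1_def algebra_simps)
  then show ?thesis by (auto simp: rmod1_def)
qed

lemma rmod1_unit_eq:
  assumes "rmod1 `` {r} = rmod1 `` {s}" "0 \<le> r" "r < 1" "0 \<le> s" "s < 1"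
  shows "r = s"
proof -
  obtain k where k: "r - s = of_int k" using assms(1) by (auto simp: rmod1_class_eq elim: Ints_cases)
  then have "k < 1" "-1 < k" using assms(2-) by linarith+
  then show ?thesis using k by simp
qed

lemma rmod1_frac: "rmod1 `` {frac r} = rmod1 `` {r}"
  by (simp add: rmod1_class_eq frac_def)

lemma sec_Sync: "z \<in> sec Sync l \<longleftrightarrow> 0 \<le> l \<and> (\<exists>r. z = Cls (rmod1 `` {r}))"
  by (auto simp: Sync_def quotient_def)

lemma res_Sync: "is_Tr l' p l \<Longrightarrow> res Sync l p l' (Cls (rmod1 `` {r})) = Cls (rmod1 `` {r + p})"
  by (auto simp: Sync_def quotient_def rmod1_class_shift)

lemma Sync_sheaf: "sheaf (Sync :: 'a cont_sheaf)"
proof (rule sheafI)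
  let ?r = "\<lambda>(l :: real) p (l' :: real) z :: 'a univ. (case z of Cls c \<Rightarrow> Cls ((\<lambda>t. t + p) ` c)) :: 'a univ"
  show "presheaf (Sync :: 'a cont_sheaf)"
  proof (rule presheafI[where r = ?r])
    show "res Sync l p l' = (if is_Tr l' p l then restrict (?r l p l') (sec Sync l) else (\<lambda>_. undefined))" for l p l'
      using is_Tr_nonneg[of l' p l] by (simp add: Sync_def)
  qed (auto simp: sec_Sync rmod1_class_shift add.assoc dest: is_Tr_nonneg)
  fix l1 l2 :: real and x1 x2 :: "'a univ"
  assume l: "0 \<le> l1" "0 \<le> l2" and x: "x1 \<in> sec Sync l1" "x2 \<in> sec Sync l2" and e: "res Sync l1 l1 0 x1 = res Sync l2 0 0 x2"
  obtain r s where rs: "x1 = Cls (rmod1 `` {r})" "x2 = Cls (rmod1 `` {s})" using x by (auto simp: sec_Sync)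
  show "\<exists>!x. x \<in> sec Sync (l1 + l2) \<and> res Sync (l1 + l2) 0 l1 x = x1 \<and> res Sync (l1 + l2) l1 l2 x = x2"
    \<comment> \<open>Restriction to an initial interval does not change the class, so the glued
      section must be \<open>x1\<close> itself; the matching condition says that shifting it by
      \<open>l1\<close> gives \<open>x2\<close>.\<close>
    using l e by (intro ex1I[of _ x1]) (auto simp: rs sec_Sync res_Sync)
qed

text \<open>
  Sections of \<open>Sigma_ob X\<close> that meet at a point strictly between two integers come from discrete sections
  that overlap in an interval of length 1.
\<close>

lemma glue_overlap:
  fixes X :: "('t::linordered_semidom, 'u) psh"
  assumes X: "sheaf X" and nn: "0 \<le> m" "0 \<le> k" "0 \<le> j"
    and x1: "x1 \<in> sec X (m + k)" and x2: "x2 \<in> sec X (k + j)" and e: "res X (m + k) m k x1 = res X (k + j) 0 k x2"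
  shows "\<exists>!x. x \<in> sec X (m + (k + j)) \<and> res X (m + (k + j)) 0 (m + k) x = x1 \<and> res X (m + (k + j)) m (k + j) x = x2"
proof -
  note P = sheaf_presheaf[OF X] and r = res_res[OF sheaf_presheaf[OF X]] and s = res_sec[OF sheaf_presheaf[OF X]]
  have T: "is_Tr (m + k) 0 (m + (k + j))" "is_Tr (k + j) m (m + (k + j))" "is_Tr k m (m + k)" "is_Tr j k (k + j)"
     "is_Tr k 0 (k + j)" "is_Tr 0 k k" "is_Tr 0 (m + k) (m + k)" "is_Tr 0 0 j"
    using nn by (auto simp: is_Tr_def)
  have a: "m + (k + j) = (m + k) + j" by (simp add: add.assoc)
  \<comment> \<open>The sheaf condition glues along a single point only, so the overlap of length
    \<open>k\<close> is cut off from \<open>x2\<close> and \<open>x1\<close> is glued with the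
    remainder.\<close>
  have x2': "res X (k + j) k j x2 \<in> sec X j" by (rule s[OF T(4) x2])
  have "res X (m + k) (m + k) 0 x1 = res X j 0 0 (res X (k + j) k j x2)"
    using r[OF T(3,6) x1] r[OF T(5,6) x2] r[OF T(4,8) x2] e by simp
  from sheaf_glue[OF X x1 x2' this, folded a] obtain x
    where x: "x \<in> sec X (m + (k + j))" and g: "res X (m + (k + j)) 0 (m + k) x = x1"
      "res X (m + (k + j)) (m + k) j x = res X (k + j) k j x2" .
  show ?thesis
  proof (intro ex1I[of _ x] conjI x g)
    show "res X (m + (k + j)) m (k + j) x = x2"
    \<comment> \<open>On the overlap the two sections agree by \<open>e\<close>, on the remainder by
      construction.\<close>
    proof (rule sheaf_eqI[OF X s[OF T(2) x] x2 nn(2,3)])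
      show "res X (k + j) 0 k (res X (m + (k + j)) m (k + j) x) = res X (k + j) 0 k x2"
        using r[OF T(2,5) x] r[OF T(1,3) x] g e by simp
      show "res X (k + j) k j (res X (m + (k + j)) m (k + j) x) = res X (k + j) k j x2"
        using r[OF T(2,4) x] g by simp
    qed
    fix y assume y: "y \<in> sec X (m + (k + j)) \<and> res X (m + (k + j)) 0 (m + k) y = x1 \<and> res X (m + (k + j)) m (k + j) y = x2"
    then have y': "y \<in> sec X (m + (k + j))" by simp
    show "y = x"
      by (rule sheaf_eqI[OF X y'[unfolded a] x[unfolded a], folded a])
        (use y g nn r[OF T(2,4) y'] in auto)
  qed
qed

section \<open>Sections, restriction and gluing in \<open>Sigma_ob X\<close>\<close>

lemma sec_Sigma:
  "z \<in> sec (Sigma_ob X) l \<longleftrightarrow> 0 \<le> l \<and> (\<exists>r x. z = Pr (Num r) x \<and> 0 \<le> r \<and> r < 1 \<and> x \<in> sec X (nat \<lceil>r + l\<rceil>))"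
  by (auto simp: Sigma_ob_def Sigma_sec_def)

lemma ceiling_frac: "\<lceil>frac u + l\<rceil> = \<lceil>u + l\<rceil> - \<lfloor>u\<rfloor>" for u l :: real
proof -
  have "frac u + l = (u + l) - of_int \<lfloor>u\<rfloor>" by (simp add: frac_def)
  then show ?thesis by (simp only: ceiling_diff_of_int)
qed

text \<open>The new offset \<open>p + r - \<lfloor>p + r\<rfloor>\<close> is a fractional part, and
  the difference \<open>b - a\<close> is the rounded-up sum of that offset and \<open>l'\<close>. In
  this form the restricted section visibly has the shape demanded of sections of length
  \<open>l'\<close>.\<close>

lemma res_Sigma:
  assumes t: "is_Tr l' p l" and z: "Pr (Num r) x \<in> sec (Sigma_ob X) l"
  shows "res (Sigma_ob X) l p l' (Pr (Num r) x) =
    Pr (Num (frac (p + r))) (res X (nat \<lceil>r + l\<rceil>) (nat \<lfloor>p + r\<rfloor>) (nat \<lceil>frac (p + r) + l'\<rceil>) x)"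
proof -
  have "Pr (Num r) x \<in> Sigma_sec X l" using z by (simp add: Sigma_ob_def)
  then show ?thesis using t unfolding ceiling_frac by (simp add: Sigma_ob_def Let_def frac_def)
qed

text \<open>Rounding out to integer endpoints is monotone, so the integer hull of a subinterval lies
  within the integer hull of the interval.\<close>

lemma is_Tr_Sigma:
  fixes l l' p r :: real
  assumes "is_Tr l' p l" "0 \<le> r"
  shows "is_Tr (nat \<lceil>frac (p + r) + l'\<rceil>) (nat \<lfloor>p + r\<rfloor>) (nat \<lceil>r + l\<rceil>)"
proof -
  have "0 \<le> \<lfloor>p + r\<rfloor>" "\<lfloor>p + r\<rfloor> \<le> \<lceil>p + r + l'\<rceil>" "\<lceil>p + r + l'\<rceil> \<le> \<lceil>r + l\<rceil>"
    using assms order_trans[OF floor_mono floor_le_ceiling, of "p + r" "p + r + l'"] ceiling_mono[of "p + r + l'" "r + l"]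
    unfolding is_Tr_def by auto
  then show ?thesis unfolding is_Tr_def ceiling_frac by (intro conjI; linarith)
qed

lemma floor_frac_add: "\<lfloor>q + frac u\<rfloor> = \<lfloor>q + u\<rfloor> - \<lfloor>u\<rfloor>" for q u :: real
proof -
  have "q + frac u = (q + u) - of_int \<lfloor>u\<rfloor>" by (simp add: frac_def)
  then show ?thesis by (simp only: floor_diff_of_int)
qed

lemma frac_frac_add: "frac (q + frac u) = frac (q + u)" for q u :: real
  using floor_frac_add[of q u] by (simp add: frac_def)

context
  fixes X :: "'a disc_sheaf"
  assumes X: "sheaf X"
begin

lemma res_Sigma_sec:
  assumes t: "is_Tr l' p l" and z: "z \<in> sec (Sigma_ob X) l"
  shows "res (Sigma_ob X) l p l' z \<in> sec (Sigma_ob X) l'"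
proof -
  obtain r x where zr: "z = Pr (Num r) x" "0 \<le> r" "x \<in> sec X (nat \<lceil>r + l\<rceil>)" using z by (auto simp: sec_Sigma)
  show ?thesis
    using res_Sigma[OF t z[unfolded zr(1)]] res_sec[OF sheaf_presheaf[OF X] is_Tr_Sigma[OF t zr(2)] zr(3)] frac_lt_1[of "p + r"] is_Tr_nonneg[OF t]
    by (auto simp: sec_Sigma zr(1))
qed

lemma Sigma_presheaf: "presheaf (Sigma_ob X)"
proof (rule presheafI[where r = "res (Sigma_ob X)"])
  note P = sheaf_presheaf[OF X]
  show "res (Sigma_ob X) l p l' z \<in> sec (Sigma_ob X) l'" if "is_Tr l' p l" "z \<in> sec (Sigma_ob X) l" for l p l' z
    by (rule res_Sigma_sec[OF that])
  show "0 \<le> l" if "z \<in> sec (Sigma_ob X) l" for l z using that by (simp add: sec_Sigma)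
  show "res (Sigma_ob X) l p l' = (if is_Tr l' p l then restrict (res (Sigma_ob X) l p l') (sec (Sigma_ob X) l) else (\<lambda>_. undefined))"
    for l p l' by (simp add: Sigma_ob_def)
  show "res (Sigma_ob X) l 0 l z = z" if l: "0 \<le> l" and z: "z \<in> sec (Sigma_ob X) l" for l z
  proof -
    obtain r x where zr: "z = Pr (Num r) x" "0 \<le> r" "r < 1" "x \<in> sec X (nat \<lceil>r + l\<rceil>)" using z by (auto simp: sec_Sigma)
    then have f: "\<lfloor>r\<rfloor> = 0" "frac r = r" by (auto simp: floor_eq_iff frac_eq)
    show ?thesis using res_Sigma[OF _ z[unfolded zr(1)], of l 0] l by (simp add: zr(1) f res_id[OF P zr(4)])
  qed
  show "res (Sigma_ob X) l' q l'' (res (Sigma_ob X) l p l' z) = res (Sigma_ob X) l (p + q) l'' z"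
    if t: "is_Tr l' p l" and t': "is_Tr l'' q l'" and z: "z \<in> sec (Sigma_ob X) l"
    for l p l' q l'' z
  proof -
    obtain r x where zr: "z = Pr (Num r) x" "0 \<le> r" "x \<in> sec X (nat \<lceil>r + l\<rceil>)" using z by (auto simp: sec_Sigma)
    have e: "q + (p + r) = p + q + r" by simp
    \<comment> \<open>Passing to the fractional part after the first restriction subtracts
      \<open>\<lfloor>p + r\<rfloor>\<close>, which the two discrete shifts together must give back.
      These inequalities guarantee that truncation by \<open>nat\<close> does not disturb the
      sum.\<close>
    have 0: "0 \<le> \<lfloor>p + r\<rfloor>" "\<lfloor>p + r\<rfloor> \<le> \<lfloor>q + (p + r)\<rfloor>" using zr(2) t t' unfolding is_Tr_def by linarith+
    have n: "nat \<lfloor>p + r\<rfloor> + nat \<lfloor>q + frac (p + r)\<rfloor> = nat \<lfloor>p + q + r\<rfloor>"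
      unfolding floor_frac_add using 0 by (simp only: e)
    have "res X (nat \<lceil>frac (p + r) + l'\<rceil>) (nat \<lfloor>q + frac (p + r)\<rfloor>) (nat \<lceil>frac (q + frac (p + r)) + l''\<rceil>)
        (res X (nat \<lceil>r + l\<rceil>) (nat \<lfloor>p + r\<rfloor>) (nat \<lceil>frac (p + r) + l'\<rceil>) x)
      = res X (nat \<lceil>r + l\<rceil>) (nat \<lfloor>p + q + r\<rfloor>) (nat \<lceil>frac (p + q + r) + l''\<rceil>) x"
      using res_res[OF P is_Tr_Sigma[OF t zr(2)] is_Tr_Sigma[OF t' frac_ge_0] zr(3)]
      by (simp only: n frac_frac_add e)
    then show ?thesis
      using res_Sigma[OF t z[unfolded zr(1)]] res_Sigma[OF is_Tr_trans[OF t t'] z[unfolded zr(1)]]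
        res_Sigma[OF t', of _ _ X] res_Sigma_sec[OF t z] unfolding zr(1) frac_frac_add e by (simp add: add_ac)
  qed
qed

text \<open>Equality of the restrictions at the meeting point identifies the offset of the second
  piece as \<open>frac (l1 + r)\<close>, and it makes the discrete sections agree on the unit
  interval around that point. \<open>glue_overlap\<close> then joins them.\<close>

lemma Sigma_sheaf: "sheaf (Sigma_ob X)"
proof (rule sheafI[OF Sigma_presheaf])
  fix l1 l2 z1 z2
  let ?S = "Sigma_ob X"
  assume l: "0 \<le> l1" "0 \<le> l2" and z1: "z1 \<in> sec ?S l1" and z2: "z2 \<in> sec ?S l2" and e: "res ?S l1 l1 0 z1 = res ?S l2 0 0 z2"
  obtain r x1 where 1: "z1 = Pr (Num r) x1" "0 \<le> r" "r < 1" "x1 \<in> sec X (nat \<lceil>r + l1\<rceil>)" using z1 by (auto simp: sec_Sigma)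
  obtain s x2 where 2: "z2 = Pr (Num s) x2" "0 \<le> s" "s < 1" "x2 \<in> sec X (nat \<lceil>s + l2\<rceil>)" using z2 by (auto simp: sec_Sigma)
  have id: "frac t = t" "\<lfloor>t\<rfloor> = 0" if "0 \<le> t" "t < 1" for t :: real using that by (auto simp: floor_eq_iff frac_eq)
  \<comment> \<open>The pieces meet at position \<open>l1 + r\<close>, and \<open>m\<close> is the
    integer below it. The overlap \<open>k\<close> is 0 if the meeting point is an integer and 1
    otherwise; \<open>j\<close> is what remains of the second discrete section beyond the
    overlap.\<close>
  define m k j where "m = nat \<lfloor>l1 + r\<rfloor>" and "k = nat \<lceil>s\<rceil>" and "j = nat \<lceil>s + l2\<rceil> - nat \<lceil>s\<rceil>"
  have e1: "Pr (Num (frac (l1 + r))) (res X (nat \<lceil>r + l1\<rceil>) m (nat \<lceil>frac (l1 + r)\<rceil>) x1) = Pr (Num s) (res X (nat \<lceil>s + l2\<rceil>) 0 k x2)"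
    using e res_Sigma[OF _ z1[unfolded 1(1)], of 0 l1] res_Sigma[OF _ z2[unfolded 2(1)], of 0 0] l id[OF 2(2,3)]
    by (auto simp: 1(1) 2(1) m_def k_def)
  then have s: "s = frac (l1 + r)" by simp
  then have e2: "res X (nat \<lceil>r + l1\<rceil>) m k x1 = res X (nat \<lceil>s + l2\<rceil>) 0 k x2" using e1 by (simp add: k_def)
  have kj: "k + j = nat \<lceil>s + l2\<rceil>" using l nat_mono[OF ceiling_mono[of s "s + l2"]] by (simp add: j_def k_def)
  \<comment> \<open>Used with \<open>u = 0\<close> for the length of the first discrete section and
    with \<open>u = l2\<close> for the length of the glued one.\<close>
  have mn: "m + nat \<lceil>s + u\<rceil> = nat \<lceil>r + (l1 + u)\<rceil>" if "0 \<le> u" for u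
  proof -
    have "0 \<le> \<lfloor>l1 + r\<rfloor>" "\<lfloor>l1 + r\<rfloor> \<le> \<lceil>l1 + r + u\<rceil>" using 1(2) l that by linarith+
    then show ?thesis unfolding s m_def ceiling_frac add.assoc[of r l1 u, symmetric] add.commute[of r l1] by linarith
  qed
  have mk: "m + k = nat \<lceil>r + l1\<rceil>" using mn[of 0] by (simp add: k_def)
  have mkj: "m + (k + j) = nat \<lceil>r + (l1 + l2)\<rceil>" using mn[OF l(2)] kj by simp
  have g: "\<exists>!x. x \<in> sec X (m + (k + j)) \<and> res X (m + (k + j)) 0 (m + k) x = x1 \<and> res X (m + (k + j)) m (k + j) x = x2"
    by (rule glue_overlap[OF X]) (use e2 1(4) 2(4) in \<open>simp_all add: mk kj\<close>)
  have res: "res ?S (l1 + l2) 0 l1 (Pr (Num r) x) = Pr (Num r) (res X (m + (k + j)) 0 (m + k) x)"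
    "res ?S (l1 + l2) l1 l2 (Pr (Num r) x) = Pr (Num s) (res X (m + (k + j)) m (k + j) x)"
    if "x \<in> sec X (m + (k + j))" for x
  proof -
    have z: "Pr (Num r) x \<in> sec ?S (l1 + l2)" using that 1 l by (simp add: sec_Sigma mkj)
    show "res ?S (l1 + l2) 0 l1 (Pr (Num r) x) = Pr (Num r) (res X (m + (k + j)) 0 (m + k) x)"
      using res_Sigma[OF _ z, of l1 0] l id[OF 1(2,3)] by (simp add: mkj mk)
    show "res ?S (l1 + l2) l1 l2 (Pr (Num r) x) = Pr (Num s) (res X (m + (k + j)) m (k + j) x)"
      using res_Sigma[OF _ z, of l2 l1] l unfolding s[symmetric] m_def[symmetric] kj[symmetric] mkj[symmetric] by simp
  qed
  show "\<exists>!z. z \<in> sec ?S (l1 + l2) \<and> res ?S (l1 + l2) 0 l1 z = z1 \<and> res ?S (l1 + l2) l1 l2 z = z2"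
  proof -
    obtain x where x: "x \<in> sec X (m + (k + j))" "res X (m + (k + j)) 0 (m + k) x = x1" "res X (m + (k + j)) m (k + j) x = x2"
      using g by blast
    show ?thesis
    proof (intro ex1I[of _ "Pr (Num r) x"] conjI)
      show "Pr (Num r) x \<in> sec ?S (l1 + l2)" using x(1) 1 l by (simp add: sec_Sigma mkj)
      show "res ?S (l1 + l2) 0 l1 (Pr (Num r) x) = z1" "res ?S (l1 + l2) l1 l2 (Pr (Num r) x) = z2"
        using res[OF x(1)] x 1(1) 2(1) by simp_all
      fix w assume w: "w \<in> sec ?S (l1 + l2) \<and> res ?S (l1 + l2) 0 l1 w = z1 \<and> res ?S (l1 + l2) l1 l2 w = z2"
      then obtain r' y where wr: "w = Pr (Num r') y" "0 \<le> r'" "r' < 1" "y \<in> sec X (nat \<lceil>r' + (l1 + l2)\<rceil>)"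
        by (auto simp: sec_Sigma)
      have "Pr (Num r') y \<in> sec ?S (l1 + l2)" using w wr(1) by simp
      \<comment> \<open>Restricting to an initial interval keeps the offset, so the first piece
        determines it.\<close>
      from res_Sigma[OF _ this, of l1 0] have "r' = r" using w wr(1) l 1(1) id[OF wr(2,3)] by simp
      then have y: "y \<in> sec X (m + (k + j))" using wr(4) by (simp add: mkj)
      have "y = x"
        by (rule ex1_unique[OF g]) (use w wr(1) \<open>r' = r\<close> res[OF y] y x 1(1) 2(1) in simp_all)
      then show "w = Pr (Num r) x" using wr(1) \<open>r' = r\<close> by simp
    qed
  qed
qed

end

section \<open>The functor \<open>Sigma_Sync\<close> and the limits it preserves\<close>

lemma Sigma_ar_hom:
  assumes h: "h \<in> hom IntN X Y"
  shows "Sigma_ar h \<in> hom IntC (Sigma_ob X) (Sigma_ob Y)"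
proof -
  note h' = shmapD[OF h]
  let ?u = "\<lambda>l z. case z of Pr (Num r) x \<Rightarrow> Pr (Num r) (smap h (nat \<lceil>r + l\<rceil>) x)"
  have "\<lparr>smsrc = Sigma_ob X, smtgt = Sigma_ob Y, smap = (\<lambda>l. restrict (?u l) (sec (Sigma_ob X) l))\<rparr> \<in> hom IntC (Sigma_ob X) (Sigma_ob Y)"
  proof (rule shmapI[OF Sigma_sheaf Sigma_sheaf])
    show u: "?u l z \<in> sec (Sigma_ob Y) l" if "z \<in> sec (Sigma_ob X) l" for l z
      using that h'(3) by (auto simp: sec_Sigma)
    fix l p l' z assume t: "is_Tr l' p l" and z: "z \<in> sec (Sigma_ob X) l"
    obtain r x where zr: "z = Pr (Num r) x" "0 \<le> r" "x \<in> sec X (nat \<lceil>r + l\<rceil>)" using z by (auto simp: sec_Sigma)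
    show "?u l' (res (Sigma_ob X) l p l' z) = res (Sigma_ob Y) l p l' (?u l z)"
      using res_Sigma[OF t z[unfolded zr(1)]] res_Sigma[OF t, of r _ Y] u[OF z] h'(4)[OF is_Tr_Sigma[OF t zr(2)] zr(3)] by (simp add: zr(1))
  qed (use h' in auto)
  then show ?thesis using h'(6,7) by (simp add: Sigma_ar_def Sigma_ob_def)
qed

lemma smap_Sigma_ar: "Pr (Num r) x \<in> sec (Sigma_ob (smsrc h)) l \<Longrightarrow> smap (Sigma_ar h) l (Pr (Num r) x) = Pr (Num r) (smap h (nat \<lceil>r + l\<rceil>) x)"
  by (simp add: Sigma_ar_def Sigma_ob_def)

lemma Sigma_ar_idn:
  assumes X: "sheaf X"
  shows "Sigma_ar (idn IntN X) = idn IntC (Sigma_ob X)"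
proof -
  interpret N: category "IntN :: ('a disc_sheaf, 'a disc_map) cat" by (rule Sheaves_category)
  interpret C: category "IntC :: ('a cont_sheaf, 'a cont_map) cat" by (rule Sheaves_category)
  have i: "idn IntN X \<in> hom IntN X X" using X by (intro N.idn_hom) simp
  show ?thesis
  proof (rule shmap_eqI[OF Sigma_ar_hom[OF i] C.idn_hom])
    fix l z assume z: "z \<in> sec (Sigma_ob X) l"
    obtain r x where zr: "z = Pr (Num r) x" "x \<in> sec X (nat \<lceil>r + l\<rceil>)" using z by (auto simp: sec_Sigma)
    show "smap (Sigma_ar (idn IntN X)) l z = smap (idn IntC (Sigma_ob X)) l z"
      using z smap_Sigma_ar[of r x "idn IntN X" l] shmapD(6)[OF i] zr by (simp add: smap_idn)
  qed (simp add: Sigma_sheaf X)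
qed

lemma Sigma_ar_cmp:
  assumes f: "f \<in> hom IntN X Y" and g: "g \<in> hom IntN Y Z"
  shows "Sigma_ar (cmp IntN g f) = cmp IntC (Sigma_ar g) (Sigma_ar f)"
proof -
  note gf = cmp_Sheaves_hom[OF f g] and F = Sigma_ar_hom[OF f] and G = Sigma_ar_hom[OF g]
  show ?thesis
  proof (rule shmap_eqI[OF Sigma_ar_hom[OF gf] cmp_Sheaves_hom[OF F G]])
    fix l z assume z: "z \<in> sec (Sigma_ob X) l"
    obtain r x where zr: "z = Pr (Num r) x" "x \<in> sec X (nat \<lceil>r + l\<rceil>)" using z by (auto simp: sec_Sigma)
    show "smap (Sigma_ar (cmp IntN g f)) l z = smap (cmp IntC (Sigma_ar g) (Sigma_ar f)) l z"
      using z zr smap_Sigma_ar[of r x f l] smap_Sigma_ar[of r x "cmp IntN g f" l] smap_Sigma_ar[of r _ g l]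
        shmapD(3)[OF F z] shmapD(6)[OF f] shmapD(6)[OF g] shmapD(6)[OF gf] shmapD(6)[OF F] by (simp add: smap_cmp)
  qed
qed

text \<open>Restriction replaces the offset by \<open>frac (p + r)\<close> on one side and shifts
  the class by \<open>p\<close> on the other; modulo 1 these are the same.\<close>

lemma Sigma_one_hom: "Sigma_one \<in> hom IntC (Sigma_ob (terminal IntN)) (Sync :: 'a cont_sheaf)"
proof -
  interpret N: finitely_complete "IntN :: ('a disc_sheaf, 'a disc_map) cat" by (rule Sheaves_finitely_complete)
  let ?T = "terminal IntN :: 'a disc_sheaf"
  have T: "sheaf ?T" using N.terminal_is_terminal by (simp add: is_terminal_def)
  let ?u = "\<lambda>(l :: real) z :: 'a univ. (case z of Pr (Num r) x \<Rightarrow> Cls (rmod1 `` {r})) :: 'a univ"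
  have "\<lparr>smsrc = Sigma_ob ?T, smtgt = Sync, smap = (\<lambda>l. restrict (?u l) (sec (Sigma_ob ?T) l))\<rparr> \<in> hom IntC (Sigma_ob ?T) Sync"
  proof (rule shmapI[OF Sigma_sheaf[OF T] Sync_sheaf])
    show "?u l z \<in> sec Sync l" if "z \<in> sec (Sigma_ob ?T) l" for l z
      using that by (auto simp: sec_Sigma sec_Sync)
    fix l p l' z assume t: "is_Tr l' p l" and z: "z \<in> sec (Sigma_ob ?T) l"
    obtain r x where zr: "z = Pr (Num r) x" using z by (auto simp: sec_Sigma)
    show "?u l' (res (Sigma_ob ?T) l p l' z) = res Sync l p l' (?u l z)"
      using res_Sigma[OF t z[unfolded zr]] by (simp add: zr res_Sync[OF t] rmod1_frac add.commute)
  qed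
  then show ?thesis by (simp add: Sigma_one_def Sigma_ob_def)
qed

text \<open>The composite through the terminal sheaf forgets the discrete section, so that only the
  class of the offset is left.\<close>

lemma fob_Sigma_Sync:
  assumes X: "sheaf (X :: 'a disc_sheaf)"
  shows "fob Sigma_Sync X \<in> hom IntC (Sigma_ob X) Sync"
    "Pr (Num r) x \<in> sec (Sigma_ob X) l \<Longrightarrow> smap (fob Sigma_Sync X) l (Pr (Num r) x) = Cls (rmod1 `` {r})"
proof -
  interpret N: finitely_complete "IntN :: ('a disc_sheaf, 'a disc_map) cat" by (rule Sheaves_finitely_complete)
  have b: "bang IntN X \<in> hom IntN X (terminal IntN)" using X by (intro N.bang_hom) simp
  note B = Sigma_ar_hom[OF b]
  show "fob Sigma_Sync X \<in> hom IntC (Sigma_ob X) Sync"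
    using cmp_Sheaves_hom[OF B Sigma_one_hom] by (simp add: Sigma_Sync_def Let_def)
  assume z: "Pr (Num r) x \<in> sec (Sigma_ob X) l"
  have "smap (Sigma_ar (bang IntN X)) l (Pr (Num r) x) \<in> Sigma_sec (terminal IntN) l"
    using shmapD(3)[OF B z] by (simp add: Sigma_ob_def)
  then show "smap (fob Sigma_Sync X) l (Pr (Num r) x) = Cls (rmod1 `` {r})"
    using z smap_Sigma_ar[of r x "bang IntN X" l] shmapD(6)[OF b] shmapD(6)[OF B]
    by (simp add: Sigma_Sync_def Let_def smap_cmp) (simp add: Sigma_one_def)
qed

text \<open>\<open>Sigma_ar h\<close> leaves offsets unchanged and is therefore an arrow over
  \<open>Sync\<close>.\<close>

lemma far_Sigma_Sync:
  assumes h: "h \<in> hom IntN X Y"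
  shows "far Sigma_Sync h = (fob Sigma_Sync X, Sigma_ar h, fob Sigma_Sync Y)"
    "far Sigma_Sync h \<in> hom IntSync (fob Sigma_Sync X) (fob Sigma_Sync Y)"
proof -
  note h' = shmapD[OF h]
  note SX = fob_Sigma_Sync[OF h'(1)] and SY = fob_Sigma_Sync[OF h'(2)] and H = Sigma_ar_hom[OF h]
  show e: "far Sigma_Sync h = (fob Sigma_Sync X, Sigma_ar h, fob Sigma_Sync Y)"
    using h' by (simp add: Sigma_Sync_def Let_def)
  have "cmp IntC (fob Sigma_Sync Y) (Sigma_ar h) = fob Sigma_Sync X"
  proof (rule shmap_eqI[OF cmp_Sheaves_hom[OF H SY(1)] SX(1)])
    fix l z assume z: "z \<in> sec (Sigma_ob X) l"
    obtain r x where zr: "z = Pr (Num r) x" using z by (auto simp: sec_Sigma)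
    show "smap (cmp IntC (fob Sigma_Sync Y) (Sigma_ar h)) l z = smap (fob Sigma_Sync X) l z"
      using z shmapD(3)[OF H z] shmapD(6)[OF H] h'(6) SX(2) SY(2) smap_Sigma_ar[of r x h l]
      by (simp add: smap_cmp zr)
  qed
  then show "far Sigma_Sync h \<in> hom IntSync (fob Sigma_Sync X) (fob Sigma_Sync Y)"
    using H shmapD(6,7)[OF SX(1)] shmapD(6,7)[OF SY(1)] SX(1) SY(1) unfolding e
    by (simp add: hom_slice hom_Sheaves)
qed

lemma Sigma_Sync_functor:
  "cat_functor IntN IntSync (Sigma_Sync :: ('a disc_sheaf, 'a disc_map, 'a cont_map, 'a cont_map \<times> 'a cont_map \<times> 'a cont_map) fct)"
proof -
  interpret N: category "IntN :: ('a disc_sheaf, 'a disc_map) cat" by (rule Sheaves_category)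
  interpret C: category "IntC :: ('a cont_sheaf, 'a cont_map) cat" by (rule Sheaves_category)
  interpret S: category "IntSync :: ('a cont_map, 'a cont_map \<times> 'a cont_map \<times> 'a cont_map) cat" by (rule C.slice_category)
  show ?thesis
  proof
    fix X Y Z :: "'a disc_sheaf" and f g :: "'a disc_map"
    assume "X \<in> obs IntN"
    then have X: "sheaf X" by simp
    then have i: "idn IntN X \<in> hom IntN X X" by (intro N.idn_hom) simp
    show "fob Sigma_Sync X \<in> obs IntSync" using fob_Sigma_Sync(1)[OF X] by (simp add: hom_Sheaves)
    show "far Sigma_Sync (idn IntN X) = idn IntSync (fob Sigma_Sync X)"
      using far_Sigma_Sync(1)[OF i] Sigma_ar_idn[OF X] fob_Sigma_Sync(1)[OF X] by (simp add: hom_Sheaves)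
  next
    fix X Y Z :: "'a disc_sheaf" and f g :: "'a disc_map"
    assume f: "f \<in> hom IntN X Y"
    show "far Sigma_Sync f \<in> hom IntSync (fob Sigma_Sync X) (fob Sigma_Sync Y)" by (rule far_Sigma_Sync(2)[OF f])
    assume g: "g \<in> hom IntN Y Z"
    show "far Sigma_Sync (cmp IntN g f) = cmp IntSync (far Sigma_Sync g) (far Sigma_Sync f)"
      unfolding far_Sigma_Sync(1)[OF f] far_Sigma_Sync(1)[OF g] far_Sigma_Sync(1)[OF cmp_Sheaves_hom[OF f g]] Sigma_ar_cmp[OF f g]
      by simp
  qed
qed

lemma Sigma_Sync_terminal:
  assumes T: "is_terminal (IntN :: ('a disc_sheaf, 'a disc_map) cat) T"
  shows "is_terminal IntSync (fob Sigma_Sync T)"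
proof -
  interpret C: finitely_complete "IntC :: ('a cont_sheaf, 'a cont_map) cat" by (rule Sheaves_finitely_complete)
  have sT: "sheaf T" using T by (simp add: is_terminal_def)
  note S = fob_Sigma_Sync[OF sT]
  \<comment> \<open>Bijectivity on sections lets the unique arrow from any object over
    \<open>Sync\<close> be chosen sectionwise by \<open>shmap_ex\<close>.\<close>
  have bij: "\<exists>!z. z \<in> sec (Sigma_ob T) l \<and> smap (fob Sigma_Sync T) l z = c" if c: "c \<in> sec Sync l" for l c
  proof -
    obtain r where r: "0 \<le> l" "c = Cls (rmod1 `` {frac r})" using c by (auto simp: sec_Sync rmod1_frac)
    obtain x where x: "x \<in> sec T (nat \<lceil>frac r + l\<rceil>)" using terminal_pointwise[OF T] by blast
    have z: "Pr (Num (frac r)) x \<in> sec (Sigma_ob T) l" using x r(1) frac_lt_1[of r] by (auto simp: sec_Sigma)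
    show ?thesis
    proof (intro ex1I[of _ "Pr (Num (frac r)) x"] conjI z)
      show "smap (fob Sigma_Sync T) l (Pr (Num (frac r)) x) = c" using S(2)[OF z] r by simp
      fix w assume w: "w \<in> sec (Sigma_ob T) l \<and> smap (fob Sigma_Sync T) l w = c"
      then obtain s y where ws: "w = Pr (Num s) y" "0 \<le> s" "s < 1" "y \<in> sec T (nat \<lceil>s + l\<rceil>)" by (auto simp: sec_Sigma)
      then have "rmod1 `` {s} = rmod1 `` {frac r}" using w r S(2)[of s y l] by simp
      from rmod1_unit_eq[OF this] have s: "s = frac r" using ws frac_lt_1[of r] by simp
      have "y = x" by (rule ex1_unique[OF terminal_pointwise[OF T]]) (use ws(4) x s in auto)
      then show "w = Pr (Num (frac r)) x" using ws(1) s by simp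
    qed
  qed
  show ?thesis
  proof (rule C.slice_terminalI)
    show "fob Sigma_Sync T \<in> obs IntSync" using S(1) by (simp add: hom_Sheaves)
    fix p :: "'a cont_map" assume "p \<in> obs IntSync"
    then have p: "p \<in> hom IntC (smsrc p) Sync" by (simp add: hom_Sheaves)
    note p' = shmapD[OF p]
    have ex: "\<exists>!z. z \<in> sec (Sigma_ob T) l \<and> smap (fob Sigma_Sync T) l z = smap p l q" if "q \<in> sec (smsrc p) l" for l q
      using bij[OF p'(3)[OF that]] .
    obtain u where u: "u \<in> hom IntC (smsrc p) (Sigma_ob T)" "\<And>l q. q \<in> sec (smsrc p) l \<Longrightarrow> smap (fob Sigma_Sync T) l (smap u l q) = smap p l q"
      by (rule shmap_ex[where R = "\<lambda>l q z. smap (fob Sigma_Sync T) l z = smap p l q", OF p'(1) Sigma_sheaf[OF sT] ex])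
        (simp_all add: shmapD(4)[OF S(1)] p'(4))
    have "\<exists>!u. u \<in> hom IntC (smsrc p) (Sigma_ob T) \<and> cmp IntC (fob Sigma_Sync T) u = p"
    proof (intro ex1I[of _ u] conjI u)
      show "cmp IntC (fob Sigma_Sync T) u = p"
        by (rule shmap_eqI[OF cmp_Sheaves_hom[OF u(1) S(1)] p]) (simp add: smap_cmp shmapD(6)[OF u(1)] u(2))
      fix v assume v: "v \<in> hom IntC (smsrc p) (Sigma_ob T) \<and> cmp IntC (fob Sigma_Sync T) v = p"
      then have v': "v \<in> hom IntC (smsrc p) (Sigma_ob T)" by simp
      show "v = u"
      proof (rule shmap_eqI[OF v' u(1)])
        fix l q assume q: "q \<in> sec (smsrc p) l"
        have "smap (fob Sigma_Sync T) l (smap v l q) = smap p l q"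
          using arg_cong[OF conjunct2[OF v], of "\<lambda>h. smap h l q"] q by (simp add: smap_cmp shmapD(6)[OF v'])
        then show "smap v l q = smap u l q"
          using u(2)[OF q] shmapD(3)[OF v' q] shmapD(3)[OF u(1) q] by (intro ex1_unique[OF ex[OF q]]) auto
      qed
    qed
    then show "\<exists>!u. u \<in> hom IntC (src IntC p) (src IntC (fob Sigma_Sync T)) \<and> cmp IntC (fob Sigma_Sync T) u = p"
      using shmapD(6)[OF S(1)] by simp
  qed
qed

lemma Sigma_pullback:
  assumes f: "f \<in> hom (IntN :: ('a disc_sheaf, 'a disc_map) cat) X Z" and g: "g \<in> hom IntN Y Z"
    and pb: "is_pullback IntN f g (P, a, b)"
  shows "is_pullback IntC (Sigma_ar f) (Sigma_ar g) (Sigma_ob P, Sigma_ar a, Sigma_ar b)"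
proof -
  interpret N: category "IntN :: ('a disc_sheaf, 'a disc_map) cat" by (rule Sheaves_category)
  note f' = shmapD[OF f] and g' = shmapD[OF g]
  have a: "a \<in> hom IntN P X" and b: "b \<in> hom IntN P Y" and e: "cmp IntN f a = cmp IntN g b"
    using N.is_pullbackD(2,3,4)[OF pb] f'(6) g'(6) by auto
  note a' = shmapD[OF a] and b' = shmapD[OF b]
  note F = Sigma_ar_hom[OF f] and G = Sigma_ar_hom[OF g] and A = Sigma_ar_hom[OF a] and B = Sigma_ar_hom[OF b]
  note sF = smap_Sigma_ar[of _ _ f, unfolded f'(6)] and sG = smap_Sigma_ar[of _ _ g, unfolded g'(6)]
    and sA = smap_Sigma_ar[of _ _ a, unfolded a'(6)] and sB = smap_Sigma_ar[of _ _ b, unfolded b'(6)]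
  show ?thesis
  proof (rule pointwise_pullback[OF F G A B])
    fix l z assume z: "z \<in> sec (Sigma_ob P) l"
    have "smap (cmp IntC (Sigma_ar f) (Sigma_ar a)) l z = smap (cmp IntC (Sigma_ar g) (Sigma_ar b)) l z"
      using Sigma_ar_cmp[OF a f] Sigma_ar_cmp[OF b g] e by simp
    then show "smap (Sigma_ar f) l (smap (Sigma_ar a) l z) = smap (Sigma_ar g) l (smap (Sigma_ar b) l z)"
      using z shmapD(6)[OF A] shmapD(6)[OF B] by (simp add: smap_cmp)
  next
    fix l z1 z2 assume z: "z1 \<in> sec (Sigma_ob X) l" "z2 \<in> sec (Sigma_ob Y) l" and e: "smap (Sigma_ar f) l z1 = smap (Sigma_ar g) l z2"
    obtain r x where 1: "z1 = Pr (Num r) x" "0 \<le> r" "r < 1" "x \<in> sec X (nat \<lceil>r + l\<rceil>)" "0 \<le> l" using z by (auto simp: sec_Sigma)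
    obtain s y where 2: "z2 = Pr (Num s) y" "y \<in> sec Y (nat \<lceil>s + l\<rceil>)" using z by (auto simp: sec_Sigma)
    \<comment> \<open>Offsets survive in \<open>Sigma_ob Z\<close>, so equal images force equal
      offsets. The two discrete sections then have the same length, and the pullback of discrete
      sheaves can be consulted at that length.\<close>
    have s: "s = r" and xy: "smap f (nat \<lceil>r + l\<rceil>) x = smap g (nat \<lceil>r + l\<rceil>) y"
      using e sF[of r x l] sG[of s y l] z unfolding 1 2 by auto
    note ex = pullback_pointwise[OF f g pb 1(4) 2(2)[unfolded s] xy]
    from ex obtain p where p: "p \<in> sec P (nat \<lceil>r + l\<rceil>)" "smap a (nat \<lceil>r + l\<rceil>) p = x" "smap b (nat \<lceil>r + l\<rceil>) p = y" by blast
    have pz: "Pr (Num r) p \<in> sec (Sigma_ob P) l" using p(1) 1 by (simp add: sec_Sigma)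
    show "\<exists>!z. z \<in> sec (Sigma_ob P) l \<and> smap (Sigma_ar a) l z = z1 \<and> smap (Sigma_ar b) l z = z2"
    proof (intro ex1I[of _ "Pr (Num r) p"] conjI pz)
      show "smap (Sigma_ar a) l (Pr (Num r) p) = z1" "smap (Sigma_ar b) l (Pr (Num r) p) = z2"
        using sA[OF pz] sB[OF pz] p 1(1) 2(1) s by auto
      fix w assume w: "w \<in> sec (Sigma_ob P) l \<and> smap (Sigma_ar a) l w = z1 \<and> smap (Sigma_ar b) l w = z2"
      then obtain t q where wt: "w = Pr (Num t) q" "q \<in> sec P (nat \<lceil>t + l\<rceil>)" by (auto simp: sec_Sigma)
      have "t = r" "smap a (nat \<lceil>t + l\<rceil>) q = x" "smap b (nat \<lceil>t + l\<rceil>) q = y"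
        using w sA[of t q l] sB[of t q l] 1(1) 2(1) unfolding wt by auto
      then show "w = Pr (Num r) p"
        using ex1_unique[OF ex, of q p] wt p by simp
    qed
  qed
qed

lemma Sigma_Sync_lex:
  "lex_functor IntN IntSync (Sigma_Sync :: ('a disc_sheaf, 'a disc_map, 'a cont_map, 'a cont_map \<times> 'a cont_map \<times> 'a cont_map) fct)"
proof -
  interpret N: finitely_complete "IntN :: ('a disc_sheaf, 'a disc_map) cat" by (rule Sheaves_finitely_complete)
  interpret C: finitely_complete "IntC :: ('a cont_sheaf, 'a cont_map) cat" by (rule Sheaves_finitely_complete)
  have "(Sync :: 'a cont_sheaf) \<in> obs IntC" by (simp add: Sync_sheaf)
  then interpret S: finitely_complete "IntSync :: ('a cont_map, 'a cont_map \<times> 'a cont_map \<times> 'a cont_map) cat"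
    by (rule C.slice_finitely_complete)
  interpret F: cat_functor "IntN :: ('a disc_sheaf, 'a disc_map) cat" IntSync Sigma_Sync by (rule Sigma_Sync_functor)
  show ?thesis
  proof
    show "is_terminal IntSync (fob Sigma_Sync T)" if "is_terminal IntN T" for T :: "'a disc_sheaf"
      by (rule Sigma_Sync_terminal[OF that])
    fix f g a b :: "'a disc_map" and X Y Z P :: "'a disc_sheaf"
    assume f: "f \<in> hom IntN X Z" and g: "g \<in> hom IntN Y Z" and pb: "is_pullback IntN f g (P, a, b)"
    have a: "a \<in> hom IntN P X" and b: "b \<in> hom IntN P Y"
      using N.is_pullbackD(2,3)[OF pb] shmapD(6)[OF f] shmapD(6)[OF g] by auto
    note F = far_Sigma_Sync(2)[OF f] and G = far_Sigma_Sync(2)[OF g] and A = far_Sigma_Sync(2)[OF a] and B = far_Sigma_Sync(2)[OF b]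
    note e = far_Sigma_Sync(1)[OF f] far_Sigma_Sync(1)[OF g] far_Sigma_Sync(1)[OF a] far_Sigma_Sync(1)[OF b]
    have s: "src IntC (fob Sigma_Sync P) = Sigma_ob P"
      using shmapD(6)[OF fob_Sigma_Sync(1)[OF shmapD(1)[OF a]]] by simp
    show "is_pullback IntSync (far Sigma_Sync f) (far Sigma_Sync g) (fob Sigma_Sync P, far Sigma_Sync a, far Sigma_Sync b)"
      by (rule C.slice_pullbackI[OF F G A B]) (simp only: e s fst_conv snd_conv Sigma_pullback[OF f g pb])
  qed
qed

lemma Delta_Sync_lex:
  "lex_functor IntC IntSync (Delta_Sync :: ('a cont_sheaf, 'a cont_map, 'a cont_map, 'a cont_map \<times> 'a cont_map \<times> 'a cont_map) fct)"
proof -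
  interpret C: finitely_complete "IntC :: ('a cont_sheaf, 'a cont_map) cat" by (rule Sheaves_finitely_complete)
  have "(Sync :: 'a cont_sheaf) \<in> obs IntC" by (simp add: Sync_sheaf)
  from C.base_change_lex[OF this] show ?thesis by (simp add: Delta_Sync_def C.base_change_def)
qed

theorem corollary5p2p1:
  shows "(\<exists>\<theta>. algebra_map (Wiring IntN)
              (Mch_N :: ('l, 'a disc_sheaf, 'a disc_map) machines)
              (restrict_alg (Wiring_fct Sigma_Sync) Mch_Sync) \<theta> \<and>
            (\<forall>X \<in> obs (Wiring IntN). cpt \<theta> X = Spn_fct IntN IntSync Sigma_Sync X)) \<and>
           (\<exists>\<theta>. algebra_map (Wiring IntC)
              (Mch_C :: ('l, 'a cont_sheaf, 'a cont_map) machines)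
              (restrict_alg (Wiring_fct Delta_Sync) Mch_Sync) \<theta> \<and>
            (\<forall>X \<in> obs (Wiring IntC). cpt \<theta> X = Spn_fct IntC IntSync Delta_Sync X))"
  unfolding Mch_N_def Mch_C_def Mch_Sync_def
  by (intro conjI lex_functor.Spn_algebra_map Sigma_Sync_lex Delta_Sync_lex)

end
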